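(* Let $\mathbb{K}$ be an algebraically closed field and let $q\in\mathbb{K}$ be a primitive $l$-th root of unity with $l\geq 3$. Let $\mathcal{A}$ be the quantum spatial ageing algebra and $\phi=EY-qYE\in\mathcal{A}$. Then each $X,\phi$-torsion free simple right $\mathcal{A}$-module is isomorphic to one of the following simple $\mathcal{A}$-modules: (1) $M_1(\underline{\mu})$ for some $\underline{\mu}\in(\mathbb{K}^* )^4$; (2) $M_2(\underline{\mu})$ for some $\underline{\mu}\in(\mathbb{K}^* )^3$; (3) $M_3(\underline{\mu})$ for some $\underline{\mu}\in(\mathbb{K}^* )^2$. Moreover, the $\mathbb{K}$-dimension of each $X,\phi$-torsion free simple $\mathcal{A}$-module is maximal, equal to the PI degree of $\mathcal{A}$.
   Context: The quantum spatial ageing algebra $\mathcal{A}$ is the $\mathbb{K}$-algebra generated by $E,K,K^{-1},X,Y$ ($K^{-1}$ the inverse of $K$) with relations $$EK=q^{-2}KE,\quad XK=q^{-1}KX,\quad YK=qKY,\quad EX=qXE,\quad EY=X+q^{-1}YE,\quad XY=qYX.$$ Modules are right modules. The elements $X$ and $\phi:=EY-qYE$ are normal in $\mathcal{A}$. A simple module $N$ is called $X,\phi$-torsion free if $uX=0$ implies $u=0$ and $u\phi=0$ implies $u=0$ for $u\in N$. (Every simple $\mathcal{A}$-module is finite dimensional, of dimension at most the PI degree of $\mathcal{A}$.) Let $l_1$ be the order of $q^2$, i.e. $l_1=l$ if $l$ is odd and $l_1=l/2$ if $l$ is even. Each of the modules below has $\mathbb{K}$-basis $\{e(a_1,a_2):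 0\le a_1\le l_1-1,\ 0\le a_2\le l-1\}$; in the first argument of $e(\cdot,\cdot)$ addition is modulo $l_1$, in the second argument modulo $l$. $M_1(\underline{\mu})$, $\underline{\mu}=(\mu_1,\mu_2,\mu_3,\mu_4)\in(\mathbb{K}^* )^4$: $e(a_1,a_2)X=\mu_1q^{a_1+a_2}e(a_1,a_2)$, $e(a_1,a_2)K^{\pm1}=\mu_4^{\pm1}e(a_1,a_2\pm1)$. If $l$ is odd: $e(a_1,a_2)E=\mu_3q^{2a_2}e(a_1+1,a_2)$ and $e(a_1,a_2)Y=\mu_3^{-1}q^{-(a_1+a_2)}\frac{q\mu_2-q^{2a_1+1}\mu_1}{1-q^2}e(a_1-1,a_2)$. If $l$ is even: $e(a_1,a_2)E=\mu_3q^{2a_2}e(a_1+1,a_2)$ for $a_1\neq\frac l2-1$ and $e(\frac l2-1,a_2)E=\mu_3q^{2a_2}e(0,\frac l2+a_2)$; $e(a_1,a_2)Y=\mu_3^{-1}q^{-(a_1+a_2)}\frac{q\mu_2-q^{2a_1+1}\mu_1}{1-q^2}e(a_1-1,a_2)$ for $a_1\ne0$ and $e(0,a_2)Y=\mu_3^{-1}q^{-a_2}\frac{q(\mu_2-\mu_1)}{1-q^2}e(\frac l2-1,\frac l2+a_2)$. $M_2(\underline{\mu})$, $\underline{\mu}=(\mu_1,\mu_2,\mu_3)\in(\mathbb{K}^* )^3$: $e(a_1,a_2)X=\mu_1q^{-a_1+a_2}e(a_1,a_2)$, $e(a_1,a_2)K^{\pm1}=\mu_3^{\pm1}e(a_1,a_2\pm1)$,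 $e(0,a_2)E=0$, $e(a_1,a_2)E=-\mu_2^{-1}\mu_1q^{a_1+2a_2}\frac{q^{-2a_1}-1}{q^{-2}-1}e(a_1-1,a_2)$ for $a_1\neq0$. If $l$ is odd: $e(a_1,a_2)Y=\mu_2q^{-a_2}e(a_1+1,a_2)$. If $l$ is even: $e(a_1,a_2)Y=\mu_2q^{-a_2}e(a_1+1,a_2)$ for $a_1\ne\frac l2-1$ and $e(\frac l2-1,a_2)Y=\mu_2q^{-a_2}e(0,\frac l2+a_2)$. $M_3(\underline{\mu})$, $\underline{\mu}=(\mu_1,\mu_2)\in(\mathbb{K}^* )^2$: $e(a_1,a_2)X=\mu_1q^{-a_1+a_2}e(a_1,a_2)$, $e(a_1,a_2)K^{\pm1}=\mu_2^{\pm1}e(a_1,a_2\pm1)$, $e(a_1,a_2)E=-q^{a_1+2a_2}\mu_1\frac{q^{-2a_1}-1}{q^{-2}-1}e(a_1-1,a_2)$ for $a_1\neq0$, $e(0,a_2)E=0$, $e(a_1,a_2)Y=q^{-a_2}e(a_1+1,a_2)$ for $a_1\ne l_1-1$, $e(l_1-1,a_2)Y=0$. *)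

theory Defs
  imports
    "HOL-Algebra.Algebraic_Closure_Type"
    "HOL-Library.Poly_Mapping"
begin

section \<open>Right modules over a (not necessarily commutative) ring\<close>

text \<open>
  The library locale \<open>module\<close> is restricted to commutative rings. Its record type is reused here for
  right modules: \<open>a \<odot>\<^bsub>M\<^esub> v\<close> stands for \<open>v a\<close>, so that \<open>(a b) \<odot> v = b \<odot> (a \<odot> v)\<close>.
\<close>

locale right_module = R?: ring R + M?: abelian_group M
  for R :: "('a, 'm) ring_scheme" (structure) and M :: "('a, 'v, 'n) module_scheme" (structure) +
  assumes smult_closed:
      "\<lbrakk>a \<in> carrier R; v \<in> carrier M\<rbrakk> \<Longrightarrow> a \<odot>\<^bsub>M\<^esub> v \<in> carrier M"
    and smult_l_distr:
      "\<lbrakk>a \<in> carrier R; b \<in> carrier R; v \<in> carrier M\<rbrakk> \<Longrightarrow>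
        (a \<oplus>\<^bsub>R\<^esub> b) \<odot>\<^bsub>M\<^esub> v = a \<odot>\<^bsub>M\<^esub> v \<oplus>\<^bsub>M\<^esub> b \<odot>\<^bsub>M\<^esub> v"
    and smult_r_distr:
      "\<lbrakk>a \<in> carrier R; v \<in> carrier M; w \<in> carrier M\<rbrakk> \<Longrightarrow>
        a \<odot>\<^bsub>M\<^esub> (v \<oplus>\<^bsub>M\<^esub> w) = a \<odot>\<^bsub>M\<^esub> v \<oplus>\<^bsub>M\<^esub> a \<odot>\<^bsub>M\<^esub> w"
    and smult_assoc:
      "\<lbrakk>a \<in> carrier R; b \<in> carrier R; v \<in> carrier M\<rbrakk> \<Longrightarrow>
        (a \<otimes>\<^bsub>R\<^esub> b) \<odot>\<^bsub>M\<^esub> v = b \<odot>\<^bsub>M\<^esub> (a \<odot>\<^bsub>M\<^esub> v)"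
    and smult_one:
      "v \<in> carrier M \<Longrightarrow> \<one>\<^bsub>R\<^esub> \<odot>\<^bsub>M\<^esub> v = v"

text \<open>The library's \<open>submodule\<close> makes no commutativity assumption and is sided only through \<open>\<odot>\<close>.\<close>

definition simple_right_module :: "('a, 'm) ring_scheme \<Rightarrow> ('a, 'v) module \<Rightarrow> bool" where
  "simple_right_module R M \<longleftrightarrow>
     right_module R M \<and> carrier M \<noteq> {\<zero>\<^bsub>M\<^esub>} \<and>
     (\<forall>H. submodule H R M \<longrightarrow> H = {\<zero>\<^bsub>M\<^esub>} \<or> H = carrier M)"

definition right_module_isomorphic ::
  "('a, 'm) ring_scheme \<Rightarrow> ('a, 'v) module \<Rightarrow> ('a, 'w) module \<Rightarrow> bool" where
  "right_module_isomorphic R M N \<longleftrightarrow>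
     (\<exists>h. bij_betw h (carrier M) (carrier N) \<and>
          (\<forall>v\<in>carrier M. \<forall>w\<in>carrier M. h (v \<oplus>\<^bsub>M\<^esub> w) = h v \<oplus>\<^bsub>N\<^esub> h w) \<and>
          (\<forall>a\<in>carrier R. \<forall>v\<in>carrier M. h (a \<odot>\<^bsub>M\<^esub> v) = a \<odot>\<^bsub>N\<^esub> h v))"


section \<open>Polynomial identities and the PI degree\<close>

text \<open>
  Elements of the free ring \<open>\<int>\<langle>x\<^sub>0, x\<^sub>1, \<dots>\<rangle>\<close> are finitely supported functions from words to
  \<^typ>\<open>int\<close>. A polynomial is monic of degree \<open>d\<close> if \<open>d\<close> is the maximal length of its
  words and some word of length \<open>d\<close> has coefficient 1.
\<close>

type_synonym nc_poly = "nat list \<Rightarrow>\<^sub>0 int"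

definition nc_eval :: "('a, 'm) ring_scheme \<Rightarrow> (nat \<Rightarrow> 'a) \<Rightarrow> nc_poly \<Rightarrow> 'a" where
  "nc_eval R \<rho> f =
     (\<Oplus>\<^bsub>R\<^esub>w\<in>Poly_Mapping.keys f.
        [Poly_Mapping.lookup f w] \<cdot>\<^bsub>R\<^esub> foldr (\<lambda>i r. \<rho> i \<otimes>\<^bsub>R\<^esub> r) w \<one>\<^bsub>R\<^esub>)"

definition nc_monic :: "nat \<Rightarrow> nc_poly \<Rightarrow> bool" where
  "nc_monic d f \<longleftrightarrow>
     (\<forall>w\<in>Poly_Mapping.keys f. length w \<le> d) \<and>
     (\<exists>w. length w = d \<and> Poly_Mapping.lookup f w = 1)"

definition polynomial_identity :: "('a, 'm) ring_scheme \<Rightarrow> nc_poly \<Rightarrow> bool" where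
  "polynomial_identity R f \<longleftrightarrow> (\<forall>\<rho>. (\<forall>i. \<rho> i \<in> carrier R) \<longrightarrow> nc_eval R \<rho> f = \<zero>\<^bsub>R\<^esub>)"

definition PI_min_degree :: "('a, 'm) ring_scheme \<Rightarrow> nat" where
  "PI_min_degree R = (LEAST d. \<exists>f. nc_monic d f \<and> polynomial_identity R f)"

text \<open>
  By Posner's theorem the minimal degree of a monic identity of a prime PI ring is even, and the
  PI degree is half of it.
\<close>

definition PI_degree :: "('a, 'm) ring_scheme \<Rightarrow> nat" where
  "PI_degree R = (THE n. 2 * n = PI_min_degree R)"


section \<open>The quantum spatial ageing algebra\<close>

text \<open>
  Words form the free monoid under concatenation, so that \<^typ>\<open>'g list \<Rightarrow>\<^sub>0 'k\<close> with the
  convolution product is the free associative algebra on \<open>'g\<close> over \<open>'k\<close>.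
\<close>

instantiation list :: (type) monoid_add
begin
definition zero_list :: "'a list" where "zero_list = []"
definition plus_list :: "'a list \<Rightarrow> 'a list \<Rightarrow> 'a list" where "plus_list = (@)"
instance by standard (simp_all add: zero_list_def plus_list_def)
end

datatype ageing_gen = GE | GK | GKinv | GX | GY

type_synonym 'k ageing_free = "ageing_gen list \<Rightarrow>\<^sub>0 'k"

definition fgen :: "ageing_gen \<Rightarrow> 'k::field ageing_free" where
  "fgen g = Poly_Mapping.single [g] 1"

definition fconst :: "'k::field \<Rightarrow> 'k ageing_free" where
  "fconst c = Poly_Mapping.single [] c"

definition ageing_relations :: "'k::field \<Rightarrow> 'k ageing_free set" where
  "ageing_relations q =
     (let e = fgen GE; k = fgen GK; k' = fgen GKinv; x = fgen GX; y = fgen GY in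
      {k * k' - 1,
       k' * k - 1,
       e * k - fconst (q powi (-2)) * k * e,
       x * k - fconst (q powi (-1)) * k * x,
       y * k - fconst q * k * y,
       e * x - fconst q * x * e,
       e * y - (x + fconst (q powi (-1)) * y * e),
       x * y - fconst q * y * x})"

definition ageing_ideal :: "'k::field \<Rightarrow> 'k ageing_free set" where
  "ageing_ideal q = genideal ring_of_type_algebra (ageing_relations q)"

definition ageing_algebra :: "'k::field \<Rightarrow> 'k ageing_free set ring" where
  "ageing_algebra q = ring_of_type_algebra Quot ageing_ideal q"

definition ageing_class :: "'k::field \<Rightarrow> 'k ageing_free \<Rightarrow> 'k ageing_free set" where
  "ageing_class q f = ageing_ideal q +>\<^bsub>ring_of_type_algebra\<^esub> f"

definition ageing_X :: "'k::field \<Rightarrow> 'k ageing_free set" where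
  "ageing_X q = ageing_class q (fgen GX)"

definition ageing_phi :: "'k::field \<Rightarrow> 'k ageing_free set" where
  "ageing_phi q = ageing_class q (fgen GE * fgen GY - fconst q * fgen GY * fgen GE)"

definition X_phi_torsion_free :: "'k::field \<Rightarrow> ('k ageing_free set, 'v) module \<Rightarrow> bool" where
  "X_phi_torsion_free q N \<longleftrightarrow>
     (\<forall>u\<in>carrier N. ageing_X q \<odot>\<^bsub>N\<^esub> u = \<zero>\<^bsub>N\<^esub> \<longrightarrow> u = \<zero>\<^bsub>N\<^esub>) \<and>
     (\<forall>u\<in>carrier N. ageing_phi q \<odot>\<^bsub>N\<^esub> u = \<zero>\<^bsub>N\<^esub> \<longrightarrow> u = \<zero>\<^bsub>N\<^esub>)"

text \<open>
  A right module over the algebra is a \<open>'k\<close>-vector space through the classes of the constants. It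
  has dimension \<open>n\<close> if it has a basis \<open>b 0, \<dots>, b (n - 1)\<close>.
\<close>

definition ageing_module_has_dim ::
  "'k::field \<Rightarrow> ('k ageing_free set, 'v) module \<Rightarrow> nat \<Rightarrow> bool" where
  "ageing_module_has_dim q N n \<longleftrightarrow>
     (\<exists>b. b \<in> {..<n} \<rightarrow> carrier N \<and>
          (\<forall>v\<in>carrier N. \<exists>!c. c \<in> {..<n} \<rightarrow>\<^sub>E (UNIV :: 'k set) \<and>
             v = (\<Oplus>\<^bsub>N\<^esub>i\<in>{..<n}. ageing_class q (fconst (c i)) \<odot>\<^bsub>N\<^esub> b i)))"


section \<open>The modules \<open>M\<^sub>1\<close>, \<open>M\<^sub>2\<close>, \<open>M\<^sub>3\<close>\<close>

definition primitive_root_of_unity :: "nat \<Rightarrow> 'k::field \<Rightarrow> bool" where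
  "primitive_root_of_unity l q \<longleftrightarrow> q ^ l = 1 \<and> (\<forall>m. 0 < m \<and> m < l \<longrightarrow> q ^ m \<noteq> 1)"

text \<open>The order of \<open>q\<^sup>2\<close> for a primitive \<open>l\<close>-th root of unity \<open>q\<close>.\<close>

definition ord_sq :: "nat \<Rightarrow> nat" where
  "ord_sq l = (if odd l then l else l div 2)"

text \<open>
  The common underlying space is spanned by \<open>e(a\<^sub>1,a\<^sub>2)\<close>; vectors are coordinate functions supported
  on the index box, and the arguments of \<open>e\<close> are read modulo \<open>ord_sq l\<close> and \<open>l\<close>.
\<close>

type_synonym 'k coords = "int \<times> int \<Rightarrow> 'k"

definition index_box :: "nat \<Rightarrow> (int \<times> int) set" where
  "index_box l = {0..<int (ord_sq l)} \<times> {0..<int l}"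

definition basis_vec :: "nat \<Rightarrow> int \<Rightarrow> int \<Rightarrow> 'k::field coords" where
  "basis_vec l a1 a2 = (\<lambda>p. if p = (a1 mod int (ord_sq l), a2 mod int l) then 1 else 0)"

definition scale_vec :: "'k::field \<Rightarrow> 'k coords \<Rightarrow> 'k coords" where
  "scale_vec c v = (\<lambda>p. c * v p)"

definition linear_ext :: "nat \<Rightarrow> (int \<Rightarrow> int \<Rightarrow> 'k::field coords) \<Rightarrow> 'k coords \<Rightarrow> 'k coords" where
  "linear_ext l T v = (\<lambda>p. \<Sum>(a1, a2)\<in>index_box l. v (a1, a2) * T a1 a2 p)"

text \<open>
  \<open>T g a1 a2\<close> is the image of \<open>e(a\<^sub>1,a\<^sub>2)\<close> under the generator \<open>g\<close>. Since the action is a right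
  action, the leftmost letter of a word acts first.
\<close>

definition word_action ::
  "nat \<Rightarrow> (ageing_gen \<Rightarrow> int \<Rightarrow> int \<Rightarrow> 'k::field coords) \<Rightarrow> ageing_gen list \<Rightarrow> 'k coords \<Rightarrow> 'k coords" where
  "word_action l T w v = foldl (\<lambda>u g. linear_ext l (T g) u) v w"

definition free_action ::
  "nat \<Rightarrow> (ageing_gen \<Rightarrow> int \<Rightarrow> int \<Rightarrow> 'k::field coords) \<Rightarrow> 'k ageing_free \<Rightarrow> 'k coords \<Rightarrow> 'k coords" where
  "free_action l T f v =
     (\<lambda>p. \<Sum>w\<in>Poly_Mapping.keys f. Poly_Mapping.lookup f w * word_action l T w v p)"

text \<open>
  An element of the algebra acts through any representative in the free algebra; the choice is
  immaterial as soon as the operators satisfy the defining relations. The record fields \<open>mult\<close> and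
  \<open>one\<close> play no role for modules.
\<close>

definition module_of_operators ::
  "nat \<Rightarrow> (ageing_gen \<Rightarrow> int \<Rightarrow> int \<Rightarrow> 'k::field coords) \<Rightarrow> ('k ageing_free set, 'k coords) module" where
  "module_of_operators l T =
     \<lparr>carrier = {v. \<forall>p. p \<notin> index_box l \<longrightarrow> v p = 0},
      monoid.mult = undefined, one = undefined,
      ring.zero = (\<lambda>_. 0), add = (\<lambda>u v p. u p + v p),
      module.smult = (\<lambda>a v. free_action l T (SOME f. f \<in> a) v)\<rparr>"

fun M1_op :: "'k::field \<Rightarrow> nat \<Rightarrow> 'k \<Rightarrow> 'k \<Rightarrow> 'k \<Rightarrow> 'k \<Rightarrow> ageing_gen \<Rightarrow> int \<Rightarrow> int \<Rightarrow> 'k coords" where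
  "M1_op q l \<mu>1 \<mu>2 \<mu>3 \<mu>4 GX a1 a2 = scale_vec (\<mu>1 * q powi (a1 + a2)) (basis_vec l a1 a2)"
| "M1_op q l \<mu>1 \<mu>2 \<mu>3 \<mu>4 GK a1 a2 = scale_vec \<mu>4 (basis_vec l a1 (a2 + 1))"
| "M1_op q l \<mu>1 \<mu>2 \<mu>3 \<mu>4 GKinv a1 a2 = scale_vec (inverse \<mu>4) (basis_vec l a1 (a2 - 1))"
| "M1_op q l \<mu>1 \<mu>2 \<mu>3 \<mu>4 GE a1 a2 =
     (if even l \<and> a1 = int l div 2 - 1
      then scale_vec (\<mu>3 * q powi (2 * a2)) (basis_vec l 0 (int l div 2 + a2))
      else scale_vec (\<mu>3 * q powi (2 * a2)) (basis_vec l (a1 + 1) a2))"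
| "M1_op q l \<mu>1 \<mu>2 \<mu>3 \<mu>4 GY a1 a2 =
     (if even l \<and> a1 = 0
      then scale_vec (inverse \<mu>3 * q powi (- a2) * (q * (\<mu>2 - \<mu>1) / (1 - q\<^sup>2)))
             (basis_vec l (int l div 2 - 1) (int l div 2 + a2))
      else scale_vec (inverse \<mu>3 * q powi (- (a1 + a2)) *
               ((q * \<mu>2 - q powi (2 * a1 + 1) * \<mu>1) / (1 - q\<^sup>2)))
             (basis_vec l (a1 - 1) a2))"

fun M2_op :: "'k::field \<Rightarrow> nat \<Rightarrow> 'k \<Rightarrow> 'k \<Rightarrow> 'k \<Rightarrow> ageing_gen \<Rightarrow> int \<Rightarrow> int \<Rightarrow> 'k coords" where
  "M2_op q l \<mu>1 \<mu>2 \<mu>3 GX a1 a2 = scale_vec (\<mu>1 * q powi (- a1 + a2)) (basis_vec l a1 a2)"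
| "M2_op q l \<mu>1 \<mu>2 \<mu>3 GK a1 a2 = scale_vec \<mu>3 (basis_vec l a1 (a2 + 1))"
| "M2_op q l \<mu>1 \<mu>2 \<mu>3 GKinv a1 a2 = scale_vec (inverse \<mu>3) (basis_vec l a1 (a2 - 1))"
| "M2_op q l \<mu>1 \<mu>2 \<mu>3 GE a1 a2 =
     (if a1 = 0 then (\<lambda>_. 0)
      else scale_vec (- (inverse \<mu>2) * \<mu>1 * q powi (a1 + 2 * a2) *
               ((q powi (- 2 * a1) - 1) / (q powi (- 2) - 1)))
             (basis_vec l (a1 - 1) a2))"
| "M2_op q l \<mu>1 \<mu>2 \<mu>3 GY a1 a2 =
     (if even l \<and> a1 = int l div 2 - 1
      then scale_vec (\<mu>2 * q powi (- a2)) (basis_vec l 0 (int l div 2 + a2))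
      else scale_vec (\<mu>2 * q powi (- a2)) (basis_vec l (a1 + 1) a2))"

fun M3_op :: "'k::field \<Rightarrow> nat \<Rightarrow> 'k \<Rightarrow> 'k \<Rightarrow> ageing_gen \<Rightarrow> int \<Rightarrow> int \<Rightarrow> 'k coords" where
  "M3_op q l \<mu>1 \<mu>2 GX a1 a2 = scale_vec (\<mu>1 * q powi (- a1 + a2)) (basis_vec l a1 a2)"
| "M3_op q l \<mu>1 \<mu>2 GK a1 a2 = scale_vec \<mu>2 (basis_vec l a1 (a2 + 1))"
| "M3_op q l \<mu>1 \<mu>2 GKinv a1 a2 = scale_vec (inverse \<mu>2) (basis_vec l a1 (a2 - 1))"
| "M3_op q l \<mu>1 \<mu>2 GE a1 a2 =
     (if a1 = 0 then (\<lambda>_. 0)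
      else scale_vec (- (q powi (a1 + 2 * a2)) * \<mu>1 *
               ((q powi (- 2 * a1) - 1) / (q powi (- 2) - 1)))
             (basis_vec l (a1 - 1) a2))"
| "M3_op q l \<mu>1 \<mu>2 GY a1 a2 =
     (if a1 = int (ord_sq l) - 1 then (\<lambda>_. 0)
      else scale_vec (q powi (- a2)) (basis_vec l (a1 + 1) a2))"

definition M1 :: "'k::field \<Rightarrow> nat \<Rightarrow> 'k \<Rightarrow> 'k \<Rightarrow> 'k \<Rightarrow> 'k \<Rightarrow> ('k ageing_free set, 'k coords) module" where
  "M1 q l \<mu>1 \<mu>2 \<mu>3 \<mu>4 = module_of_operators l (M1_op q l \<mu>1 \<mu>2 \<mu>3 \<mu>4)"

definition M2 :: "'k::field \<Rightarrow> nat \<Rightarrow> 'k \<Rightarrow> 'k \<Rightarrow> 'k \<Rightarrow> ('k ageing_free set, 'k coords) module" where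
  "M2 q l \<mu>1 \<mu>2 \<mu>3 = module_of_operators l (M2_op q l \<mu>1 \<mu>2 \<mu>3)"

definition M3 :: "'k::field \<Rightarrow> nat \<Rightarrow> 'k \<Rightarrow> 'k \<Rightarrow> ('k ageing_free set, 'k coords) module" where
  "M3 q l \<mu>1 \<mu>2 = module_of_operators l (M3_op q l \<mu>1 \<mu>2)"

end

theory Submission
  imports Defs "Jordan_Normal_Form.Char_Poly" "HOL-Library.Function_Algebras"
begin

text \<open>
  Suppose \<open>V\<close> is a simple module. The central elements \<open>K\<^sup>l\<close>, \<open>X\<^sup>l\<close>, \<open>\<phi>\<^sup>l\<close> act on \<open>V\<close> by scalars: \<open>V\<close> is finitely
  generated over the commutative algebra spanned by central powers, which therefore acts through a field
  that is finite over the ground field by Zariski's lemma. If \<open>X\<close> is injective, take a common eigenvector of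
  \<open>X\<close> and \<open>\<phi>\<close>, or, when \<open>E\<close> is nilpotent, an eigenvector of \<open>X\<close> killed by \<open>E\<close>. Its images under the
  powers of \<open>K\<close> and \<open>E\<close> (respectively \<open>K\<close> and \<open>Y\<close>) satisfy the multiplication table of \<open>M\<^sub>1\<close> (respectively
  \<open>M\<^sub>2\<close> or \<open>M\<^sub>3\<close>), which yields a homomorphism from that module onto \<open>V\<close>. The modules \<open>M\<^sub>i\<close> are simple because
  \<open>X\<close> and \<open>\<phi>\<close> separate their basis vectors.

  With \<open>n = l\<^sub>1 l\<close>, the algebra embeds into \<open>n \<times> n\<close> matrices over the functions of the nonzero parameters \<open>\<mu>\<close> through all the
  modules \<open>M\<^sub>1(\<mu>)\<close>, so it satisfies the standard identity of degree \<open>2n\<close> by the Amitsur-Levitzki theorem. It maps onto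
  the full matrix algebra through any single \<open>M\<^sub>1(\<mu>)\<close>, so no monic identity has smaller degree.
\<close>

section \<open>Matrices with vanishing power traces\<close>

text \<open>Two features of the ground field shape the proof. It may be countable, so the
  cardinality argument for Schur's lemma is out of reach and finite dimension of a simple module is
  not known beforehand; hence Zariski's lemma. Its characteristic is only prime to \<open>l\<close>,
  so the trace argument behind Amitsur-Levitzki is carried out over the integers and transferred by
  multilinearity. For even \<open>l\<close> the order of \<open>q^2\<close> is \<open>l/2\<close>,
  and \<open>E^(l/2)\<close> commutes with \<open>X\<close> and \<open>Y\<close> only up to sign.
  Powers of \<open>K\<close> and \<open>X\<close> with exponent \<open>s\<close> correct this, and
  the same \<open>s\<close> is the shift of the second index when the first one wraps around. The
  basis of \<open>M_1\<close> is therefore indexed by all pairs of integers with the shift built in.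
  No single \<open>M_1\<close> is faithful, being finite dimensional. In the whole family the
  parameters act as independent variables, which separate the exponents of ordered words. Simple
  modules with injective \<open>X\<close> and with \<open>\<phi>\<close> torsion enter the dimension
  bound as quotients of \<open>M_1\<close> with \<open>\<mu>2 = 0\<close>.\<close>

text \<open>Matrices of size \<open>n\<close> are functions on pairs of indices, of which only those below \<open>n\<close> matter.\<close>

definition mmult :: "nat \<Rightarrow> (nat \<Rightarrow> nat \<Rightarrow> 'a::semiring_1) \<Rightarrow> (nat \<Rightarrow> nat \<Rightarrow> 'a) \<Rightarrow> nat \<Rightarrow> nat \<Rightarrow> 'a" where
  "mmult n A B p q = (\<Sum>r<n. A p r * B r q)"

text \<open>The entries may come from any semiring because powers are taken both over the
  noncommutative exterior algebra and over its commutative even part.\<close>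

fun mpower :: "nat \<Rightarrow> (nat \<Rightarrow> nat \<Rightarrow> 'a::semiring_1) \<Rightarrow> nat \<Rightarrow> nat \<Rightarrow> nat \<Rightarrow> 'a" where
  "mpower n A 0 p q = (if p = q then 1 else 0)"
| "mpower n A (Suc k) p q = mmult n A (mpower n A k) p q"

lemma mmult_assoc: "mmult n (mmult n A B) C p q = mmult n A (mmult n B C) p q"
proof -
  have "mmult n (mmult n A B) C p q = (\<Sum>s<n. \<Sum>r<n. A p r * B r s * C s q)"
    by (simp add: mmult_def sum_distrib_right)
  also have "\<dots> = (\<Sum>r<n. \<Sum>s<n. A p r * B r s * C s q)" by (rule sum.swap)
  finally show ?thesis by (simp add: mmult_def sum_distrib_left mult.assoc)
qed

lemma mmult_cong:
  "(\<And>r. r < n \<Longrightarrow> A p r = A' p r) \<Longrightarrow> (\<And>r. r < n \<Longrightarrow> B r q = B' r q) \<Longrightarrow> mmult n A B p q = mmult n A' B' p q"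
  by (simp add: mmult_def)

text \<open>The bounds on the indices matter: \<open>mpower n A 0\<close> has ones on the whole
  diagonal, but a sum over \<open>r < n\<close> only meets those below \<open>n\<close>.\<close>

lemma mpower_Suc_right: "p < n \<Longrightarrow> q < n \<Longrightarrow> mpower n A (Suc k) p q = mmult n (mpower n A k) A p q"
proof (induction k arbitrary: p q)
  case 0
  then show ?case by (simp add: mmult_def if_distrib[of "\<lambda>x. _ * x"] if_distrib[of "\<lambda>x. x * _"] cong: if_cong)
next
  case (Suc k)
  have "mpower n A (Suc (Suc k)) p q = mmult n A (mpower n A (Suc k)) p q" by simp
  also have "\<dots> = mmult n A (mmult n (mpower n A k) A) p q"
    by (rule mmult_cong) (use Suc in auto)
  also have "\<dots> = mmult n (mmult n A (mpower n A k)) A p q" by (rule mmult_assoc[symmetric])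
  also have "\<dots> = mmult n (mpower n A (Suc k)) A p q" by (rule mmult_cong) auto
  finally show ?case .
qed

lemma mpower_add:
  "p < n \<Longrightarrow> mpower n A (j + k) p q = mmult n (mpower n A j) (mpower n A k) p q"
proof (induction j arbitrary: p)
  case 0
  then show ?case by (simp add: mmult_def if_distrib[of "\<lambda>x. x * _"] cong: if_cong)
next
  case (Suc j)
  have "mpower n A (Suc j + k) p q = mmult n A (mmult n (mpower n A j) (mpower n A k)) p q"
    using Suc by (auto intro: mmult_cong)
  also have "\<dots> = mmult n (mmult n A (mpower n A j)) (mpower n A k) p q" by (rule mmult_assoc[symmetric])
  finally show ?case by (simp add: mmult_def)
qed

section \<open>Formal derivatives and the Faddeev-LeVerrier recursion\<close>

text \<open>The library's \<open>pderiv\<close> is restricted to coefficient rings without zero divisors.\<close>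

definition fderiv :: "'a::comm_ring_1 poly \<Rightarrow> 'a poly" where
  "fderiv p = (\<Sum>i\<le>degree p. monom (of_nat i * coeff p i) (i - 1))"

lemma coeff_fderiv: "coeff (fderiv p) k = of_nat (Suc k) * coeff p (Suc k)"
proof -
  have "coeff (fderiv p) k = (\<Sum>i\<le>degree p. if i = Suc k then of_nat (Suc k) * coeff p (Suc k) else 0)"
    unfolding fderiv_def coeff_sum
  proof (intro sum.cong refl)
    fix i
    show "coeff (monom (of_nat i * coeff p i) (i - 1)) k = (if i = Suc k then of_nat (Suc k) * coeff p (Suc k) else 0)"
      by (cases i) auto
  qed
  then show ?thesis by (simp add: coeff_eq_0)
qed

lemma fderiv_add: "fderiv (p + q) = fderiv p + fderiv q"
  by (rule poly_eqI) (simp add: coeff_fderiv distrib_left)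

lemma fderiv_0: "fderiv 0 = 0"
  by (rule poly_eqI) (simp add: coeff_fderiv)

lemma fderiv_sum: "fderiv (sum f I) = (\<Sum>i\<in>I. fderiv (f i))"
  by (induction I rule: infinite_finite_induct) (simp_all add: fderiv_0 fderiv_add)

lemma fderiv_smult: "fderiv (smult a p) = smult a (fderiv p)"
  by (rule poly_eqI) (simp add: coeff_fderiv mult_ac)

lemma fderiv_pCons: "fderiv (pCons a p) = p + pCons 0 (fderiv p)"
proof (rule poly_eqI)
  fix k
  show "coeff (fderiv (pCons a p)) k = coeff (p + pCons 0 (fderiv p)) k"
    by (cases k) (simp_all add: coeff_fderiv algebra_simps)
qed

lemma fderiv_1: "fderiv 1 = 0"
  by (rule poly_eqI) (simp add: coeff_fderiv)

lemma fderiv_mult: "fderiv (p * q) = p * fderiv q + q * fderiv p"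
proof (induction p)
  case 0
  then show ?case by (simp add: fderiv_0)
next
  case (pCons a p)
  have "fderiv (pCons a p * q) = smult a (fderiv q) + (p * q + pCons 0 (p * fderiv q + q * fderiv p))"
    using pCons by (simp add: fderiv_add fderiv_smult fderiv_pCons)
  also have "\<dots> = pCons a p * fderiv q + q * fderiv (pCons a p)"
    by (simp add: fderiv_pCons algebra_simps)
  finally show ?case .
qed

lemma fderiv_prod:
  fixes f :: "'b \<Rightarrow> 'a::comm_ring_1 poly"
  assumes "finite I"
  shows "fderiv (prod f I) = (\<Sum>i\<in>I. fderiv (f i) * prod f (I - {i}))"
  using assms
proof (induction I rule: finite_induct)
  case empty
  then show ?case by (simp add: fderiv_1)
next
  case (insert x F)
  have "(\<Sum>i\<in>F. fderiv (f i) * prod f (insert x F - {i})) = (\<Sum>i\<in>F. f x * (fderiv (f i) * prod f (F - {i})))"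
  proof (intro sum.cong refl)
    fix i assume i: "i \<in> F"
    then have "insert x F - {i} = insert x (F - {i})" using insert.hyps by auto
    then show "fderiv (f i) * prod f (insert x F - {i}) = f x * (fderiv (f i) * prod f (F - {i}))"
      using insert.hyps by (simp add: mult_ac)
  qed
  moreover have "insert x F - {x} = F" using insert.hyps by simp
  ultimately show ?case using insert
    by (simp add: fderiv_mult sum_distrib_left[symmetric] mult_ac add_ac)
qed

lemma fderiv_of_int_mult: "fderiv (of_int s * (p :: 'a::comm_ring_1 poly)) = of_int s * fderiv p"
proof -
  have c: "of_int s = [:of_int s :: 'a:]"
    by (induction s rule: int_induct[where k = 0]) (auto simp: one_pCons)
  show ?thesis unfolding c by (simp add: fderiv_smult)
qed

text \<open>Jacobi's formula for the derivative of the characteristic polynomial, over any commutative ring.\<close>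

lemma fderiv_char_poly:
  fixes A :: "'a::comm_ring_1 mat"
  assumes A: "A \<in> carrier_mat n n"
  shows "fderiv (char_poly A) = (\<Sum>j<n. adj_mat (char_poly_matrix A) $$ (j, j))"
proof -
  define M where "M = char_poly_matrix A"
  have M: "M \<in> carrier_mat n n" using A by (simp add: M_def)
  have dM: "fderiv (M $$ (i, j)) = (if i = j then 1 else 0)" if "i < n" "j < n" for i j
    using that A by (simp add: M_def char_poly_matrix_def fderiv_pCons fderiv_0 fderiv_1)
  \<comment> \<open>\<open>R j\<close> is \<open>M\<close> with row \<open>j\<close> replaced by the
    \<open>j\<close>-th unit vector. Only the diagonal entries of \<open>M\<close> involve the
    variable, each with derivative 1, so this is what differentiating row \<open>j\<close>
    leaves.\<close>
  define R where "R j = mat n n (\<lambda>(i, k). if i = j then (if k = j then 1 else 0) else M $$ (i, k))" for j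
  have R: "R j \<in> carrier_mat n n" for j by (simp add: R_def)
  have detR: "det (R j) = (\<Sum>s | s permutes {0..<n}. of_int (sign s) *
      (if s j = j then (\<Prod>i\<in>{0..<n} - {j}. M $$ (i, s i)) else 0))" if j: "j < n" for j
    unfolding det_def'[OF R]
  proof (intro sum.cong refl arg_cong2[of _ _ _ _ "(*)"])
    fix s assume "s \<in> {s. s permutes {0..<n}}"
    then have s: "s i < n" if "i < n" for i using that permutes_in_image[of s "{0..<n}"] by simp
    have "(\<Prod>i = 0..<n. R j $$ (i, s i)) = R j $$ (j, s j) * (\<Prod>i\<in>{0..<n} - {j}. R j $$ (i, s i))"
      using j by (intro prod.remove) auto
    also have "(\<Prod>i\<in>{0..<n} - {j}. R j $$ (i, s i)) = (\<Prod>i\<in>{0..<n} - {j}. M $$ (i, s i))"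
      using s by (intro prod.cong) (auto simp: R_def)
    finally show "(\<Prod>i = 0..<n. R j $$ (i, s i)) = (if s j = j then \<Prod>i\<in>{0..<n} - {j}. M $$ (i, s i) else 0)"
      using s j by (simp add: R_def)
  qed
  \<comment> \<open>Laplace expansion along the unit row leaves a single cofactor, and that cofactor
    does not see row \<open>j\<close>.\<close>
  have adj: "det (R j) = adj_mat M $$ (j, j)" if j: "j < n" for j
  proof -
    have "mat_delete (R j) j j = mat_delete M j j"
      using M j by (auto simp: mat_delete_def R_def intro!: eq_matI)
    then have cof: "cofactor (R j) j j = cofactor M j j" by (simp add: cofactor_def)
    have "det (R j) = (\<Sum>k<n. R j $$ (j, k) * cofactor (R j) j k)"
      by (rule laplace_expansion_row[OF R j])
    also have "\<dots> = (\<Sum>k<n. if k = j then cofactor (R j) j j else 0)"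
      using j by (intro sum.cong) (auto simp: R_def)
    also have "\<dots> = cofactor M j j" using j cof by simp
    finally show ?thesis using M j by (simp add: adj_mat_def)
  qed
  have "fderiv (det M) = (\<Sum>s | s permutes {0..<n}. of_int (sign s) * fderiv (\<Prod>i = 0..<n. M $$ (i, s i)))"
    unfolding det_def'[OF M] by (simp add: fderiv_sum fderiv_of_int_mult)
  also have "\<dots> = (\<Sum>s | s permutes {0..<n}. \<Sum>j<n. of_int (sign s) *
      (if s j = j then (\<Prod>i\<in>{0..<n} - {j}. M $$ (i, s i)) else 0))"
  proof (intro sum.cong refl)
    fix s assume "s \<in> {s. s permutes {0..<n}}"
    then have s: "s i < n" if "i < n" for i using that permutes_in_image[of s "{0..<n}"] by simp
    have "fderiv (\<Prod>i = 0..<n. M $$ (i, s i)) =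
        (\<Sum>j\<in>{0..<n}. fderiv (M $$ (j, s j)) * (\<Prod>i\<in>{0..<n} - {j}. M $$ (i, s i)))"
      by (rule fderiv_prod) simp
    also have "\<dots> = (\<Sum>j<n. if s j = j then (\<Prod>i\<in>{0..<n} - {j}. M $$ (i, s i)) else 0)"
      unfolding lessThan_atLeast0 using s by (intro sum.cong refl) (auto simp: dM)
    finally show "of_int (sign s) * fderiv (\<Prod>i = 0..<n. M $$ (i, s i)) =
        (\<Sum>j<n. of_int (sign s) * (if s j = j then (\<Prod>i\<in>{0..<n} - {j}. M $$ (i, s i)) else 0))"
      by (simp only: sum_distrib_left)
  qed
  also have "\<dots> = (\<Sum>j<n. det (R j))"
    by (subst sum.swap) (simp add: detR)
  also have "\<dots> = (\<Sum>j<n. adj_mat M $$ (j, j))" by (simp add: adj)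
  finally show ?thesis by (simp add: M_def char_poly_def)
qed

text \<open>
  If all power traces vanish, comparing the traces of the coefficients of the adjugate of \<open>t - B\<close> with the
  derivative of \<open>det (t - B)\<close> (the Faddeev-LeVerrier recursion) leaves only the leading coefficient of the
  characteristic polynomial.
\<close>

lemma nilpotent_if_traces_vanish:
  fixes B :: "nat \<Rightarrow> nat \<Rightarrow> 'a::comm_ring_1"
  assumes torsion_free: "\<And>k (x :: 'a). of_int k * x = 0 \<Longrightarrow> k \<noteq> 0 \<Longrightarrow> x = 0"
    and traces: "\<And>k. k > 0 \<Longrightarrow> (\<Sum>i<n. mpower n B k i i) = 0"
    and ij: "i < n" "j < n"
  shows "mpower n B n i j = 0"
proof -
  define A where "A = mat n n (\<lambda>(i, j). B i j)"
  have A: "A \<in> carrier_mat n n" by (simp add: A_def)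
  define M where "M = char_poly_matrix A"
  have M: "M \<in> carrier_mat n n" using A by (simp add: M_def)
  define p where "p = char_poly A"
  \<comment> \<open>\<open>C k\<close> is the matrix of the coefficients of \<open>t^k\<close> in
    the adjugate of \<open>t - B\<close>. Comparing coefficients in the product of
    \<open>t - B\<close> with its adjugate gives \<open>c0\<close> and \<open>cS\<close>.\<close>
  define C where "C k i j = coeff (adj_mat M $$ (i, j)) k" for k i j
  have monic: "degree p = n" "coeff p n = 1" using degree_monic_char_poly[OF A] by (auto simp: p_def)
  have Mij: "M $$ (i, j) = [:- B i j, if i = j then 1 else 0:]" if "i < n" "j < n" for i j
    using that by (simp add: M_def char_poly_matrix_def A_def)
  have adj: "(\<Sum>r<n. M $$ (i, r) * adj_mat M $$ (r, j)) = (if i = j then p else 0)" if "i < n" "j < n" for i j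
  proof -
    have "(M * adj_mat M) $$ (i, j) = (if i = j then p else 0)"
      using adj_mat(2)[OF M] that by (simp add: p_def char_poly_def M_def)
    moreover have "(M * adj_mat M) $$ (i, j) = (\<Sum>r<n. M $$ (i, r) * adj_mat M $$ (r, j))"
      using M adj_mat(1)[OF M] that by (auto simp: scalar_prod_def lessThan_atLeast0 intro!: sum.cong)
    ultimately show ?thesis by simp
  qed
  have c0: "- mmult n B (C 0) i j = (if i = j then coeff p 0 else 0)" if ij: "i < n" "j < n" for i j
  proof -
    have "coeff (\<Sum>r<n. M $$ (i, r) * adj_mat M $$ (r, j)) 0 = (\<Sum>r<n. - (B i r * C 0 r j))"
      unfolding coeff_sum using ij by (intro sum.cong) (auto simp: Mij C_def coeff_mult)
    then show ?thesis using adj[OF ij] by (simp add: mmult_def sum_negf split: if_splits)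
  qed
  have cS: "C k i j - mmult n B (C (Suc k)) i j = (if i = j then coeff p (Suc k) else 0)"
    if ij: "i < n" "j < n" for i j k
  proof -
    have "coeff (\<Sum>r<n. M $$ (i, r) * adj_mat M $$ (r, j)) (Suc k) =
        (\<Sum>r<n. (if r = i then C k i j else 0) - B i r * C (Suc k) r j)"
      unfolding coeff_sum using ij by (intro sum.cong) (auto simp: Mij C_def)
    also have "\<dots> = C k i j - mmult n B (C (Suc k)) i j"
      using ij by (simp add: sum_subtractf mmult_def)
    finally show ?thesis using adj[OF ij] by (simp split: if_splits)
  qed
  \<comment> \<open>All \<open>C k\<close> vanish above some degree; the descending inductions on
    \<open>k\<close> below start there.\<close>
  obtain K where K: "\<And>k i j. k \<ge> K \<Longrightarrow> i < n \<Longrightarrow> j < n \<Longrightarrow> C k i j = 0"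
  proof -
    define K where "K = Suc (Max ((\<lambda>(i, j). degree (adj_mat M $$ (i, j))) ` ({..<n} \<times> {..<n})))"
    have "C k i j = 0" if "k \<ge> K" "i < n" "j < n" for k i j
    proof -
      have "degree (adj_mat M $$ (i, j)) \<le> Max ((\<lambda>(i, j). degree (adj_mat M $$ (i, j))) ` ({..<n} \<times> {..<n}))"
        using that by (intro Max_ge) auto
      then show ?thesis using that(1) by (simp add: C_def K_def coeff_eq_0)
    qed
    then show ?thesis using that by blast
  qed
  have CS: "C k i j = mmult n B (C (Suc k)) i j + coeff p (Suc k) * mpower n B 0 i j"
    if "i < n" "j < n" for i j k
    using cS[OF that, of k] by (auto simp: algebra_simps split: if_splits)
  \<comment> \<open>Descending induction: substituting the recursion \<open>CS\<close> for
    \<open>C k\<close> raises the power of \<open>B\<close> by one and adds a multiple of a power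
    trace, which is zero.\<close>
  have trC: "(\<Sum>i<n. mmult n (mpower n B (Suc m)) (C k) i i) = 0" for m k
  proof (cases "k \<le> K")
    case True
    then show ?thesis
    proof (induction arbitrary: m rule: inc_induct)
      case base
      then show ?case by (simp add: mmult_def K)
    next
      case (step k)
      have "mmult n (mpower n B (Suc m)) (C k) i i =
          mmult n (mpower n B (Suc (Suc m))) (C (Suc k)) i i + coeff p (Suc k) * mpower n B (Suc m) i i"
        if i: "i < n" for i
      proof -
        have "mmult n (mpower n B (Suc m)) (C k) i i =
          mmult n (mpower n B (Suc m)) (mmult n B (C (Suc k))) i i
            + coeff p (Suc k) * mmult n (mpower n B (Suc m)) (mpower n B 0) i i"
          unfolding mmult_def[of n "mpower n B (Suc m)"]
          using i by (simp add: CS distrib_left sum.distrib sum_distrib_left mult_ac del: mpower.simps)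
        also have "mmult n (mpower n B (Suc m)) (mmult n B (C (Suc k))) i i =
            mmult n (mmult n (mpower n B (Suc m)) B) (C (Suc k)) i i"
          by (rule mmult_assoc[symmetric])
        also have "\<dots> = mmult n (mpower n B (Suc (Suc m))) (C (Suc k)) i i"
          using i mpower_Suc_right[of i n _ B "Suc m"] by (intro mmult_cong) auto
        also have "mmult n (mpower n B (Suc m)) (mpower n B 0) i i = mpower n B (Suc m) i i"
          using mpower_add[OF i, of B "Suc m" 0 i] by simp
        finally show ?thesis .
      qed
      then show ?case using step traces[of "Suc m"]
        by (simp add: sum.distrib sum_distrib_left[symmetric] del: mpower.simps)
    qed
  next
    case False
    then show ?thesis by (simp add: mmult_def K)
  qed
  have mB: "mmult n (mpower n B (Suc 0)) Z i j = mmult n B Z i j" if "i < n" for Z i j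
    using that by (auto simp: mmult_def if_distrib[of "\<lambda>x. _ * x"] cong: if_cong intro!: sum.cong)
  have trB: "(\<Sum>i<n. mmult n B (C k) i i) = 0" for k
    using trC[of 0 k] by (simp add: mB del: mpower.simps)
  \<comment> \<open>The recursion gives \<open>C m\<close> the trace \<open>n\<close> times the
    coefficient of \<open>p\<close> at \<open>m + 1\<close>, Jacobi's formula gives
    \<open>m + 1\<close> times that coefficient. The factor \<open>m + 1 - n\<close> is cancelled by
    torsion-freeness. The constant coefficient comes from the trace of \<open>c0\<close>.\<close>
  have coeff0: "coeff p k = 0" if "k \<noteq> n" for k
  proof (cases k)
    case 0
    have "of_int (int n) * coeff p 0 = (\<Sum>i<n. - mmult n B (C 0) i i)" by (simp add: c0)
    also have "\<dots> = 0" using trB[of 0] by (simp add: sum_negf)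
    finally show ?thesis using torsion_free[of "int n" "coeff p 0"] that 0 by simp
  next
    case (Suc m)
    have "coeff (fderiv p) m = (\<Sum>i<n. C m i i)"
      unfolding p_def fderiv_char_poly[OF A] by (simp add: C_def M_def coeff_sum)
    also have "\<dots> = (\<Sum>i<n. mmult n B (C (Suc m)) i i + coeff p (Suc m))"
      by (intro sum.cong) (auto simp: CS)
    also have "\<dots> = of_nat n * coeff p (Suc m)" using trB[of "Suc m"] by (simp add: sum.distrib)
    finally have "of_int (int (Suc m) - int n) * coeff p (Suc m) = 0"
      by (simp add: coeff_fderiv algebra_simps)
    then show ?thesis using torsion_free that Suc by (metis of_nat_eq_iff right_minus_eq)
  qed
  have Cn: "C k i j = 0" if "k \<ge> n" "i < n" "j < n" for k i j
  proof (cases "k \<le> K")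
    case True
    then show ?thesis using that
    proof (induction arbitrary: i j rule: inc_induct)
      case base
      then show ?case by (simp add: K)
    next
      case (step k)
      have "C k i j = mmult n B (C (Suc k)) i j + coeff p (Suc k) * mpower n B 0 i j"
        by (rule CS[OF step.prems(2,3)])
      moreover have "mmult n B (C (Suc k)) i j = 0"
        unfolding mmult_def using step by (intro sum.neutral ballI) simp
      ultimately show ?case using coeff0[of "Suc k"] step.prems(1) by simp
    qed
  next
    case False
    then show ?thesis using that K by simp
  qed
  \<comment> \<open>Only the leading coefficient of \<open>p\<close> is left, so the recursion
    starts with the identity matrix at \<open>n - 1\<close> and multiplies by \<open>B\<close> at
    every step down. At index 0 it has reached \<open>B^(n-1)\<close>, and \<open>c0\<close> then
    says that \<open>B^n\<close> vanishes.\<close>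
  have Cpow: "C (n - Suc m) i j = mpower n B m i j" if "m < n" "i < n" "j < n" for m i j
    using that
  proof (induction m arbitrary: i j)
    case 0
    then have "C (n - 1) i j = mmult n B (C n) i j + coeff p n * mpower n B 0 i j"
      using CS[of i j "n - 1"] by simp
    moreover have "mmult n B (C n) i j = 0" using 0 by (simp add: mmult_def Cn)
    ultimately show ?case using monic by simp
  next
    case (Suc m)
    then have e: "Suc (n - Suc (Suc m)) = n - Suc m" by simp
    have "C (n - Suc (Suc m)) i j = mmult n B (C (n - Suc m)) i j + coeff p (n - Suc m) * mpower n B 0 i j"
      using CS[of i j "n - Suc (Suc m)"] Suc.prems unfolding e by simp
    moreover have "coeff p (n - Suc m) = 0" using Suc.prems by (intro coeff0) simp
    moreover have "mmult n B (C (n - Suc m)) i j = mmult n B (mpower n B m) i j"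
      using Suc by (intro mmult_cong) auto
    ultimately show ?case by simp
  qed
  obtain m where m: "n = Suc m" using ij by (cases n) auto
  have "mpower n B n i j = mmult n B (mpower n B m) i j" unfolding m by simp
  also have "\<dots> = mmult n B (C 0) i j" using Cpow[of m] ij m by (intro mmult_cong) auto
  also have "\<dots> = - (if i = j then coeff p 0 else 0)" using c0[OF ij] by (metis minus_minus)
  also have "\<dots> = 0" using coeff0[of 0] m by simp
  finally show ?thesis .
qed

section \<open>Exterior algebra over the integers and the Amitsur-Levitzki identity\<close>

text \<open>
  The exterior algebra on generators \<open>e\<^sub>0, e\<^sub>1, \<dots>\<close> has the basis \<open>e\<^sub>U\<close> for finite \<open>U\<close>, where \<open>e\<^sub>U\<close> is the
  product of the \<open>e\<^sub>i\<close> for \<open>i \<in> U\<close> in increasing order.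
\<close>

definition inversions :: "nat set \<Rightarrow> nat set \<Rightarrow> nat" where
  "inversions S T = card {(s, t). s \<in> S \<and> t \<in> T \<and> t < s}"

text \<open>For disjoint \<open>S\<close> and \<open>T\<close>, the sign that arises when the
  product of \<open>e_S\<close> and \<open>e_T\<close> is sorted into increasing order.\<close>

definition ext_sign :: "nat set \<Rightarrow> nat set \<Rightarrow> int" where
  "ext_sign S T = (- 1) ^ inversions S T"

lemma finite_inversions: "finite S \<Longrightarrow> finite T \<Longrightarrow> finite {(s, t). s \<in> S \<and> t \<in> T \<and> (t :: nat) < s}"
  by (rule finite_subset[of _ "S \<times> T"]) auto

lemma ext_sign_Un_left:
  assumes "finite S" "finite S'" "finite T" "S \<inter> S' = {}"
  shows "ext_sign (S \<union> S') T = ext_sign S T * ext_sign S' T"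
proof -
  have "{(s, t). s \<in> S \<union> S' \<and> t \<in> T \<and> t < s} =
      {(s, t). s \<in> S \<and> t \<in> T \<and> t < s} \<union> {(s, t). s \<in> S' \<and> t \<in> T \<and> t < s}" by auto
  then have "inversions (S \<union> S') T = inversions S T + inversions S' T"
    unfolding inversions_def using assms
    by (simp only:, intro card_Un_disjoint finite_inversions) auto
  then show ?thesis by (simp add: ext_sign_def power_add)
qed

lemma ext_sign_Un_right:
  assumes "finite S" "finite T'" "finite T" "T \<inter> T' = {}"
  shows "ext_sign S (T \<union> T') = ext_sign S T * ext_sign S T'"
proof -
  have "{(s, t). s \<in> S \<and> t \<in> T \<union> T' \<and> t < s} =
      {(s, t). s \<in> S \<and> t \<in> T \<and> t < s} \<union> {(s, t). s \<in> S \<and> t \<in> T' \<and> t < s}" by auto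
  then have "inversions S (T \<union> T') = inversions S T + inversions S T'"
    unfolding inversions_def using assms
    by (simp only:, intro card_Un_disjoint finite_inversions) auto
  then show ?thesis by (simp add: ext_sign_def power_add)
qed

text \<open>Each pair in \<open>S \<times> T\<close> is an inversion for exactly one of the two
  orders, so the two inversion numbers add up to \<open>card S * card T\<close>.\<close>

lemma ext_sign_swap:
  assumes "finite S" "finite T" "S \<inter> T = {}"
  shows "ext_sign T S = (- 1) ^ (card S * card T) * ext_sign S T"
proof -
  have "S \<times> T = {(s, t). s \<in> S \<and> t \<in> T \<and> t < s} \<union> prod.swap ` {(s, t). s \<in> T \<and> t \<in> S \<and> t < s}"
  proof (intro equalityI subsetI)
    fix a assume "a \<in> S \<times> T"
    then obtain s t where a: "a = (s, t)" "s \<in> S" "t \<in> T" by auto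
    then have "s \<noteq> t" using assms(3) by auto
    then consider "t < s" | "s < t" by linarith
    then show "a \<in> {(s, t). s \<in> S \<and> t \<in> T \<and> t < s} \<union> prod.swap ` {(s, t). s \<in> T \<and> t \<in> S \<and> t < s}"
      by cases (use a in \<open>auto simp: image_iff\<close>)
  qed auto
  then have "card S * card T = card ({(s, t). s \<in> S \<and> t \<in> T \<and> t < s} \<union> prod.swap ` {(s, t). s \<in> T \<and> t \<in> S \<and> t < s})"
    by (metis card_cartesian_product)
  also have "\<dots> = inversions S T + inversions T S"
    unfolding inversions_def using assms
    by (subst card_Un_disjoint) (auto simp: card_image intro!: finite_inversions)
  finally have "card S * card T = inversions S T + inversions T S" .
  moreover have "(- 1 :: int) ^ (a + b) * (- 1) ^ a = (- 1) ^ b" for a b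
    by (cases "even a"; cases "even b") auto
  ultimately show ?thesis by (simp add: ext_sign_def)
qed

lemma ext_sign_empty [simp]: "ext_sign {} T = 1" "ext_sign S {} = 1"
  by (simp_all add: ext_sign_def inversions_def)

text \<open>Infinitely many coefficients may be nonzero; only infinite index sets are excluded. The
  product is still defined, since its coefficient at \<open>U\<close> involves only the subsets of
  \<open>U\<close>. Integer coefficients make the ring torsion-free.\<close>

typedef ext = "{f :: nat set \<Rightarrow> int. \<forall>U. infinite U \<longrightarrow> f U = 0}"
  morphisms ext_coeff Abs_ext
  by (rule exI[of _ "\<lambda>_. 0"]) simp

lemma ext_coeff_infinite: "infinite U \<Longrightarrow> ext_coeff x U = 0"
  using ext_coeff[of x] by simp

lemma ext_eqI: "(\<And>U. finite U \<Longrightarrow> ext_coeff x U = ext_coeff y U) \<Longrightarrow> x = y"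
  by (subst ext_coeff_inject[symmetric]) (metis ext ext_coeff_infinite)

instantiation ext :: ring_1
begin

definition "0 = Abs_ext (\<lambda>_. 0)"
definition "1 = Abs_ext (\<lambda>U. if U = {} then 1 else 0)"
definition "x + y = Abs_ext (\<lambda>U. ext_coeff x U + ext_coeff y U)"
definition "x - y = Abs_ext (\<lambda>U. ext_coeff x U - ext_coeff y U)"
definition "- x = Abs_ext (\<lambda>U. - ext_coeff x U)"
definition "x * y = Abs_ext (\<lambda>U. \<Sum>S\<in>Pow U. ext_sign S (U - S) * ext_coeff x S * ext_coeff y (U - S))"

lemma ext_coeff_simps [simp]:
  "ext_coeff 0 U = 0"
  "ext_coeff 1 U = (if U = {} then 1 else 0)"
  "ext_coeff (x + y) U = ext_coeff x U + ext_coeff y U"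
  "ext_coeff (x - y) U = ext_coeff x U - ext_coeff y U"
  "ext_coeff (- x) U = - ext_coeff x U"
  unfolding zero_ext_def one_ext_def plus_ext_def minus_ext_def uminus_ext_def
  by (simp_all add: Abs_ext_inverse ext_coeff_infinite)

text \<open>At an infinite \<open>U\<close> both sides are zero, the right one because a sum over an
  infinite set is zero by convention.\<close>

lemma ext_coeff_mult:
  "ext_coeff (x * y) U = (\<Sum>S\<in>Pow U. ext_sign S (U - S) * ext_coeff x S * ext_coeff y (U - S))"
  unfolding times_ext_def by (subst Abs_ext_inverse) (auto simp: finite_Pow_iff)

instance
proof
  fix x y z :: ext
  show "x * y * z = x * (y * z)"
  proof (rule ext_eqI)
    fix U :: "nat set" assume U: "finite U"
    note fin = finite_subset[OF _ U]
    have "ext_coeff (x * y * z) U = (\<Sum>(S, T)\<in>Sigma (Pow U) Pow.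
        ext_sign S (U - S) * ext_sign T (S - T) * ext_coeff x T * ext_coeff y (S - T) * ext_coeff z (U - S))"
      unfolding ext_coeff_mult sum_distrib_left sum_distrib_right using U fin
      by (subst sum.Sigma) (auto intro!: sum.cong simp: mult_ac)
    \<comment> \<open>Chains \<open>T \<subseteq> S \<subseteq> U\<close> correspond to partitions
      of \<open>U\<close> into \<open>T\<close>, \<open>R = S - T\<close> and the rest. The signs
      agree because \<open>ext_sign\<close> is multiplicative in each argument.\<close>
    also have "\<dots> = (\<Sum>(T, R)\<in>Sigma (Pow U) (\<lambda>T. Pow (U - T)).
        ext_sign T (U - T) * ext_sign R (U - T - R) * ext_coeff x T * ext_coeff y R * ext_coeff z (U - T - R))"
    proof (rule sum.reindex_bij_witness[of _ "\<lambda>(T, R). (T \<union> R, T)" "\<lambda>(S, T). (T, S - T)"], goal_cases)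
      case (5 a)
      then obtain S T where a: "a = (S, T)" "S \<subseteq> U" "T \<subseteq> S" by auto
      have f: "finite S" "finite T" "finite (S - T)" "finite (U - S)" using a fin U by auto
      have e: "S = T \<union> (S - T)" "U - T = (S - T) \<union> (U - S)" "U - T - (S - T) = U - S" using a by auto
      have "ext_sign S (U - S) = ext_sign T (U - S) * ext_sign (S - T) (U - S)"
        using ext_sign_Un_left[of T "S - T" "U - S"] f e(1) by simp
      moreover have "ext_sign T (U - T) = ext_sign T (S - T) * ext_sign T (U - S)"
        using ext_sign_Un_right[of T "U - S" "S - T"] f e(2) by auto
      ultimately show ?case using a e(3) by (simp add: mult_ac)
    qed auto
    also have "\<dots> = ext_coeff (x * (y * z)) U"
      unfolding ext_coeff_mult sum_distrib_left sum_distrib_right using U fin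
      by (subst sum.Sigma) (auto intro!: sum.cong simp: mult_ac)
    finally show "ext_coeff (x * y * z) U = ext_coeff (x * (y * z)) U" .
  qed
  show "1 * x = x"
  proof (rule ext_eqI)
    fix U :: "nat set" assume "finite U"
    then have "ext_coeff (1 * x) U = (\<Sum>S\<in>Pow U. if S = {} then ext_coeff x U else 0)"
      unfolding ext_coeff_mult by (intro sum.cong) auto
    then show "ext_coeff (1 * x) U = ext_coeff x U" using \<open>finite U\<close> by simp
  qed
  show "x * 1 = x"
  proof (rule ext_eqI)
    fix U :: "nat set" assume "finite U"
    then have "ext_coeff (x * 1) U = (\<Sum>S\<in>Pow U. if S = U then ext_coeff x U else 0)"
      unfolding ext_coeff_mult by (intro sum.cong) auto
    then show "ext_coeff (x * 1) U = ext_coeff x U" using \<open>finite U\<close> by simp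
  qed
  show "(x + y) * z = x * z + y * z"
    by (rule ext_eqI) (simp add: ext_coeff_mult algebra_simps sum.distrib)
  show "x * (y + z) = x * y + x * z"
    by (rule ext_eqI) (simp add: ext_coeff_mult algebra_simps sum.distrib)
  have "ext_coeff (0 :: ext) {} \<noteq> ext_coeff 1 {}" by simp
  then show "(0 :: ext) \<noteq> 1" by metis
qed (auto intro!: ext_eqI)

end

lemma ext_coeff_sum: "ext_coeff (sum f I) U = (\<Sum>i\<in>I. ext_coeff (f i) U)"
  by (induction I rule: infinite_finite_induct) simp_all

lemma ext_coeff_of_nat: "ext_coeff (of_nat k * x) U = int k * ext_coeff x U"
  by (induction k) (simp_all add: algebra_simps)

lemma ext_coeff_of_int: "ext_coeff (of_int k * x) U = k * ext_coeff x U"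
  by (cases k rule: int_cases2) (simp_all add: ext_coeff_of_nat)

section \<open>Parity and graded commutativity\<close>

definition ext_even :: "ext \<Rightarrow> bool" where
  "ext_even x \<longleftrightarrow> (\<forall>U. odd (card U) \<longrightarrow> ext_coeff x U = 0)"

definition ext_odd :: "ext \<Rightarrow> bool" where
  "ext_odd x \<longleftrightarrow> (\<forall>U. even (card U) \<longrightarrow> ext_coeff x U = 0)"

lemma ext_mult_parity:
  "ext_even x \<Longrightarrow> ext_even y \<Longrightarrow> ext_even (x * y)"
  "ext_odd x \<Longrightarrow> ext_odd y \<Longrightarrow> ext_even (x * y)"
  "ext_odd x \<Longrightarrow> ext_even y \<Longrightarrow> ext_odd (x * y)"
proof -
  have vanish: "ext_coeff (x * y) U = 0"
    if *: "\<And>S. S \<subseteq> U \<Longrightarrow> finite U \<Longrightarrow> card U = card S + card (U - S) \<Longrightarrow>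
        ext_coeff x S = 0 \<or> ext_coeff y (U - S) = 0" for U
  proof (cases "finite U")
    case True
    have "ext_coeff x S = 0 \<or> ext_coeff y (U - S) = 0" if S: "S \<subseteq> U" for S
      using that True by (intro *) (auto simp: card_Diff_subset finite_subset card_mono)
    then show ?thesis unfolding ext_coeff_mult by (intro sum.neutral ballI) auto
  qed (rule ext_coeff_infinite)
  show "ext_even x \<Longrightarrow> ext_even y \<Longrightarrow> ext_even (x * y)"
    unfolding ext_even_def by (intro allI impI vanish) (metis even_add)
  show "ext_odd x \<Longrightarrow> ext_odd y \<Longrightarrow> ext_even (x * y)"
    unfolding ext_even_def ext_odd_def by (intro allI impI vanish) (metis even_add)
  show "ext_odd x \<Longrightarrow> ext_even y \<Longrightarrow> ext_odd (x * y)"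
    unfolding ext_even_def ext_odd_def by (intro allI impI vanish) (metis even_add)
qed

text \<open>Passing \<open>e_T\<close> across \<open>e_S\<close> costs the sign
  \<open>(-1)^(|S| |T|)\<close>. If it is the same for all pairs that occur in \<open>x\<close> and
  \<open>y\<close>, it factors out of the product; even factors and pairs of odd factors are the two
  applications.\<close>

lemma ext_commute:
  assumes "\<And>S T. ext_coeff x S \<noteq> 0 \<Longrightarrow> ext_coeff y T \<noteq> 0 \<Longrightarrow> (- 1 :: int) ^ (card S * card T) = c"
  shows "y * x = of_int c * (x * y)"
proof (rule ext_eqI)
  fix U :: "nat set" assume U: "finite U"
  have "ext_coeff (y * x) U = (\<Sum>S\<in>Pow U. ext_sign (U - S) S * ext_coeff y (U - S) * ext_coeff x S)"
    unfolding ext_coeff_mult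
    by (rule sum.reindex_bij_witness[of _ "\<lambda>S. U - S" "\<lambda>S. U - S"]) (auto simp: double_diff)
  also have "\<dots> = (\<Sum>S\<in>Pow U. c * (ext_sign S (U - S) * ext_coeff x S * ext_coeff y (U - S)))"
  proof (intro sum.cong refl)
    fix S assume S: "S \<in> Pow U"
    then have "ext_sign (U - S) S = (- 1) ^ (card S * card (U - S)) * ext_sign S (U - S)"
      using U by (intro ext_sign_swap) (auto intro: finite_subset)
    then show "ext_sign (U - S) S * ext_coeff y (U - S) * ext_coeff x S =
        c * (ext_sign S (U - S) * ext_coeff x S * ext_coeff y (U - S))"
      using assms[of S "U - S"] by (cases "ext_coeff x S = 0 \<or> ext_coeff y (U - S) = 0") auto
  qed
  also have "\<dots> = ext_coeff (of_int c * (x * y)) U"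
    by (simp add: ext_coeff_of_int ext_coeff_mult[of x y] sum_distrib_left)
  finally show "ext_coeff (y * x) U = ext_coeff (of_int c * (x * y)) U" .
qed

lemma ext_even_commute: "ext_even x \<Longrightarrow> y * x = x * y"
  using ext_commute[of x y 1] by (force simp: ext_even_def)

lemma ext_odd_anticommute: "ext_odd x \<Longrightarrow> ext_odd y \<Longrightarrow> y * x = - (x * y)"
  using ext_commute[of x y "-1"] by (force simp: ext_odd_def)

text \<open>The even part becomes a type of its own, so that it is an instance of
  \<open>comm_ring_1\<close> and characteristic polynomials over it make sense.\<close>

typedef ext_ev = "{x. ext_even x}"
  by (rule exI[of _ 0]) (simp add: ext_even_def)

lemma ext_even_Rep: "ext_even (Rep_ext_ev x)"
  using Rep_ext_ev[of x] by simp

instantiation ext_ev :: comm_ring_1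
begin

definition "0 = Abs_ext_ev 0"
definition "1 = Abs_ext_ev 1"
definition "x + y = Abs_ext_ev (Rep_ext_ev x + Rep_ext_ev y)"
definition "x - y = Abs_ext_ev (Rep_ext_ev x - Rep_ext_ev y)"
definition "- x = Abs_ext_ev (- Rep_ext_ev x)"
definition "x * y = Abs_ext_ev (Rep_ext_ev x * Rep_ext_ev y)"

lemma Rep_ext_ev_simps:
  "Rep_ext_ev 0 = 0" "Rep_ext_ev 1 = 1" "Rep_ext_ev (x + y) = Rep_ext_ev x + Rep_ext_ev y"
  "Rep_ext_ev (x - y) = Rep_ext_ev x - Rep_ext_ev y" "Rep_ext_ev (- x) = - Rep_ext_ev x"
  "Rep_ext_ev (x * y) = Rep_ext_ev x * Rep_ext_ev y"
  unfolding zero_ext_ev_def one_ext_ev_def plus_ext_ev_def minus_ext_ev_def uminus_ext_ev_def times_ext_ev_def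
  by (intro Abs_ext_ev_inverse; use ext_even_Rep in \<open>auto simp: ext_even_def intro: ext_mult_parity(1)[unfolded ext_even_def, rule_format]\<close>)+

instance
proof
  fix x y z :: ext_ev
  show "x * y = y * x"
    using ext_even_commute[OF ext_even_Rep[of y], of "Rep_ext_ev x"]
    unfolding Rep_ext_ev_inject[symmetric] Rep_ext_ev_simps .
qed (simp_all add: Rep_ext_ev_inject[symmetric] Rep_ext_ev_simps algebra_simps)

end

lemma Rep_ext_ev_sum: "Rep_ext_ev (sum f I) = (\<Sum>i\<in>I. Rep_ext_ev (f i))"
  by (induction I rule: infinite_finite_induct) (simp_all add: Rep_ext_ev_simps)

lemma Rep_ext_ev_of_int: "Rep_ext_ev (of_int k) = of_int k"
proof -
  have "Rep_ext_ev (of_nat n) = of_nat n" for n by (induction n) (simp_all add: Rep_ext_ev_simps)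
  then show ?thesis by (cases k rule: int_cases2) (simp_all add: Rep_ext_ev_simps)
qed

lemma ext_ev_torsion_free: "of_int k * (x :: ext_ev) = 0 \<Longrightarrow> k \<noteq> 0 \<Longrightarrow> x = 0"
proof -
  assume "of_int k * x = 0" "k \<noteq> 0"
  then have "of_int k * Rep_ext_ev x = 0" by (metis Rep_ext_ev_simps(1,6) Rep_ext_ev_of_int)
  then have "k * ext_coeff (Rep_ext_ev x) U = 0" for U by (metis ext_coeff_of_int ext_coeff_simps(1))
  then have "Rep_ext_ev x = 0" using \<open>k \<noteq> 0\<close> by (intro ext_eqI) simp
  then show "x = 0" by (metis Rep_ext_ev_inject Rep_ext_ev_simps(1))
qed

text \<open>
  Rosset's argument: the square of a matrix with odd entries has commuting entries, and the trace of its
  powers vanishes because moving one odd factor around the cycle changes the sign.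
\<close>

lemma odd_matrix_nilpotent:
  assumes odd: "\<And>p q. ext_odd (W p q)" and pq: "p < n" "q < n"
  shows "mpower n W (2 * n) p q = 0"
proof -
  have sum_parity: "(\<And>i. i \<in> I \<Longrightarrow> ext_even (f i)) \<Longrightarrow> ext_even (sum f I)"
    "(\<And>i. i \<in> I \<Longrightarrow> ext_odd (f i)) \<Longrightarrow> ext_odd (sum f I)" for f :: "nat \<Rightarrow> ext" and I
    by (auto simp: ext_even_def ext_odd_def ext_coeff_sum intro!: sum.neutral)
  have even_W: "ext_even (mmult n W W p q)" for p q
    unfolding mmult_def by (intro sum_parity ext_mult_parity odd)
  have parity: "ext_even (mpower n W (2 * k) p q) \<and> ext_odd (mpower n W (Suc (2 * k)) p q)" for k p q
  proof -
    have o: "ext_odd (mpower n W (Suc j) p q)" if "\<And>r. ext_even (mpower n W j r q)" for j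
      using that by (auto simp: mmult_def intro!: sum_parity ext_mult_parity odd)
    have e: "ext_even (mpower n W (Suc j) p q)" if "\<And>r. ext_odd (mpower n W j r q)" for j
      using that by (auto simp: mmult_def intro!: sum_parity ext_mult_parity odd)
    have "\<forall>p. ext_even (mpower n W (2 * k) p q)"
    proof (induction k)
      case 0
      then show ?case by (auto simp: ext_even_def)
    next
      case (Suc k)
      have "ext_odd (mpower n W (Suc (2 * k)) r q)" for r
        using Suc by (auto simp: mmult_def intro!: sum_parity ext_mult_parity odd)
      then show ?case by (auto simp: mmult_def[of n W "mpower n W (Suc (2 * k))"] simp del: mpower.simps
          simp: mpower.simps(2)[of n W "Suc (2 * k)"] intro!: sum_parity ext_mult_parity odd)
    qed
    then show ?thesis using o by blast
  qed
  define B where "B p q = Abs_ext_ev (mmult n W W p q)" for p q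
  have RB: "Rep_ext_ev (B p q) = mmult n W W p q" for p q
    unfolding B_def by (rule Abs_ext_ev_inverse) (simp add: even_W)
  have RBk: "Rep_ext_ev (mpower n B k p q) = mpower n W (2 * k) p q" if "p < n" "q < n" for k p q
    using that
  proof (induction k arbitrary: p q)
    case 0
    then show ?case by (simp add: Rep_ext_ev_simps)
  next
    case (Suc k)
    have "Rep_ext_ev (mpower n B (Suc k) p q) = mmult n (mmult n W W) (mpower n W (2 * k)) p q"
      using Suc by (simp add: mmult_def[of n B] mmult_def[of n "mmult n W W"] Rep_ext_ev_sum Rep_ext_ev_simps RB)
    also have "\<dots> = mmult n W (mmult n W (mpower n W (2 * k))) p q" by (rule mmult_assoc)
    finally show ?case by (simp add: mmult_def)
  qed
  have "mpower n B n p q = 0"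
  proof (rule nilpotent_if_traces_vanish[OF _ _ pq])
    fix k :: nat assume "k > 0"
    then obtain j where j: "2 * k = Suc (Suc (2 * j))" by (cases k) auto
    define t where "t = (\<Sum>i<n. mpower n W (2 * k) i i)"
    \<comment> \<open>The first factor \<open>W\<close> is split off the even power and moved to the
      end. Both factors are odd, so every swap changes the sign, and the moved sum is the same trace
      again.\<close>
    have "t = (\<Sum>i<n. \<Sum>r<n. W i r * mpower n W (Suc (2 * j)) r i)"
      unfolding t_def j by (simp only: mpower.simps(2)[of n W "Suc (2 * j)"] mmult_def[of n W "mpower n W (Suc (2 * j))"])
    also have "\<dots> = (\<Sum>i<n. \<Sum>r<n. - (mpower n W (Suc (2 * j)) r i * W i r))"
      by (intro sum.cong refl ext_odd_anticommute odd parity[THEN conjunct2])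
    also have "\<dots> = - (\<Sum>r<n. \<Sum>i<n. mpower n W (Suc (2 * j)) r i * W i r)"
      by (subst sum.swap) (simp add: sum_negf)
    also have "\<dots> = - (\<Sum>r<n. mmult n (mpower n W (Suc (2 * j))) W r r)"
      by (simp only: mmult_def[of n "mpower n W (Suc (2 * j))" W])
    also have "\<dots> = - t"
      unfolding t_def j by (simp add: mpower_Suc_right del: mpower.simps)
    finally have "t = - t" .
    then have "ext_coeff t U = - ext_coeff t U" for U by (metis ext_coeff_simps(5))
    \<comment> \<open>Integer coefficients are essential here: over a ring of characteristic two
      nothing would follow from \<open>t = - t\<close>.\<close>
    then have "t = 0" by (intro ext_eqI) simp
    then have "Rep_ext_ev (\<Sum>i<n. mpower n B k i i) = 0" by (simp add: Rep_ext_ev_sum RBk t_def)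
    then show "(\<Sum>i<n. mpower n B k i i) = 0" by (metis Rep_ext_ev_inject Rep_ext_ev_simps(1))
  qed (rule ext_ev_torsion_free)
  then show ?thesis using RBk[OF pq, of n] by (simp add: Rep_ext_ev_simps)
qed

section \<open>The standard polynomial and the Amitsur-Levitzki identity\<close>

definition ext_gen :: "nat \<Rightarrow> ext" where
  "ext_gen i = Abs_ext (\<lambda>U. if U = {i} then 1 else 0)"

lemma ext_coeff_gen: "ext_coeff (ext_gen i) U = (if U = {i} then 1 else 0)"
  unfolding ext_gen_def by (subst Abs_ext_inverse) auto

definition ext_word :: "nat list \<Rightarrow> ext" where
  "ext_word w = prod_list (map ext_gen w)"

text \<open>The coefficients of the standard polynomial: the sign of \<open>w\<close> if \<open>w\<close> is a permutation of \<open>0, \<dots>, N - 1\<close>.\<close>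

definition std_coeff :: "nat \<Rightarrow> nat list \<Rightarrow> int" where
  "std_coeff N w = ext_coeff (ext_word w) {..<N}"

lemma ext_coeff_gen_mult:
  "ext_coeff (ext_gen i * y) U = (if i \<in> U \<and> finite U then ext_sign {i} (U - {i}) * ext_coeff y (U - {i}) else 0)"
proof (cases "finite U")
  case True
  have "ext_coeff (ext_gen i * y) U = (\<Sum>S\<in>Pow U. if S = {i} then ext_sign {i} (U - {i}) * ext_coeff y (U - {i}) else 0)"
    unfolding ext_coeff_mult by (intro sum.cong) (auto simp: ext_coeff_gen)
  then show ?thesis using True by simp
qed (simp add: ext_coeff_infinite)

lemma ext_word_support: "ext_coeff (ext_word w) U \<noteq> 0 \<Longrightarrow> distinct w \<and> set w = U"
proof (induction w arbitrary: U)
  case Nil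
  then show ?case by (auto simp: ext_word_def split: if_splits)
next
  case (Cons i w)
  have "ext_coeff (ext_gen i * ext_word w) U \<noteq> 0" using Cons.prems by (simp add: ext_word_def)
  then have "i \<in> U" "ext_coeff (ext_word w) (U - {i}) \<noteq> 0"
    by (auto simp: ext_coeff_gen_mult split: if_splits)
  then show ?case using Cons.IH[of "U - {i}"] by auto
qed

lemma std_coeff_support:
  assumes "std_coeff N w \<noteq> 0"
  shows "distinct w" "set w = {..<N}" "length w = N"
proof -
  show *: "distinct w" "set w = {..<N}" using assms ext_word_support by (auto simp: std_coeff_def)
  show "length w = N" using distinct_card[OF *(1)] *(2) by simp
qed

lemma std_coeff_upt: "std_coeff N [0..<N] = 1"
proof -
  have "ext_coeff (ext_word [m..<N]) {m..<N} = 1" if "m \<le> N" for m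
    using that
  proof (induction m rule: inc_induct)
    case base
    then show ?case by (simp add: ext_word_def)
  next
    case (step m)
    have u: "[m..<N] = m # [Suc m..<N]" using step by (simp add: upt_conv_Cons)
    have d: "{m..<N} - {m} = {Suc m..<N}" by auto
    have "inversions {m} {Suc m..<N} = 0" by (auto simp: inversions_def card_eq_0_iff)
    then have "ext_sign {m} {Suc m..<N} = 1" by (simp add: ext_sign_def)
    moreover have "ext_word [m..<N] = ext_gen m * ext_word [Suc m..<N]" by (simp add: u ext_word_def)
    ultimately show ?case using step d by (simp add: ext_coeff_gen_mult)
  qed
  from this[of 0] show ?thesis by (simp add: std_coeff_def lessThan_atLeast0)
qed

fun wprod :: "nat \<Rightarrow> ('i \<Rightarrow> nat \<Rightarrow> nat \<Rightarrow> 'a::semiring_1) \<Rightarrow> 'i list \<Rightarrow> nat \<Rightarrow> nat \<Rightarrow> 'a" where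
  "wprod n x [] p q = (if p = q then 1 else 0)"
| "wprod n x (i # w) p q = (\<Sum>r<n. x i p r * wprod n x w r q)"

lemma finite_words: "finite {w. set w \<subseteq> {..<N::nat} \<and> length w = k}"
  by (rule finite_lists_length_eq) simp

lemma words_Suc:
  "{w. set w \<subseteq> {..<N::nat} \<and> length w = Suc k} =
     (\<lambda>(i, w). i # w) ` ({..<N} \<times> {w. set w \<subseteq> {..<N} \<and> length w = k})"
  by (auto simp: length_Suc_conv image_iff)

lemma of_int_ext_commute: "y * of_int a = of_int a * (y :: 'a::ring_1)"
  by (rule mult_of_int_commute[symmetric])

text \<open>Attaching anticommuting generators to matrices produces the standard polynomial as the
  coefficient of \<open>W^N\<close> at \<open>{..<N}\<close>: words with a repeated letter vanish,
  and the others carry the sign of their permutation.\<close>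

lemma mpower_generic:
  fixes x :: "nat \<Rightarrow> nat \<Rightarrow> nat \<Rightarrow> int" and N :: nat
  defines "W \<equiv> \<lambda>p q. \<Sum>i<N. of_int (x i p q) * ext_gen i"
  shows "mpower n W k p q = (\<Sum>w | set w \<subseteq> {..<N} \<and> length w = k. of_int (wprod n x w p q) * ext_word w)"
proof (induction k arbitrary: p)
  case 0
  have "{w. set w \<subseteq> {..<N} \<and> length w = 0} = {[]}" by auto
  then show ?case by (simp add: ext_word_def)
next
  case (Suc k)
  let ?L = "{w. set w \<subseteq> {..<N} \<and> length w = k}"
  have "mpower n W (Suc k) p q =
      (\<Sum>r<n. (\<Sum>i<N. of_int (x i p r) * ext_gen i) * (\<Sum>w\<in>?L. of_int (wprod n x w r q) * ext_word w))"
    by (simp add: mmult_def Suc) (simp add: W_def)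
  also have "\<dots> = (\<Sum>r<n. \<Sum>(i, w)\<in>{..<N} \<times> ?L. of_int (x i p r * wprod n x w r q) * ext_word (i # w))"
  proof (intro sum.cong refl)
    fix r
    have "of_int (x i p r) * ext_gen i * (of_int (wprod n x w r q) * ext_word w) =
        of_int (x i p r * wprod n x w r q) * ext_word (i # w)" for i w
      using of_int_ext_commute[of "ext_gen i" "wprod n x w r q"]
      by (simp add: ext_word_def mult.assoc) (metis mult.assoc)
    then show "(\<Sum>i<N. of_int (x i p r) * ext_gen i) * (\<Sum>w\<in>?L. of_int (wprod n x w r q) * ext_word w) =
        (\<Sum>(i, w)\<in>{..<N} \<times> ?L. of_int (x i p r * wprod n x w r q) * ext_word (i # w))"
      by (simp add: sum_product sum.cartesian_product)
  qed
  also have "\<dots> = (\<Sum>(i, w)\<in>{..<N} \<times> ?L. of_int (wprod n x (i # w) p q) * ext_word (i # w))"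
    by (subst sum.swap) (simp add: case_prod_beta' sum_distrib_right of_int_sum)
  also have "\<dots> = (\<Sum>w | set w \<subseteq> {..<N} \<and> length w = Suc k. of_int (wprod n x w p q) * ext_word w)"
    unfolding words_Suc by (subst sum.reindex) (auto simp: inj_on_def case_prod_beta')
  finally show ?case .
qed

text \<open>This is the coefficient at \<open>{..<2 * n}\<close> of the vanishing power
  \<open>W^(2n)\<close>; the matrix \<open>W\<close> is odd, being linear in the generators.\<close>

theorem amitsur_levitzki_int:
  fixes x :: "nat \<Rightarrow> nat \<Rightarrow> nat \<Rightarrow> int"
  assumes "p < n" "q < n"
  shows "(\<Sum>w | set w \<subseteq> {..<2 * n} \<and> length w = 2 * n. std_coeff (2 * n) w * wprod n x w p q) = 0"
proof -
  define W where "W p q = (\<Sum>i<2 * n. of_int (x i p q) * ext_gen i)" for p q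
  have "ext_odd (W p q)" for p q
    by (auto simp: ext_odd_def W_def ext_coeff_sum ext_coeff_of_int ext_coeff_gen intro!: sum.neutral)
  then have "ext_coeff (mpower n W (2 * n) p q) {..<2 * n} = 0"
    using odd_matrix_nilpotent[of W p n q] assms by simp
  then show ?thesis
    unfolding W_def[abs_def] mpower_generic by (simp add: ext_coeff_sum ext_coeff_of_int std_coeff_def mult.commute)
qed

text \<open>Each matrix is written as a combination of matrix units, and \<open>c\<close> chooses
  one unit for every letter. As the letters of \<open>w\<close> are distinct, the choices are
  functions on \<open>set w\<close>. Products of units have integer entries.\<close>

lemma wprod_expand:
  fixes x :: "'i \<Rightarrow> nat \<Rightarrow> nat \<Rightarrow> 'a::comm_ring_1"
  assumes "distinct w" "p < n"
  shows "wprod n x w p q = (\<Sum>c\<in>(set w \<rightarrow>\<^sub>E {..<n} \<times> {..<n}).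
    (\<Prod>i\<in>set w. x i (fst (c i)) (snd (c i))) * of_int (wprod n (\<lambda>i r s. if c i = (r, s) then 1 else 0) w p q))"
  using assms
proof (induction w arbitrary: p)
  case Nil
  have "(({} :: 'i set) \<rightarrow>\<^sub>E {..<n} \<times> {..<n}) = {\<lambda>_. undefined}" by (rule PiE_empty_domain)
  then show ?case by (simp only: list.set prod.empty wprod.simps sum.insert finite.emptyI sum.empty) auto
next
  case (Cons i w)
  let ?D = "{..<n} \<times> {..<n}"
  let ?u = "\<lambda>c i r s. if c i = (r, s) then 1 else (0::int)"
  have i: "i \<notin> set w" "distinct w" using Cons.prems by auto
  \<comment> \<open>The letter \<open>i\<close> does not occur in \<open>w\<close>, so changing the
    choice at \<open>i\<close> leaves products along \<open>w\<close> alone.\<close>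
  have w_upd: "wprod n (?u (c(i := d))) v r q = wprod n (?u c) v r q" if "set v \<subseteq> set w" for c d v r
    using that i(1) by (induction v arbitrary: r) (auto intro!: sum.cong)
  have "(\<Sum>c\<in>(set (i # w) \<rightarrow>\<^sub>E ?D). (\<Prod>j\<in>set (i # w). x j (fst (c j)) (snd (c j))) * of_int (wprod n (?u c) (i # w) p q))
     = (\<Sum>(d, c)\<in>?D \<times> (set w \<rightarrow>\<^sub>E ?D).
         (\<Prod>j\<in>set (i # w). x j (fst ((c(i := d)) j)) (snd ((c(i := d)) j))) *
           of_int (wprod n (?u (c(i := d))) (i # w) p q))"
    unfolding list.set(2) PiE_insert_eq
    by (subst sum.reindex) (use inj_combinator[OF i(1), of "\<lambda>_. ?D"] in \<open>auto simp: case_prod_beta' inj_on_def\<close>)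
  also have "\<dots> = (\<Sum>(d, c)\<in>?D \<times> (set w \<rightarrow>\<^sub>E ?D). if fst d = p then
      x i p (snd d) * ((\<Prod>j\<in>set w. x j (fst (c j)) (snd (c j))) * of_int (wprod n (?u c) w (snd d) q)) else 0)"
  proof (intro sum.cong refl, clarify)
    fix a b c assume ab: "a < n" "b < n"
    have p1: "(\<Prod>j\<in>set (i # w). x j (fst ((c(i := (a, b))) j)) (snd ((c(i := (a, b))) j))) =
        x i a b * (\<Prod>j\<in>set w. x j (fst (c j)) (snd (c j)))"
    proof -
      have "(\<Prod>j\<in>set w. x j (fst ((c(i := (a, b))) j)) (snd ((c(i := (a, b))) j))) =
          (\<Prod>j\<in>set w. x j (fst (c j)) (snd (c j)))"
        using i(1) by (intro prod.cong) auto
      then show ?thesis using i(1) by (simp del: fun_upd_apply) simp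
    qed
    have "wprod n (?u (c(i := (a, b)))) (i # w) p q =
        (\<Sum>r<n. if r = b then (if a = p then wprod n (?u c) w b q else 0) else 0)"
      unfolding wprod.simps w_upd[OF subset_refl] by (intro sum.cong refl) auto
    then have p2: "wprod n (?u (c(i := (a, b)))) (i # w) p q = (if a = p then wprod n (?u c) w b q else 0)"
      using ab by simp
    show "(\<Prod>j\<in>set (i # w). x j (fst ((c(i := (a, b))) j)) (snd ((c(i := (a, b))) j))) *
           of_int (wprod n (?u (c(i := (a, b)))) (i # w) p q) = (if fst (a, b) = p then
      x i p (snd (a, b)) * ((\<Prod>j\<in>set w. x j (fst (c j)) (snd (c j))) * of_int (wprod n (?u c) w (snd (a, b)) q)) else 0)"
      unfolding p1 p2 by (simp add: mult.assoc)
  qed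
  also have "\<dots> = (\<Sum>d\<in>?D. if fst d = p then x i p (snd d) * wprod n x w (snd d) q else 0)"
    unfolding sum.cartesian_product[symmetric]
    using i(2) by (intro sum.cong refl) (auto simp: Cons.IH sum_distrib_left)
  also have "\<dots> = (\<Sum>a<n. if a = p then \<Sum>r<n. x i p r * wprod n x w r q else 0)"
  proof -
    have "(\<Sum>d\<in>?D. if fst d = p then x i p (snd d) * wprod n x w (snd d) q else 0) =
        (\<Sum>a<n. \<Sum>r<n. if a = p then x i p r * wprod n x w r q else 0)"
      by (simp add: sum.cartesian_product case_prod_beta')
    also have "\<dots> = (\<Sum>a<n. if a = p then \<Sum>r<n. x i p r * wprod n x w r q else 0)"
      by (intro sum.cong) auto
    finally show ?thesis .
  qed
  also have "\<dots> = wprod n x (i # w) p q" using Cons.prems by simp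
  finally show ?case by simp
qed

text \<open>The standard polynomial is multilinear, so it vanishes on all matrices once it vanishes
  on matrix units, whose entries are integers. This carries the identity to every
  characteristic.\<close>

theorem amitsur_levitzki:
  fixes x :: "nat \<Rightarrow> nat \<Rightarrow> nat \<Rightarrow> 'a::comm_ring_1"
  assumes "p < n" "q < n"
  shows "(\<Sum>w | set w \<subseteq> {..<2 * n} \<and> length w = 2 * n. of_int (std_coeff (2 * n) w) * wprod n x w p q) = 0"
proof -
  let ?L = "{w. set w \<subseteq> {..<2 * n} \<and> length w = 2 * n}"
  let ?C = "{..<2 * n} \<rightarrow>\<^sub>E {..<n} \<times> {..<n}"
  let ?u = "\<lambda>c i r s. if c i = (r, s) then 1 else (0::int)"
  let ?P = "\<lambda>c. \<Prod>i<2 * n. x i (fst (c i)) (snd (c i))"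
  have "of_int (std_coeff (2 * n) w) * wprod n x w p q =
      (\<Sum>c\<in>?C. ?P c * of_int (std_coeff (2 * n) w * wprod n (?u c) w p q))" for w
  proof (cases "std_coeff (2 * n) w = 0")
    case False
    then show ?thesis
      using wprod_expand[of w p n x q] std_coeff_support[OF False] assms
      by (simp add: sum_distrib_left mult_ac)
  qed simp
  then have "(\<Sum>w\<in>?L. of_int (std_coeff (2 * n) w) * wprod n x w p q) =
      (\<Sum>c\<in>?C. ?P c * of_int (\<Sum>w\<in>?L. std_coeff (2 * n) w * wprod n (?u c) w p q))"
    by (simp only:, subst sum.swap) (simp add: sum_distrib_left)
  also have "\<dots> = 0" by (simp add: amitsur_levitzki_int[OF assms])
  finally show ?thesis .
qed

section \<open>Finitely generated commutative algebras acting on a simple module\<close>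

definition prime_set :: "'r::comm_ring_1 set \<Rightarrow> bool" where
  "prime_set m \<longleftrightarrow> 0 \<in> m \<and> (\<forall>x\<in>m. \<forall>y\<in>m. x + y \<in> m) \<and> (\<forall>x\<in>m. \<forall>r. r * x \<in> m) \<and>
     1 \<notin> m \<and> (\<forall>x y. x * y \<in> m \<longrightarrow> x \<in> m \<or> y \<in> m)"

text \<open>For a prime ideal \<open>m\<close> of \<open>R\<close>, this says that some localisation \<open>(R/m)\<^sub>f\<close> is a field.\<close>

definition locally_field :: "'r::comm_ring_1 set \<Rightarrow> bool" where
  "locally_field m \<longleftrightarrow> (\<exists>f. f \<notin> m \<and> (\<forall>r. r \<notin> m \<longrightarrow> (\<exists>k s. r * s - f ^ k \<in> m)))"

lemma prime_setD:
  assumes "prime_set m"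
  shows "0 \<in> m" "x \<in> m \<Longrightarrow> y \<in> m \<Longrightarrow> x + y \<in> m" "x \<in> m \<Longrightarrow> r * x \<in> m" "x \<in> m \<Longrightarrow> x * r \<in> m"
    "1 \<notin> m" "x * y \<in> m \<Longrightarrow> x \<in> m \<or> y \<in> m" "x \<in> m \<Longrightarrow> - x \<in> m"
    "x \<in> m \<Longrightarrow> y \<in> m \<Longrightarrow> x - y \<in> m"
proof -
  show mult: "x \<in> m \<Longrightarrow> r * x \<in> m" for x r using assms by (simp add: prime_set_def)
  show "x \<in> m \<Longrightarrow> x * r \<in> m" for x r using mult[of x r] by (simp add: mult.commute)
  show neg: "x \<in> m \<Longrightarrow> - x \<in> m" for x using mult[of x "-1"] by simp
  show "x \<in> m \<Longrightarrow> y \<in> m \<Longrightarrow> x - y \<in> m" for x y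
    using assms neg[of y] by (metis prime_set_def diff_conv_add_uminus)
qed (use assms in \<open>auto simp: prime_set_def\<close>)

lemma prime_set_trans:
  assumes "prime_set m" "x - y \<in> m" "y - z \<in> m"
  shows "x - z \<in> m"
  using prime_setD(2)[OF assms] by simp

lemma prime_set_mult_cong:
  assumes "prime_set m" "x - y \<in> m" "x' - y' \<in> m"
  shows "x * x' - y * y' \<in> m"
proof -
  have "x * x' - y * y' = x' * (x - y) + y * (x' - y')" by (simp add: algebra_simps)
  then show ?thesis using prime_setD(2,3)[OF assms(1)] assms(2,3) by simp
qed

lemma prime_set_power_cong:
  assumes "prime_set m" "x - y \<in> m"
  shows "x ^ k - y ^ k \<in> m"
proof (induction k)
  case 0
  then show ?case using prime_setD(1)[OF assms(1)] by simp
next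
  case (Suc k)
  then show ?case using prime_set_mult_cong[OF assms] by simp
qed

lemma prime_set_power:
  assumes "prime_set m" "x \<notin> m"
  shows "x ^ k \<notin> m"
proof (induction k)
  case 0
  then show ?case using prime_setD(5)[OF assms(1)] by simp
next
  case (Suc k)
  then show ?case using prime_setD(6)[OF assms(1), of x "x ^ k"] assms(2) by auto
qed

lemma prime_set_sum:
  assumes "prime_set m" "\<And>i. i \<in> A \<Longrightarrow> f i \<in> m"
  shows "sum f A \<in> m"
  using assms(2)
proof (induction A rule: infinite_finite_induct)
  case (insert x F)
  then have "f x + sum f F \<in> m" by (intro prime_setD(2)[OF assms(1)]) simp_all
  then show ?case using insert.hyps by simp
qed (simp_all add: prime_setD(1)[OF assms(1)])

lemma prime_set_contraction:
  assumes "prime_set (m :: 'r::comm_ring_1 poly set)"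
  shows "prime_set {r. [:r:] \<in> m}"
proof -
  have "[:x + y:] \<in> m" if "[:x:] \<in> m" "[:y:] \<in> m" for x y
    using prime_setD(2)[OF assms that] by simp
  moreover have "[:r * x:] \<in> m" if "[:x:] \<in> m" for r x
    using prime_setD(3)[OF assms that, of "[:r:]"] by (simp add: mult.commute)
  moreover have "[:x:] \<in> m \<or> [:y:] \<in> m" if "[:x * y:] \<in> m" for x y
    using prime_setD(6)[OF assms, of "[:x:]" "[:y:]"] that by (simp add: mult.commute)
  ultimately show ?thesis
    using prime_setD(1,5)[OF assms] unfolding prime_set_def by (auto simp: one_pCons)
qed

lemma poly_in_prime_set:
  assumes "prime_set (m :: 'r::comm_ring_1 poly set)" "\<And>i. [:coeff p i:] \<in> m"
  shows "p \<in> m"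
proof -
  have "p = (\<Sum>i\<le>degree p. monom (coeff p i) i)" by (rule poly_as_sum_of_monoms[symmetric])
  also have "\<dots> = (\<Sum>i\<le>degree p. monom 1 i * [:coeff p i:])"
    by (intro sum.cong) (auto simp: mult_monom monom_0[symmetric])
  also have "\<dots> \<in> m" by (intro prime_set_sum[OF assms(1)] prime_setD(3)[OF assms(1)] assms(2))
  finally show ?thesis .
qed

text \<open>Here \<open>a\<close> and \<open>b\<close> bound the degrees of \<open>p\<close> and
  \<open>q\<close> modulo \<open>m\<close>. Every other product of coefficients that contributes at
  \<open>a + b\<close> has a factor in \<open>m\<close>.\<close>

lemma coeff_mult_top_mod:
  assumes m: "prime_set m" and a: "\<And>i. i > a \<Longrightarrow> coeff p i \<in> m" and b: "\<And>i. i > b \<Longrightarrow> coeff q i \<in> m"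
  shows "coeff (p * q) (a + b) - coeff p a * coeff q b \<in> m"
    and "n > a + b \<Longrightarrow> coeff (p * q) n \<in> m"
proof -
  have t: "coeff p i * coeff q (n - i) \<in> m" if "n \<ge> a + b" "i \<le> n" "i \<noteq> a \<or> n > a + b" for i n
  proof (cases "i > a")
    case True
    then show ?thesis using a prime_setD(4)[OF m] by blast
  next
    case False
    then have "n - i > b" using that by linarith
    then show ?thesis using b prime_setD(3)[OF m] by blast
  qed
  have "coeff (p * q) (a + b) = coeff p a * coeff q b + (\<Sum>i\<in>{..a + b} - {a}. coeff p i * coeff q (a + b - i))"
    unfolding coeff_mult by (subst sum.remove[of _ a]) auto
  moreover have "(\<Sum>i\<in>{..a + b} - {a}. coeff p i * coeff q (a + b - i)) \<in> m"
    by (intro prime_set_sum[OF m] t) auto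
  ultimately show "coeff (p * q) (a + b) - coeff p a * coeff q b \<in> m" by simp
  show "n > a + b \<Longrightarrow> coeff (p * q) n \<in> m"
    unfolding coeff_mult by (intro prime_set_sum[OF m] t) auto
qed

lemma coeff_power_top_mod:
  assumes m: "prime_set m" and a: "\<And>i. i > a \<Longrightarrow> coeff p i \<in> m"
  shows "coeff (p ^ k) (k * a) - coeff p a ^ k \<in> m \<and> (\<forall>n > k * a. coeff (p ^ k) n \<in> m)"
proof (induction k)
  case 0
  then show ?case using prime_setD(1)[OF m] by simp
next
  case (Suc k)
  then have b: "\<And>i. i > k * a \<Longrightarrow> coeff (p ^ k) i \<in> m" by blast
  have "coeff (p * p ^ k) (a + k * a) - coeff p a * coeff (p ^ k) (k * a) \<in> m"
    by (rule coeff_mult_top_mod(1)[OF m a b])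
  moreover have "coeff p a * coeff (p ^ k) (k * a) - coeff p a * coeff p a ^ k \<in> m"
    using prime_setD(3)[OF m, of "coeff (p ^ k) (k * a) - coeff p a ^ k" "coeff p a"] Suc
    by (simp add: right_diff_distrib)
  ultimately have "coeff (p ^ Suc k) (Suc k * a) - coeff p a ^ Suc k \<in> m"
    using prime_set_trans[OF m] by simp
  moreover have "coeff (p ^ Suc k) n \<in> m" if "n > Suc k * a" for n
    using coeff_mult_top_mod(2)[OF m a b] that by simp
  ultimately show ?case by blast
qed

text \<open>This \<open>n\<close> is the degree of \<open>p\<close> modulo \<open>m\<close>, which
  may be smaller than \<open>degree p\<close>.\<close>

lemma top_coeff_mod:
  assumes "coeff p i \<notin> m" "0 \<in> m"
  obtains n where "coeff p n \<notin> m" "\<And>i. i > n \<Longrightarrow> coeff p i \<in> m" "i \<le> n"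
proof -
  define A where "A = {i. coeff p i \<notin> m}"
  have sub: "A \<subseteq> {..degree p}"
    using assms(2) by (auto simp: A_def) (metis coeff_eq_0 not_le)
  then have fin: "finite A" using finite_subset by blast
  have "i \<in> A" using assms(1) by (simp add: A_def)
  then have "Max A \<in> A" "i \<le> Max A" using fin by (auto intro: Max_in)
  moreover have "coeff p j \<in> m" if "j > Max A" for j
  proof -
    have "j \<notin> A" using fin that by (metis Max_ge not_le)
    then show ?thesis by (simp add: A_def)
  qed
  ultimately show ?thesis using that unfolding A_def by blast
qed

text \<open>Cutting off the coefficients above the degree modulo \<open>m\<close> gives a
  representative of the same class whose true leading coefficient lies outside the contraction of
  \<open>m\<close>, as pseudo-division by it will require.\<close>

lemma truncate_mod:
  assumes "prime_set (m :: 'r::comm_ring_1 poly set)" "\<And>i. i > n \<Longrightarrow> [:coeff p i:] \<in> m"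
    "[:coeff p n:] \<notin> m"
  shows "p - poly_cutoff (Suc n) p \<in> m" "degree (poly_cutoff (Suc n) p) = n"
    "lead_coeff (poly_cutoff (Suc n) p) = coeff p n"
proof -
  show "p - poly_cutoff (Suc n) p \<in> m"
    by (rule poly_in_prime_set[OF assms(1)]) (use assms(2) prime_setD(1)[OF assms(1)] in \<open>auto simp: coeff_poly_cutoff\<close>)
  have "coeff p n \<noteq> 0" using assms(3) prime_setD(1)[OF assms(1)] by auto
  then show d: "degree (poly_cutoff (Suc n) p) = n"
    by (intro antisym degree_le le_degree) (auto simp: coeff_poly_cutoff)
  show "lead_coeff (poly_cutoff (Suc n) p) = coeff p n" unfolding d by (simp add: coeff_poly_cutoff)
qed

text \<open>
  The inductive step of Zariski's lemma, from \<open>R[x]\<close> to \<open>R\<close>. If \<open>x\<close> is transcendental modulo \<open>m\<close>, a leading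
  coefficient of \<open>f\<close> serves as the new \<open>f\<close>; otherwise \<open>f\<close> has a multiple in \<open>R\<close>, and one divides with
  remainder by an algebraic relation of minimal degree for \<open>x\<close>.
\<close>

lemma locally_field_contraction:
  fixes m :: "'r::idom poly set"
  assumes m: "prime_set m" and lf: "locally_field m"
  shows "locally_field {r. [:r:] \<in> m}"
proof -
  define m0 where "m0 = {r. [:r:] \<in> m}"
  have m0: "prime_set m0" unfolding m0_def by (rule prime_set_contraction[OF m])
  obtain f where f: "f \<notin> m" "\<And>r. r \<notin> m \<Longrightarrow> \<exists>k s. r * s - f ^ k \<in> m"
    using lf unfolding locally_field_def by blast
  have "locally_field m0"
  \<comment> \<open>In the first case \<open>m\<close> has no relation for \<open>x\<close> beyond
    those with coefficients in \<open>m0\<close>: the transcendental case.\<close>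
  proof (cases "\<forall>p\<in>m. \<forall>i. coeff p i \<in> m0")
    case True
    have "\<exists>i. coeff f i \<notin> m0"
      using poly_in_prime_set[OF m, of f] f(1) unfolding m0_def by blast
    then obtain n where n: "coeff f n \<notin> m0" "\<And>i. i > n \<Longrightarrow> coeff f i \<in> m0"
      using top_coeff_mod[OF _ prime_setD(1)[OF m0]] by metis
    have "\<exists>k s. r * s - coeff f n ^ k \<in> m0" if "r \<notin> m0" for r
    proof -
      have "[:r:] \<notin> m" using that by (simp add: m0_def)
      then obtain k s where ks: "[:r:] * s - f ^ k \<in> m" using f(2) by blast
      \<comment> \<open>Position \<open>k * n\<close> is where \<open>f ^ k\<close> has the
        coefficient \<open>coeff f n ^ k\<close> modulo \<open>m0\<close>.\<close>
      then have "coeff ([:r:] * s - f ^ k) (k * n) \<in> m0" using True by blast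
      then have "r * coeff s (k * n) - coeff (f ^ k) (k * n) \<in> m0" by simp
      moreover have "coeff (f ^ k) (k * n) - coeff f n ^ k \<in> m0"
        using coeff_power_top_mod[OF m0 n(2)] by blast
      ultimately show ?thesis using prime_set_trans[OF m0] by blast
    qed
    then show ?thesis using n(1) unfolding locally_field_def by blast
  next
    case False
    \<comment> \<open>\<open>Q n\<close> says that some relation for \<open>x\<close> has degree
      \<open>n\<close> modulo \<open>m0\<close>. A relation \<open>p\<close> of least degree
      replaces the minimal polynomial, with leading coefficient \<open>c\<close> instead of
      1.\<close>
    define Q where "Q n \<longleftrightarrow> (\<exists>p\<in>m. coeff p n \<notin> m0 \<and> (\<forall>i>n. coeff p i \<in> m0))" for n
    have Qex: "\<exists>j\<ge>i. Q j" if p: "p \<in> m" "coeff p i \<notin> m0" for p i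
    proof -
      obtain n where "coeff p n \<notin> m0" "\<And>i. i > n \<Longrightarrow> coeff p i \<in> m0" "i \<le> n"
        using top_coeff_mod[OF p(2) prime_setD(1)[OF m0]] by metis
      then show ?thesis using p(1) unfolding Q_def by blast
    qed
    define n where "n = (LEAST n. Q n)"
    have "Q n" using Qex False unfolding n_def by (metis LeastI)
    then obtain p0 where p0: "p0 \<in> m" "coeff p0 n \<notin> m0" "\<And>i. i > n \<Longrightarrow> coeff p0 i \<in> m0"
      unfolding Q_def by blast
    define p where "p = poly_cutoff (Suc n) p0"
    define c where "c = coeff p0 n"
    have tr: "p0 - p \<in> m" "degree p = n" "lead_coeff p = c"
      using truncate_mod[OF m, of n p0] p0(2,3) by (auto simp: p_def c_def m0_def)
    have pm: "p \<in> m" using prime_setD(8)[OF m p0(1) tr(1)] by simp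
    have c: "c \<notin> m0" using p0(2) by (simp add: c_def)
    have p_nz: "p \<noteq> 0" using c tr(3) prime_setD(1)[OF m0] by auto
    \<comment> \<open>By minimality of \<open>n\<close>, a relation of lower degree is trivial
      modulo \<open>m0\<close>.\<close>
    have small: "coeff h i \<in> m0" if "h \<in> m" "degree h < n" for h i
    proof (rule ccontr)
      assume i: "coeff h i \<notin> m0"
      obtain j where j: "coeff h j \<notin> m0" "\<And>i. i > j \<Longrightarrow> coeff h i \<in> m0"
        using top_coeff_mod[OF i prime_setD(1)[OF m0]] by metis
      then have "Q j" using that(1) unfolding Q_def by blast
      then have "n \<le> j" unfolding n_def by (rule Least_le)
      then have "coeff h j = 0" using that(2) by (intro coeff_eq_0) simp
      then show False using j(1) prime_setD(1)[OF m0] by simp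
    qed
    have n_pos: "n > 0"
    proof (rule ccontr)
      assume "\<not> n > 0"
      then have "p = [:c:]" using tr(2,3) by (metis coeff_pCons_0 degree_eq_zeroE gr0I)
      then show False using pm c by (simp add: m0_def)
    qed
    \<comment> \<open>Since \<open>p\<close> is not monic, division with remainder is possible only
      after multiplying by a power of \<open>c\<close>.\<close>
    have reduce: "\<exists>N h. [:c ^ N:] * g - h \<in> m \<and> degree h < n" for g
    proof -
      obtain s h where sh: "pseudo_divmod g p = (s, h)" by fastforce
      define N where "N = Suc (degree g) - degree p"
      have eq: "smult (c ^ N) g = p * s + h" and "h = 0 \<or> degree h < degree p"
        using pseudo_divmod[OF p_nz sh] tr(3) by (auto simp: N_def)
      then have "degree h < n" using tr(2) n_pos by auto
      moreover have "[:c ^ N:] * g - h \<in> m" using eq prime_setD(4)[OF m pm, of s] by simp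
      ultimately show ?thesis by blast
    qed
    \<comment> \<open>Among the multiples of \<open>f\<close> modulo \<open>m\<close> that lie
      outside \<open>m\<close> and have degree below \<open>n\<close>, one of least degree is
      chosen. It turns out to be a constant \<open>e\<close>, the multiple of \<open>f\<close> in
      \<open>R\<close> that is sought.\<close>
    define P where "P d \<longleftrightarrow> (\<exists>g h. degree g = d \<and> d < n \<and> g \<notin> m \<and> g - f * h \<in> m)" for d
    have "\<exists>d. P d"
    proof -
      obtain N h where h: "[:c ^ N:] * f - h \<in> m" "degree h < n" using reduce by blast
      have "c ^ N \<notin> m0" by (rule prime_set_power[OF m0 c])
      then have "[:c ^ N:] \<notin> m" by (simp add: m0_def)
      then have nm: "[:c ^ N:] * f \<notin> m" using f(1) prime_setD(6)[OF m] by blast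
      have "h \<notin> m"
        using prime_setD(2)[OF m h(1)] nm by force
      moreover have "h - f * [:c ^ N:] \<in> m" using prime_setD(7)[OF m h(1)] by (simp add: mult.commute)
      ultimately show ?thesis using h(2) unfolding P_def by blast
    qed
    define d where "d = (LEAST d. P d)"
    have "P d" using \<open>\<exists>d. P d\<close> unfolding d_def by (metis LeastI)
    then obtain g0 h0 where g0: "degree g0 = d" "d < n" "g0 \<notin> m" "g0 - f * h0 \<in> m"
      unfolding P_def by blast
    have "\<exists>i. coeff g0 i \<notin> m0"
      using poly_in_prime_set[OF m, of g0] g0(3) unfolding m0_def by blast
    then obtain k where k: "coeff g0 k \<notin> m0" "\<And>i. i > k \<Longrightarrow> coeff g0 i \<in> m0"
      using top_coeff_mod[OF _ prime_setD(1)[OF m0]] by metis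
    define g where "g = poly_cutoff (Suc k) g0"
    define e where "e = coeff g0 k"
    have g: "g0 - g \<in> m" "degree g = k" "lead_coeff g = e"
      using truncate_mod[OF m, of k g0] k by (auto simp: g_def e_def m0_def)
    have e: "e \<notin> m0" using k(1) by (simp add: e_def)
    have g_nz: "g \<noteq> 0" using e g(3) prime_setD(1)[OF m0] by auto
    have gm: "g \<notin> m" using prime_setD(2)[OF m g(1)] g0(3) by force
    have kd: "k \<le> d" using k(1) g0(1) prime_setD(1)[OF m0] by (metis coeff_eq_0 not_le)
    have gf: "g - f * h0 \<in> m"
      using prime_setD(8)[OF m g0(4) g(1)] by (simp add: algebra_simps)
    \<comment> \<open>Otherwise \<open>p\<close> is pseudo-divided by \<open>g\<close>. The
      remainder is again a multiple of \<open>f\<close>, of smaller degree, hence in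
      \<open>m\<close>, and then so is the quotient \<open>s\<close>. As \<open>s\<close> has degree
      below \<open>n\<close>, its coefficients lie in \<open>m0\<close>, against the leading
      coefficient \<open>e ^ N * c\<close> of \<open>g * s\<close>.\<close>
    have k0: "k = 0"
    proof (rule ccontr)
      assume k_pos: "k \<noteq> 0"
      obtain s r where sr: "pseudo_divmod p g = (s, r)" by fastforce
      define N where "N = Suc (degree p) - degree g"
      have eq: "smult (e ^ N) p = g * s + r" and "r = 0 \<or> degree r < degree g"
        using pseudo_divmod[OF g_nz sr] g(3) by (auto simp: N_def)
      then have dr: "degree r < k" using g(2) k_pos by auto
      have "g * s + r \<in> m" using prime_setD(3)[OF m pm, of "[:e ^ N:]"] eq by simp
      have "r - f * (- (h0 * s)) \<in> m"
      proof -
        have "r - f * (- (h0 * s)) = (g * s + r) - (g - f * h0) * s" by (simp add: algebra_simps)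
        moreover have "(g * s + r) - (g - f * h0) * s \<in> m"
          by (rule prime_setD(8)[OF m \<open>g * s + r \<in> m\<close> prime_setD(4)[OF m gf]])
        ultimately show ?thesis by (simp only:)
      qed
      have rm: "r \<in> m"
      proof (rule ccontr)
        assume "r \<notin> m"
        then have "P (degree r)" using \<open>r - f * (- (h0 * s)) \<in> m\<close> dr kd g0(2)
          unfolding P_def by (metis order.strict_trans2 order.strict_trans)
        then have "d \<le> degree r" unfolding d_def by (rule Least_le)
        then show False using dr kd by linarith
      qed
      then have "g * s \<in> m" using prime_setD(8)[OF m \<open>g * s + r \<in> m\<close> rm] by simp
      then have sm: "s \<in> m" using gm prime_setD(6)[OF m] by blast
      have e_nz: "e \<noteq> 0" using e prime_setD(1)[OF m0] by auto
      have lc: "coeff (smult (e ^ N) p) n = e ^ N * c" using tr by simp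
      have "coeff (g * s + r) n = coeff (g * s) n" using dr kd g0(2) by (simp add: coeff_eq_0)
      moreover have "degree s < n"
      proof -
        have "degree (g * s) \<le> n"
        proof -
          have "g * s = smult (e ^ N) p - r" using eq by simp
          then show ?thesis using degree_diff_le[of "smult (e ^ N) p" n r] tr(2) dr kd g0(2) by simp
        qed
        then show ?thesis
          using degree_mult_eq[OF g_nz, of s] g(2) k_pos n_pos by (cases "s = 0") auto
      qed
      then have "coeff s i \<in> m0" for i using small[OF sm] by blast
      then have "coeff (g * s) n \<in> m0"
        unfolding coeff_mult by (intro prime_set_sum[OF m0] prime_setD(3)[OF m0])
      ultimately have "e ^ N * c \<in> m0" using lc eq by simp
      then show False using prime_setD(6)[OF m0] prime_set_power[OF m0 e] c by blast
    qed
    then have ge: "g = [:e:]" using g(2,3) by (metis coeff_pCons_0 degree_eq_zeroE)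
    have fe: "f * h0 - [:e:] \<in> m" using prime_setD(7)[OF m gf] ge by simp
    \<comment> \<open>The new \<open>f\<close> is \<open>e * c\<close>. Multiplying
      \<open>r s = f^k\<close> by \<open>h0^k\<close> makes the right side \<open>e^k\<close>, and
      reducing the cofactor of \<open>r\<close> below degree \<open>n\<close> costs a power of
      \<open>c\<close>.\<close>
    have "\<exists>k s. r * s - (e * c) ^ k \<in> m0" if "r \<notin> m0" for r
    proof -
      have "[:r:] \<notin> m" using that by (simp add: m0_def)
      then obtain k s where ks: "[:r:] * s - f ^ k \<in> m" using f(2) by blast
      obtain N h where h: "[:c ^ N:] * (s * h0 ^ k) - h \<in> m" "degree h < n" using reduce by blast
      have "[:r:] * s * h0 ^ k - f ^ k * h0 ^ k \<in> m"
        using prime_setD(4)[OF m ks, of "h0 ^ k"] by (simp add: left_diff_distrib)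
      moreover have "(f * h0) ^ k - [:e:] ^ k \<in> m" by (rule prime_set_power_cong[OF m fe])
      ultimately have 1: "[:r:] * s * h0 ^ k - [:e:] ^ k \<in> m"
        using prime_set_trans[OF m] by (simp add: power_mult_distrib)
      have "[:r:] * h - [:c ^ N:] * [:e:] ^ k =
          [:c ^ N:] * ([:r:] * s * h0 ^ k - [:e:] ^ k) - [:r:] * ([:c ^ N:] * (s * h0 ^ k) - h)"
        by (simp only: algebra_simps)
      also have "\<dots> \<in> m" by (intro prime_setD(8)[OF m] prime_setD(3)[OF m] 1 h(1))
      finally have 2: "[:r:] * h - [:c ^ N:] * [:e:] ^ k \<in> m" .
      have ek: "[:c ^ N:] * [:e:] ^ k = [:c ^ N * e ^ k:]"
        by (induction k) (auto simp: mult.assoc mult.left_commute one_pCons)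
      \<comment> \<open>The difference lies in \<open>m\<close> and has degree below
        \<open>n\<close>, so by \<open>small\<close> its constant term is a relation modulo
        \<open>m0\<close>.\<close>
      have "degree ([:r:] * h - [:c ^ N:] * [:e:] ^ k) < n"
        unfolding ek using h(2) n_pos by (intro degree_diff_less) (auto intro: le_less_trans[OF degree_smult_le])
      then have "coeff ([:r:] * h - [:c ^ N:] * [:e:] ^ k) 0 \<in> m0" by (rule small[OF 2])
      then have "r * coeff h 0 - c ^ N * e ^ k \<in> m0" unfolding ek by simp
      then have "(e ^ N * c ^ k) * (r * coeff h 0 - c ^ N * e ^ k) \<in> m0" by (rule prime_setD(3)[OF m0])
      \<comment> \<open>The factor \<open>e ^ N * c ^ k\<close> equalises the exponents of
        \<open>e\<close> and \<open>c\<close>.\<close>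
      moreover have "(e ^ N * c ^ k) * (r * coeff h 0 - c ^ N * e ^ k) =
          r * (e ^ N * c ^ k * coeff h 0) - (e * c) ^ (N + k)"
        by (simp add: algebra_simps power_add power_mult_distrib)
      ultimately have "r * (e ^ N * c ^ k * coeff h 0) - (e * c) ^ (N + k) \<in> m0" by simp
      then show ?thesis by blast
    qed
    moreover have "e * c \<notin> m0" using e c prime_setD(6)[OF m0] by blast
    ultimately show ?thesis unfolding locally_field_def by blast
  qed
  then show ?thesis by (simp add: m0_def)
qed

lemma infinite_alg_closed: "infinite (UNIV :: 'k::alg_closed_field set)"
proof
  assume fin: "finite (UNIV :: 'k set)"
  define p where "p = 1 + (\<Prod>a\<in>(UNIV :: 'k set). [:- a, 1:])"
  have "poly p x = 1" for x
    by (simp add: p_def poly_prod prod_zero[OF fin])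
  moreover have "degree p > 0"
  proof -
    have "degree (\<Prod>a\<in>(UNIV :: 'k set). [:- a, 1:]) = card (UNIV :: 'k set)"
      by (subst degree_prod_eq_sum_degree) auto
    moreover have "card (UNIV :: 'k set) > 0" using fin by (simp add: card_gt_0_iff)
    ultimately show ?thesis unfolding p_def by (subst degree_add_eq_right) auto
  qed
  then obtain x where "poly p x = 0" using alg_closed_imp_poly_has_root by blast
  ultimately show False by simp
qed

text \<open>If \<open>m\<close> were zero, then \<open>x - c\<close> with
  \<open>f(c) \<noteq> 0\<close> would divide a power of \<open>f\<close>. So \<open>m\<close>
  contains a nonzero polynomial and, being prime, one of its linear factors.\<close>

lemma locally_field_alg_closed:
  fixes m :: "'k::alg_closed_field poly set"
  assumes m: "prime_set m" and lf: "locally_field m"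
  shows "\<exists>c. [:- c, 1:] \<in> m"
proof -
  obtain f where f: "f \<notin> m" "\<And>r. r \<notin> m \<Longrightarrow> \<exists>k s. r * s - f ^ k \<in> m"
    using lf unfolding locally_field_def by blast
  have f_nz: "f \<noteq> 0" using f(1) prime_setD(1)[OF m] by auto
  obtain c where c: "poly f c \<noteq> 0"
    using poly_roots_finite[OF f_nz] infinite_alg_closed
    by (metis (mono_tags, lifting) UNIV_I finite_subset mem_Collect_eq subsetI)
  have "\<exists>p\<in>m. p \<noteq> 0"
  proof (rule ccontr)
    assume "\<not> (\<exists>p\<in>m. p \<noteq> 0)"
    then have z: "p = 0" if "p \<in> m" for p using that by blast
    then have "[:- c, 1:] \<notin> m" by fastforce
    then obtain k s where "[:- c, 1:] * s - f ^ k \<in> m" using f(2) by blast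
    then have "[:- c, 1:] * s - f ^ k = 0" by (rule z)
    then have "poly ([:- c, 1:] * s - f ^ k) c = 0" by (simp only: poly_0)
    then show False using c by simp
  qed
  then obtain p where "p \<in> m" "p \<noteq> 0" by blast
  then show ?thesis
  proof (induction "degree p" arbitrary: p rule: less_induct)
    case less
    show ?case
    proof (cases "degree p = 0")
      case True
      then obtain a where a: "p = [:a:]" by (metis degree_eq_zeroE)
      then have "[:inverse a:] * p = 1" using less.prems(2) by (simp add: one_pCons)
      then show ?thesis using prime_setD(3)[OF m less.prems(1), of "[:inverse a:]"] prime_setD(5)[OF m] by simp
    next
      case False
      then obtain x where "poly p x = 0" using alg_closed_imp_poly_has_root by blast
      then obtain p' where p': "p = [:- x, 1:] * p'" by (metis dvdE poly_eq_0_iff_dvd)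
      then have nz: "p' \<noteq> 0" using less.prems(2) by auto
      then have d: "degree p' < degree p" unfolding p' by (subst degree_mult_eq) auto
      show ?thesis
      proof (cases "p' \<in> m")
        case True
        then show ?thesis using less.hyps[OF d] nz by blast
      next
        case False
        then show ?thesis using prime_setD(6)[OF m] less.prems(1) p' by blast
      qed
    qed
  qed
qed

text \<open>The ring is a type and \<open>V\<close> a fixed subset of a group, so that the same
  \<open>V\<close> carries the actions of a whole tower of polynomial rings, each a type built from
  the previous one.\<close>

locale comm_action =
  fixes V :: "'b::ab_group_add set" and \<rho> :: "'r::comm_ring_1 \<Rightarrow> 'b \<Rightarrow> 'b"
  assumes zero_closed: "0 \<in> V"
    and add_closed: "v \<in> V \<Longrightarrow> w \<in> V \<Longrightarrow> v + w \<in> V"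
    and act_closed: "v \<in> V \<Longrightarrow> \<rho> r v \<in> V"
    and act_add_left: "v \<in> V \<Longrightarrow> \<rho> (r + s) v = \<rho> r v + \<rho> s v"
    and act_mult: "v \<in> V \<Longrightarrow> \<rho> (r * s) v = \<rho> r (\<rho> s v)"
    and act_one: "v \<in> V \<Longrightarrow> \<rho> 1 v = v"
    and act_add_right: "v \<in> V \<Longrightarrow> w \<in> V \<Longrightarrow> \<rho> r (v + w) = \<rho> r v + \<rho> r w"
begin

lemma act_zero_right: "\<rho> r 0 = 0"
  using act_add_right[OF zero_closed zero_closed, of r] by simp

lemma act_zero_left: "v \<in> V \<Longrightarrow> \<rho> 0 v = 0"
  using act_add_left[of v 0 0] by simp

lemma act_uminus: "v \<in> V \<Longrightarrow> \<rho> (- r) v = - \<rho> r v"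
  using act_add_left[of v "- r" r] act_zero_left by (simp add: eq_neg_iff_add_eq_0)

lemma act_diff: "v \<in> V \<Longrightarrow> \<rho> (r - s) v = \<rho> r v - \<rho> s v"
  using act_add_left[of v r "- s"] act_uminus by simp

lemma sum_closed: "(\<And>i. i \<in> A \<Longrightarrow> f i \<in> V) \<Longrightarrow> sum f A \<in> V"
  by (induction A rule: infinite_finite_induct) (auto intro: zero_closed add_closed)

lemma act_sum_right: "(\<And>i. i \<in> A \<Longrightarrow> f i \<in> V) \<Longrightarrow> \<rho> r (sum f A) = (\<Sum>i\<in>A. \<rho> r (f i))"
  by (induction A rule: infinite_finite_induct) (simp_all add: act_zero_right act_add_right sum_closed)

end

inductive_set rspan :: "('r \<Rightarrow> 'b::ab_group_add \<Rightarrow> 'b) \<Rightarrow> 'b set \<Rightarrow> 'b set" for \<rho> S where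
  rspan_zero: "0 \<in> rspan \<rho> S"
| rspan_step: "s \<in> S \<Longrightarrow> u \<in> rspan \<rho> S \<Longrightarrow> \<rho> r s + u \<in> rspan \<rho> S"

context comm_action
begin

lemma rspan_add: "u \<in> rspan \<rho> S \<Longrightarrow> w \<in> rspan \<rho> S \<Longrightarrow> u + w \<in> rspan \<rho> S"
  by (induction rule: rspan.induct) (auto simp: add.assoc intro: rspan_step)

lemma rspan_closed: "S \<subseteq> V \<Longrightarrow> rspan \<rho> S \<subseteq> V"
proof
  show "u \<in> rspan \<rho> S \<Longrightarrow> S \<subseteq> V \<Longrightarrow> u \<in> V" for u
    by (induction rule: rspan.induct) (auto intro: zero_closed add_closed act_closed)
qed

lemma rspan_act:
  assumes "S \<subseteq> V" "u \<in> rspan \<rho> S"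
  shows "\<rho> r u \<in> rspan \<rho> S"
  using assms(2)
proof (induction rule: rspan.induct)
  case 2: (rspan_step s u r')
  then have "s \<in> V" "u \<in> V" using rspan_closed assms(1) by auto
  then have "\<rho> r (\<rho> r' s + u) = \<rho> (r * r') s + \<rho> r u"
    by (simp add: act_add_right act_closed act_mult)
  then show ?case using rspan.rspan_step[of s S "\<rho> r u" \<rho> "r * r'"] 2 by simp
qed (simp add: act_zero_right rspan_zero)

lemma rspan_base: "S \<subseteq> V \<Longrightarrow> s \<in> S \<Longrightarrow> s \<in> rspan \<rho> S"
  using rspan_step[OF _ rspan_zero, of s S \<rho> 1] act_one by auto

lemma rspan_trans:
  assumes "S' \<subseteq> V" "S \<subseteq> rspan \<rho> S'" "u \<in> rspan \<rho> S"
  shows "u \<in> rspan \<rho> S'"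
  using assms(3)
proof (induction rule: rspan.induct)
  case (rspan_step s u r)
  then show ?case using assms(1,2) rspan_add rspan_act by blast
qed (rule rspan_zero)

end

definition poly_act :: "('r::comm_ring_1 \<Rightarrow> 'b::ab_group_add \<Rightarrow> 'b) \<Rightarrow> ('b \<Rightarrow> 'b) \<Rightarrow> 'r poly \<Rightarrow> 'b \<Rightarrow> 'b" where
  "poly_act \<rho> z p v = (\<Sum>i\<le>degree p. \<rho> (coeff p i) ((z ^^ i) v))"

locale comm_action_endo = comm_action V \<rho> for V :: "'b::ab_group_add set" and \<rho> :: "'r::comm_ring_1 \<Rightarrow> 'b \<Rightarrow> 'b" +
  fixes z :: "'b \<Rightarrow> 'b"
  assumes z_closed: "v \<in> V \<Longrightarrow> z v \<in> V"
    and z_add: "v \<in> V \<Longrightarrow> w \<in> V \<Longrightarrow> z (v + w) = z v + z w"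
    and z_commute: "v \<in> V \<Longrightarrow> z (\<rho> r v) = \<rho> r (z v)"
begin

lemma z_pow_closed: "v \<in> V \<Longrightarrow> (z ^^ i) v \<in> V"
  by (induction i) (auto intro: z_closed)

lemma z_pow_add: "v \<in> V \<Longrightarrow> w \<in> V \<Longrightarrow> (z ^^ i) (v + w) = (z ^^ i) v + (z ^^ i) w"
  by (induction i) (auto simp: z_add z_pow_closed)

lemma z_zero: "z 0 = 0"
  using z_add[OF zero_closed zero_closed] by simp

lemma z_sum: "(\<And>i. i \<in> A \<Longrightarrow> f i \<in> V) \<Longrightarrow> z (sum f A) = (\<Sum>i\<in>A. z (f i))"
  by (induction A rule: infinite_finite_induct) (simp_all add: z_zero z_add sum_closed)

lemma poly_act_bound:
  assumes "degree p \<le> n" "v \<in> V"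
  shows "poly_act \<rho> z p v = (\<Sum>i\<le>n. \<rho> (coeff p i) ((z ^^ i) v))"
  unfolding poly_act_def
  by (rule sum.mono_neutral_left) (use assms in \<open>auto simp: coeff_eq_0 act_zero_left z_pow_closed\<close>)

lemma poly_act_closed: "v \<in> V \<Longrightarrow> poly_act \<rho> z p v \<in> V"
  unfolding poly_act_def by (intro sum_closed act_closed z_pow_closed)

lemma poly_act_add_left:
  assumes "v \<in> V"
  shows "poly_act \<rho> z (p + q) v = poly_act \<rho> z p v + poly_act \<rho> z q v"
proof -
  define n where "n = max (degree p) (degree q)"
  have "degree (p + q) \<le> n" "degree p \<le> n" "degree q \<le> n"
    by (auto simp: n_def intro: degree_add_le)
  then show ?thesis
    using assms by (simp add: poly_act_bound act_add_left z_pow_closed sum.distrib)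
qed

lemma poly_act_add_right:
  "v \<in> V \<Longrightarrow> w \<in> V \<Longrightarrow> poly_act \<rho> z p (v + w) = poly_act \<rho> z p v + poly_act \<rho> z p w"
  unfolding poly_act_def by (simp add: z_pow_add act_add_right z_pow_closed sum.distrib)

lemma poly_act_const: "poly_act \<rho> z [:r:] v = \<rho> r v"
  by (simp add: poly_act_def)

lemma poly_act_pCons:
  assumes "v \<in> V"
  shows "poly_act \<rho> z (pCons a p) v = \<rho> a v + poly_act \<rho> z p (z v)"
proof -
  have "poly_act \<rho> z (pCons a p) v = (\<Sum>i\<le>Suc (degree p). \<rho> (coeff (pCons a p) i) ((z ^^ i) v))"
    by (rule poly_act_bound) (auto simp: degree_pCons_le assms)
  also have "\<dots> = \<rho> a v + (\<Sum>i\<le>degree p. \<rho> (coeff p i) ((z ^^ Suc i) v))"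
    by (subst sum.atMost_Suc_shift) simp
  also have "\<dots> = \<rho> a v + poly_act \<rho> z p (z v)"
    unfolding poly_act_def by (simp add: funpow_swap1)
  finally show ?thesis .
qed

lemma poly_act_smult:
  assumes "v \<in> V"
  shows "poly_act \<rho> z (smult a q) v = \<rho> a (poly_act \<rho> z q v)"
proof -
  have "poly_act \<rho> z (smult a q) v = (\<Sum>i\<le>degree q. \<rho> (coeff (smult a q) i) ((z ^^ i) v))"
    by (rule poly_act_bound) (auto simp: degree_smult_le assms)
  also have "\<dots> = (\<Sum>i\<le>degree q. \<rho> a (\<rho> (coeff q i) ((z ^^ i) v)))"
    using assms by (simp add: act_mult z_pow_closed)
  also have "\<dots> = \<rho> a (poly_act \<rho> z q v)"
    unfolding poly_act_def using assms by (intro act_sum_right[symmetric]) (auto intro: act_closed z_pow_closed)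
  finally show ?thesis .
qed

lemma poly_act_z: "v \<in> V \<Longrightarrow> z (poly_act \<rho> z p v) = poly_act \<rho> z p (z v)"
  unfolding poly_act_def
  by (subst z_sum) (auto simp: z_commute z_pow_closed funpow_swap1 intro: act_closed)

lemma poly_act_mult:
  "v \<in> V \<Longrightarrow> poly_act \<rho> z (p * q) v = poly_act \<rho> z p (poly_act \<rho> z q v)"
proof (induction p arbitrary: v)
  case 0
  then show ?case by (simp add: act_zero_left poly_act_const[of 0, simplified] poly_act_closed)
next
  case (pCons a p)
  have "poly_act \<rho> z (pCons a p * q) v =
      poly_act \<rho> z (smult a q) v + poly_act \<rho> z (pCons 0 (p * q)) v"
    by (simp add: poly_act_add_left pCons.prems)
  also have "\<dots> = \<rho> a (poly_act \<rho> z q v) + poly_act \<rho> z (p * q) (z v)"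
    by (simp add: poly_act_smult poly_act_pCons act_zero_left pCons.prems)
  also have "poly_act \<rho> z (p * q) (z v) = poly_act \<rho> z p (z (poly_act \<rho> z q v))"
    using pCons by (simp add: z_closed poly_act_z)
  finally show ?case by (simp add: poly_act_pCons poly_act_closed pCons.prems)
qed

lemma comm_action_poly: "comm_action V (poly_act \<rho> z)"
  by unfold_locales
    (auto simp: zero_closed add_closed poly_act_closed poly_act_add_left poly_act_mult
      poly_act_add_right poly_act_const act_one one_pCons)

text \<open>Once \<open>z\<close> belongs to the acting ring, a generator \<open>z^k s'\<close> can
  be replaced by \<open>s'\<close>. Repeating this shrinks an infinite generating set to a finite
  one.\<close>

lemma rspan_poly_act:
  assumes S': "S' \<subseteq> V" and S: "\<And>s. s \<in> S \<Longrightarrow> \<exists>k. \<exists>s'\<in>S'. s = (z ^^ k) s'"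
  shows "rspan \<rho> S \<subseteq> rspan (poly_act \<rho> z) S'"
proof
  interpret P: comm_action V "poly_act \<rho> z" by (rule comm_action_poly)
  fix u assume "u \<in> rspan \<rho> S"
  then show "u \<in> rspan (poly_act \<rho> z) S'"
  proof (induction rule: rspan.induct)
    case 2: (rspan_step s u r)
    obtain k s' where s': "s' \<in> S'" "s = (z ^^ k) s'" using S 2 by blast
    have "poly_act \<rho> z (monom r k) s' = (\<Sum>i\<le>k. \<rho> (coeff (monom r k) i) ((z ^^ i) s'))"
      using s' S' by (intro poly_act_bound) (auto simp: degree_monom_le)
    also have "\<dots> = (\<Sum>i\<le>k. if i = k then \<rho> r s else 0)"
      using s' S' by (intro sum.cong) (auto simp: act_zero_left z_pow_closed subset_iff)
    finally have "poly_act \<rho> z (monom r k) s' = \<rho> r s" by simp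
    then show ?case using rspan.rspan_step[OF s'(1) 2(3), of "monom r k"] by simp
  qed (rule rspan_zero)
qed

end

section \<open>Schur's lemma from finite generation over central operators\<close>

locale simple_operators =
  fixes V :: "'b::ab_group_add set" and Ops :: "('b \<Rightarrow> 'b) set"
  assumes V_zero: "0 \<in> V"
    and V_add: "v \<in> V \<Longrightarrow> w \<in> V \<Longrightarrow> v + w \<in> V"
    and op_closed: "A \<in> Ops \<Longrightarrow> v \<in> V \<Longrightarrow> A v \<in> V"
    and op_add: "A \<in> Ops \<Longrightarrow> v \<in> V \<Longrightarrow> w \<in> V \<Longrightarrow> A (v + w) = A v + A w"
    and V_nontrivial: "V \<noteq> {0}"
    and simple: "H \<subseteq> V \<Longrightarrow> 0 \<in> H \<Longrightarrow> (\<And>v w. v \<in> H \<Longrightarrow> w \<in> H \<Longrightarrow> v + w \<in> H) \<Longrightarrow>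
       (\<And>A v. A \<in> Ops \<Longrightarrow> v \<in> H \<Longrightarrow> A v \<in> H) \<Longrightarrow> H = {0} \<or> H = V"
begin

definition endo :: "('b \<Rightarrow> 'b) \<Rightarrow> bool" where
  "endo T \<longleftrightarrow> (\<forall>v\<in>V. T v \<in> V) \<and> (\<forall>v\<in>V. \<forall>w\<in>V. T (v + w) = T v + T w) \<and>
     (\<forall>A\<in>Ops. \<forall>v\<in>V. T (A v) = A (T v))"

lemma endoD:
  assumes "endo T"
  shows "v \<in> V \<Longrightarrow> T v \<in> V" "v \<in> V \<Longrightarrow> w \<in> V \<Longrightarrow> T (v + w) = T v + T w"
    "A \<in> Ops \<Longrightarrow> v \<in> V \<Longrightarrow> T (A v) = A (T v)" "T 0 = 0"
  using assms V_zero unfolding endo_def by auto (metis add_cancel_right_right)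

lemma op_zero: "A \<in> Ops \<Longrightarrow> A 0 = 0"
  using op_add[OF _ V_zero V_zero] by simp

lemma endo_kernel:
  assumes "endo T" "v \<in> V" "v \<noteq> 0" "T v = 0" "w \<in> V"
  shows "T w = 0"
proof -
  have "{v \<in> V. T v = 0} = {0} \<or> {v \<in> V. T v = 0} = V"
    using endoD[OF assms(1)] by (intro simple) (auto simp: V_zero V_add op_closed op_zero)
  then show ?thesis using assms by blast
qed

lemma endo_image:
  assumes "endo T" "v \<in> V" "T v \<noteq> 0"
  shows "T ` V = V"
proof -
  note T = endoD[OF assms(1)]
  have "T ` V = {0} \<or> T ` V = V"
  proof (rule simple)
    show "T ` V \<subseteq> V" "0 \<in> T ` V" using T V_zero by (auto simp: image_iff intro: bexI[of _ 0])
    show "x + y \<in> T ` V" if "x \<in> T ` V" "y \<in> T ` V" for x y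
      using that T(2) V_add by (auto simp: image_iff) metis
    show "A x \<in> T ` V" if "A \<in> Ops" "x \<in> T ` V" for A x
      using that T(3) op_closed by (auto simp: image_iff) metis
  qed
  then show ?thesis using assms by blast
qed

lemma endo_sum:
  assumes "\<And>i. i \<in> I \<Longrightarrow> endo (f i)"
  shows "endo (\<lambda>v. \<Sum>i\<in>I. f i v)"
  using assms
proof (induction I rule: infinite_finite_induct)
  case (insert x F)
  then show ?case unfolding endo_def by (simp add: V_add op_add add_ac)
qed (auto simp: endo_def V_zero op_zero)

lemma endo_comp: "endo S \<Longrightarrow> endo T \<Longrightarrow> endo (\<lambda>v. S (T v))"
  unfolding endo_def by simp

lemma endo_funpow: "endo T \<Longrightarrow> endo (T ^^ i)"
  by (induction i) (auto simp: endo_def)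

definition annihilator :: "('r \<Rightarrow> 'b \<Rightarrow> 'b) \<Rightarrow> 'r set" where
  "annihilator \<rho> = {r. \<forall>v\<in>V. \<rho> r v = 0}"

definition endo_action :: "('r::comm_ring_1 \<Rightarrow> 'b \<Rightarrow> 'b) \<Rightarrow> bool" where
  "endo_action \<rho> \<longleftrightarrow> comm_action V \<rho> \<and> (\<forall>r. endo (\<rho> r))"

text \<open>Endomorphisms of a simple module are zero or injective, so a product acting as zero has
  a factor acting as zero.\<close>

lemma prime_annihilator:
  assumes "endo_action \<rho>"
  shows "prime_set (annihilator \<rho>)"
proof -
  interpret comm_action V \<rho> using assms by (simp add: endo_action_def)
  have endo: "endo (\<rho> r)" for r using assms by (simp add: endo_action_def)
  obtain v0 where v0: "v0 \<in> V" "v0 \<noteq> 0" using V_nontrivial V_zero by blast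
  have "x \<in> annihilator \<rho> \<or> y \<in> annihilator \<rho>" if "x * y \<in> annihilator \<rho>" for x y
  proof (rule ccontr)
    assume "\<not> ?thesis"
    then obtain v where v: "v \<in> V" "\<rho> y v \<noteq> 0" and "x \<notin> annihilator \<rho>"
      by (auto simp: annihilator_def)
    moreover have "\<rho> x (\<rho> y v) = 0" using that v act_mult by (simp add: annihilator_def)
    then have "x \<in> annihilator \<rho>"
      using endo_kernel[OF endo act_closed[OF v(1)] v(2)] unfolding annihilator_def by blast
    ultimately show False by blast
  qed
  then show ?thesis
    unfolding prime_set_def using v0
    by (auto simp: annihilator_def act_zero_left act_add_left act_mult act_zero_right act_one)
qed

lemma endo_action_poly:
  assumes "endo_action \<rho>" "endo z" "\<forall>v\<in>V. \<forall>r. z (\<rho> r v) = \<rho> r (z v)"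
  shows "comm_action_endo V \<rho> z" "endo_action (poly_act \<rho> z)"
    "annihilator \<rho> = {r. [:r:] \<in> annihilator (poly_act \<rho> z)}"
proof -
  interpret comm_action V \<rho> using assms(1) by (simp add: endo_action_def)
  show *: "comm_action_endo V \<rho> z"
    using endoD[OF assms(2)] assms(3) by unfold_locales auto
  interpret comm_action_endo V \<rho> z by (rule *)
  have "endo (\<lambda>v. \<rho> r ((z ^^ i) v))" for r i
    using endo_comp[of "\<rho> r" "z ^^ i"] endo_funpow[OF assms(2)] assms(1) by (simp add: endo_action_def)
  then have "endo (\<lambda>v. \<Sum>i\<le>degree p. \<rho> (coeff p i) ((z ^^ i) v))" for p
    by (rule endo_sum)
  then have "endo (poly_act \<rho> z p)" for p by (simp add: poly_act_def[abs_def])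
  then show "endo_action (poly_act \<rho> z)" using comm_action_poly by (simp add: endo_action_def)
  show "annihilator \<rho> = {r. [:r:] \<in> annihilator (poly_act \<rho> z)}"
    by (simp add: annihilator_def poly_act_const)
qed

text \<open>
  For a generating set \<open>insert s S\<^sub>1\<close> of minimal size, every \<open>t\<close> with \<open>t s\<close> in the span of \<open>S\<^sub>1\<close> annihilates
  \<open>V\<close>: otherwise \<open>s\<close> itself, lying in \<open>t V\<close>, would be in that span. Writing \<open>s = r w\<close> then inverts \<open>r\<close>.
\<close>

lemma fg_action_field:
  assumes "endo_action \<rho>" "finite S0" "S0 \<subseteq> V" "V \<subseteq> rspan \<rho> S0" "r \<notin> annihilator \<rho>"
  shows "\<exists>s. r * s - 1 \<in> annihilator \<rho>"
proof -
  interpret comm_action V \<rho> using assms(1) by (simp add: endo_action_def)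
  have endo: "endo (\<rho> r)" for r using assms(1) by (simp add: endo_action_def)
  define gen where "gen n \<longleftrightarrow> (\<exists>S. finite S \<and> S \<subseteq> V \<and> V \<subseteq> rspan \<rho> S \<and> card S = n)" for n
  define n where "n = (LEAST n. gen n)"
  have "gen (card S0)" using assms by (auto simp: gen_def)
  then have "gen n" unfolding n_def by (rule LeastI)
  then obtain S where S: "finite S" "S \<subseteq> V" "V \<subseteq> rspan \<rho> S" "card S = n" by (auto simp: gen_def)
  have "S \<noteq> {}"
  proof
    assume "S = {}"
    then have "u = 0" if "u \<in> rspan \<rho> S" for u using that by (auto elim: rspan.cases)
    then show False using S(3) V_nontrivial V_zero by blast
  qed
  then obtain s S1 where s: "S = insert s S1" "s \<notin> S1" by (meson all_not_in_conv mk_disjoint_insert)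
  have S1: "finite S1" "S1 \<subseteq> V" "card S1 < n" "s \<in> V" using S s by auto
  define N1 where "N1 = rspan \<rho> S1"
  have sN1: "s \<notin> N1"
  proof
    assume "s \<in> N1"
    then have "S \<subseteq> rspan \<rho> S1" using s rspan_base[OF S1(2)] by (auto simp: N1_def)
    then have "V \<subseteq> rspan \<rho> S1" using S(3) rspan_trans[OF S1(2)] by blast
    then have "gen (card S1)" using S1 by (auto simp: gen_def)
    then have "n \<le> card S1" unfolding n_def by (rule Least_le)
    then show False using S1(3) by simp
  qed
  have decomp: "\<exists>a. \<exists>n1\<in>N1. u = \<rho> a s + n1" if "u \<in> rspan \<rho> S" for u
    using that
  proof (induction rule: rspan.induct)
    case rspan_zero
    show ?case using act_zero_left[OF S1(4)] by (intro exI[of _ 0] bexI[of _ 0]) (auto simp: N1_def rspan.rspan_zero)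
  next
    case 2: (rspan_step x u b)
    then obtain a n1 where a: "n1 \<in> N1" "u = \<rho> a s + n1" by blast
    show ?case
    proof (cases "x = s")
      case True
      then have "\<rho> b x + u = \<rho> (b + a) s + n1" using a act_add_left[OF S1(4)] by (simp add: add.assoc)
      then show ?thesis using a by blast
    next
      case False
      then have "\<rho> b x + n1 \<in> N1" using 2(1) s a(1) rspan_step by (auto simp: N1_def)
      moreover have "\<rho> b x + u = \<rho> a s + (\<rho> b x + n1)" using a by (simp add: add_ac)
      ultimately show ?thesis by blast
    qed
  qed
  \<comment> \<open>A nonzero endomorphism is onto, hence \<open>s = t w\<close>; writing
    \<open>w\<close> through \<open>s\<close> and \<open>S1\<close> gives the required form.\<close>
  have inv: "\<exists>a. \<exists>n1\<in>N1. s = \<rho> (t * a) s + n1" if t: "t \<notin> annihilator \<rho>" for t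
  proof -
    obtain v where "v \<in> V" "\<rho> t v \<noteq> 0" using t by (auto simp: annihilator_def)
    then have "s \<in> \<rho> t ` V" using endo_image[OF endo] S1(4) by simp
    then obtain w where w: "w \<in> V" "s = \<rho> t w" by auto
    then obtain a n1 where a: "n1 \<in> N1" "w = \<rho> a s + n1" using decomp S(3) by blast
    have "n1 \<in> V" using a(1) rspan_closed[OF S1(2)] by (auto simp: N1_def)
    then have "s = \<rho> (t * a) s + \<rho> t n1"
      using w(2) a(2) S1(4) by (simp add: act_add_right act_closed act_mult)
    moreover have "\<rho> t n1 \<in> N1" using a(1) rspan_act[OF S1(2)] by (simp add: N1_def)
    ultimately show ?thesis by blast
  qed
  have J: "t \<in> annihilator \<rho>" if t: "\<rho> t s \<in> N1" for t
  proof (rule ccontr)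
    assume "t \<notin> annihilator \<rho>"
    then obtain a n1 where "n1 \<in> N1" "s = \<rho> (t * a) s + n1" using inv by blast
    moreover have "\<rho> (t * a) s = \<rho> a (\<rho> t s)" using act_mult[OF S1(4), of a t] by (simp add: mult.commute)
    ultimately have "s \<in> N1" using t rspan_act[OF S1(2)] rspan_add unfolding N1_def by metis
    then show False using sN1 by blast
  qed
  obtain a n1 where a: "n1 \<in> N1" "s = \<rho> (r * a) s + n1" using inv[OF assms(5)] by blast
  then have "\<rho> (1 - r * a) s = n1" using act_diff[OF S1(4)] act_one[OF S1(4)] by (metis add_diff_cancel_left')
  then have "1 - r * a \<in> annihilator \<rho>" using J a(1) by simp
  then have "r * a - 1 \<in> annihilator \<rho>"
    using prime_setD(7)[OF prime_annihilator[OF assms(1)]] by fastforce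
  then show ?thesis by blast
qed

lemma locally_field_poly_act:
  fixes \<rho> :: "'r::idom \<Rightarrow> 'b \<Rightarrow> 'b"
  assumes "endo_action \<rho>" "endo z" "\<forall>v\<in>V. \<forall>r. z (\<rho> r v) = \<rho> r (z v)"
    "locally_field (annihilator (poly_act \<rho> z))"
  shows "locally_field (annihilator \<rho>)"
  using locally_field_contraction[OF prime_annihilator[OF endo_action_poly(2)[OF assms(1-3)]] assms(4)]
  by (simp only: endo_action_poly(3)[OF assms(1-3)])

text \<open>\<open>T\<close> is adjoined first and the central operators after it, so that
  descending through the polynomial rings ends at \<open>k[T]\<close>. The top ring acts through a
  field because \<open>V\<close> is finitely generated over it; each contraction removes one
  variable, and the annihilator in \<open>k[T]\<close> then contains some \<open>T - c\<close>.
  Every adjunction changes the type of the ring, hence the fixed number of operators.\<close>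

lemma schur_fg:
  fixes sc :: "'k::alg_closed_field \<Rightarrow> 'b \<Rightarrow> 'b"
  assumes sc: "endo_action sc" "\<And>c. sc c \<in> Ops"
    and T: "endo T"
    and z: "endo z1" "endo z2" "endo z3" "endo z4" "endo z5"
    and central: "\<And>U v. endo U \<Longrightarrow> v \<in> V \<Longrightarrow>
      z1 (U v) = U (z1 v) \<and> z2 (U v) = U (z2 v) \<and> z3 (U v) = U (z3 v) \<and> z4 (U v) = U (z4 v) \<and> z5 (U v) = U (z5 v)"
    and S: "S0 \<subseteq> V" "S1 \<subseteq> V" "S2 \<subseteq> V" "S3 \<subseteq> V" "S4 \<subseteq> V" "S5 \<subseteq> V"
    and span: "V \<subseteq> rspan sc S0"
    and chain: "\<And>s. s \<in> S0 \<Longrightarrow> \<exists>k. \<exists>s'\<in>S1. s = (z1 ^^ k) s'"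
      "\<And>s. s \<in> S1 \<Longrightarrow> \<exists>k. \<exists>s'\<in>S2. s = (z2 ^^ k) s'"
      "\<And>s. s \<in> S2 \<Longrightarrow> \<exists>k. \<exists>s'\<in>S3. s = (z3 ^^ k) s'"
      "\<And>s. s \<in> S3 \<Longrightarrow> \<exists>k. \<exists>s'\<in>S4. s = (z4 ^^ k) s'"
      "\<And>s. s \<in> S4 \<Longrightarrow> \<exists>k. \<exists>s'\<in>S5. s = (z5 ^^ k) s'"
    and fin: "finite S5"
  shows "\<exists>c. \<forall>v\<in>V. T v = sc c v"
proof -
  have e0: "endo (\<rho> r)" if "endo_action \<rho>" for \<rho> :: "'r::comm_ring_1 \<Rightarrow> 'b \<Rightarrow> 'b" and r
    using that by (simp add: endo_action_def)
  define \<rho>0 where "\<rho>0 = poly_act sc T"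
  define \<rho>1 where "\<rho>1 = poly_act \<rho>0 z1"
  define \<rho>2 where "\<rho>2 = poly_act \<rho>1 z2"
  define \<rho>3 where "\<rho>3 = poly_act \<rho>2 z3"
  define \<rho>4 where "\<rho>4 = poly_act \<rho>3 z4"
  define \<rho>5 where "\<rho>5 = poly_act \<rho>4 z5"
  have c0: "\<forall>v\<in>V. \<forall>r. T (sc r v) = sc r (T v)" using endoD(3)[OF T sc(2)] by blast
  note A0 = endo_action_poly[OF sc(1) T c0, folded \<rho>0_def]
  have c1: "\<forall>v\<in>V. \<forall>r. z1 (\<rho>0 r v) = \<rho>0 r (z1 v)"
    using central[OF e0[OF A0(2)]] by blast
  note A1 = endo_action_poly[OF A0(2) z(1) c1, folded \<rho>1_def]
  have c2: "\<forall>v\<in>V. \<forall>r. z2 (\<rho>1 r v) = \<rho>1 r (z2 v)"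
    using central[OF e0[OF A1(2)]] by blast
  note A2 = endo_action_poly[OF A1(2) z(2) c2, folded \<rho>2_def]
  have c3: "\<forall>v\<in>V. \<forall>r. z3 (\<rho>2 r v) = \<rho>2 r (z3 v)"
    using central[OF e0[OF A2(2)]] by blast
  note A3 = endo_action_poly[OF A2(2) z(3) c3, folded \<rho>3_def]
  have c4: "\<forall>v\<in>V. \<forall>r. z4 (\<rho>3 r v) = \<rho>3 r (z4 v)"
    using central[OF e0[OF A3(2)]] by blast
  note A4 = endo_action_poly[OF A3(2) z(4) c4, folded \<rho>4_def]
  have c5: "\<forall>v\<in>V. \<forall>r. z5 (\<rho>4 r v) = \<rho>4 r (z5 v)"
    using central[OF e0[OF A4(2)]] by blast
  note A5 = endo_action_poly[OF A4(2) z(5) c5, folded \<rho>5_def]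
  \<comment> \<open>Adjoining \<open>T\<close> only enlarges the ring; the generating set is kept by
    using exponent zero.\<close>
  have triv: "\<exists>k. \<exists>s'\<in>S0. s = (T ^^ k) s'" if "s \<in> S0" for s
    using that by (intro exI[of _ 0]) auto
  have "V \<subseteq> rspan \<rho>0 S0"
    using comm_action_endo.rspan_poly_act[OF A0(1) S(1) triv] span unfolding \<rho>0_def by blast
  then have "V \<subseteq> rspan \<rho>1 S1"
    using comm_action_endo.rspan_poly_act[OF A1(1) S(2) chain(1)] unfolding \<rho>1_def by blast
  then have "V \<subseteq> rspan \<rho>2 S2"
    using comm_action_endo.rspan_poly_act[OF A2(1) S(3) chain(2)] unfolding \<rho>2_def by blast
  then have "V \<subseteq> rspan \<rho>3 S3"
    using comm_action_endo.rspan_poly_act[OF A3(1) S(4) chain(3)] unfolding \<rho>3_def by blast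
  then have "V \<subseteq> rspan \<rho>4 S4"
    using comm_action_endo.rspan_poly_act[OF A4(1) S(5) chain(4)] unfolding \<rho>4_def by blast
  then have "V \<subseteq> rspan \<rho>5 S5"
    using comm_action_endo.rspan_poly_act[OF A5(1) S(6) chain(5)] unfolding \<rho>5_def by blast
  then have "\<exists>s. r * s - 1 \<in> annihilator \<rho>5" if "r \<notin> annihilator \<rho>5" for r
    using fg_action_field[OF A5(2) fin S(6) _ that] by blast
  \<comment> \<open>At the top the quotient is already a field, so localising at 1 is
    enough.\<close>
  then have "locally_field (annihilator \<rho>5)"
    unfolding locally_field_def using prime_setD(5)[OF prime_annihilator[OF A5(2)]]
    by (intro exI[of _ 1]) auto
  then have "locally_field (annihilator \<rho>4)"
    unfolding \<rho>5_def
    by (rule locally_field_poly_act[OF A4(2) z(5) c5])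
  then have "locally_field (annihilator \<rho>3)"
    unfolding \<rho>4_def
    by (rule locally_field_poly_act[OF A3(2) z(4) c4])
  then have "locally_field (annihilator \<rho>2)"
    unfolding \<rho>3_def
    by (rule locally_field_poly_act[OF A2(2) z(3) c3])
  then have "locally_field (annihilator \<rho>1)"
    unfolding \<rho>2_def
    by (rule locally_field_poly_act[OF A1(2) z(2) c2])
  then have "locally_field (annihilator \<rho>0)"
    unfolding \<rho>1_def
    by (rule locally_field_poly_act[OF A0(2) z(1) c1])
  then obtain c where c: "[:- c, 1:] \<in> annihilator \<rho>0"
    using locally_field_alg_closed[OF prime_annihilator[OF A0(2)]] by blast
  interpret comm_action_endo V sc T by (rule A0(1))
  have "T v = sc c v" if v: "v \<in> V" for v
  proof -
    have "\<rho>0 [:- c, 1:] v = 0" using c v by (simp add: annihilator_def)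
    moreover have "\<rho>0 [:- c, 1:] v = - sc c v + T v"
      unfolding \<rho>0_def using v by (simp add: poly_act_pCons poly_act_const act_uminus z_closed act_one)
    ultimately show ?thesis by (simp add: eq_neg_iff_add_eq_0)
  qed
  then show ?thesis by blast
qed

end

section \<open>The free algebra and its quotient\<close>

lemma poly_mapping_as_sum: "f = (\<Sum>w\<in>Poly_Mapping.keys f. Poly_Mapping.single w (Poly_Mapping.lookup f w))"
proof (rule poly_mapping_eqI)
  fix v
  have "Poly_Mapping.lookup (\<Sum>w\<in>Poly_Mapping.keys f. Poly_Mapping.single w (Poly_Mapping.lookup f w)) v
      = (\<Sum>w\<in>Poly_Mapping.keys f. if w = v then Poly_Mapping.lookup f v else 0)"
    unfolding lookup_sum by (intro sum.cong) (auto simp: lookup_single when_def)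
  then show "Poly_Mapping.lookup f v =
      Poly_Mapping.lookup (\<Sum>w\<in>Poly_Mapping.keys f. Poly_Mapping.single w (Poly_Mapping.lookup f w)) v"
    by (simp add: in_keys_iff)
qed

lemma fconst_mult_single: "fconst c * Poly_Mapping.single w a = Poly_Mapping.single w (c * a)"
  by (simp add: fconst_def mult_single plus_list_def)

lemma single_mult_fconst: "Poly_Mapping.single w a * fconst c = Poly_Mapping.single w (c * a)"
  by (simp add: fconst_def mult_single plus_list_def mult.commute)

lemma fconst_commute: "f * fconst c = fconst c * f"
proof -
  have "(\<Sum>w\<in>Poly_Mapping.keys f. Poly_Mapping.single w (Poly_Mapping.lookup f w)) * fconst c =
      fconst c * (\<Sum>w\<in>Poly_Mapping.keys f. Poly_Mapping.single w (Poly_Mapping.lookup f w))"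
    by (simp add: sum_distrib_left sum_distrib_right fconst_mult_single single_mult_fconst)
  then show ?thesis using poly_mapping_as_sum[of f] by metis
qed

lemma fconst_simps:
  "fconst (a + b) = fconst a + fconst b" "fconst (a * b) = fconst a * fconst b" "fconst 1 = 1" "fconst 0 = 0"
  "fconst (- a) = - fconst a" "fconst (a - b) = fconst a - fconst b"
proof -
  show "fconst (a * b) = fconst a * fconst b" by (simp add: fconst_def mult_single plus_list_def)
  show "fconst 1 = 1" by (simp add: fconst_def zero_list_def[symmetric])
qed (simp_all add: fconst_def single_add single_uminus single_diff)

lemma single_Cons: "Poly_Mapping.single (g # w) c = fgen g * Poly_Mapping.single w c"
  by (simp add: fgen_def mult_single plus_list_def)

lemma vector_space_free: "vector_space (\<lambda>c f. fconst c * (f :: 'k::field ageing_free))"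
  by unfold_locales (simp_all add: fconst_simps algebra_simps)

abbreviation free_ring :: "'k::field ageing_free ring" where
  "free_ring \<equiv> ring_of_type_algebra"

lemma free_ring_simps [simp]:
  "carrier free_ring = UNIV" "x \<otimes>\<^bsub>free_ring\<^esub> y = x * y" "x \<oplus>\<^bsub>free_ring\<^esub> y = x + y"
  "\<one>\<^bsub>free_ring\<^esub> = 1" "\<zero>\<^bsub>free_ring\<^esub> = 0"
  by (simp_all add: ring_of_type_algebra_def)

lemma ring_free_ring: "ring (free_ring :: 'k::field ageing_free ring)"
proof (rule ringI)
  show "abelian_group (free_ring :: 'k ageing_free ring)"
    by (rule abelian_groupI) (auto simp: add_ac intro: exI[of _ "- x" for x])
  show "Group.monoid (free_ring :: 'k ageing_free ring)" by (rule monoidI) (auto simp: mult.assoc)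
qed (auto simp: algebra_simps)

lemma ideal_ageing_ideal: "ideal (ageing_ideal q) free_ring"
  unfolding ageing_ideal_def by (rule ring.genideal_ideal[OF ring_free_ring]) simp

lemma free_ring_uminus [simp]: "\<ominus>\<^bsub>free_ring\<^esub> x = - x"
proof -
  interpret R: ring "free_ring :: 'a ageing_free ring" by (rule ring_free_ring)
  have "x \<oplus>\<^bsub>free_ring\<^esub> - x = \<zero>\<^bsub>free_ring\<^esub>" by simp
  then show ?thesis by (metis R.add.inv_equality R.add.m_comm UNIV_I free_ring_simps(1))
qed

lemma ageing_ideal_closed:
  "0 \<in> ageing_ideal q"
  "x \<in> ageing_ideal q \<Longrightarrow> y \<in> ageing_ideal q \<Longrightarrow> x + y \<in> ageing_ideal q"
  "x \<in> ageing_ideal q \<Longrightarrow> - x \<in> ageing_ideal q"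
  "x \<in> ageing_ideal q \<Longrightarrow> a * x \<in> ageing_ideal q"
  "x \<in> ageing_ideal q \<Longrightarrow> x * a \<in> ageing_ideal q"
proof -
  interpret ideal "ageing_ideal q" "free_ring :: 'a ageing_free ring" by (rule ideal_ageing_ideal)
  show "0 \<in> ageing_ideal q" using additive_subgroup.zero_closed[OF is_additive_subgroup] by simp
  show "x \<in> ageing_ideal q \<Longrightarrow> y \<in> ageing_ideal q \<Longrightarrow> x + y \<in> ageing_ideal q" using additive_subgroup.a_closed[OF is_additive_subgroup, of x y] by simp
  show "x \<in> ageing_ideal q \<Longrightarrow> - x \<in> ageing_ideal q" using additive_subgroup.a_inv_closed[OF is_additive_subgroup, of x] by simp
  show "x \<in> ageing_ideal q \<Longrightarrow> a * x \<in> ageing_ideal q" using I_l_closed[of x a] by simp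
  show "x \<in> ageing_ideal q \<Longrightarrow> x * a \<in> ageing_ideal q" using I_r_closed[of x a] by simp
qed

lemma ageing_ideal_diff: "x \<in> ageing_ideal q \<Longrightarrow> y \<in> ageing_ideal q \<Longrightarrow> x - y \<in> ageing_ideal q"
  using ageing_ideal_closed(2)[of x q "- y"] ageing_ideal_closed(3)[of y q] by simp

lemma ageing_relations_subset: "ageing_relations q \<subseteq> ageing_ideal q"
  unfolding ageing_ideal_def by (rule ring.genideal_self[OF ring_free_ring]) simp

lemma ageing_ideal_minimal:
  assumes "ageing_relations q \<subseteq> J" "0 \<in> J" "\<And>x y. x \<in> J \<Longrightarrow> y \<in> J \<Longrightarrow> x + y \<in> J"
    "\<And>x a. x \<in> J \<Longrightarrow> a * x \<in> J" "\<And>x a. x \<in> J \<Longrightarrow> x * a \<in> J"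
  shows "ageing_ideal q \<subseteq> J"
proof -
  interpret R: ring "free_ring :: 'a ageing_free ring" by (rule ring_free_ring)
  have "- x \<in> J" if "x \<in> J" for x using assms(4)[OF that, of "- 1"] by simp
  then have "subgroup J (add_monoid free_ring)"
    by (intro R.add.subgroupI) (use assms in \<open>auto simp: a_inv_def[symmetric]\<close>)
  then have "ideal J free_ring" by (rule idealI[OF ring_free_ring]) (use assms in auto)
  then show ?thesis unfolding ageing_ideal_def by (rule R.genideal_minimal) (rule assms(1))
qed

lemma ageing_class_iff: "f' \<in> ageing_class q f \<longleftrightarrow> f' - f \<in> ageing_ideal q"
proof
  assume "f' \<in> ageing_class q f"
  then show "f' - f \<in> ageing_ideal q" by (auto simp: ageing_class_def a_r_coset_def')
next
  assume "f' - f \<in> ageing_ideal q"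
  then show "f' \<in> ageing_class q f"
    unfolding ageing_class_def a_r_coset_def' by (auto intro!: bexI[of _ "f' - f"])
qed

lemma ageing_class_eq_iff: "ageing_class q f = ageing_class q g \<longleftrightarrow> f - g \<in> ageing_ideal q"
proof
  assume "ageing_class q f = ageing_class q g"
  moreover have "f \<in> ageing_class q f" by (simp add: ageing_class_iff ageing_ideal_closed(1))
  ultimately show "f - g \<in> ageing_ideal q" by (simp add: ageing_class_iff)
next
  assume fg: "f - g \<in> ageing_ideal q"
  have "x - f \<in> ageing_ideal q \<longleftrightarrow> x - g \<in> ageing_ideal q" for x
    using ageing_ideal_closed(2)[OF _ fg, of "x - f"] ageing_ideal_diff[OF _ fg, of "x - g"] by auto
  then show "ageing_class q f = ageing_class q g" by (auto simp: ageing_class_iff)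
qed

lemma ageing_algebra_ring: "ring (ageing_algebra q)"
  unfolding ageing_algebra_def by (rule ideal.quotient_is_ring[OF ideal_ageing_ideal])

lemma ageing_algebra_simps:
  "carrier (ageing_algebra q) = range (ageing_class q)"
  "ageing_class q f \<otimes>\<^bsub>ageing_algebra q\<^esub> ageing_class q g = ageing_class q (f * g)"
  "ageing_class q f \<oplus>\<^bsub>ageing_algebra q\<^esub> ageing_class q g = ageing_class q (f + g)"
  "\<one>\<^bsub>ageing_algebra q\<^esub> = ageing_class q 1"
  "\<zero>\<^bsub>ageing_algebra q\<^esub> = ageing_class q 0"
proof -
  interpret ideal "ageing_ideal q" "free_ring :: 'a ageing_free ring" by (rule ideal_ageing_ideal)
  show "carrier (ageing_algebra q) = range (ageing_class q)"
    by (auto simp: ageing_algebra_def FactRing_def A_RCOSETS_def' ageing_class_def)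
  show "ageing_class q f \<otimes>\<^bsub>ageing_algebra q\<^esub> ageing_class q g = ageing_class q (f * g)"
    using rcoset_mult_add[of f g] by (simp add: ageing_algebra_def FactRing_def ageing_class_def)
  show "ageing_class q f \<oplus>\<^bsub>ageing_algebra q\<^esub> ageing_class q g = ageing_class q (f + g)"
    using a_rcos_sum[of f g] by (simp add: ageing_algebra_def FactRing_def ageing_class_def)
  show "\<one>\<^bsub>ageing_algebra q\<^esub> = ageing_class q 1"
    by (simp add: ageing_algebra_def FactRing_def ageing_class_def)
  show "\<zero>\<^bsub>ageing_algebra q\<^esub> = ageing_class q 0"
    by (auto simp: ageing_algebra_def FactRing_def ageing_class_iff)
qed

section \<open>Representations on subsets of type-level groups\<close>

text \<open>Modules are represented on subsets of a type of class \<open>ab_group_add\<close>, where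
  ordinary sums and differences are available. The order of composition in \<open>act_mult\<close>
  is that of right modules.\<close>

locale free_rep =
  fixes V :: "'b::ab_group_add set" and act :: "'k::field ageing_free \<Rightarrow> 'b \<Rightarrow> 'b"
  assumes V_zero: "0 \<in> V"
    and V_add: "v \<in> V \<Longrightarrow> w \<in> V \<Longrightarrow> v + w \<in> V"
    and act_closed: "v \<in> V \<Longrightarrow> act f v \<in> V"
    and act_add_left: "v \<in> V \<Longrightarrow> act (f + g) v = act f v + act g v"
    and act_mult: "v \<in> V \<Longrightarrow> act (f * g) v = act g (act f v)"
    and act_one: "v \<in> V \<Longrightarrow> act 1 v = v"
    and act_add_right: "v \<in> V \<Longrightarrow> w \<in> V \<Longrightarrow> act f (v + w) = act f v + act f w"
begin

abbreviation sc :: "'k \<Rightarrow> 'b \<Rightarrow> 'b" where "sc c \<equiv> act (fconst c)"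

lemma act_zero_right: "act f 0 = 0"
  using act_add_right[OF V_zero V_zero, of f] by simp

lemma act_zero_left: "v \<in> V \<Longrightarrow> act 0 v = 0"
  using act_add_left[of v 0 0] by simp

lemma act_uminus_left: "v \<in> V \<Longrightarrow> act (- f) v = - act f v"
  using act_add_left[of v "- f" f] act_zero_left by (simp add: eq_neg_iff_add_eq_0)

lemma act_diff_left: "v \<in> V \<Longrightarrow> act (f - g) v = act f v - act g v"
  using act_add_left[of v f "- g"] act_uminus_left by simp

lemma V_uminus: "v \<in> V \<Longrightarrow> - v \<in> V"
  using act_closed[of v "- 1"] by (simp add: act_uminus_left act_one)

lemma V_sum: "(\<And>i. i \<in> I \<Longrightarrow> f i \<in> V) \<Longrightarrow> sum f I \<in> V"
  by (induction I rule: infinite_finite_induct) (auto intro: V_zero V_add)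

lemma act_uminus_right: "v \<in> V \<Longrightarrow> act f (- v) = - act f v"
  using act_add_right[of v "- v" f] V_uminus act_zero_right by (simp add: eq_neg_iff_add_eq_0 add.commute)

lemma act_diff_right: "v \<in> V \<Longrightarrow> w \<in> V \<Longrightarrow> act f (v - w) = act f v - act f w"
  using act_add_right[of v "- w" f] V_uminus act_uminus_right by simp

lemma act_sum_left: "v \<in> V \<Longrightarrow> act (sum f I) v = (\<Sum>i\<in>I. act (f i) v)"
  by (induction I rule: infinite_finite_induct) (simp_all add: act_zero_left act_add_left)

lemma act_sum_right: "(\<And>i. i \<in> I \<Longrightarrow> f i \<in> V) \<Longrightarrow> act a (sum f I) = (\<Sum>i\<in>I. act a (f i))"
  by (induction I rule: infinite_finite_induct) (simp_all add: act_zero_right act_add_right V_sum)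

lemma act_sc: "v \<in> V \<Longrightarrow> act f (sc c v) = sc c (act f v)"
  by (simp add: act_mult[symmetric] fconst_commute)

lemma sc_simps:
  assumes "v \<in> V"
  shows "sc (a + b) v = sc a v + sc b v" "sc (a * b) v = sc a (sc b v)" "sc 1 v = v" "sc 0 v = 0"
    "sc (- a) v = - sc a v" "sc (a - b) v = sc a v - sc b v" "a \<noteq> 0 \<Longrightarrow> sc (inverse a) (sc a v) = v"
    "a \<noteq> 0 \<Longrightarrow> sc a (sc (inverse a) v) = v"
proof -
  show m: "sc (a * b) v = sc a (sc b v)" for a b
    using act_mult[OF assms, of "fconst b" "fconst a"] by (simp only: fconst_simps(2) fconst_commute[of "fconst b" a])
  show "sc 1 v = v" using assms by (simp add: fconst_simps act_one)
  then show "a \<noteq> 0 \<Longrightarrow> sc (inverse a) (sc a v) = v" "a \<noteq> 0 \<Longrightarrow> sc a (sc (inverse a) v) = v"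
    using m[of "inverse a" a] m[of a "inverse a"] by (metis left_inverse, metis right_inverse)
qed (use assms in \<open>simp_all add: fconst_simps act_add_left act_zero_left act_uminus_left act_diff_left\<close>)

lemma sc_eq_0: "v \<in> V \<Longrightarrow> sc c v = 0 \<Longrightarrow> c = 0 \<or> v = 0"
  using sc_simps(7)[of v c] act_zero_right by metis

lemma act_single_Cons:
  "v \<in> V \<Longrightarrow> act (Poly_Mapping.single (g # w) c) v = act (Poly_Mapping.single w c) (act (fgen g) v)"
  by (simp add: single_Cons act_mult)

lemma act_closed_generators:
  assumes "H \<subseteq> V" "0 \<in> H" "\<And>v w. v \<in> H \<Longrightarrow> w \<in> H \<Longrightarrow> v + w \<in> H" "\<And>c v. v \<in> H \<Longrightarrow> sc c v \<in> H"
    "\<And>g v. v \<in> H \<Longrightarrow> act (fgen g) v \<in> H" "v \<in> H"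
  shows "act f v \<in> H"
proof -
  have w: "act (Poly_Mapping.single w c) v \<in> H" if "v \<in> H" for w c v
    using that assms(1)
    by (induction w arbitrary: v) (auto simp: act_single_Cons assms(5) fconst_def[symmetric] assms(4) subset_iff)
  have "v \<in> V" using assms by blast
  then have "act f v = (\<Sum>w\<in>Poly_Mapping.keys f. act (Poly_Mapping.single w (Poly_Mapping.lookup f w)) v)"
    by (metis act_sum_left poly_mapping_as_sum)
  moreover have "(\<Sum>w\<in>I. act (Poly_Mapping.single w (Poly_Mapping.lookup f w)) v) \<in> H" for I
    by (induction I rule: infinite_finite_induct) (auto simp: assms w)
  ultimately show ?thesis by simp
qed

lemma act_relations_iff:
  assumes v: "v \<in> V"
  shows "(\<forall>f\<in>ageing_relations q. act f v = 0) \<longleftrightarrow>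
    act (fgen GKinv) (act (fgen GK) v) = v \<and>
    act (fgen GK) (act (fgen GKinv) v) = v \<and>
    act (fgen GK) (act (fgen GE) v) = sc (q powi (-2)) (act (fgen GE) (act (fgen GK) v)) \<and>
    act (fgen GK) (act (fgen GX) v) = sc (q powi (-1)) (act (fgen GX) (act (fgen GK) v)) \<and>
    act (fgen GK) (act (fgen GY) v) = sc q (act (fgen GY) (act (fgen GK) v)) \<and>
    act (fgen GX) (act (fgen GE) v) = sc q (act (fgen GE) (act (fgen GX) v)) \<and>
    act (fgen GY) (act (fgen GE) v) = act (fgen GX) v + sc (q powi (-1)) (act (fgen GE) (act (fgen GY) v)) \<and>
    act (fgen GY) (act (fgen GX) v) = sc q (act (fgen GX) (act (fgen GY) v))"
proof -
  have 1: "act (f * g - 1) v = 0 \<longleftrightarrow> act g (act f v) = v" for f g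
    using v by (simp add: act_diff_left act_mult act_one)
  have 2: "act (f * g - fconst c * g * f) v = 0 \<longleftrightarrow> act g (act f v) = sc c (act f (act g v))" for f g c
    using v by (simp add: act_diff_left act_mult act_closed act_sc)
  have 3: "act (f * g - (h + fconst c * g * f)) v = 0 \<longleftrightarrow> act g (act f v) = act h v + sc c (act f (act g v))" for f g h c
    using v by (simp add: act_diff_left act_add_left act_mult act_closed act_sc)
  show ?thesis by (simp add: ageing_relations_def Let_def 1 2 3)
qed

end

locale ageing_rep = free_rep V act
  for q :: "'k::field" and V :: "'b::ab_group_add set" and act :: "'k ageing_free \<Rightarrow> 'b \<Rightarrow> 'b" +
  assumes act_relation: "f \<in> ageing_relations q \<Longrightarrow> v \<in> V \<Longrightarrow> act f v = 0"
begin

lemma act_ideal: "f \<in> ageing_ideal q \<Longrightarrow> v \<in> V \<Longrightarrow> act f v = 0"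
proof -
  have "ageing_ideal q \<subseteq> {f. \<forall>v\<in>V. act f v = 0}"
    by (rule ageing_ideal_minimal)
      (auto simp: act_relation act_zero_left act_add_left act_mult act_zero_right act_closed)
  then show "f \<in> ageing_ideal q \<Longrightarrow> v \<in> V \<Longrightarrow> act f v = 0" by blast
qed

lemma act_cong: "f - g \<in> ageing_ideal q \<Longrightarrow> v \<in> V \<Longrightarrow> act f v = act g v"
  using act_ideal[of "f - g" v] by (simp add: act_diff_left)

lemma act_relations:
  assumes "v \<in> V"
  shows "act (fgen GKinv) (act (fgen GK) v) = v"
    "act (fgen GK) (act (fgen GKinv) v) = v"
    "act (fgen GK) (act (fgen GE) v) = sc (q powi (-2)) (act (fgen GE) (act (fgen GK) v))"
    "act (fgen GK) (act (fgen GX) v) = sc (q powi (-1)) (act (fgen GX) (act (fgen GK) v))"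
    "act (fgen GK) (act (fgen GY) v) = sc q (act (fgen GY) (act (fgen GK) v))"
    "act (fgen GX) (act (fgen GE) v) = sc q (act (fgen GE) (act (fgen GX) v))"
    "act (fgen GY) (act (fgen GE) v) = act (fgen GX) v + sc (q powi (-1)) (act (fgen GE) (act (fgen GY) v))"
    "act (fgen GY) (act (fgen GX) v) = sc q (act (fgen GX) (act (fgen GY) v))"
  using act_relations_iff[OF assms, of q] act_relation assms by blast+

end

locale ageing_simple = ageing_rep +
  assumes nontrivial: "V \<noteq> {0}"
    and simple: "H \<subseteq> V \<Longrightarrow> 0 \<in> H \<Longrightarrow> (\<And>v w. v \<in> H \<Longrightarrow> w \<in> H \<Longrightarrow> v + w \<in> H) \<Longrightarrow>
      (\<And>f v. v \<in> H \<Longrightarrow> act f v \<in> H) \<Longrightarrow> H = {0} \<or> H = V"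

lemma ageing_hom_generators:
  assumes A: "ageing_rep q V act" and B: "ageing_rep q W act'"
    and h: "\<And>v. v \<in> V \<Longrightarrow> h v \<in> W" "\<And>v w. v \<in> V \<Longrightarrow> w \<in> V \<Longrightarrow> h (v + w) = h v + h w"
    and c: "\<And>c v. v \<in> V \<Longrightarrow> h (act (fconst c) v) = act' (fconst c) (h v)"
    and g: "\<And>g v. v \<in> V \<Longrightarrow> h (act (fgen g) v) = act' (fgen g) (h v)"
    and v: "v \<in> V"
  shows "h (act f v) = act' f (h v)"
proof -
  interpret A: ageing_rep q V act by (rule A)
  interpret B: ageing_rep q W act' by (rule B)
  have w: "h (act (Poly_Mapping.single w c) v) = act' (Poly_Mapping.single w c) (h v)" if "v \<in> V" for w c v
    using that by (induction w arbitrary: v) 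
      (auto simp: A.act_single_Cons B.act_single_Cons g h fconst_def[symmetric] c A.act_closed)
  have h0: "h 0 = 0" using h(2)[OF A.V_zero A.V_zero] by simp
  have s: "h (\<Sum>w\<in>I. act (Poly_Mapping.single w (k w)) v) =
      (\<Sum>w\<in>I. act' (Poly_Mapping.single w (k w)) (h v))" for I k
    by (induction I rule: infinite_finite_induct) (simp_all add: h0 h w v A.V_sum A.act_closed)
  have "h (act (\<Sum>w\<in>Poly_Mapping.keys f. Poly_Mapping.single w (Poly_Mapping.lookup f w)) v) =
      act' (\<Sum>w\<in>Poly_Mapping.keys f. Poly_Mapping.single w (Poly_Mapping.lookup f w)) (h v)"
    by (simp add: A.act_sum_left B.act_sum_left v h s)
  then show ?thesis by (metis poly_mapping_as_sum)
qed

section \<open>Passing between module records and representations\<close>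

lemma right_module_act:
  fixes N :: "('k::field ageing_free set, 'v) module"
  assumes "right_module (ageing_algebra q) N"
  shows "u \<in> carrier N \<Longrightarrow> ageing_class q f \<odot>\<^bsub>N\<^esub> u \<in> carrier N"
    and "u \<in> carrier N \<Longrightarrow> ageing_class q (f + g) \<odot>\<^bsub>N\<^esub> u = ageing_class q f \<odot>\<^bsub>N\<^esub> u \<oplus>\<^bsub>N\<^esub> ageing_class q g \<odot>\<^bsub>N\<^esub> u"
    and "u \<in> carrier N \<Longrightarrow> ageing_class q (f * g) \<odot>\<^bsub>N\<^esub> u = ageing_class q g \<odot>\<^bsub>N\<^esub> (ageing_class q f \<odot>\<^bsub>N\<^esub> u)"
    and "u \<in> carrier N \<Longrightarrow> ageing_class q 1 \<odot>\<^bsub>N\<^esub> u = u"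
    and "u \<in> carrier N \<Longrightarrow> ageing_class q 0 \<odot>\<^bsub>N\<^esub> u = \<zero>\<^bsub>N\<^esub>"
    and "ageing_class q f \<odot>\<^bsub>N\<^esub> \<zero>\<^bsub>N\<^esub> = \<zero>\<^bsub>N\<^esub>"
    and "u \<in> carrier N \<Longrightarrow> w \<in> carrier N \<Longrightarrow>
      ageing_class q f \<odot>\<^bsub>N\<^esub> (u \<oplus>\<^bsub>N\<^esub> w) = ageing_class q f \<odot>\<^bsub>N\<^esub> u \<oplus>\<^bsub>N\<^esub> ageing_class q f \<odot>\<^bsub>N\<^esub> w"
proof -
  interpret right_module "ageing_algebra q" N by (rule assms)
  have car: "ageing_class q f \<in> carrier (ageing_algebra q)" for f by (simp add: ageing_algebra_simps)
  show cl: "u \<in> carrier N \<Longrightarrow> ageing_class q f \<odot>\<^bsub>N\<^esub> u \<in> carrier N" for u f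
    using smult_closed[OF car] .
  show add: "u \<in> carrier N \<Longrightarrow> ageing_class q (f + g) \<odot>\<^bsub>N\<^esub> u = ageing_class q f \<odot>\<^bsub>N\<^esub> u \<oplus>\<^bsub>N\<^esub> ageing_class q g \<odot>\<^bsub>N\<^esub> u" for f g u
    using smult_l_distr[OF car car] by (simp add: ageing_algebra_simps)
  show "u \<in> carrier N \<Longrightarrow> ageing_class q (f * g) \<odot>\<^bsub>N\<^esub> u = ageing_class q g \<odot>\<^bsub>N\<^esub> (ageing_class q f \<odot>\<^bsub>N\<^esub> u)"
    using smult_assoc[OF car car] by (simp add: ageing_algebra_simps)
  show "u \<in> carrier N \<Longrightarrow> ageing_class q 1 \<odot>\<^bsub>N\<^esub> u = u"
    using smult_one by (simp add: ageing_algebra_simps)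
  show r: "u \<in> carrier N \<Longrightarrow> w \<in> carrier N \<Longrightarrow>
      ageing_class q f \<odot>\<^bsub>N\<^esub> (u \<oplus>\<^bsub>N\<^esub> w) = ageing_class q f \<odot>\<^bsub>N\<^esub> u \<oplus>\<^bsub>N\<^esub> ageing_class q f \<odot>\<^bsub>N\<^esub> w" for u w
    using smult_r_distr[OF car] by simp
  show "u \<in> carrier N \<Longrightarrow> ageing_class q 0 \<odot>\<^bsub>N\<^esub> u = \<zero>\<^bsub>N\<^esub>"
    using add[of u 0 0] cl[of u 0] by (metis M.add.r_cancel_one' add_0)
  show "ageing_class q f \<odot>\<^bsub>N\<^esub> \<zero>\<^bsub>N\<^esub> = \<zero>\<^bsub>N\<^esub>"
    using r[of "\<zero>\<^bsub>N\<^esub>" "\<zero>\<^bsub>N\<^esub>"] cl[of "\<zero>\<^bsub>N\<^esub>" f] by (metis M.add.r_cancel_one' M.r_zero M.zero_closed)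
qed

lemma right_module_group: "right_module R N \<Longrightarrow> abelian_group N"
  by (simp add: right_module_def)

lemma submoduleI_right:
  fixes N :: "('k::field ageing_free set, 'v) module"
  assumes N: "right_module (ageing_algebra q) N" and "H \<subseteq> carrier N" "\<zero>\<^bsub>N\<^esub> \<in> H"
    "\<And>u w. u \<in> H \<Longrightarrow> w \<in> H \<Longrightarrow> u \<oplus>\<^bsub>N\<^esub> w \<in> H" "\<And>f u. u \<in> H \<Longrightarrow> ageing_class q f \<odot>\<^bsub>N\<^esub> u \<in> H"
  shows "submodule H (ageing_algebra q) N"
proof -
  interpret M: abelian_group N by (rule right_module_group[OF N])
  note act = right_module_act[OF N]
  have neg: "\<ominus>\<^bsub>N\<^esub> u \<in> H" if "u \<in> H" for u
  proof -
    have u: "u \<in> carrier N" using that assms by blast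
    have "ageing_class q (- 1) \<odot>\<^bsub>N\<^esub> u \<oplus>\<^bsub>N\<^esub> u = \<zero>\<^bsub>N\<^esub>"
      using act(2)[OF u, of "- 1" 1] act(4,5)[OF u] by simp
    then have "\<ominus>\<^bsub>N\<^esub> u = ageing_class q (- 1) \<odot>\<^bsub>N\<^esub> u"
      using M.minus_equality[OF _ u act(1)[OF u]] by simp
    then show ?thesis using assms(5)[OF that] by simp
  qed
  show ?thesis
  proof (intro submodule.intro submodule_axioms.intro)
    show "subgroup H (add_monoid N)"
      by (rule M.add.subgroupI) (use assms neg in \<open>auto simp: a_inv_def[symmetric]\<close>)
    show "a \<odot>\<^bsub>N\<^esub> x \<in> H" if "a \<in> carrier (ageing_algebra q)" "x \<in> H" for a x
      using that assms(5) by (auto simp: ageing_algebra_simps)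
  qed
qed

text \<open>
  A simple module is \<open>F/I\<close> for a right ideal \<open>I\<close> of the free algebra \<open>F\<close>, and hence is carried by a linear
  complement of \<open>I\<close>, the image of a projection \<open>\<pi>\<close> with kernel \<open>I\<close>.
\<close>

lemma quotient_realization:
  fixes I :: "'k::field ageing_free set"
  assumes I: "0 \<in> I" "\<And>f g. f \<in> I \<Longrightarrow> g \<in> I \<Longrightarrow> f + g \<in> I" "\<And>f g. f \<in> I \<Longrightarrow> f * g \<in> I"
    and ideal: "ageing_ideal q \<subseteq> I"
  obtains \<pi> where "\<And>x y. \<pi> x = \<pi> y \<longleftrightarrow> x - y \<in> I" "\<And>x. \<pi> (\<pi> x) = \<pi> x" "\<And>x y. \<pi> (x + y) = \<pi> x + \<pi> y"
    "\<And>c x. \<pi> (fconst c * x) = fconst c * \<pi> x" "ageing_rep q (range \<pi>) (\<lambda>f u. \<pi> (u * f))"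
proof -
  interpret vs: vector_space "\<lambda>c f. fconst c * (f :: 'k ageing_free)" by (rule vector_space_free)
  interpret vsp: vector_space_pair "\<lambda>c f. fconst c * (f :: 'k ageing_free)" "\<lambda>c f. fconst c * (f :: 'k ageing_free)" ..
  have I_scale: "fconst c * x \<in> I" if "x \<in> I" for c x
    using I(3)[OF that, of "fconst c"] by (simp only: fconst_commute)
  have I_sub: "vs.subspace I" by (rule vs.subspaceI) (use I(1,2) I_scale in auto)
  obtain B where B: "B \<subseteq> I" "vs.independent B" "I \<subseteq> vs.span B" by (rule vs.basis_exists)
  define C where "C = vs.extend_basis B"
  have C: "B \<subseteq> C" "vs.independent C" "vs.span C = UNIV"
    using vs.extend_basis_superset[OF B(2)] vs.independent_extend_basis[OF B(2)] vs.span_extend_basis[OF B(2)]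
    by (auto simp: C_def)
  \<comment> \<open>\<open>\<pi>\<close> kills the basis \<open>B\<close> of \<open>I\<close> and
    fixes the vectors that complete it to a basis of the free algebra, so it is a projection along
    \<open>I\<close>.\<close>
  obtain \<pi> where \<pi>: "Vector_Spaces.linear (\<lambda>c f. fconst c * f) (\<lambda>c f. fconst c * f) \<pi>"
    "\<And>b. b \<in> C \<Longrightarrow> \<pi> b = (if b \<in> B then 0 else b)"
    using vsp.linear_independent_extend[OF C(2), of "\<lambda>b. if b \<in> B then 0 else b"] by auto
  interpret \<pi>: Vector_Spaces.linear "\<lambda>c f. fconst c * f" "\<lambda>c f. fconst c * f" \<pi> by (rule \<pi>(1))
  have \<pi>I: "\<pi> x = 0" if "x \<in> I" for x
  proof -
    have "x \<in> vs.span B" using B that by blast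
    then show ?thesis
      by (rule vs.span_induct_alt) (use \<pi>(2) C(1) in \<open>auto simp: \<pi>.add \<pi>.scale \<pi>.zero\<close>)
  qed
  have x\<pi>: "x - \<pi> x \<in> I" for x
  proof -
    have "x \<in> vs.span C" by (simp add: C)
    then show ?thesis
    proof (rule vs.span_induct_alt)
      show "0 - \<pi> 0 \<in> I" using vs.subspace_0[OF I_sub] by (simp add: \<pi>.zero)
      fix c x y assume "x \<in> C" "y - \<pi> y \<in> I"
      moreover have "x - \<pi> x \<in> I"
        using \<pi>(2)[OF \<open>x \<in> C\<close>] B(1) vs.subspace_0[OF I_sub] by auto
      ultimately have "fconst c * (x - \<pi> x) + (y - \<pi> y) \<in> I"
        using vs.subspace_scale[OF I_sub] I(2) by blast
      then show "fconst c * x + y - \<pi> (fconst c * x + y) \<in> I"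
        by (simp add: \<pi>.add \<pi>.scale algebra_simps)
    qed
  qed
  have \<pi>eq: "\<pi> x = \<pi> y \<longleftrightarrow> x - y \<in> I" for x y
  proof
    assume "x - y \<in> I"
    then show "\<pi> x = \<pi> y" using \<pi>I[of "x - y"] by (simp add: \<pi>.diff)
  next
    assume "\<pi> x = \<pi> y"
    then have "x - y = (x - \<pi> x) + (y - \<pi> y) * - 1" by simp
    then show "x - y \<in> I" using I(2)[OF x\<pi> I(3)[OF x\<pi>]] by metis
  qed
  have \<pi>\<pi>: "\<pi> (\<pi> x) = \<pi> x" for x
    using I(3)[OF x\<pi>[of x], of "- 1"] by (simp add: \<pi>eq)
  \<comment> \<open>Replacing \<open>x\<close> by its representative does not change the class of
    \<open>x * f\<close>, because \<open>I\<close> is a right ideal.\<close>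
  have m: "\<pi> (\<pi> x * f) = \<pi> (x * f)" for x f
    using I(3)[OF I(3)[OF x\<pi>[of x], of "- 1"], of f] by (simp add: \<pi>eq left_diff_distrib)
  have "ageing_rep q (range \<pi>) (\<lambda>f u. \<pi> (u * f))"
  proof
    show "0 \<in> range \<pi>" using \<pi>.zero by (metis rangeI)
    show "u + w \<in> range \<pi>" if "u \<in> range \<pi>" "w \<in> range \<pi>" for u w
      using that by (auto simp: \<pi>.add[symmetric])
    show "\<pi> (u * f) = 0" if "f \<in> ageing_relations q" for u f
      using that ageing_relations_subset ageing_ideal_closed(4)[of f q u] ideal \<pi>I by blast
    fix u w f g assume u: "u \<in> range \<pi>" "w \<in> range \<pi>"
    show "\<pi> ((u + w) * f) = \<pi> (u * f) + \<pi> (w * f)" by (simp only: distrib_right \<pi>.add)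
  next
    fix u f g assume u: "u \<in> range \<pi>"
    show "\<pi> (u * (f + g)) = \<pi> (u * f) + \<pi> (u * g)" by (simp only: distrib_left \<pi>.add)
    show "\<pi> (u * (f * g)) = \<pi> (\<pi> (u * f) * g)" by (simp only: m mult.assoc)
    show "\<pi> (u * 1) = u" using u by (auto simp: \<pi>\<pi>)
    show "\<pi> (u * f) \<in> range \<pi>" by (rule rangeI)
  qed
  then show ?thesis by (intro that[of \<pi>] \<pi>eq \<pi>\<pi> \<pi>.add \<pi>.scale)
qed

text \<open>The carrier type of \<open>N\<close> is arbitrary, while \<open>V\<close> consists of
  elements of the free algebra. The last clause lets scalars act by the multiplication of the free
  algebra, so that linear algebra there applies to \<open>V\<close> and, through \<open>h\<close>,
  to \<open>N\<close>.\<close>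

lemma simple_module_realization:
  fixes N :: "('k::field ageing_free set, 'v) module"
  assumes N: "simple_right_module (ageing_algebra q) N"
  obtains V :: "'k ageing_free set" and act h where
    "ageing_simple q V act" "bij_betw h V (carrier N)"
    "\<And>u w. u \<in> V \<Longrightarrow> w \<in> V \<Longrightarrow> h (u + w) = h u \<oplus>\<^bsub>N\<^esub> h w"
    "\<And>f u. u \<in> V \<Longrightarrow> h (act f u) = ageing_class q f \<odot>\<^bsub>N\<^esub> h u"
    "\<And>c v. v \<in> V \<Longrightarrow> act (fconst c) v = fconst c * v"
proof -
  have rm: "right_module (ageing_algebra q) N" using N by (simp add: simple_right_module_def)
  interpret M: abelian_group N by (rule right_module_group[OF rm])
  note act = right_module_act[OF rm]
  define h where "h f v = ageing_class q f \<odot>\<^bsub>N\<^esub> v" for f v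
  obtain v where v: "v \<in> carrier N" "v \<noteq> \<zero>\<^bsub>N\<^esub>"
    using N M.zero_closed by (auto simp: simple_right_module_def)
  \<comment> \<open>The annihilator of one nonzero vector; since that vector generates
    \<open>N\<close>, acting on it identifies the quotient by \<open>I\<close> with
    \<open>N\<close>.\<close>
  define I where "I = {f. h f v = \<zero>\<^bsub>N\<^esub>}"
  have hd: "h (f - g) v = \<zero>\<^bsub>N\<^esub> \<longleftrightarrow> h f v = h g v" for f g
  proof -
    have "h f v = h (f - g) v \<oplus>\<^bsub>N\<^esub> h g v" using act(2)[OF v(1), of "f - g" g] by (simp add: h_def)
    then show ?thesis using act(1)[OF v(1)] by (simp add: h_def)
  qed
  have I_mult: "f * g \<in> I" if "f \<in> I" for f g
    using that act(3)[OF v(1)] act(6) by (simp add: I_def h_def)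
  have I_add: "f + g \<in> I" if "f \<in> I" "g \<in> I" for f g
    using that act(2)[OF v(1)] by (simp add: I_def h_def)
  have I0: "0 \<in> I" using act(5)[OF v(1)] by (simp add: I_def h_def)
  have ideal: "ageing_ideal q \<subseteq> I"
    using act(5)[OF v(1)] by (auto simp: I_def h_def) (metis ageing_class_eq_iff diff_zero)
  obtain \<pi> where \<pi>I: "\<And>x y. \<pi> x = \<pi> y \<longleftrightarrow> x - y \<in> I" and \<pi>\<pi>: "\<And>x. \<pi> (\<pi> x) = \<pi> x"
    and \<pi>_add: "\<And>x y. \<pi> (x + y) = \<pi> x + \<pi> y"
    and \<pi>_scale: "\<And>c x. \<pi> (fconst c * x) = fconst c * \<pi> x" and rep': "ageing_rep q (range \<pi>) (\<lambda>f u. \<pi> (u * f))"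
    by (rule quotient_realization[of I q]) (use I0 I_add I_mult ideal in auto)
  have \<pi>eq: "\<pi> x = \<pi> y \<longleftrightarrow> h x v = h y v" for x y using \<pi>I hd by (simp add: I_def)
  have h\<pi>: "h (\<pi> x) v = h x v" for x using \<pi>\<pi> \<pi>eq by metis
  define V where "V = range \<pi>"
  define A where "A f u = \<pi> (u * f)" for f u
  have \<pi>V: "\<pi> u = u" if "u \<in> V" for u using that \<pi>eq h\<pi> by (auto simp: V_def)
  have hA: "h (A f u) v = ageing_class q f \<odot>\<^bsub>N\<^esub> h u v" for f u
    using act(3)[OF v(1), of u f] by (simp add: A_def h\<pi>) (simp add: h_def)
  have V_eq: "u = w" if "u \<in> V" "w \<in> V" "h u v = h w v" for u w
    using \<pi>eq[of u w] that \<pi>V by simp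
  have AV: "A f u \<in> V" for f u by (simp add: A_def V_def)
  have rep: "ageing_rep q V A" using rep' by (simp only: V_def A_def[abs_def])
  interpret rep: ageing_rep q V A by (rule rep)
  have sub: "K = {\<zero>\<^bsub>N\<^esub>} \<or> K = carrier N"
    if "K \<subseteq> carrier N" "\<zero>\<^bsub>N\<^esub> \<in> K" "\<And>u w. u \<in> K \<Longrightarrow> w \<in> K \<Longrightarrow> u \<oplus>\<^bsub>N\<^esub> w \<in> K"
      "\<And>f u. u \<in> K \<Longrightarrow> ageing_class q f \<odot>\<^bsub>N\<^esub> u \<in> K" for K
    using N submoduleI_right[OF rm that] by (auto simp: simple_right_module_def)
  have hadd: "h (f + g) v = h f v \<oplus>\<^bsub>N\<^esub> h g v" for f g using act(2)[OF v(1)] by (simp add: h_def)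
  have h0: "h 0 v = \<zero>\<^bsub>N\<^esub>" using act(5)[OF v(1)] by (simp add: h_def)
  have inj: "inj_on (\<lambda>u. h u v) V" using V_eq by (auto simp: inj_on_def)
  have hN: "h f v \<in> carrier N" for f using act(1)[OF v(1)] by (simp add: h_def)
  have img: "(\<lambda>u. h u v) ` V = carrier N"
  proof -
    have "(\<lambda>u. h u v) ` V = {\<zero>\<^bsub>N\<^esub>} \<or> (\<lambda>u. h u v) ` V = carrier N"
    proof (rule sub)
      show "(\<lambda>u. h u v) ` V \<subseteq> carrier N" using hN by auto
      show "\<zero>\<^bsub>N\<^esub> \<in> (\<lambda>u. h u v) ` V" using rep.V_zero h0 by (metis image_eqI)
      show "u \<oplus>\<^bsub>N\<^esub> w \<in> (\<lambda>u. h u v) ` V" if "u \<in> (\<lambda>u. h u v) ` V" "w \<in> (\<lambda>u. h u v) ` V" for u w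
        using that rep.V_add hadd by (smt (verit, best) image_iff)
      show "ageing_class q f \<odot>\<^bsub>N\<^esub> u \<in> (\<lambda>u. h u v) ` V" if "u \<in> (\<lambda>u. h u v) ` V" for f u
        using that hA AV by (smt (verit, best) image_iff)
    qed
    moreover have "v \<in> (\<lambda>u. h u v) ` V"
    proof -
      have "h (\<pi> 1) v = v" using act(4)[OF v(1)] by (simp add: h\<pi>) (simp add: h_def)
      then show ?thesis unfolding V_def by (metis image_eqI rangeI)
    qed
    ultimately show ?thesis using v(2) by auto
  qed
  have "ageing_simple q V A"
  proof (intro ageing_simple.intro rep ageing_simple_axioms.intro)
    show "V \<noteq> {0}" using img v h0 by auto
    fix H assume H: "H \<subseteq> V" "0 \<in> H" "\<And>v w. v \<in> H \<Longrightarrow> w \<in> H \<Longrightarrow> v + w \<in> H" "\<And>f v. v \<in> H \<Longrightarrow> A f v \<in> H"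
    have "(\<lambda>u. h u v) ` H = {\<zero>\<^bsub>N\<^esub>} \<or> (\<lambda>u. h u v) ` H = carrier N"
    proof (rule sub)
      show "(\<lambda>u. h u v) ` H \<subseteq> carrier N" using hN by auto
      show "\<zero>\<^bsub>N\<^esub> \<in> (\<lambda>u. h u v) ` H" using H(2) h0 by (metis image_eqI)
      show "u \<oplus>\<^bsub>N\<^esub> w \<in> (\<lambda>u. h u v) ` H" if "u \<in> (\<lambda>u. h u v) ` H" "w \<in> (\<lambda>u. h u v) ` H" for u w
        using that H(3) hadd by (smt (verit, best) image_iff)
      show "ageing_class q f \<odot>\<^bsub>N\<^esub> u \<in> (\<lambda>u. h u v) ` H" if "u \<in> (\<lambda>u. h u v) ` H" for f u
        using that hA H(4) by (smt (verit, best) image_iff)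
    qed
    then show "H = {0} \<or> H = V"
    proof
      assume "(\<lambda>u. h u v) ` H = {\<zero>\<^bsub>N\<^esub>}"
      then have "u = 0" if "u \<in> H" for u using that V_eq[of u 0] H(1,2) h0 by auto
      then show ?thesis using H(2) by blast
    next
      assume "(\<lambda>u. h u v) ` H = carrier N"
      then show ?thesis using img inj H(1) by (metis inj_on_image_eq_iff order_refl)
    qed
  qed
  moreover have "bij_betw (\<lambda>u. h u v) V (carrier N)" using inj img by (simp add: bij_betw_def)
  moreover have "A (fconst c) u = fconst c * u" if "u \<in> V" for c u
    using that by (simp add: A_def fconst_commute \<pi>_scale \<pi>V)
  ultimately show ?thesis using that[of V A "\<lambda>u. h u v"] hadd hA by blast
qed

section \<open>Coordinate modules\<close>

locale root_setting =
  fixes q :: "'k::field" and l :: nat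
  assumes l_ge_3: "l \<ge> 3" and primitive: "primitive_root_of_unity l q"
begin

abbreviation L :: int where "L \<equiv> int l"
abbreviation m :: int where "m \<equiv> int (ord_sq l)"
text \<open>The amount by which the second index moves when the first one wraps around in
  \<open>M_1\<close> and \<open>M_2\<close>; zero for odd \<open>l\<close>.\<close>

definition s :: int where "s = (if even l then int l div 2 else 0)"

lemma q_nonzero: "q \<noteq> 0"
  using primitive l_ge_3 by (auto simp: primitive_root_of_unity_def power_0_left)

lemma q_powi_eq_1_iff: "q powi a = 1 \<longleftrightarrow> L dvd a"
proof -
  have qL: "q powi L = 1" using primitive by (simp add: primitive_root_of_unity_def power_int_def)
  have "q powi a = q powi (L * (a div L) + a mod L)" by simp
  also have "\<dots> = q powi (a mod L)"
    using q_nonzero by (subst power_int_add) (simp_all only: power_int_mult qL power_int_1_left mult_1 disjI1 simp_thms)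
  also have "\<dots> = q ^ nat (a mod L)" using l_ge_3 by (simp add: power_int_def)
  finally have e: "q powi a = q ^ nat (a mod L)" .
  have "nat (a mod L) < l" using l_ge_3 by (simp add: nat_less_iff)
  then have "q ^ nat (a mod L) = 1 \<longleftrightarrow> nat (a mod L) = 0"
    using primitive unfolding primitive_root_of_unity_def by (metis gr0I power_0)
  moreover have "nat (a mod L) = 0 \<longleftrightarrow> a mod L = 0" using l_ge_3 pos_mod_sign[of L a] by linarith
  ultimately show ?thesis using e by (simp add: dvd_eq_mod_eq_0)
qed

lemma q_powi_eq_iff: "q powi a = q powi b \<longleftrightarrow> L dvd a - b"
proof -
  have "q powi a = q powi b \<longleftrightarrow> q powi (a - b) = 1"
    using q_nonzero by (simp add: power_int_diff)
  then show ?thesis by (simp add: q_powi_eq_1_iff)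
qed

lemma m_pos: "m > 0" and L_pos: "L > 0"
  using l_ge_3 by (auto simp: ord_sq_def)

lemma L_dvd_twice_iff: "L dvd 2 * a \<longleftrightarrow> m dvd a"
proof (cases "even l")
  case True
  then have "L = 2 * m" by (auto simp: ord_sq_def elim: evenE)
  then show ?thesis by simp
next
  case False
  then have "coprime L 2" by (simp add: coprime_commute)
  then show ?thesis using False by (simp add: ord_sq_def coprime_dvd_mult_right_iff)
qed

text \<open>These relations treat both parities at once: \<open>(m, s)\<close> is
  \<open>(l, 0)\<close> for odd \<open>l\<close> and \<open>(l/2, l/2)\<close> for even
  \<open>l\<close>.\<close>

lemma L_eq: "L = m + s" "L dvd m - s"
proof -
  show "L = m + s" by (cases "even l") (auto simp: ord_sq_def s_def elim: evenE)
  show "L dvd m - s" by (cases "even l") (auto simp: ord_sq_def s_def elim: evenE)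
qed

lemma L_dvd_mult_2s: "L dvd 2 * s" "L dvd 2 * m"
proof -
  show "L dvd 2 * m" using L_dvd_twice_iff[of m] by simp
  then show "L dvd 2 * s" using L_eq(2) by (metis dvd_diff_commute dvd_mult right_diff_distrib' zdvd_zdiffD)
qed

lemma q_powi_cong: "L dvd a - b \<Longrightarrow> q powi a = q powi b"
  by (simp add: q_powi_eq_iff)

lemma q_sq_neq_1: "q powi 2 \<noteq> 1" "q powi (- 2) \<noteq> 1" "q\<^sup>2 \<noteq> 1" "1 - q\<^sup>2 \<noteq> 0"
proof -
  have "\<not> L dvd 2" using l_ge_3 by (auto dest: zdvd_imp_le)
  then show *: "q powi 2 \<noteq> 1" "q powi (- 2) \<noteq> 1" by (simp_all only: q_powi_eq_1_iff dvd_minus_iff not_False_eq_True)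
  then show "q\<^sup>2 \<noteq> 1" by (simp add: power_int_def)
  then show "1 - q\<^sup>2 \<noteq> 0" by simp
qed

end

section \<open>Coordinate vectors and the action of the free algebra\<close>

definition coord_space :: "nat \<Rightarrow> 'k::field coords set" where
  "coord_space l = {v. \<forall>p. p \<notin> index_box l \<longrightarrow> v p = 0}"

lemma finite_index_box: "finite (index_box l)"
  by (simp add: index_box_def)

lemma index_box_mod: "l \<ge> 3 \<Longrightarrow> (a mod int (ord_sq l), b mod int l) \<in> index_box l"
  by (auto simp: index_box_def ord_sq_def)

lemma basis_vec_in_coord_space: "l \<ge> 3 \<Longrightarrow> basis_vec l a b \<in> coord_space l"
  using index_box_mod[of l a b] by (auto simp: basis_vec_def coord_space_def)

lemma basis_vec_box: "(a, b) \<in> index_box l \<Longrightarrow> basis_vec l a b = (\<lambda>p. if p = (a, b) then 1 else 0)"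
  by (auto simp: basis_vec_def index_box_def)

lemma sum_fun_apply: "sum f I p = (\<Sum>i\<in>I. f i p)" for f :: "'i \<Rightarrow> 'p \<Rightarrow> 'b::ab_group_add"
  by (induction I rule: infinite_finite_induct) simp_all

lemma coord_expand:
  assumes "v \<in> coord_space l"
  shows "v = (\<Sum>(a, b)\<in>index_box l. scale_vec (v (a, b)) (basis_vec l a b))"
proof
  fix p
  have "(\<Sum>(a, b)\<in>index_box l. scale_vec (v (a, b)) (basis_vec l a b)) p =
      (\<Sum>x\<in>index_box l. if x = p then v p else 0)"
    by (auto simp: sum_fun_apply scale_vec_def basis_vec_box intro!: sum.cong)
  also have "\<dots> = v p" using assms finite_index_box[of l] unfolding coord_space_def by (cases p) simp
  finally show "v p = (\<Sum>(a, b)\<in>index_box l. scale_vec (v (a, b)) (basis_vec l a b)) p" ..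
qed

lemma linear_ext_basis:
  assumes "l \<ge> 3"
  shows "linear_ext l T (basis_vec l a b) = T (a mod int (ord_sq l)) (b mod int l)"
proof
  fix p
  have "linear_ext l T (basis_vec l a b) p =
      (\<Sum>x\<in>index_box l. if x = (a mod int (ord_sq l), b mod int l) then T (fst x) (snd x) p else 0)"
    unfolding linear_ext_def by (intro sum.cong) (auto simp: basis_vec_def split: if_splits)
  then show "linear_ext l T (basis_vec l a b) p = T (a mod int (ord_sq l)) (b mod int l) p"
    using index_box_mod[OF assms, of a b] finite_index_box[of l] by simp
qed

lemma linear_ext_add: "linear_ext l T (u + v) = linear_ext l T u + linear_ext l T v"
  by (auto simp: linear_ext_def fun_eq_iff distrib_right sum.distrib case_prod_beta')

lemma linear_ext_scale: "linear_ext l T (scale_vec c v) = scale_vec c (linear_ext l T v)"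
  by (auto simp: linear_ext_def fun_eq_iff scale_vec_def sum_distrib_left mult.assoc case_prod_beta')

lemma word_action_add: "word_action l T w (u + v) = word_action l T w u + word_action l T w v"
  unfolding word_action_def by (induction w arbitrary: u v) (auto simp: linear_ext_add)

lemma word_action_scale: "word_action l T w (scale_vec c v) = scale_vec c (word_action l T w v)"
  unfolding word_action_def by (induction w arbitrary: v) (auto simp: linear_ext_scale)

lemma word_action_append: "word_action l T (w @ w') v = word_action l T w' (word_action l T w v)"
  by (simp add: word_action_def)

lemma scale_vec_simps:
  "scale_vec a (u + v) = scale_vec a u + scale_vec a v" "scale_vec (a + b) v = scale_vec a v + scale_vec b v"
  "scale_vec a (scale_vec b v) = scale_vec (a * b) v" "scale_vec 1 v = v" "scale_vec 0 v = 0" "scale_vec a 0 = 0"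
  by (auto simp: scale_vec_def fun_eq_iff algebra_simps)

lemma scale_vec_sum: "scale_vec a (sum f I) = (\<Sum>i\<in>I. scale_vec a (f i))"
  by (simp add: fun_eq_iff sum_fun_apply scale_vec_def sum_distrib_left)

lemma free_action_superset:
  assumes "finite W" "Poly_Mapping.keys f \<subseteq> W"
  shows "free_action l T f v = (\<Sum>w\<in>W. scale_vec (Poly_Mapping.lookup f w) (word_action l T w v))"
proof
  fix p
  have "free_action l T f v p = (\<Sum>w\<in>W. Poly_Mapping.lookup f w * word_action l T w v p)"
    unfolding free_action_def using assms by (intro sum.mono_neutral_left) (auto simp: in_keys_iff)
  then show "free_action l T f v p = (\<Sum>w\<in>W. scale_vec (Poly_Mapping.lookup f w) (word_action l T w v)) p"
    by (simp add: sum_fun_apply scale_vec_def)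
qed

lemma free_action_single: "free_action l T (Poly_Mapping.single w c) v = scale_vec c (word_action l T w v)"
  using free_action_superset[of "{w}" "Poly_Mapping.single w c" l T v] by (simp split: if_splits)

lemma free_action_gen: "free_action l T (fgen g) v = linear_ext l (T g) v"
  by (simp add: fgen_def free_action_single word_action_def scale_vec_simps)

lemma free_action_const: "free_action l T (fconst c) v = scale_vec c v"
  by (simp add: fconst_def free_action_single word_action_def)

lemma free_action_add_left: "free_action l T (f + g) v = free_action l T f v + free_action l T g v"
proof -
  let ?W = "Poly_Mapping.keys f \<union> Poly_Mapping.keys g"
  have k: "Poly_Mapping.keys (f + g) \<subseteq> ?W" by (rule Poly_Mapping.keys_add)
  show ?thesis
    using k by (simp add: free_action_superset[of ?W] lookup_add scale_vec_simps sum.distrib)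
qed

lemma free_action_add_right: "free_action l T f (u + v) = free_action l T f u + free_action l T f v"
  by (simp add: free_action_superset[OF _ order_refl] word_action_add scale_vec_simps sum.distrib)

lemma free_action_0: "free_action l T 0 v = 0"
  by (simp add: free_action_def fun_eq_iff)

lemma free_action_sum: "free_action l T (sum f I) v = (\<Sum>i\<in>I. free_action l T (f i) v)"
  by (induction I rule: infinite_finite_induct) (simp_all add: free_action_0 free_action_add_left)

lemma free_action_sum_right:
  "free_action l T f (sum v I) = (\<Sum>i\<in>I. free_action l T f (v i))"
proof -
  have z: "free_action l T f 0 = 0" using free_action_add_right[of l T f 0 0] by simp
  show ?thesis
    by (induction I rule: infinite_finite_induct)
      (simp_all only: z free_action_add_right sum.insert sum.empty sum.infinite not_False_eq_True simp_thms)
qed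

lemma free_action_mult: "free_action l T (f * g) v = free_action l T g (free_action l T f v)"
proof -
  have s: "free_action l T (Poly_Mapping.single w a * Poly_Mapping.single w' b) v =
      free_action l T (Poly_Mapping.single w' b) (free_action l T (Poly_Mapping.single w a) v)" for w w' a b
    by (simp add: mult_single free_action_single plus_list_def word_action_append word_action_scale
        scale_vec_simps mult.commute)
  have "free_action l T ((\<Sum>w\<in>Poly_Mapping.keys f. Poly_Mapping.single w (Poly_Mapping.lookup f w)) *
      (\<Sum>w\<in>Poly_Mapping.keys g. Poly_Mapping.single w (Poly_Mapping.lookup g w))) v =
    free_action l T (\<Sum>w\<in>Poly_Mapping.keys g. Poly_Mapping.single w (Poly_Mapping.lookup g w))
     (free_action l T (\<Sum>w\<in>Poly_Mapping.keys f. Poly_Mapping.single w (Poly_Mapping.lookup f w)) v)"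
    unfolding sum_product free_action_sum s free_action_sum_right by (rule refl)
  then show ?thesis by (simp only: poly_mapping_as_sum[symmetric])
qed

lemma free_action_scale: "free_action l T f (scale_vec c v) = scale_vec c (free_action l T f v)"
  by (simp add: free_action_superset[OF _ order_refl] word_action_scale scale_vec_sum scale_vec_simps mult.commute)

lemma scale_vec_coord_space: "v \<in> coord_space l \<Longrightarrow> scale_vec c v \<in> coord_space l"
  by (auto simp: coord_space_def scale_vec_def)

lemma coord_space_sum: "(\<And>i. i \<in> I \<Longrightarrow> f i \<in> coord_space l) \<Longrightarrow> sum f I \<in> coord_space l"
  by (auto simp: coord_space_def sum_fun_apply)

lemma free_rep_coords:
  assumes T: "\<And>g a b. (a, b) \<in> index_box l \<Longrightarrow> T g a b \<in> coord_space l"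
  shows "free_rep (coord_space l) (free_action l T)"
proof
  have le: "linear_ext l (T g) v \<in> coord_space l" for g v
    using T by (force simp: coord_space_def linear_ext_def intro!: sum.neutral)
  have w: "word_action l T w v \<in> coord_space l" if "v \<in> coord_space l" for w v
    using that le unfolding word_action_def by (induction w arbitrary: v) auto
  show "free_action l T f v \<in> coord_space l" if "v \<in> coord_space l" for f v
    unfolding free_action_superset[OF finite_keys order_refl]
    by (intro coord_space_sum scale_vec_coord_space w that)
  show "free_action l T 1 v = v" for v
    using free_action_const[of l T 1 v] by (simp add: fconst_simps scale_vec_simps)
qed (auto simp: coord_space_def free_action_add_left free_action_mult free_action_add_right)

lemma ageing_rep_coords:
  fixes q :: "'k::field"
  assumes T: "\<And>g a b. (a, b) \<in> index_box l \<Longrightarrow> T g a b \<in> coord_space l"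
    and rel: "\<And>f a b. f \<in> ageing_relations q \<Longrightarrow> (a, b) \<in> index_box l \<Longrightarrow> free_action l T f (basis_vec l a b) = 0"
  shows "ageing_rep q (coord_space l) (free_action l T)"
proof (intro ageing_rep.intro free_rep_coords T ageing_rep_axioms.intro)
  fix f and v :: "'k coords"
  assume f: "f \<in> ageing_relations q" and v: "v \<in> coord_space l"
  have "free_action l T f (\<Sum>(a, b)\<in>index_box l. scale_vec (v (a, b)) (basis_vec l a b)) = 0"
    unfolding free_action_sum_right
    by (rule sum.neutral) (simp add: free_action_scale rel[OF f] scale_vec_simps split_paired_all)
  then show "free_action l T f v = 0" by (simp only: coord_expand[OF v, symmetric])
qed

lemma module_of_operators_simps:
  "carrier (module_of_operators l T) = coord_space l"
  "\<zero>\<^bsub>module_of_operators l T\<^esub> = 0"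
  "u \<oplus>\<^bsub>module_of_operators l T\<^esub> v = u + v"
  by (auto simp: module_of_operators_def coord_space_def fun_eq_iff)

text \<open>The representative picked by \<open>SOME\<close> differs from \<open>f\<close> by an
  element of the ideal, which acts as zero.\<close>

lemma module_of_operators_smult:
  assumes "ageing_rep q (coord_space l) (free_action l T)" "v \<in> coord_space l"
  shows "ageing_class q f \<odot>\<^bsub>module_of_operators l T\<^esub> v = free_action l T f v"
proof -
  interpret ageing_rep q "coord_space l" "free_action l T" by (rule assms(1))
  have "(SOME f'. f' \<in> ageing_class q f) \<in> ageing_class q f"
    by (rule someI[of _ f]) (simp add: ageing_class_iff ageing_ideal_closed(1))
  then have "free_action l T (SOME f'. f' \<in> ageing_class q f) v = free_action l T f v"
    using assms(2) by (intro act_cong) (simp_all add: ageing_class_iff)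
  then show ?thesis by (simp add: module_of_operators_def)
qed

lemma right_module_operators:
  assumes rep: "ageing_rep q (coord_space l) (free_action l T)"
  shows "right_module (ageing_algebra q) (module_of_operators l T)"
proof -
  interpret ageing_rep q "coord_space l" "free_action l T" by (rule rep)
  interpret R: ring "ageing_algebra q" by (rule ageing_algebra_ring)
  have "abelian_group (module_of_operators l T)"
  proof (rule abelian_groupI)
    fix u assume "u \<in> carrier (module_of_operators l T)"
    then show "\<exists>y\<in>carrier (module_of_operators l T). y \<oplus>\<^bsub>module_of_operators l T\<^esub> u = \<zero>\<^bsub>module_of_operators l T\<^esub>"
      by (intro bexI[of _ "- u"]) (auto simp: module_of_operators_simps V_uminus)
  qed (auto simp: module_of_operators_simps V_zero V_add add_ac)
  moreover have "right_module_axioms (ageing_algebra q) (module_of_operators l T)"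
    by unfold_locales
      (auto simp: module_of_operators_simps ageing_algebra_simps module_of_operators_smult[OF rep]
        act_closed act_add_left act_add_right act_mult act_one V_add)
  ultimately show ?thesis by (intro right_module.intro R.ring_axioms)
qed

lemma simple_operators_module:
  assumes "ageing_simple q (coord_space l) (free_action l T)"
  shows "simple_right_module (ageing_algebra q) (module_of_operators l T)"
proof -
  interpret ageing_simple q "coord_space l" "free_action l T" by (rule assms)
  have rep: "ageing_rep q (coord_space l) (free_action l T)" by unfold_locales
  have "H = {0} \<or> H = coord_space l" if H: "submodule H (ageing_algebra q) (module_of_operators l T)" for H
  proof -
    interpret H: submodule H "ageing_algebra q" "module_of_operators l T" by (rule H)
    have sub: "H \<subseteq> coord_space l" using H.subset by (simp add: module_of_operators_simps)
    show ?thesis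
    proof (rule simple[OF sub])
      show "0 \<in> H" using H.one_closed by (simp add: module_of_operators_simps)
      show "v + w \<in> H" if "v \<in> H" "w \<in> H" for v w
        using H.m_closed[OF that] by (simp add: module_of_operators_simps)
      show "free_action l T f v \<in> H" if "v \<in> H" for f v
      proof -
        have "ageing_class q f \<odot>\<^bsub>module_of_operators l T\<^esub> v \<in> H"
          using H.smult_closed[of "ageing_class q f" v] that by (simp add: ageing_algebra_simps)
        then show ?thesis by (simp only: module_of_operators_smult[OF rep subsetD[OF sub that]])
      qed
    qed
  qed
  then show ?thesis
    using right_module_operators[OF rep] nontrivial
    by (simp add: simple_right_module_def module_of_operators_simps)
qed

lemma free_action_single_gen: "free_action l T (fconst c * f) v = free_action l T f (scale_vec c v)"
  by (simp add: free_action_mult free_action_const)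

text \<open>
  A family \<open>w\<close> on which every generator acts by \<open>w\<^sub>i g = c\<^sub>g(i) w\<^bsub>\<sigma>\<^sub>g(i)\<^esub>\<close>. The bases of the modules
  \<open>M\<^sub>1, M\<^sub>2, M\<^sub>3\<close> and their counterparts in an arbitrary simple module are compared through \<open>(c, \<sigma>)\<close>.
\<close>

definition (in free_rep) monomial ::
  "'i set \<Rightarrow> ('i \<Rightarrow> 'b) \<Rightarrow> (ageing_gen \<Rightarrow> 'i \<Rightarrow> 'k) \<Rightarrow> (ageing_gen \<Rightarrow> 'i \<Rightarrow> 'i) \<Rightarrow> bool" where
  "monomial J w c \<sigma> \<longleftrightarrow> (\<forall>i\<in>J. w i \<in> V \<and>
     (\<forall>g. \<sigma> g i \<in> J \<and> act (fgen g) (w i) = sc (c g i) (w (\<sigma> g i))))"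

context free_rep
begin

lemma monomialD:
  assumes "monomial J w c \<sigma>" "i \<in> J"
  shows "w i \<in> V" "\<sigma> g i \<in> J" "act (fgen g) (w i) = sc (c g i) (w (\<sigma> g i))"
    "act (fgen h) (act (fgen g) (w i)) = sc (c g i * c h (\<sigma> g i)) (w (\<sigma> h (\<sigma> g i)))"
proof -
  show *: "w i \<in> V" "\<sigma> g i \<in> J" "act (fgen g) (w i) = sc (c g i) (w (\<sigma> g i))"
    using assms by (auto simp: monomial_def)
  have "w (\<sigma> g i) \<in> V" "w (\<sigma> h (\<sigma> g i)) \<in> V"
    "act (fgen h) (w (\<sigma> g i)) = sc (c h (\<sigma> g i)) (w (\<sigma> h (\<sigma> g i)))"
    using assms *(2) by (auto simp: monomial_def)
  then show "act (fgen h) (act (fgen g) (w i)) = sc (c g i * c h (\<sigma> g i)) (w (\<sigma> h (\<sigma> g i)))"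
    by (simp only: *(3) act_sc[OF \<open>w (\<sigma> g i) \<in> V\<close>] sc_simps(2)[OF \<open>w (\<sigma> h (\<sigma> g i)) \<in> V\<close>])
qed

text \<open>In the last hypothesis, an index may be off only where its coefficient vanishes.\<close>

lemma monomial_relations:
  assumes w: "monomial J w c \<sigma>" and i: "i \<in> J"
    and ind: "\<And>g h. g \<noteq> h \<Longrightarrow> {g, h} \<noteq> {GE, GY} \<Longrightarrow>
      w (\<sigma> g (\<sigma> h i)) = w (\<sigma> h (\<sigma> g i))"
    and X: "\<sigma> GX i = i" and K: "w (\<sigma> GK (\<sigma> GKinv i)) = w i" "c GKinv i * c GK (\<sigma> GKinv i) = 1" "c GK i * c GKinv (\<sigma> GK i) = 1"
    and EK: "c GE i * c GK (\<sigma> GE i) = q powi (-2) * (c GK i * c GE (\<sigma> GK i))"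
    and XK: "c GX i * c GK (\<sigma> GX i) = q powi (-1) * (c GK i * c GX (\<sigma> GK i))"
    and YK: "c GY i * c GK (\<sigma> GY i) = q * (c GK i * c GY (\<sigma> GK i))"
    and EX: "c GE i * c GX (\<sigma> GE i) = q * (c GX i * c GE (\<sigma> GX i))"
    and XY: "c GX i * c GY (\<sigma> GX i) = q * (c GY i * c GX (\<sigma> GY i))"
    and EY: "c GE i * c GY (\<sigma> GE i) = c GX i + q powi (-1) * (c GY i * c GE (\<sigma> GY i))"
    and EYi: "w (\<sigma> GY (\<sigma> GE i)) = w i \<or> c GE i = 0"
      "w (\<sigma> GE (\<sigma> GY i)) = w i \<or> c GE (\<sigma> GY i) = 0"
    and f: "f \<in> ageing_relations q"
  shows "act f (w i) = 0"
proof -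
  note D = monomialD[OF w i]
  have wV: "w j \<in> V" if "j \<in> J" for j using monomialD(1)[OF w that] .
  have V2: "w (\<sigma> g (\<sigma> h i)) \<in> V" for g h using D(2) monomialD(2)[OF w] wV by blast
  have s: "sc a (sc b v) = sc (a * b) v" if "v \<in> V" for a b v using sc_simps(2)[OF that] by simp
  have ki: "w (\<sigma> GKinv (\<sigma> GK i)) = w i" using ind[of GKinv GK] K(1) by (auto simp: doubleton_eq_iff)
  \<comment> \<open>If the index is off, the coefficient is zero and either vector may stand
    there.\<close>
  have a1: "sc (c GE i * c GY (\<sigma> GE i)) (w (\<sigma> GY (\<sigma> GE i))) = sc (c GE i * c GY (\<sigma> GE i)) (w i)"
    using EYi(1) V2 D(1) by (auto simp: sc_simps(4))
  have a2: "sc (c GY i * c GE (\<sigma> GY i)) (w (\<sigma> GE (\<sigma> GY i))) = sc (c GY i * c GE (\<sigma> GY i)) (w i)"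
    using EYi(2) V2 D(1) by (auto simp: sc_simps(4))
  have "act (fgen GKinv) (act (fgen GK) (w i)) = w i"
    unfolding D(4) by (simp only: K(3) ki sc_simps(3)[OF D(1)])
  moreover have "act (fgen GK) (act (fgen GKinv) (w i)) = w i"
    unfolding D(4) by (simp only: K(1,2) sc_simps(3)[OF D(1)])
  moreover have "act (fgen GK) (act (fgen GE) (w i)) = sc (q powi (-2)) (act (fgen GE) (act (fgen GK) (w i)))"
    unfolding D(4) s[OF V2] EK using ind[of GK GE] by (auto simp: doubleton_eq_iff)
  moreover have "act (fgen GK) (act (fgen GX) (w i)) = sc (q powi (-1)) (act (fgen GX) (act (fgen GK) (w i)))"
    unfolding D(4) s[OF V2] XK using ind[of GK GX] by (auto simp: doubleton_eq_iff)
  moreover have "act (fgen GK) (act (fgen GY) (w i)) = sc q (act (fgen GY) (act (fgen GK) (w i)))"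
    unfolding D(4) s[OF V2] YK using ind[of GK GY] by (auto simp: doubleton_eq_iff)
  moreover have "act (fgen GX) (act (fgen GE) (w i)) = sc q (act (fgen GE) (act (fgen GX) (w i)))"
    unfolding D(4) s[OF V2] EX using ind[of GX GE] by (auto simp: doubleton_eq_iff)
  moreover have "act (fgen GY) (act (fgen GX) (w i)) = sc q (act (fgen GX) (act (fgen GY) (w i)))"
    unfolding D(4) s[OF V2] XY using ind[of GX GY] by (auto simp: doubleton_eq_iff)
  moreover have "act (fgen GY) (act (fgen GE) (w i)) =
      act (fgen GX) (w i) + sc (q powi (-1)) (act (fgen GE) (act (fgen GY) (w i)))"
    unfolding D(4) unfolding D(3) X a1 a2 s[OF D(1)] unfolding EY by (rule sc_simps(1)[OF D(1)])
  ultimately show ?thesis using act_relations_iff[OF D(1), of q] f by blast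
qed

end

text \<open>The index set \<open>J\<close> exceeds the box, so that the formulas for the generators
  avoid wrapping in the second index, and for \<open>M_1\<close> in the first as well.
  \<open>nrm\<close> picks the representative in the box; compatibility of \<open>w\<close> with it
  makes linear extension from the box agree with \<open>w\<close> on all of
  \<open>J\<close>.\<close>

lemma coord_hom:
  fixes q :: "'k::field" and V :: "'b::ab_group_add set"
  assumes l: "l \<ge> 3"
    and M: "ageing_rep q (coord_space l) (free_action l T)" and N: "ageing_rep q V act"
    and u: "free_rep.monomial (coord_space l) (free_action l T) J u c \<sigma>"
    and w: "free_rep.monomial V act J w c \<sigma>"
    and nrm: "\<And>i. i \<in> J \<Longrightarrow> nrm i \<in> index_box l \<and> u i = basis_vec l (fst (nrm i)) (snd (nrm i)) \<and> w i = w (nrm i)"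
    and box: "index_box l \<subseteq> J" "\<And>a b. (a, b) \<in> index_box l \<Longrightarrow> nrm (a, b) = (a, b)"
  obtains h where "\<And>v. v \<in> coord_space l \<Longrightarrow> h v \<in> V"
    "\<And>v v'. v \<in> coord_space l \<Longrightarrow> v' \<in> coord_space l \<Longrightarrow> h (v + v') = h v + h v'"
    "\<And>f v. v \<in> coord_space l \<Longrightarrow> h (free_action l T f v) = act f (h v)"
    "\<And>i. i \<in> J \<Longrightarrow> h (u i) = w i"
    "\<And>v. h v = (\<Sum>p\<in>index_box l. act (fconst (v p)) (w p))"
proof -
  interpret M: ageing_rep q "coord_space l" "free_action l T" by (rule M)
  interpret N: ageing_rep q V act by (rule N)
  note uD = M.monomialD[OF u] and wD = N.monomialD[OF w]
  define h where "h v = (\<Sum>p\<in>index_box l. N.sc (v p) (w p))" for v :: "'k coords"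
  have wV: "w p \<in> V" if "p \<in> index_box l" for p using wD(1) box(1) that by blast
  have hV: "h v \<in> V" for v
    unfolding h_def by (intro N.V_sum N.act_closed wV)
  have hadd: "h (v + v') = h v + h v'" for v v'
    unfolding h_def by (simp add: wV N.sc_simps sum.distrib)
  have hsc: "h (scale_vec a v) = N.sc a (h v)" for a v
    unfolding h_def scale_vec_def
    by (subst N.act_sum_right) (auto simp: wV N.sc_simps(2) N.act_closed)
  have hu: "h (u i) = w i" if i: "i \<in> J" for i
  proof -
    have n: "nrm i \<in> index_box l" using nrm[OF i] by simp
    have "h (u i) = (\<Sum>p\<in>index_box l. if p = nrm i then w (nrm i) else 0)"
      unfolding h_def
    proof (intro sum.cong refl)
      fix p assume p: "p \<in> index_box l"
      have "u i p = (if p = nrm i then 1 else 0)"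
        using nrm[OF i] fun_cong[OF basis_vec_box[of "fst (nrm i)" "snd (nrm i)" l], of p] n by simp
      then show "N.sc (u i p) (w p) = (if p = nrm i then w (nrm i) else 0)"
        using N.sc_simps(3,4)[OF wV[OF p]] by auto
    qed
    also have "\<dots> = w i" using n finite_index_box[of l] nrm[OF i] by simp
    finally show ?thesis .
  qed
  have h0: "h 0 = 0" using hadd[of 0 0] by simp
  have hsum: "h (sum f I) = (\<Sum>i\<in>I. h (f i))" for f :: "int \<times> int \<Rightarrow> 'k coords" and I
    by (induction I rule: infinite_finite_induct)
      (simp_all only: h0 hadd sum.insert sum.empty sum.infinite not_False_eq_True simp_thms)
  have hgu: "h (free_action l T (fgen g) (u i)) = act (fgen g) (h (u i))" if i: "i \<in> J" for g i
    using uD(2,3)[OF i, of g] wD(3)[OF i, of g] by (simp add: free_action_const hsc hu i)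
  have hg: "h (free_action l T (fgen g) v) = act (fgen g) (h v)" if v: "v \<in> coord_space l" for g v
  proof -
    have b: "basis_vec l a b = u (a, b)" if "(a, b) \<in> index_box l" for a b
      using nrm[of "(a, b)"] box that by auto
    have "h (free_action l T (fgen g) (\<Sum>(a, b)\<in>index_box l. scale_vec (v (a, b)) (basis_vec l a b))) =
        (\<Sum>p\<in>index_box l. N.sc (v p) (h (free_action l T (fgen g) (u p))))"
      unfolding free_action_sum_right hsum using b
      by (intro sum.cong) (auto simp: free_action_scale hsc)
    also have "\<dots> = (\<Sum>p\<in>index_box l. act (fgen g) (N.sc (v p) (w p)))"
      using box(1) wV by (intro sum.cong refl) (auto simp: hgu hu N.act_sc)
    also have "\<dots> = act (fgen g) (h v)"
      unfolding h_def by (rule N.act_sum_right[symmetric]) (intro N.act_closed wV)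
    finally show ?thesis by (simp only: coord_expand[OF v, symmetric])
  qed
  have hact: "h (free_action l T f v) = act f (h v)" if v: "v \<in> coord_space l" for f v
  proof (rule ageing_hom_generators[OF M N, of h])
    show "h (free_action l T (fconst c) v) = act (fconst c) (h v)" for c v
      unfolding free_action_const by (rule hsc)
    show "h v \<in> V" for v by (rule hV)
    show "h (v + w) = h v + h w" for v w by (rule hadd)
    show "h (free_action l T (fgen g) v) = act (fgen g) (h v)" if "v \<in> coord_space l" for g v
      by (rule hg[OF that])
    show "v \<in> coord_space l" by (rule v)
  qed
  show ?thesis by (rule that[OF hV hadd hact hu]) (simp_all only: h_def)
qed

abbreviation phi_word :: "'k::field \<Rightarrow> 'k ageing_free" where
  "phi_word q \<equiv> fgen GE * fgen GY - fconst q * fgen GY * fgen GE"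

text \<open>Polynomials in the commuting diagonal operators \<open>X\<close> and \<open>\<phi>\<close> separate the basis.\<close>

lemma coord_matrix_units:
  fixes q :: "'k::field"
  assumes l: "l \<ge> 3"
    and rep: "ageing_rep q (coord_space l) (free_action l T)"
    and X: "\<And>p. p \<in> index_box l \<Longrightarrow> free_action l T (fgen GX) (basis_vec l (fst p) (snd p)) =
      scale_vec (x p) (basis_vec l (fst p) (snd p))"
    and phi: "\<And>p. p \<in> index_box l \<Longrightarrow> free_action l T (phi_word q) (basis_vec l (fst p) (snd p)) =
      scale_vec (y p) (basis_vec l (fst p) (snd p))"
    and inj: "inj_on (\<lambda>p. (x p, y p)) (index_box l)"
    and reach: "\<And>p p'. p \<in> index_box l \<Longrightarrow> p' \<in> index_box l \<Longrightarrow>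
      \<exists>f c. c \<noteq> 0 \<and> free_action l T f (basis_vec l (fst p) (snd p)) = scale_vec c (basis_vec l (fst p') (snd p'))"
    and p: "p \<in> index_box l" and p': "p' \<in> index_box l"
  shows "\<exists>f. \<forall>r\<in>index_box l. free_action l T f (basis_vec l (fst r) (snd r)) =
    (if r = p then basis_vec l (fst p') (snd p') else 0)"
proof -
  let ?e = "\<lambda>p. basis_vec l (fst p) (snd p) :: 'k coords"
  \<comment> \<open>Lagrange interpolation: a product of diagonal factors that is 1 at
    \<open>p\<close> and 0 on \<open>S\<close>, built up one point of \<open>S\<close> at a
    time.\<close>
  have proj: "\<exists>f. (\<forall>r\<in>index_box l. \<exists>c. free_action l T f (?e r) = scale_vec c (?e r)) \<and>
      free_action l T f (?e p) = ?e p \<and> (\<forall>r\<in>S. free_action l T f (?e r) = 0)"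
    if "S \<subseteq> index_box l - {p}" for S
    using finite_subset[OF that finite_Diff[OF finite_index_box]] that
  proof (induction S rule: finite_induct)
    case empty
    have "free_action l T (fconst 1) (?e r) = scale_vec 1 (?e r)" for r by (rule free_action_const)
    then show ?case by (intro exI[of _ "fconst 1"]) (auto simp: scale_vec_simps(4) intro: exI[of _ 1])
  next
    case (insert r S)
    then obtain f where f: "\<And>r. r \<in> index_box l \<Longrightarrow> \<exists>c. free_action l T f (?e r) = scale_vec c (?e r)"
      "free_action l T f (?e p) = ?e p" "\<And>r. r \<in> S \<Longrightarrow> free_action l T f (?e r) = 0" by blast
    have r: "r \<in> index_box l" "r \<noteq> p" using insert.prems by auto
    \<comment> \<open>\<open>D\<close> is \<open>X\<close> or \<open>\<phi>\<close>, whichever has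
      different eigenvalues at \<open>r\<close> and \<open>p\<close>.\<close>
    have "\<exists>D z. (\<forall>t\<in>index_box l. free_action l T D (?e t) = scale_vec (z t) (?e t)) \<and> z r \<noteq> z p"
      using X phi inj_onD[OF inj _ r(1) p] r(2) by (metis (no_types, lifting) prod.inject)
    then obtain D z where D: "\<And>t. t \<in> index_box l \<Longrightarrow> free_action l T D (?e t) = scale_vec (z t) (?e t)" "z r \<noteq> z p"
      by blast
    \<comment> \<open>The linear factor of the interpolation, scaled to act as 0 at \<open>r\<close>
      and as 1 at \<open>p\<close>.\<close>
    define g where "g = fconst (inverse (z p - z r)) * (D + fconst (- z r))"
    have g: "free_action l T g (?e t) = scale_vec (inverse (z p - z r) * (z t - z r)) (?e t)" if "t \<in> index_box l" for t
      using D(1)[OF that]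
      by (simp add: g_def free_action_single_gen free_action_add_left free_action_const free_action_scale scale_vec_simps right_diff_distrib'
          flip: scale_vec_simps(2))
    show ?case
    proof (intro exI[of _ "f * g"] conjI ballI)
      fix t assume t: "t \<in> index_box l"
      obtain c where "free_action l T f (?e t) = scale_vec c (?e t)" using f(1)[OF t] by blast
      then show "\<exists>c. free_action l T (f * g) (?e t) = scale_vec c (?e t)"
        by (simp add: free_action_mult free_action_scale g[OF t] scale_vec_simps) blast
    next
      show "free_action l T (f * g) (?e p) = ?e p"
        using D(2) by (simp add: free_action_mult f(2) g[OF p] scale_vec_simps)
    next
      fix t assume t: "t \<in> insert r S"
      have t': "t \<in> index_box l" using t insert.prems by auto
      obtain c where c: "free_action l T f (?e t) = scale_vec c (?e t)" using f(1)[OF t'] by blast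
      show "free_action l T (f * g) (?e t) = 0"
      proof (cases "t = r")
        case True
        then show ?thesis using c by (simp add: free_action_mult free_action_scale g[OF r(1)] scale_vec_simps)
      next
        case False
        then have "free_action l T f (?e t) = 0" using t f(3) by blast
        then show ?thesis using free_action_scale[of l T g 0 0] by (simp add: free_action_mult scale_vec_simps)
      qed
    qed
  qed
  obtain f where f: "free_action l T f (?e p) = ?e p" "\<And>r. r \<in> index_box l - {p} \<Longrightarrow> free_action l T f (?e r) = 0"
    using proj[OF order_refl] by blast
  obtain g c where g: "c \<noteq> 0" "free_action l T g (?e p) = scale_vec c (?e p')" using reach[OF p p'] by blast
  have z: "free_action l T g 0 = 0" for g using free_action_scale[of l T g 0 0] by (simp add: scale_vec_simps)
  have "free_action l T (f * (fconst (inverse c) * g)) (?e r) = (if r = p then ?e p' else 0)" if "r \<in> index_box l" for r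
    using that f g by (auto simp: free_action_mult free_action_single_gen free_action_scale scale_vec_simps z free_action_const)
  then show ?thesis by blast
qed

text \<open>A nonzero coordinate of a vector of \<open>H\<close> at \<open>p\<close> is isolated and
  carried to every other basis vector by the matrix units.\<close>

lemma coord_simple:
  fixes q :: "'k::field"
  assumes l: "l \<ge> 3"
    and rep: "ageing_rep q (coord_space l) (free_action l T)"
    and units: "\<And>p p'. p \<in> index_box l \<Longrightarrow> p' \<in> index_box l \<Longrightarrow>
      \<exists>f. \<forall>r\<in>index_box l. free_action l T f (basis_vec l (fst r) (snd r)) =
        (if r = p then basis_vec l (fst p') (snd p') else 0)"
  shows "ageing_simple q (coord_space l) (free_action l T)"
proof (intro ageing_simple.intro rep ageing_simple_axioms.intro)
  interpret ageing_rep q "coord_space l" "free_action l T" by (rule rep)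
  let ?e = "\<lambda>p. basis_vec l (fst p) (snd p) :: 'k coords"
  have e: "?e p \<in> coord_space l" for p by (rule basis_vec_in_coord_space[OF l])
  have "(0, 0) \<in> index_box l" using index_box_mod[OF l, of 0 0] by simp
  then have "?e (0, 0) (0, 0) = 1" by (simp add: basis_vec_box)
  then have "?e (0, 0) \<noteq> 0" by (metis zero_fun_apply zero_neq_one)
  then show "coord_space l \<noteq> {0 :: 'k coords}" using e[of "(0, 0)"] by auto
  fix H assume H: "H \<subseteq> coord_space l" "0 \<in> H" "\<And>v w. v \<in> H \<Longrightarrow> w \<in> H \<Longrightarrow> v + w \<in> H"
    "\<And>f v. v \<in> H \<Longrightarrow> free_action l T f v \<in> H"
  show "H = {0} \<or> H = coord_space l"
  proof (cases "H = {0}")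
    case False
    then obtain v where v: "v \<in> H" "v \<noteq> 0" using H(2) by blast
    then obtain p where vp: "v p \<noteq> 0" by (metis ext zero_fun_apply)
    have vC: "v \<in> coord_space l" using H(1) v(1) by blast
    then have p: "p \<in> index_box l" using vp unfolding coord_space_def by (cases p) auto
    have eH: "?e p' \<in> H" if p': "p' \<in> index_box l" for p'
    proof -
      obtain f where f: "\<And>r. r \<in> index_box l \<Longrightarrow> free_action l T f (?e r) = (if r = p then ?e p' else 0)"
        using units[OF p p'] by blast
      have "free_action l T f (\<Sum>(a, b)\<in>index_box l. scale_vec (v (a, b)) (basis_vec l a b)) =
          (\<Sum>r\<in>index_box l. if r = p then scale_vec (v p) (?e p') else 0)"
        unfolding free_action_sum_right
      proof (intro sum.cong refl)
        fix r assume r: "r \<in> index_box l"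
        show "free_action l T f (case r of (a, b) \<Rightarrow> scale_vec (v (a, b)) (basis_vec l a b)) =
            (if r = p then scale_vec (v p) (?e p') else 0)"
          using f[OF r] by (cases r) (simp add: free_action_scale scale_vec_simps)
      qed
      then have "free_action l T f v = scale_vec (v p) (?e p')"
        using p finite_index_box[of l] by (simp only: coord_expand[OF vC, symmetric] sum.delta if_True)
      then have "scale_vec (v p) (?e p') \<in> H" using H(4)[OF v(1), of f] by simp
      then have "free_action l T (fconst (inverse (v p))) (scale_vec (v p) (?e p')) \<in> H" by (rule H(4))
      then show ?thesis using vp by (simp add: free_action_const scale_vec_simps)
    qed
    have "w \<in> H" if w: "w \<in> coord_space l" for w
    proof -
      have "(\<Sum>(a, b)\<in>I. scale_vec (w (a, b)) (basis_vec l a b)) \<in> H" if "I \<subseteq> index_box l" for I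
        using finite_subset[OF that finite_index_box] that
      proof (induction I rule: finite_induct)
        case (insert r I)
        then have "scale_vec (w r) (?e r) \<in> H"
          using H(4)[OF eH, of r "fconst (w r)"] by (simp add: free_action_const)
        moreover have "(\<Sum>(a, b)\<in>I. scale_vec (w (a, b)) (basis_vec l a b)) \<in> H" using insert by blast
        ultimately have "scale_vec (w r) (?e r) + (\<Sum>(a, b)\<in>I. scale_vec (w (a, b)) (basis_vec l a b)) \<in> H"
          by (rule H(3))
        then show ?case unfolding sum.insert[OF insert.hyps(1,2)] by (simp only: case_prod_beta' prod.collapse)
      qed (simp only: sum.empty H(2))
      from this[OF order_refl] show ?thesis by (simp only: coord_expand[OF w, symmetric])
    qed
    then show ?thesis using H(1) by blast
  qed simp
qed

section \<open>The modules \<open>M\<^sub>1\<close>, \<open>M\<^sub>2\<close>, \<open>M\<^sub>3\<close>\<close>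

fun M1_coef :: "'k::field \<Rightarrow> 'k \<Rightarrow> 'k \<Rightarrow> 'k \<Rightarrow> 'k \<Rightarrow> ageing_gen \<Rightarrow> int \<times> int \<Rightarrow> 'k" where
  "M1_coef q \<mu>1 \<mu>2 \<mu>3 \<mu>4 GX (a, b) = \<mu>1 * q powi (a + b)"
| "M1_coef q \<mu>1 \<mu>2 \<mu>3 \<mu>4 GK (a, b) = \<mu>4"
| "M1_coef q \<mu>1 \<mu>2 \<mu>3 \<mu>4 GKinv (a, b) = inverse \<mu>4"
| "M1_coef q \<mu>1 \<mu>2 \<mu>3 \<mu>4 GE (a, b) = \<mu>3 * q powi (2 * b)"
| "M1_coef q \<mu>1 \<mu>2 \<mu>3 \<mu>4 GY (a, b) =
     inverse \<mu>3 * q powi (- (a + b)) * ((q * \<mu>2 - q powi (2 * a + 1) * \<mu>1) / (1 - q\<^sup>2))"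

fun M1_ind :: "ageing_gen \<Rightarrow> int \<times> int \<Rightarrow> int \<times> int" where
  "M1_ind GX (a, b) = (a, b)"
| "M1_ind GK (a, b) = (a, b + 1)"
| "M1_ind GKinv (a, b) = (a, b - 1)"
| "M1_ind GE (a, b) = (a + 1, b)"
| "M1_ind GY (a, b) = (a - 1, b)"

text \<open>
  The modules on which \<open>E\<close> is nilpotent: \<open>\<theta> = 1\<close> gives \<open>M\<^sub>2\<close>, and \<open>\<theta> = 0\<close> with \<open>\<mu>\<^sub>2 = 1\<close> gives \<open>M\<^sub>3\<close>.
\<close>

fun nil_coef :: "'k::field \<Rightarrow> int \<Rightarrow> 'k \<Rightarrow> 'k \<Rightarrow> 'k \<Rightarrow> 'k \<Rightarrow> ageing_gen \<Rightarrow> int \<times> int \<Rightarrow> 'k" where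
  "nil_coef q m \<theta> \<mu>1 \<mu>2 \<mu>3 GX (a, b) = \<mu>1 * q powi (b - a)"
| "nil_coef q m \<theta> \<mu>1 \<mu>2 \<mu>3 GK (a, b) = \<mu>3"
| "nil_coef q m \<theta> \<mu>1 \<mu>2 \<mu>3 GKinv (a, b) = inverse \<mu>3"
| "nil_coef q m \<theta> \<mu>1 \<mu>2 \<mu>3 GE (a, b) =
     - inverse \<mu>2 * \<mu>1 * q powi (a + 2 * b) * ((q powi (- 2 * a) - 1) / (q powi (- 2) - 1))"
| "nil_coef q m \<theta> \<mu>1 \<mu>2 \<mu>3 GY (a, b) = (if a = m - 1 then \<theta> else 1) * (\<mu>2 * q powi (- b))"

text \<open>The target of \<open>E\<close> at \<open>a = 0\<close> is a dummy that stays in range,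
  since the coefficient there is zero. The same holds for \<open>Y\<close> at
  \<open>a = m - 1\<close> when \<open>\<theta> = 0\<close>.\<close>

fun nil_ind :: "int \<Rightarrow> int \<Rightarrow> ageing_gen \<Rightarrow> int \<times> int \<Rightarrow> int \<times> int" where
  "nil_ind m s GX (a, b) = (a, b)"
| "nil_ind m s GK (a, b) = (a, b + 1)"
| "nil_ind m s GKinv (a, b) = (a, b - 1)"
| "nil_ind m s GE (a, b) = (if a = 0 then 0 else a - 1, b)"
| "nil_ind m s GY (a, b) = (if a = m - 1 then (0, s + b) else (a + 1, b))"

lemma basis_vec_cong:
  "a mod int (ord_sq l) = a' mod int (ord_sq l) \<Longrightarrow> b mod int l = b' mod int l \<Longrightarrow> basis_vec l a b = basis_vec l a' b'"
  by (simp add: basis_vec_def)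

context root_setting
begin

lemma q_powi_nonzero: "q powi a \<noteq> 0"
  using q_nonzero by simp

lemma powi_simps:
  "q powi (a + b) = q powi a * q powi b" "q powi (a - b) = q powi a / q powi b"
  "q powi (- a) = inverse (q powi a)" "q powi (2 * a) = (q powi a)\<^sup>2" "q powi (- 2 * a) = inverse ((q powi a)\<^sup>2)"
  "q powi (- (2 * a)) = inverse ((q powi a)\<^sup>2)"
  "q powi 2 = q\<^sup>2" "q powi (- 2) = inverse (q\<^sup>2)" "q powi 1 = q" "q powi (- 1) = inverse q" "q powi 0 = 1"
proof -
  show add: "q powi (a + b) = q powi a * q powi b" for a b using q_nonzero by (simp add: power_int_add)
  show "q powi (a - b) = q powi a / q powi b" using q_nonzero by (simp add: power_int_diff)
  show mi: "q powi (- a) = inverse (q powi a)" for a by (rule power_int_minus)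
  show two: "q powi (2 * a) = (q powi a)\<^sup>2" for a by (simp only: mult_2 add power2_eq_square)
  show "q powi (- (2 * a)) = inverse ((q powi a)\<^sup>2)" unfolding mi two ..
  then show "q powi (- 2 * a) = inverse ((q powi a)\<^sup>2)" by simp
  show "q powi 2 = q\<^sup>2" by (simp add: power_int_def)
  then show "q powi (- 2) = inverse (q\<^sup>2)" using mi[of 2] by simp
  show "q powi (- 1) = inverse q" using mi[of 1] by simp
qed simp_all

lemma m_ge_2: "m \<ge> 2"
  using l_ge_3 by (auto simp: ord_sq_def)

lemma q_pow_m: "q powi m = q powi s" "(q powi m)\<^sup>2 = 1" "q powi s * q powi s = 1" "q powi m * q powi m = 1"
proof -
  show 1: "q powi m = q powi s" by (rule q_powi_cong[OF L_eq(2)])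
  have "q powi (2 * m) = 1" using L_dvd_mult_2s(2) by (simp only: q_powi_eq_1_iff)
  then show 2: "(q powi m)\<^sup>2 = 1" by (simp only: powi_simps(4))
  then show "q powi s * q powi s = 1" "q powi m * q powi m = 1" using 1 by (simp_all add: power2_eq_square)
qed

lemma inverse_q_pow_m: "inverse (q powi m) = q powi m" "inverse (q powi s) = q powi s"
  using q_pow_m by (metis inverse_unique)+

end

text \<open>Only the free algebra acts here; that the defining relations hold is derived from the
  multiplication tables.\<close>

locale free_root = free_rep V act + root_setting q l
  for V :: "'b::ab_group_add set" and act :: "'k::field ageing_free \<Rightarrow> 'b \<Rightarrow> 'b" and q :: 'k and l
begin

lemma phi_eigen:
  assumes w: "monomial J w c \<sigma>" and i: "i \<in> J"
    and "w (\<sigma> GY (\<sigma> GE i)) = w i \<or> c GE i = 0" "w (\<sigma> GE (\<sigma> GY i)) = w i \<or> c GE (\<sigma> GY i) = 0"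
    and y: "c GE i * c GY (\<sigma> GE i) - q * (c GY i * c GE (\<sigma> GY i)) = y"
  shows "act (phi_word q) (w i) = sc y (w i)"
proof -
  note D = monomialD[OF w i]
  have V2: "w (\<sigma> g (\<sigma> h i)) \<in> V" for g h
    using D(2) monomialD(1,2)[OF w] by blast
  have a1: "sc (c GE i * c GY (\<sigma> GE i)) (w (\<sigma> GY (\<sigma> GE i))) = sc (c GE i * c GY (\<sigma> GE i)) (w i)"
    using assms(3) V2 D(1) by (auto simp: sc_simps(4))
  have a2: "sc (c GY i * c GE (\<sigma> GY i)) (w (\<sigma> GE (\<sigma> GY i))) = sc (c GY i * c GE (\<sigma> GY i)) (w i)"
    using assms(4) V2 D(1) by (auto simp: sc_simps(4))
  have "act (phi_word q) (w i) = act (fgen GY) (act (fgen GE) (w i)) - sc q (act (fgen GE) (act (fgen GY) (w i)))"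
    using D(1) by (simp add: act_diff_left act_mult act_closed act_sc)
  also have "\<dots> = sc (c GE i * c GY (\<sigma> GE i) - q * (c GY i * c GE (\<sigma> GY i))) (w i)"
    unfolding D(4) a1 a2 sc_simps(6)[OF D(1)] sc_simps(2)[OF D(1), of q] ..
  finally show ?thesis by (simp only: y)
qed

lemma M1_relations:
  assumes w: "monomial UNIV w (M1_coef q \<mu>1 \<mu>2 \<mu>3 \<mu>4) M1_ind" and \<mu>: "\<mu>3 \<noteq> 0" "\<mu>4 \<noteq> 0"
    and f: "f \<in> ageing_relations q"
  shows "act f (w i) = 0"
proof (cases i)
  case (Pair a b)
  note nz = q_powi_nonzero q_nonzero q_sq_neq_1
  show ?thesis
  proof (rule monomial_relations[OF w UNIV_I _ _ _ _ _ _ _ _ _ _ _ _ _ f])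
    show "w (M1_ind g (M1_ind h i)) = w (M1_ind h (M1_ind g i))" for g h
      unfolding Pair by (cases g; cases h) simp_all
  qed (use \<mu> nz in \<open>simp_all add: Pair powi_simps divide_simps power2_eq_square\<close>,
      (simp add: algebra_simps power2_eq_square power3_eq_cube)?)
qed

lemma M1_phi:
  assumes w: "monomial UNIV w (M1_coef q \<mu>1 \<mu>2 \<mu>3 \<mu>4) M1_ind" and \<mu>: "\<mu>3 \<noteq> 0"
  shows "act (phi_word q) (w (a, b)) = sc (\<mu>2 * q powi (b - a)) (w (a, b))"
  by (rule phi_eigen[OF w])
    (use \<mu> q_powi_nonzero q_nonzero q_sq_neq_1 in \<open>simp_all add: powi_simps divide_simps power2_eq_square\<close>,
     (simp add: algebra_simps power2_eq_square power3_eq_cube)?)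

text \<open>The value of \<open>\<theta>\<close> is arbitrary: in the only inhomogeneous relation,
  the one for \<open>E Y\<close>, it is multiplied by the coefficient of \<open>E\<close> at
  \<open>a = 0\<close>, which vanishes.\<close>

lemma nil_relations:
  assumes w: "monomial ({0..<m} \<times> UNIV) w (nil_coef q m \<theta> \<mu>1 \<mu>2 \<mu>3) (nil_ind m s)" and \<mu>: "\<mu>2 \<noteq> 0" "\<mu>3 \<noteq> 0"
    and f: "f \<in> ageing_relations q" and i: "i \<in> {0..<m} \<times> UNIV"
  shows "act f (w i) = 0"
proof -
  obtain a b where ab: "i = (a, b)" "0 \<le> a" "a < m" using i by auto
  note nz = q_powi_nonzero q_nonzero q_sq_neq_1
  let ?c = "nil_coef q m \<theta> \<mu>1 \<mu>2 \<mu>3" and ?\<sigma> = "nil_ind m s"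
  have XY: "?c GX i * ?c GY (?\<sigma> GX i) = q * (?c GY i * ?c GX (?\<sigma> GY i))"
  proof (cases "a = m - 1")
    case True
    \<comment> \<open>\<open>Y\<close> wraps around at \<open>a = m - 1\<close>. The eigenvalues of
      \<open>X\<close> match because \<open>q powi (- m)\<close>, \<open>q powi m\<close> and
      \<open>q powi s\<close> coincide.\<close>
    have "q powi (b - (m - 1)) = q * q powi (s + b)"
      using q_pow_m inverse_q_pow_m nz(1,2) by (simp add: powi_simps field_simps)
    then show ?thesis by (simp add: ab True)
  next
    case False
    then show ?thesis using nz by (simp add: ab powi_simps field_simps)
  qed
  have EY: "?c GE i * ?c GY (?\<sigma> GE i) = ?c GX i + q powi (-1) * (?c GY i * ?c GE (?\<sigma> GY i))"
  proof -
    consider "a = 0" | "a = m - 1" "a \<noteq> 0" | "a \<noteq> m - 1" "a \<noteq> 0" by blast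
    then show ?thesis
    proof cases
      case 1
      then show ?thesis using nz \<mu> m_ge_2 by (simp add: ab powi_simps divide_simps power2_eq_square) (simp add: algebra_simps)?
    next
      case 2
      \<comment> \<open>The path through \<open>Y\<close> first contributes nothing here; the path
        through \<open>E\<close> first gives the right coefficient because \<open>l\<close> divides
        \<open>2 * m\<close>.\<close>
      have "q powi (- 2 * a) = q powi 2"
        by (rule q_powi_cong) (use L_dvd_mult_2s(2) in \<open>simp add: 2 algebra_simps\<close>)
      then have "q powi (- 2 * a) = q\<^sup>2" by (simp only: powi_simps)
      moreover have "q powi a = q powi m / q" by (simp add: 2 powi_simps)
      ultimately show ?thesis
        using nz \<mu> m_ge_2 2 q_pow_m inverse_q_pow_m
        by (simp add: ab powi_simps divide_simps power2_eq_square) (simp add: algebra_simps)?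
    next
      case 3
      moreover have "a \<noteq> m" using ab by simp
      ultimately show ?thesis using nz \<mu> by (simp add: ab powi_simps divide_simps power2_eq_square) (simp add: algebra_simps)?
    qed
  qed
  show ?thesis
  proof (rule monomial_relations[OF w i _ _ _ _ _ _ _ _ _ XY EY _ _ f])
    show "w (?\<sigma> g (?\<sigma> h i)) = w (?\<sigma> h (?\<sigma> g i))" if "g \<noteq> h" "{g, h} \<noteq> {GE, GY}" for g h
      using that unfolding ab by (cases g; cases h) (auto simp: doubleton_eq_iff algebra_simps)
    show "w (?\<sigma> GY (?\<sigma> GE i)) = w i \<or> ?c GE i = 0"
      using ab by auto
    show "w (?\<sigma> GE (?\<sigma> GY i)) = w i \<or> ?c GE (?\<sigma> GY i) = 0"
      using ab by auto
  qed (use \<mu> nz ab in \<open>auto simp: powi_simps field_simps power2_eq_square\<close>)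
qed

lemma nil_phi:
  assumes w: "monomial ({0..<m} \<times> UNIV) w (nil_coef q m \<theta> \<mu>1 \<mu>2 \<mu>3) (nil_ind m s)" and \<mu>: "\<mu>2 \<noteq> 0" "\<mu>3 \<noteq> 0"
    and a: "0 \<le> a" "a < m"
  shows "act (phi_word q) (w (a, b)) = sc (\<mu>1 * q powi (a + b + 2)) (w (a, b))"
proof (rule phi_eigen[OF w])
  let ?c = "nil_coef q m \<theta> \<mu>1 \<mu>2 \<mu>3" and ?\<sigma> = "nil_ind m s"
  note nz = q_powi_nonzero q_nonzero q_sq_neq_1
  show "(a, b) \<in> {0..<m} \<times> UNIV" using a by simp
  show "w (?\<sigma> GY (?\<sigma> GE (a, b))) = w (a, b) \<or> ?c GE (a, b) = 0"
    using a by auto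
  show "w (?\<sigma> GE (?\<sigma> GY (a, b))) = w (a, b) \<or> ?c GE (?\<sigma> GY (a, b)) = 0"
    using a by auto
  consider "a = 0" | "a = m - 1" "a \<noteq> 0" | "a \<noteq> m - 1" "a \<noteq> 0" by blast
  then show "?c GE (a, b) * ?c GY (?\<sigma> GE (a, b)) - q * (?c GY (a, b) * ?c GE (?\<sigma> GY (a, b))) = \<mu>1 * q powi (a + b + 2)"
  proof cases
    case 1
    then show ?thesis using nz \<mu> m_ge_2 by (simp add: powi_simps divide_simps power2_eq_square) (simp add: algebra_simps)?
  next
    case 2
    have "q powi (- 2 * a) = q powi 2"
      by (rule q_powi_cong) (use L_dvd_mult_2s(2) in \<open>simp add: 2 algebra_simps\<close>)
    then have "q powi (- 2 * a) = q\<^sup>2" by (simp only: powi_simps)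
    then show ?thesis
      using nz \<mu> m_ge_2 2
      by (simp add: powi_simps divide_simps power2_eq_square) (simp add: algebra_simps)?
  next
    case 3
    moreover have "a \<noteq> m" using a by simp
    ultimately show ?thesis using nz \<mu> by (simp add: powi_simps divide_simps power2_eq_square) (simp add: algebra_simps)?
  qed
qed

end


section \<open>Reaching one basis vector from another\<close>

context free_rep
begin

lemma reach_trans:
  assumes "u \<in> V" "v \<in> V" "w \<in> V" "\<exists>f c. c \<noteq> 0 \<and> act f u = sc c v" "\<exists>f c. c \<noteq> 0 \<and> act f v = sc c w"
  shows "\<exists>f c. c \<noteq> 0 \<and> act f u = sc c w"
proof -
  obtain f a g b where f: "a \<noteq> 0" "act f u = sc a v" "b \<noteq> 0" "act g v = sc b w" using assms by blast
  have "act (f * g) u = sc a (sc b w)"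
    by (simp only: act_mult[OF assms(1)] f act_sc[OF assms(2)])
  then have "act (f * g) u = sc (a * b) w" by (simp only: sc_simps(2)[OF assms(3)])
  then show ?thesis using f by (intro exI[of _ "f * g"] exI[of _ "a * b"]) simp
qed

lemma reach_refl: "u \<in> V \<Longrightarrow> \<exists>f c. c \<noteq> 0 \<and> act f u = sc c u"
  by (intro exI[of _ 1] exI[of _ 1]) (simp add: fconst_simps)

lemma reach_steps:
  assumes w: "monomial J w c \<sigma>" and i: "\<And>n. n \<le> N \<Longrightarrow> i n \<in> J"
    and step: "\<And>n. n < N \<Longrightarrow> \<exists>g. c g (i n) \<noteq> 0 \<and> \<sigma> g (i n) = i (Suc n)"
  shows "\<exists>f c. c \<noteq> 0 \<and> act f (w (i 0)) = sc c (w (i N))"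
proof -
  have "\<exists>f c. c \<noteq> 0 \<and> act f (w (i 0)) = sc c (w (i n))" if "n \<le> N" for n
    using that
  proof (induction n)
    case 0
    then show ?case using monomialD(1)[OF w i] by (intro reach_refl) simp
  next
    case (Suc n)
    obtain g where g: "c g (i n) \<noteq> 0" "\<sigma> g (i n) = i (Suc n)" using step[of n] Suc.prems by auto
    have "act (fgen g) (w (i n)) = sc (c g (i n)) (w (i (Suc n)))"
      using monomialD(3)[OF w i, of n g] g Suc.prems by simp
    then show ?case
      using Suc g(1) monomialD(1)[OF w i] by (intro reach_trans[of "w (i 0)" "w (i n)" "w (i (Suc n))"]) auto
  qed
  then show ?thesis by simp
qed

end

context root_setting
begin

text \<open>The extension of \<open>e\<close> to all integers: each round of the first index shifts
  the second by \<open>s\<close>, so \<open>E\<close> and \<open>Y\<close> move the first index by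
  one without exceptions.\<close>

definition M1_basis :: "int \<times> int \<Rightarrow> 'k coords" where
  "M1_basis = (\<lambda>(a, b). basis_vec l a (b + s * (a div m)))"

definition nil_basis :: "int \<times> int \<Rightarrow> 'k coords" where
  "nil_basis = (\<lambda>(a, b). basis_vec l a b)"

definition M1_norm :: "int \<times> int \<Rightarrow> int \<times> int" where
  "M1_norm = (\<lambda>(a, b). (a mod m, (b + s * (a div m)) mod L))"

definition nil_norm :: "int \<times> int \<Rightarrow> int \<times> int" where
  "nil_norm = (\<lambda>(a, b). (a, b mod L))"

lemma half_L: "even l \<Longrightarrow> L div 2 = m" "even l \<Longrightarrow> s = m" "odd l \<Longrightarrow> s = 0"
  by (auto simp: s_def ord_sq_def)

lemma zero_coord_space: "(\<lambda>_. 0) \<in> coord_space l"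
  by (simp add: coord_space_def)

lemma M1_op_coord_space: "M1_op q l \<mu>1 \<mu>2 \<mu>3 \<mu>4 g a b \<in> coord_space l"
  by (cases g) (auto intro!: scale_vec_coord_space basis_vec_in_coord_space l_ge_3)

lemma M2_op_coord_space: "M2_op q l \<mu>1 \<mu>2 \<mu>3 g a b \<in> coord_space l"
  by (cases g) (auto intro!: scale_vec_coord_space basis_vec_in_coord_space l_ge_3 zero_coord_space)

lemma M3_op_coord_space: "M3_op q l \<mu>1 \<mu>2 g a b \<in> coord_space l"
  by (cases g) (auto intro!: scale_vec_coord_space basis_vec_in_coord_space l_ge_3 zero_coord_space)

lemma div_mod_shift:
  "a mod m = m - 1 \<Longrightarrow> (a + 1) mod m = 0 \<and> (a + 1) div m = a div m + 1"
  "a mod m \<noteq> m - 1 \<Longrightarrow> (a + 1) mod m = a mod m + 1 \<and> (a + 1) div m = a div m"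
  "a mod m = 0 \<Longrightarrow> (a - 1) mod m = m - 1 \<and> (a - 1) div m = a div m - 1"
  "a mod m \<noteq> 0 \<Longrightarrow> (a - 1) mod m = a mod m - 1 \<and> (a - 1) div m = a div m"
proof -
  have e: "m * (a div m) = a - a mod m" by (rule minus_mod_eq_mult_div[symmetric])
  have r: "0 \<le> a mod m" "a mod m < m" using m_pos by simp_all
  have sh: "m * (a div m + 1) = m * (a div m) + m" "m * (a div m - 1) = m * (a div m) - m"
    by (simp_all add: distrib_left right_diff_distrib)
  have u: "c mod m = t \<and> c div m = k" if "c = m * k + t" "0 \<le> t" "t < m" for c k t
    using that by (metis div_pos_pos_trivial mod_pos_pos_trivial add.commute add.right_neutral div_mult_self2 mod_mult_self2 order.strict_iff_not m_pos)
  show "a mod m = m - 1 \<Longrightarrow> (a + 1) mod m = 0 \<and> (a + 1) div m = a div m + 1"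
    by (rule u, unfold sh) (use m_pos e in linarith)+
  show "a mod m \<noteq> m - 1 \<Longrightarrow> (a + 1) mod m = a mod m + 1 \<and> (a + 1) div m = a div m"
    by (rule u) (use r m_pos e in linarith)+
  show "a mod m = 0 \<Longrightarrow> (a - 1) mod m = m - 1 \<and> (a - 1) div m = a div m - 1"
    by (rule u, unfold sh) (use m_pos e in linarith)+
  show "a mod m \<noteq> 0 \<Longrightarrow> (a - 1) mod m = a mod m - 1 \<and> (a - 1) div m = a div m"
    by (rule u) (use r m_pos e in linarith)+
qed

text \<open>Passing from \<open>(a, b)\<close> to its representative \<open>(A, B)\<close> in the
  box changes \<open>a + b\<close> by a multiple of \<open>m - s\<close>, \<open>2 * b\<close> by a
  multiple of \<open>2 * s\<close> and \<open>2 * a\<close> by one of \<open>2 * m\<close>, always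
  up to multiples of \<open>l\<close>. All of these are divisible by \<open>l\<close>, so the
  coefficients do not depend on the representative.\<close>

lemma M1_monomial:
  "free_rep.monomial (coord_space l) (free_action l (M1_op q l \<mu>1 \<mu>2 \<mu>3 \<mu>4)) UNIV
     M1_basis (M1_coef q \<mu>1 \<mu>2 \<mu>3 \<mu>4) M1_ind"
proof -
  let ?T = "M1_op q l \<mu>1 \<mu>2 \<mu>3 \<mu>4"
  interpret free_rep "coord_space l" "free_action l ?T" by (rule free_rep_coords) (rule M1_op_coord_space)
  have "free_action l ?T (fgen g) (M1_basis (a, b)) =
      scale_vec (M1_coef q \<mu>1 \<mu>2 \<mu>3 \<mu>4 g (a, b)) (M1_basis (M1_ind g (a, b)))" for g a b
  proof -
    define k where "k = a div m"
    define A where "A = a mod m"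
    define t where "t = b + s * k"
    define B where "B = t mod L"
    have a: "a = m * k + A" by (simp add: k_def A_def)
    have Bt: "B mod L = t mod L" "(B + c) mod L = (t + c) mod L" "(c + B) mod L = (t + c) mod L"
      "(B - c) mod L = (t - c) mod L" for c
      by (simp_all add: B_def mod_simps add.commute)
    have LB: "L dvd B - t" by (simp add: B_def mod_eq_dvd_iff[symmetric])
    have Lms: "L dvd m * k - s * k" using L_eq(2) by (metis dvd_mult2 left_diff_distrib)
    have "L dvd (B - t) - (m * k - s * k)" using LB Lms by (rule dvd_diff)
    then have ab: "L dvd (A + B) - (a + b)" by (simp add: a t_def algebra_simps)
    then have ab': "L dvd - (A + B) - - (a + b)" by (metis dvd_minus_iff minus_diff_minus)
    have "L dvd 2 * (B - t)" "L dvd 2 * s * k" using LB L_dvd_mult_2s(1) by (simp_all only: dvd_mult dvd_mult2)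
    then have "L dvd 2 * (B - t) + 2 * s * k" by (rule dvd_add)
    then have bb: "L dvd 2 * B - 2 * b" by (simp add: t_def algebra_simps)
    have "L dvd - (2 * m * k)" using L_dvd_mult_2s(2) by (simp only: dvd_minus_iff dvd_mult2)
    then have aa: "L dvd (2 * A + 1) - (2 * a + 1)" by (simp add: a algebra_simps)
    note q_eq = q_powi_cong[OF ab] q_powi_cong[OF ab'] q_powi_cong[OF bb] q_powi_cong[OF aa]
    have Lm: "L = m + s" by (rule L_eq)
    have e: "free_action l ?T (fgen g) (M1_basis (a, b)) = ?T g A B"
      by (simp add: M1_basis_def free_action_gen linear_ext_basis[OF l_ge_3] A_def B_def t_def k_def)
    have Am: "A mod m = a mod m" by (simp add: A_def)
    show ?thesis
    proof (cases g)
      case GE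
      show ?thesis
      proof (cases "A = m - 1")
        case True
        then have d: "(a + 1) mod m = 0" "(a + 1) div m = k + 1" using div_mod_shift(1)[of a] by (auto simp: A_def k_def)
        have "?T GE A B = scale_vec (\<mu>3 * q powi (2 * b)) (basis_vec l 0 (s + B))"
        proof (cases "even l")
          case even: True
          then show ?thesis using True half_L(1,2)[OF even] q_eq(3) by simp
        next
          case odd: False
          have "basis_vec l (A + 1) B = (basis_vec l 0 (s + B) :: 'k coords)"
            by (rule basis_vec_cong) (use True half_L(3)[OF odd] in simp_all)
          then show ?thesis using odd q_eq(3) by simp
        qed
        moreover have "basis_vec l 0 (s + B) = (M1_basis (a + 1, b) :: 'k coords)"
          unfolding M1_basis_def prod.case d by (rule basis_vec_cong, simp add: d, simp add: Bt t_def algebra_simps)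
        ultimately show ?thesis using e GE by simp
      next
        case False
        then have d: "(a + 1) mod m = A + 1" "(a + 1) div m = k" using div_mod_shift(2)[of a] by (auto simp: A_def k_def)
        have "?T GE A B = scale_vec (\<mu>3 * q powi (2 * b)) (basis_vec l (A + 1) B)"
          using False half_L q_eq(3) by auto
        moreover have "basis_vec l (A + 1) B = (M1_basis (a + 1, b) :: 'k coords)"
          unfolding M1_basis_def prod.case by (rule basis_vec_cong) (use d in \<open>simp_all add: Bt t_def A_def mod_simps\<close>)
        ultimately show ?thesis using e GE by simp
      qed
    next
      case GY
      show ?thesis
      proof (cases "A = 0")
        case True
        then have d: "(a - 1) mod m = m - 1" "(a - 1) div m = k - 1" using div_mod_shift(3)[of a] by (auto simp: A_def k_def)
        have c: "q powi (- B) = q powi (- (a + b))" "q powi (2 * a + 1) = q" using q_eq(2,4) True by (simp_all del: power_int_minus)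
        have "?T GY A B = scale_vec (M1_coef q \<mu>1 \<mu>2 \<mu>3 \<mu>4 GY (a, b)) (basis_vec l (m - 1) (B - s))"
        proof (cases "even l")
          case even: True
          have "basis_vec l (m - 1) (m + B) = (basis_vec l (m - 1) (B - s) :: 'k coords)"
            by (rule basis_vec_cong) (use Lm half_L(2)[OF even] in \<open>simp_all add: mod_eq_dvd_iff\<close>)
          moreover have "?T GY A B = scale_vec (inverse \<mu>3 * q powi (- B) * (q * (\<mu>2 - \<mu>1) / (1 - q\<^sup>2))) (basis_vec l (m - 1) (m + B))"
            using even True half_L(1)[OF even] by simp
          ultimately show ?thesis
            unfolding M1_coef.simps c by (simp only: right_diff_distrib)
        next
          case odd: False
          have "basis_vec l (- 1) B = (basis_vec l (m - 1) (B - s) :: 'k coords)"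
            by (rule basis_vec_cong) (use half_L(3)[OF odd] in \<open>simp_all add: mod_eq_dvd_iff\<close>)
          moreover have "?T GY A B = scale_vec (inverse \<mu>3 * q powi (- (A + B)) * ((q * \<mu>2 - q powi (2 * A + 1) * \<mu>1) / (1 - q\<^sup>2))) (basis_vec l (- 1) B)"
            using odd True by simp
          ultimately show ?thesis unfolding M1_coef.simps q_eq(2,4) by (simp only:)
        qed
        moreover have "(m - 1) mod m = m - 1" using m_pos by (intro mod_pos_pos_trivial) simp_all
        then have "basis_vec l (m - 1) (B - s) = (M1_basis (a - 1, b) :: 'k coords)"
          unfolding M1_basis_def prod.case d
          by (intro basis_vec_cong, simp only: d, simp add: Bt t_def algebra_simps)
        ultimately show ?thesis using e GY by (simp only: M1_ind.simps)
      next
        case False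
        then have d: "(a - 1) mod m = A - 1" "(a - 1) div m = k" using div_mod_shift(4)[of a] by (auto simp: A_def k_def)
        have "?T GY A B = scale_vec (inverse \<mu>3 * q powi (- (A + B)) * ((q * \<mu>2 - q powi (2 * A + 1) * \<mu>1) / (1 - q\<^sup>2))) (basis_vec l (A - 1) B)"
          using False by simp
        moreover have "basis_vec l (A - 1) B = (M1_basis (a - 1, b) :: 'k coords)"
          unfolding M1_basis_def prod.case by (rule basis_vec_cong) (use d in \<open>simp_all add: Bt t_def A_def mod_simps\<close>)
        ultimately show ?thesis using e GY by (simp only: M1_ind.simps M1_coef.simps q_eq(2,4))
      qed
    next
      case GX
      have "basis_vec l A B = (M1_basis (a, b) :: 'k coords)"
        unfolding M1_basis_def prod.case by (rule basis_vec_cong) (simp_all add: A_def Bt t_def k_def)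
      then show ?thesis using e GX q_eq(1) by simp
    next
      case GK
      have "basis_vec l A (B + 1) = (M1_basis (a, b + 1) :: 'k coords)"
        unfolding M1_basis_def prod.case by (rule basis_vec_cong) (simp_all add: A_def Bt t_def k_def algebra_simps)
      then show ?thesis using e GK by simp
    next
      case GKinv
      have "basis_vec l A (B - 1) = (M1_basis (a, b - 1) :: 'k coords)"
        unfolding M1_basis_def prod.case by (rule basis_vec_cong) (simp_all add: A_def Bt t_def k_def algebra_simps)
      then show ?thesis using e GKinv by simp
    qed
  qed
  then show ?thesis
    unfolding monomial_def by (auto simp: M1_basis_def free_action_const basis_vec_in_coord_space[OF l_ge_3])
qed

text \<open>One verification for \<open>M_2\<close> and \<open>M_3\<close>, whose tables differ only
  in the normalisation \<open>\<mu>2\<close> and in \<open>Y\<close> at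
  \<open>a = m - 1\<close>.\<close>

lemma nil_monomial:
  assumes T: "\<And>g a b. T g a b \<in> coord_space l"
    and X: "\<And>a b. T GX a b = scale_vec (\<mu>1 * q powi (- a + b)) (basis_vec l a b)"
    and K: "\<And>a b. T GK a b = scale_vec \<mu>3 (basis_vec l a (b + 1))"
    and Ki: "\<And>a b. T GKinv a b = scale_vec (inverse \<mu>3) (basis_vec l a (b - 1))"
    and E: "\<And>a b. a \<noteq> 0 \<Longrightarrow> T GE a b = scale_vec (- (inverse \<mu>2) * \<mu>1 * q powi (a + 2 * b) *
               ((q powi (- 2 * a) - 1) / (q powi (- 2) - 1))) (basis_vec l (a - 1) b)"
    and E0: "\<And>b. T GE 0 b = 0"
    and Y: "\<And>a b. a \<noteq> m - 1 \<Longrightarrow> T GY a b = scale_vec (\<mu>2 * q powi (- b)) (basis_vec l (a + 1) b)"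
    and Ym: "\<And>b. T GY (m - 1) b = scale_vec (\<theta> * (\<mu>2 * q powi (- b))) (basis_vec l 0 (s + b))"
  shows "free_rep.monomial (coord_space l) (free_action l T) ({0..<m} \<times> UNIV)
     nil_basis (nil_coef q m \<theta> \<mu>1 \<mu>2 \<mu>3) (nil_ind m s)"
proof -
  interpret free_rep "coord_space l" "free_action l T" by (rule free_rep_coords) (rule T)
  have "free_action l T (fgen g) (nil_basis (a, b)) =
      scale_vec (nil_coef q m \<theta> \<mu>1 \<mu>2 \<mu>3 g (a, b)) (nil_basis (nil_ind m s g (a, b)))" if a: "0 \<le> a" "a < m" for g a b
  proof -
    define B where "B = b mod L"
    have e: "free_action l T (fgen g) (nil_basis (a, b)) = T g a B"
      using a by (simp add: nil_basis_def free_action_gen linear_ext_basis[OF l_ge_3] B_def)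
    have cg: "basis_vec l c (B + d) = (basis_vec l c (b + d) :: 'k coords)" "basis_vec l c (d + B) = (basis_vec l c (d + b) :: 'k coords)"
      "basis_vec l c (B - d) = (basis_vec l c (b - d) :: 'k coords)" "basis_vec l c B = (basis_vec l c b :: 'k coords)" for c d
      by (rule basis_vec_cong; simp add: B_def mod_simps)+
    have LB: "L dvd B - b" by (simp add: B_def mod_eq_dvd_iff[symmetric])
    have "L dvd (- a + B) - (b - a)" using LB by simp
    note qx = q_powi_cong[OF this]
    have "L dvd (a + 2 * B) - (a + 2 * b)" using dvd_mult[OF LB, of 2] by (simp add: algebra_simps)
    note qe = q_powi_cong[OF this]
    have "L dvd - B - - b" using LB by (simp add: dvd_diff_commute)
    note qy = q_powi_cong[OF this]
    show ?thesis
    proof (cases g)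
      case GE
      show ?thesis
      proof (cases "a = 0")
        case True
        then show ?thesis using e GE by (simp only: E0 nil_coef.simps) (simp add: scale_vec_simps)
      next
        case False
        then show ?thesis unfolding e[unfolded GE] GE E[OF False] by (simp only: nil_coef.simps nil_ind.simps qe cg nil_basis_def prod.case if_False)
      qed
    next
      case GY
      show ?thesis
      proof (cases "a = m - 1")
        case True
        then show ?thesis unfolding e[unfolded GY] GY by (simp only: Ym nil_coef.simps nil_ind.simps qy cg nil_basis_def prod.case if_True simp_thms)
      next
        case False
        then show ?thesis unfolding e[unfolded GY] GY Y[OF False] by (simp only: nil_coef.simps nil_ind.simps qy cg nil_basis_def prod.case if_False mult_1)
      qed
    next
      case GX
      show ?thesis unfolding e[unfolded GX] GX X by (simp only: nil_coef.simps nil_ind.simps qx cg nil_basis_def prod.case)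
    next
      case GK
      show ?thesis unfolding e[unfolded GK] GK K by (simp only: nil_coef.simps nil_ind.simps cg nil_basis_def prod.case)
    next
      case GKinv
      show ?thesis unfolding e[unfolded GKinv] GKinv Ki by (simp only: nil_coef.simps nil_ind.simps cg nil_basis_def prod.case)
    qed
  qed
  moreover have "nil_ind m s g i \<in> {0..<m} \<times> UNIV" if "i \<in> {0..<m} \<times> UNIV" for g i
    using that m_ge_2 by (cases g; cases i) auto
  ultimately show ?thesis
    unfolding monomial_def by (auto simp: nil_basis_def free_action_const basis_vec_in_coord_space[OF l_ge_3])
qed

lemma M2_monomial:
  "free_rep.monomial (coord_space l) (free_action l (M2_op q l \<mu>1 \<mu>2 \<mu>3)) ({0..<m} \<times> UNIV)
     nil_basis (nil_coef q m 1 \<mu>1 \<mu>2 \<mu>3) (nil_ind m s)"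
proof (rule nil_monomial)
  show "M2_op q l \<mu>1 \<mu>2 \<mu>3 GY a b = scale_vec (\<mu>2 * q powi (- b)) (basis_vec l (a + 1) b)" if "a \<noteq> m - 1" for a b
    using that half_L(1) by auto
  show "M2_op q l \<mu>1 \<mu>2 \<mu>3 GY (m - 1) b = scale_vec (1 * (\<mu>2 * q powi (- b))) (basis_vec l 0 (s + b))" for b
  proof (cases "even l")
    case False
    have "basis_vec l m b = (basis_vec l 0 (s + b) :: 'k coords)"
      by (rule basis_vec_cong) (use half_L(3)[OF False] in simp_all)
    then show ?thesis using False by simp
  qed (use half_L in auto)
qed (auto simp: M2_op_coord_space zero_fun_def)

lemma M3_monomial:
  "free_rep.monomial (coord_space l) (free_action l (M3_op q l \<mu>1 \<mu>2)) ({0..<m} \<times> UNIV)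
     nil_basis (nil_coef q m 0 \<mu>1 1 \<mu>2) (nil_ind m s)"
  by (rule nil_monomial) (auto simp: M3_op_coord_space zero_fun_def scale_vec_def)

end

section \<open>Simplicity of the coordinate modules\<close>

context root_setting
begin

lemma index_box_iff: "(a, b) \<in> index_box l \<longleftrightarrow> 0 \<le> a \<and> a < m \<and> 0 \<le> b \<and> b < L"
  by (auto simp: index_box_def)

lemma card_index_box: "card (index_box l) = ord_sq l * l"
  by (simp add: index_box_def card_cartesian_product)

lemma box_M1_basis: "p \<in> index_box l \<Longrightarrow> basis_vec l (fst p) (snd p) = M1_basis p"
  by (cases p) (simp add: M1_basis_def index_box_iff div_pos_pos_trivial)

lemma box_nil_basis: "basis_vec l (fst p) (snd p) = nil_basis p"
  by (cases p) (simp add: nil_basis_def)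

text \<open>The eigenvalues of \<open>X\<close> and \<open>\<phi>\<close> determine
  \<open>a + b\<close> and \<open>b - a\<close> modulo \<open>l\<close>. Their difference
  \<open>2 * a\<close> modulo \<open>l\<close> determines \<open>a\<close> modulo \<open>m\<close>,
  and then \<open>b\<close> follows.\<close>

lemma separated:
  assumes "p \<in> index_box l" "p' \<in> index_box l"
    and "L dvd (fst p + snd p) - (fst p' + snd p')" "L dvd (snd p - fst p) - (snd p' - fst p')"
  shows "p = p'"
proof -
  obtain a b a' b' where p: "p = (a, b)" "p' = (a', b')" by (cases p, cases p') auto
  have ab: "0 \<le> a" "a < m" "0 \<le> b" "b < L" "0 \<le> a'" "a' < m" "0 \<le> b'" "b' < L"
    using assms(1,2) by (auto simp: p index_box_iff)
  have small: "x = y" if "c dvd x - y" "0 \<le> x" "x < c" "0 \<le> y" "y < c" for c x y :: int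
    using that by (metis mod_eq_dvd_iff mod_pos_pos_trivial)
  have "L dvd ((a + b) - (a' + b')) - ((b - a) - (b' - a'))"
    using dvd_diff[OF assms(3,4)] by (simp only: p fst_conv snd_conv)
  then have "L dvd 2 * (a - a')" by (simp add: algebra_simps)
  then have "m dvd a - a'" by (simp only: L_dvd_twice_iff)
  then have "a = a'" using small ab by blast
  moreover have "L dvd b - b'" using assms(3) \<open>a = a'\<close> by (simp add: p)
  then have "b = b'" using small ab by blast
  ultimately show ?thesis by (simp add: p)
qed

context
  fixes \<mu>1 \<mu>2 \<mu>3 \<mu>4 :: 'k
  assumes \<mu>: "\<mu>3 \<noteq> 0" "\<mu>4 \<noteq> 0"
begin

text \<open>The case \<open>\<mu>2 = 0\<close> is included on purpose: it serves the dimension bound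
  for simple modules killed by \<open>\<phi>\<close>.\<close>

lemma M1_rep: "ageing_rep q (coord_space l) (free_action l (M1_op q l \<mu>1 \<mu>2 \<mu>3 \<mu>4))"
proof (rule ageing_rep_coords[OF M1_op_coord_space])
  interpret free_root "coord_space l" "free_action l (M1_op q l \<mu>1 \<mu>2 \<mu>3 \<mu>4)" q l
    by (intro free_root.intro free_rep_coords M1_op_coord_space root_setting_axioms)
  fix f a b assume "f \<in> ageing_relations q" "(a, b) \<in> index_box l"
  then show "free_action l (M1_op q l \<mu>1 \<mu>2 \<mu>3 \<mu>4) f (basis_vec l a b) = 0"
    using M1_relations[OF M1_monomial \<mu>, of f "(a, b)"] box_M1_basis[of "(a, b)"] by simp
qed

lemma M1_units:
  assumes \<mu>': "\<mu>1 \<noteq> 0" "\<mu>2 \<noteq> 0" and p: "p \<in> index_box l" "p' \<in> index_box l"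
  shows "\<exists>f. \<forall>r\<in>index_box l. free_action l (M1_op q l \<mu>1 \<mu>2 \<mu>3 \<mu>4) f (basis_vec l (fst r) (snd r)) =
    (if r = p then basis_vec l (fst p') (snd p') else 0)"
proof -
  let ?T = "M1_op q l \<mu>1 \<mu>2 \<mu>3 \<mu>4"
  interpret free_root "coord_space l" "free_action l ?T" q l
    by (intro free_root.intro free_rep_coords M1_op_coord_space root_setting_axioms)
  note mono = M1_monomial[of \<mu>1 \<mu>2 \<mu>3 \<mu>4]
  show ?thesis
  proof (rule coord_matrix_units[OF l_ge_3 M1_rep _ _ _ _ p])
    fix r assume r: "r \<in> index_box l"
    show "free_action l ?T (fgen GX) (basis_vec l (fst r) (snd r)) =
        scale_vec (\<mu>1 * q powi (fst r + snd r)) (basis_vec l (fst r) (snd r))"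
      unfolding box_M1_basis[OF r] using monomialD(3)[OF mono, of r GX] by (cases r) (simp add: free_action_const)
    show "free_action l ?T (phi_word q) (basis_vec l (fst r) (snd r)) =
        scale_vec (\<mu>2 * q powi (snd r - fst r)) (basis_vec l (fst r) (snd r))"
      using M1_phi[OF mono \<mu>(1), of "fst r" "snd r"] by (simp only: box_M1_basis[OF r] free_action_const prod.collapse)
  next
    show "inj_on (\<lambda>r. (\<mu>1 * q powi (fst r + snd r), \<mu>2 * q powi (snd r - fst r))) (index_box l)"
      using \<mu>' separated by (intro inj_onI) (simp add: q_powi_eq_iff)
  next
    fix r r' assume r: "r \<in> index_box l" "r' \<in> index_box l"
    obtain a b a' b' where ab: "r = (a, b)" "r' = (a', b')" by (cases r, cases r') auto
    have box: "0 \<le> a" "a < m" "0 \<le> b" "b < L" "0 \<le> a'" "a' < m" "0 \<le> b'" "b' < L"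
      using r by (auto simp: ab index_box_iff)
    have V: "M1_basis i \<in> coord_space l" for i by (rule monomialD(1)[OF mono]) simp
    \<comment> \<open>\<open>E\<close> only increases the first index. Aiming at
      \<open>a' + 2 * m\<close> keeps the number of steps nonnegative, and two rounds shift the
      second index by \<open>2 * s\<close>, which is zero modulo \<open>l\<close>.\<close>
    have 1: "\<exists>f c. c \<noteq> 0 \<and> free_action l ?T f (M1_basis (a + int 0, b)) =
        sc c (M1_basis (a + int (nat (a' - a + 2 * m)), b))"
      by (rule reach_steps[OF mono, where i = "\<lambda>n. (a + int n, b)"])
        (auto intro!: exI[of _ GE] simp: \<mu> q_nonzero)
    have 2: "\<exists>f c. c \<noteq> 0 \<and> free_action l ?T f (M1_basis (a' + 2 * m, b + int 0)) =
        sc c (M1_basis (a' + 2 * m, b + int (nat (b' - b + L))))"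
      by (rule reach_steps[OF mono, where i = "\<lambda>n. (a' + 2 * m, b + int n)"])
        (auto intro!: exI[of _ GK] simp: \<mu> q_nonzero)
    have "\<exists>f c. c \<noteq> 0 \<and> free_action l ?T f (M1_basis (a, b)) = sc c (M1_basis (a' + 2 * m, b' + L))"
      by (rule reach_trans[OF V V V, of _ "(a' + 2 * m, b)"]) (use 1 2 box in simp_all)
    moreover have "M1_basis (a' + 2 * m, b' + L) = M1_basis (a', b')"
      unfolding M1_basis_def prod.case
    proof (rule basis_vec_cong)
      have d: "(a' + 2 * m) div m = a' div m + 2" using m_pos by simp
      have "b' + L + s * (a' div m + 2) - (b' + s * (a' div m)) = L + 2 * s" by (simp add: algebra_simps)
      moreover have "L dvd L + 2 * s" using L_dvd_mult_2s(1) by (intro dvd_add) simp_all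
      ultimately show "(b' + L + s * ((a' + 2 * m) div m)) mod L = (b' + s * (a' div m)) mod L"
        unfolding d by (simp only: mod_eq_dvd_iff)
    qed simp
    ultimately show "\<exists>f c. c \<noteq> 0 \<and> free_action l ?T f (basis_vec l (fst r) (snd r)) =
        scale_vec c (basis_vec l (fst r') (snd r'))"
      unfolding box_M1_basis[OF r(1)] box_M1_basis[OF r(2)] by (simp only: ab free_action_const)
  qed
qed

lemma M1_simple:
  assumes \<mu>': "\<mu>1 \<noteq> 0" "\<mu>2 \<noteq> 0"
  shows "ageing_simple q (coord_space l) (free_action l (M1_op q l \<mu>1 \<mu>2 \<mu>3 \<mu>4))"
  by (rule coord_simple[OF l_ge_3 M1_rep M1_units[OF \<mu>']])

end

lemma nil_rep_simple:
  assumes mono: "free_rep.monomial (coord_space l) (free_action l T) ({0..<m} \<times> UNIV)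
     nil_basis (nil_coef q m \<theta> \<mu>1 \<mu>2 \<mu>3) (nil_ind m s)"
    and T: "\<And>g a b. T g a b \<in> coord_space l"
    and \<mu>: "\<mu>1 \<noteq> 0" "\<mu>2 \<noteq> 0" "\<mu>3 \<noteq> 0"
  shows "ageing_simple q (coord_space l) (free_action l T)"
proof -
  interpret free_root "coord_space l" "free_action l T" q l
    by (intro free_root.intro free_rep_coords T root_setting_axioms)
  have J: "r \<in> {0..<m} \<times> UNIV" if "r \<in> index_box l" for r using that by (cases r) (simp add: index_box_iff)
  have rep: "ageing_rep q (coord_space l) (free_action l T)"
  proof (rule ageing_rep_coords[OF T])
    fix f a b assume "f \<in> ageing_relations q" and ab: "(a, b) \<in> index_box l"
    then show "free_action l T f (basis_vec l a b) = 0"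
      using nil_relations[OF mono \<mu>(2,3) _ J[OF ab]] box_nil_basis[of "(a, b)"] by simp
  qed
  show ?thesis
  proof (rule coord_simple[OF l_ge_3 rep coord_matrix_units[OF l_ge_3 rep]])
    fix r assume r: "r \<in> index_box l"
    show "free_action l T (fgen GX) (basis_vec l (fst r) (snd r)) =
        scale_vec (\<mu>1 * q powi (snd r - fst r)) (basis_vec l (fst r) (snd r))"
      unfolding box_nil_basis using monomialD(3)[OF mono J[OF r], of GX] by (cases r) (simp add: free_action_const)
    have "0 \<le> fst r" "fst r < m" using J[OF r] by auto
    from nil_phi[OF mono \<mu>(2,3) this, of "snd r"]
    show "free_action l T (phi_word q) (basis_vec l (fst r) (snd r)) =
        scale_vec (\<mu>1 * q powi (fst r + snd r + 2)) (basis_vec l (fst r) (snd r))"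
      by (simp only: box_nil_basis free_action_const prod.collapse)
  next
    show "inj_on (\<lambda>r. (\<mu>1 * q powi (snd r - fst r), \<mu>1 * q powi (fst r + snd r + 2))) (index_box l)"
      using \<mu> separated by (intro inj_onI) (simp add: q_powi_eq_iff)
  next
    fix r r' assume r: "r \<in> index_box l" "r' \<in> index_box l"
    obtain a b a' b' where ab: "r = (a, b)" "r' = (a', b')" by (cases r, cases r') auto
    have box: "0 \<le> a" "a < m" "0 \<le> b" "b < L" "0 \<le> a'" "a' < m" "0 \<le> b'" "b' < L"
      using r by (auto simp: ab index_box_iff)
    have V: "nil_basis i \<in> coord_space l" for i by (cases i) (simp add: nil_basis_def basis_vec_in_coord_space[OF l_ge_3])
    have cE: "nil_coef q m \<theta> \<mu>1 \<mu>2 \<mu>3 GE (c, d) \<noteq> 0" if "0 < c" "c < m" for c d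
    proof -
      have "\<not> m dvd c" using that zdvd_imp_le by fastforce
      then have "\<not> L dvd - 2 * c" using L_dvd_twice_iff[of c] by simp
      then have "q powi (- 2 * c) \<noteq> 1" by (simp only: q_powi_eq_1_iff not_False_eq_True)
      then show ?thesis using \<mu> q_powi_nonzero q_sq_neq_1(2) by simp
    qed
    \<comment> \<open>The route goes down to first index 0 by \<open>E\<close>, up to
      \<open>a'\<close> by \<open>Y\<close>, stopping before the wraparound, and then along
      \<open>K\<close>. Hence \<open>\<theta>\<close> never enters.\<close>
    have 1: "\<exists>f c. c \<noteq> 0 \<and> free_action l T f (nil_basis (a - int 0, b)) = sc c (nil_basis (a - int (nat a), b))"
    proof (rule reach_steps[OF mono, where i = "\<lambda>n. (a - int n, b)"])
      fix n assume n: "n < nat a"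
      show "\<exists>g. nil_coef q m \<theta> \<mu>1 \<mu>2 \<mu>3 g (a - int n, b) \<noteq> 0 \<and> nil_ind m s g (a - int n, b) = (a - int (Suc n), b)"
        using cE[of "a - int n" b] n box by (intro exI[of _ GE]) auto
    qed (use box in auto)
    have 2: "\<exists>f c. c \<noteq> 0 \<and> free_action l T f (nil_basis (int 0, b)) = sc c (nil_basis (int (nat a'), b))"
    proof (rule reach_steps[OF mono, where i = "\<lambda>n. (int n, b)"])
      fix n assume n: "n < nat a'"
      show "\<exists>g. nil_coef q m \<theta> \<mu>1 \<mu>2 \<mu>3 g (int n, b) \<noteq> 0 \<and> nil_ind m s g (int n, b) = (int (Suc n), b)"
        using n box \<mu> q_powi_nonzero by (intro exI[of _ GY]) auto
    qed (use box in auto)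
    have 3: "\<exists>f c. c \<noteq> 0 \<and> free_action l T f (nil_basis (a', b + int 0)) = sc c (nil_basis (a', b + int (nat (b' - b + L))))"
      by (rule reach_steps[OF mono, where i = "\<lambda>n. (a', b + int n)"])
        (use box \<mu> in \<open>auto intro!: exI[of _ GK]\<close>)
    have "\<exists>f c. c \<noteq> 0 \<and> free_action l T f (nil_basis (a, b)) = sc c (nil_basis (a', b))"
      by (rule reach_trans[OF V V V, of _ "(0, b)"]) (use 1 2 box in simp_all)
    then have "\<exists>f c. c \<noteq> 0 \<and> free_action l T f (nil_basis (a, b)) = sc c (nil_basis (a', b' + L))"
      by (rule reach_trans[OF V V V, of _ "(a', b)"]) (use 3 box in simp_all)
    moreover have "nil_basis (a', b' + L) = nil_basis (a', b')"
      unfolding nil_basis_def prod.case by (rule basis_vec_cong) simp_all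
    ultimately show "\<exists>f c. c \<noteq> 0 \<and> free_action l T f (basis_vec l (fst r) (snd r)) =
        scale_vec c (basis_vec l (fst r') (snd r'))"
      unfolding box_nil_basis by (simp only: ab free_action_const)
  qed
qed

lemmas M2_simple = nil_rep_simple[OF M2_monomial M2_op_coord_space]
lemmas M3_simple = nil_rep_simple[OF M3_monomial M3_op_coord_space _ one_neq_zero]

end

section \<open>Commutation rules and ordered monomials\<close>

locale ageing_root = ageing_rep q V act + root_setting q l
  for q :: "'k::field" and V :: "'b::ab_group_add set" and act :: "'k ageing_free \<Rightarrow> 'b \<Rightarrow> 'b" and l
begin

abbreviation "gE \<equiv> fgen GE"
abbreviation "gK \<equiv> fgen GK"
abbreviation "gKi \<equiv> fgen GKinv"
abbreviation "gX \<equiv> fgen GX"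
abbreviation "gY \<equiv> fgen GY"

lemma act_sc_gen: "v \<in> V \<Longrightarrow> act (fgen g) (sc c v) = sc c (act (fgen g) v)"
  and act_sc_pow: "v \<in> V \<Longrightarrow> act (fgen g ^ n) (sc c v) = sc c (act (fgen g ^ n) v)"
  by (rule act_sc; assumption)+

text \<open>For the right action this is the relation \<open>a b = c b a\<close> on
  \<open>V\<close>.\<close>

definition qcomm :: "'k ageing_free \<Rightarrow> 'k ageing_free \<Rightarrow> 'k \<Rightarrow> bool" where
  "qcomm a b c \<longleftrightarrow> (\<forall>v\<in>V. act b (act a v) = sc c (act a (act b v)))"

lemma qcommD: "qcomm a b c \<Longrightarrow> v \<in> V \<Longrightarrow> act b (act a v) = sc c (act a (act b v))"
  by (simp add: qcomm_def)

lemma sc_sc: "v \<in> V \<Longrightarrow> sc a (sc b v) = sc (a * b) v"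
  using sc_simps(2)[of v a b] by simp

lemma qcomm_mult_left:
  assumes "qcomm a b c" "qcomm a' b c'"
  shows "qcomm (a * a') b (c * c')"
  unfolding qcomm_def
proof
  fix v assume v: "v \<in> V"
  have "act b (act (a * a') v) = sc c' (act a' (act b (act a v)))"
    by (simp only: act_mult[OF v] qcommD[OF assms(2) act_closed[OF v]])
  also have "\<dots> = sc c' (sc c (act a' (act a (act b v))))"
    by (simp only: qcommD[OF assms(1) v] act_sc[OF act_closed[OF act_closed[OF v]]])
  also have "\<dots> = sc (c * c') (act (a * a') (act b v))"
    by (simp only: sc_sc act_closed v act_mult mult.commute)
  finally show "act b (act (a * a') v) = sc (c * c') (act (a * a') (act b v))" .
qed

lemma qcomm_1: "qcomm 1 b 1" "qcomm a 1 1" "qcomm a a 1"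
  by (auto simp: qcomm_def act_one act_closed sc_simps(3))

lemma qcomm_power_left: "qcomm a b c \<Longrightarrow> qcomm (a ^ n) b (c ^ n)"
  by (induction n) (auto intro: qcomm_mult_left qcomm_1)

lemma qcomm_sym:
  assumes "qcomm a b c" "c \<noteq> 0"
  shows "qcomm b a (inverse c)"
  unfolding qcomm_def
proof
  fix v assume v: "v \<in> V"
  have "sc (inverse c) (act b (act a v)) = act a (act b v)"
    by (simp only: qcommD[OF assms(1) v] sc_simps(7)[OF act_closed[OF act_closed[OF v]] assms(2)])
  then show "act a (act b v) = sc (inverse c) (act b (act a v))" ..
qed

lemma K_cancel: "v \<in> V \<Longrightarrow> act gKi (act gK v) = v" "v \<in> V \<Longrightarrow> act gK (act gKi v) = v"
  using act_relations by blast+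

lemma qcomm_K_inverse:
  assumes "qcomm a gK c" "c \<noteq> 0"
  shows "qcomm a gKi (inverse c)"
  unfolding qcomm_def
proof
  fix v assume v: "v \<in> V"
  have 1: "act gKi v \<in> V" and av: "act a v \<in> V" and a1: "act a (act gKi v) \<in> V" using v act_closed by auto
  have "act gK (act a (act gKi v)) = sc c (act a v)"
    using qcommD[OF assms(1) 1] K_cancel(2)[OF v] by simp
  then have "act a (act gKi v) = act gKi (sc c (act a v))" using K_cancel(1)[OF a1] by simp
  then have "act a (act gKi v) = sc c (act gKi (act a v))" by (simp only: act_sc[OF av])
  then show "act gKi (act a v) = sc (inverse c) (act a (act gKi v))"
    by (simp only: sc_simps(7)[OF act_closed[OF av] assms(2)])
qed

lemma qcomm_generators:
  "qcomm gE gK (q powi (-2))" "qcomm gX gK (q powi (-1))" "qcomm gY gK q" "qcomm gE gX q" "qcomm gX gY q"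
  "qcomm gK gKi 1" "qcomm gE gKi (q powi 2)" "qcomm gX gKi q" "qcomm gY gKi (q powi (-1))"
  "qcomm gK gE (q powi 2)" "qcomm gK gX q" "qcomm gK gY (q powi (-1))" "qcomm gX gE (q powi (-1))"
  "qcomm gY gX (q powi (-1))" "qcomm gKi gK 1" "qcomm gKi gE (q powi (-2))" "qcomm gKi gX (q powi (-1))" "qcomm gKi gY q"
proof -
  have inv: "inverse (q powi (-2)) = q powi 2" "inverse (q powi (-1)) = q" "inverse (q powi 2) = q powi (-2)"
    "inverse q = q powi (-1)" by (simp_all only: powi_simps inverse_inverse_eq)
  show EK: "qcomm gE gK (q powi (-2))" and XK: "qcomm gX gK (q powi (-1))" and YK: "qcomm gY gK q"
    and EX: "qcomm gE gX q" and XY: "qcomm gX gY q"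
    unfolding qcomm_def using act_relations by blast+
  show K: "qcomm gK gKi 1" "qcomm gKi gK 1" by (auto simp: qcomm_def K_cancel sc_simps(3))
  have nz: "q powi (-2) \<noteq> 0" "q powi (-1) \<noteq> 0" "q powi 2 \<noteq> 0" using q_nonzero by simp_all
  show EKi: "qcomm gE gKi (q powi 2)" and XKi: "qcomm gX gKi q" and YKi: "qcomm gY gKi (q powi (-1))"
    using qcomm_K_inverse[OF EK nz(1)] qcomm_K_inverse[OF XK nz(2)] qcomm_K_inverse[OF YK q_nonzero]
    by (simp_all only: inv)
  show "qcomm gK gE (q powi 2)" "qcomm gK gX q" "qcomm gK gY (q powi (-1))" "qcomm gX gE (q powi (-1))"
    "qcomm gY gX (q powi (-1))" "qcomm gKi gE (q powi (-2))" "qcomm gKi gX (q powi (-1))" "qcomm gKi gY q"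
    using qcomm_sym[OF EK nz(1)] qcomm_sym[OF XK nz(2)] qcomm_sym[OF YK q_nonzero] qcomm_sym[OF EX q_nonzero]
      qcomm_sym[OF XY q_nonzero] qcomm_sym[OF EKi nz(3)] qcomm_sym[OF XKi q_nonzero] qcomm_sym[OF YKi nz(2)]
    by (simp_all only: inv)
qed

lemma act_power_Suc: "v \<in> V \<Longrightarrow> act (a ^ Suc n) v = act (a ^ n) (act a v)"
  "v \<in> V \<Longrightarrow> act (a ^ Suc n) v = act a (act (a ^ n) v)"
  by (simp add: act_mult) (simp only: power_Suc2 act_mult)

lemma EY_rel: "v \<in> V \<Longrightarrow> act gY (act gE v) = act gX v + sc (q powi (-1)) (act gE (act gY v))"
  using act_relations by blast

text \<open>The quotient is the quantum integer \<open>[n]\<close>, obtained by moving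
  \<open>Y\<close> past one factor \<open>E\<close> at a time. It vanishes when \<open>m\<close>
  divides \<open>n\<close>, so \<open>E^m\<close> commutes with \<open>Y\<close> up to a scalar and
  \<open>E^l\<close> commutes with it.\<close>

lemma E_power_Y:
  assumes "v \<in> V"
  shows "act gY (act (gE ^ n) v) =
    sc (q powi (- int n)) (act (gE ^ n) (act gY v)) +
    sc ((q powi int n - q powi (- int n)) / (q - q powi (-1))) (act (gE ^ (n - 1)) (act gX v))"
  using assms
proof (induction n arbitrary: v)
  case 0
  then show ?case by (simp add: act_one act_closed sc_simps)
next
  case (Suc n)
  define c where "c n = (q powi int n - q powi (- int n)) / (q - q powi (-1))" for n
  note V = Suc.prems act_closed[OF Suc.prems] act_closed[OF act_closed[OF Suc.prems]]
    act_closed[OF act_closed[OF act_closed[OF Suc.prems]]]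
  have step: "c n * q + q powi (- int n) = c (Suc n)"
  proof -
    have "q powi 2 \<noteq> 1" by (rule q_sq_neq_1)
    then have "q - q powi (-1) \<noteq> 0" using q_nonzero by (simp add: powi_simps field_simps power2_eq_square)
    moreover have "(q powi int n - q powi (- int n)) * q + q powi (- int n) * (q - q powi (-1)) =
        q powi int (Suc n) - q powi (- int (Suc n))"
      using q_nonzero by (simp add: powi_simps field_simps)
    ultimately show ?thesis by (simp add: c_def field_simps)
  qed
  have qq: "q powi (- int n) * q powi (-1) = q powi (- int (Suc n))"
    by (simp only: powi_simps(1)[symmetric]) (simp add: algebra_simps)
  \<comment> \<open>At \<open>n = 0\<close> the truncated exponent \<open>n - 1\<close> does no
    harm, as the coefficient \<open>c 0\<close> is zero.\<close>
  have Xpart: "sc (c n) (act (gE ^ (n - 1)) (act gX (act gE v))) = sc (c n * q) (act (gE ^ n) (act gX v))"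
  proof (cases n)
    case 0
    then show ?thesis using V by (simp add: c_def sc_simps(4))
  next
    case (Suc k)
    have "act gX (act gE v) = sc q (act gE (act gX v))" using act_relations(6)[OF V(1)] .
    then show ?thesis
      using V(1) by (simp only: Suc diff_Suc_1 act_sc_gen act_sc_pow act_power_Suc(1) sc_sc act_closed)
  qed
  have "act gY (act (gE ^ Suc n) v) = act gY (act (gE ^ n) (act gE v))"
    by (simp only: act_power_Suc(1)[OF V(1)])
  also have "\<dots> = sc (q powi (- int n)) (act (gE ^ n) (act gY (act gE v))) +
      sc (c n) (act (gE ^ (n - 1)) (act gX (act gE v)))"
    unfolding c_def by (rule Suc.IH[OF V(2)])
  also have "act gY (act gE v) = act gX v + sc (q powi (-1)) (act gE (act gY v))"
    by (rule EY_rel[OF V(1)])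
  also have "sc (q powi (- int n)) (act (gE ^ n) (act gX v + sc (q powi (-1)) (act gE (act gY v)))) =
      sc (q powi (- int n)) (act (gE ^ n) (act gX v)) + sc (q powi (- int (Suc n))) (act (gE ^ Suc n) (act gY v))"
    unfolding act_add_right[OF V(2) act_closed[OF V(3)]] act_sc_pow[OF V(3)]
      act_add_right[OF act_closed[OF V(2)] act_closed[OF act_closed[OF V(3)]]]
    unfolding sc_sc[OF act_closed[OF V(3)]] qq act_power_Suc(1)[OF V(2)] ..
  finally have "act gY (act (gE ^ Suc n) v) =
      sc (q powi (- int n)) (act (gE ^ n) (act gX v)) + sc (q powi (- int (Suc n))) (act (gE ^ Suc n) (act gY v)) +
      sc (c n * q) (act (gE ^ n) (act gX v))"
    unfolding Xpart .
  also have "\<dots> = sc (q powi (- int (Suc n))) (act (gE ^ Suc n) (act gY v)) + sc (c n * q + q powi (- int n)) (act (gE ^ n) (act gX v))"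
    unfolding sc_simps(1)[OF act_closed[OF V(2)]] by (simp only: add_ac)
  finally show ?case unfolding step unfolding c_def diff_Suc_1 .
qed

text \<open>The mirror image of the rule for \<open>E^n Y\<close>. Applied to a vector killed by
  \<open>E\<close>, it yields the coefficient of \<open>E\<close> in \<open>M_2\<close> and
  \<open>M_3\<close>.\<close>

lemma E_Y_power:
  assumes "v \<in> V"
  shows "act (gY ^ n) (act gE v) =
    sc (q powi (- int n)) (act gE (act (gY ^ n) v)) +
    sc ((q powi (- 2 * int n) - 1) / (q powi (-2) - 1)) (act (gY ^ (n - 1)) (act gX v))"
proof (induction n)
  case 0
  then show ?case using assms by (simp add: act_one act_closed sc_simps)
next
  case (Suc n)
  define d where "d n = (q powi (- 2 * int n) - 1) / (q powi (-2) - 1)" for n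
  let ?w = "act (gY ^ n) v"
  note V = assms act_closed[OF assms] act_closed[OF act_closed[OF assms]]
    act_closed[OF act_closed[OF act_closed[OF assms]]]
  have step: "q powi (- 2 * int n) + d n = d (Suc n)"
  proof -
    have nz: "q powi (-2) - 1 \<noteq> 0" using q_sq_neq_1 by simp
    have "q powi (- 2 * int n) * (q powi (-2) - 1) + (q powi (- 2 * int n) - 1) = q powi (- 2 * int (Suc n)) - 1"
    proof -
      have "q powi (- 2 * int (Suc n)) = q powi (- 2 * int n) * q powi (-2)"
        by (simp only: powi_simps(1)[symmetric]) (simp add: algebra_simps)
      then show ?thesis by (simp add: algebra_simps)
    qed
    then have "(q powi (- 2 * int n) * (q powi (-2) - 1) + (q powi (- 2 * int n) - 1)) / (q powi (-2) - 1) = d (Suc n)"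
      unfolding d_def by simp
    then show ?thesis unfolding d_def add_divide_distrib using nz by simp
  qed
  have Xw: "act gX ?w = sc (q powi (- int n)) (act (gY ^ n) (act gX v))"
    using qcommD[OF qcomm_power_left[OF qcomm_generators(14)] V(1), of n] by (simp add: power_int_minus power_int_def power_inverse)
  have Xpart: "act gY (sc (d n) (act (gY ^ (n - 1)) (act gX v))) = sc (d n) (act (gY ^ n) (act gX v))"
  proof (cases n)
    case 0
    then show ?thesis using V by (simp add: d_def sc_simps(4) act_zero_right)
  next
    case (Suc k)
    then show ?thesis using V(1) by (simp only: Suc diff_Suc_1 act_sc_gen act_power_Suc(2) act_closed)
  qed
  have qq: "q powi (- int n) * q powi (-1) = q powi (- int (Suc n))" "q powi (- int n) * q powi (- int n) = q powi (- 2 * int n)"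
    by (simp_all only: powi_simps(1)[symmetric]) (simp_all add: algebra_simps)
  have "act (gY ^ Suc n) (act gE v) = act gY (act (gY ^ n) (act gE v))"
    by (rule act_power_Suc(2)[OF V(2)])
  also have "\<dots> = act gY (sc (q powi (- int n)) (act gE ?w) + sc (d n) (act (gY ^ (n - 1)) (act gX v)))"
    unfolding Suc d_def ..
  also have "\<dots> = sc (q powi (- int n)) (act gY (act gE ?w)) + sc (d n) (act (gY ^ n) (act gX v))"
    unfolding act_add_right[OF act_closed[OF V(3)] act_closed[OF V(3)]] Xpart unfolding act_sc_gen[OF V(3)] ..
  also have "act gY (act gE ?w) = sc (q powi (- int n)) (act (gY ^ n) (act gX v)) + sc (q powi (-1)) (act gE (act gY ?w))"
    unfolding EY_rel[OF V(2)] Xw ..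
  also have "sc (q powi (- int n)) (sc (q powi (- int n)) (act (gY ^ n) (act gX v)) + sc (q powi (-1)) (act gE (act gY ?w))) =
      sc (q powi (- 2 * int n)) (act (gY ^ n) (act gX v)) + sc (q powi (- int (Suc n))) (act gE (act (gY ^ Suc n) v))"
    unfolding act_add_right[OF act_closed[OF V(3)] act_closed[OF V(4)]] sc_sc[OF V(3)] sc_sc[OF V(4)] qq
      act_power_Suc(2)[OF V(1)] ..
  finally have "act (gY ^ Suc n) (act gE v) = sc (q powi (- int (Suc n))) (act gE (act (gY ^ Suc n) v)) +
      sc (q powi (- 2 * int n) + d n) (act (gY ^ n) (act gX v))"
    unfolding sc_simps(1)[OF V(3)] by (simp only: add_ac)
  then show ?case unfolding step unfolding d_def diff_Suc_1 .
qed

text \<open>\<open>K\<close> and its inverse keep separate natural exponents, so that each of the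
  five powers can later be reduced by its own central \<open>l\<close>-th power. The resulting words
  are redundant, but they are only used to span.\<close>

definition pbw :: "'b \<Rightarrow> nat \<Rightarrow> nat \<Rightarrow> nat \<Rightarrow> nat \<Rightarrow> nat \<Rightarrow> 'b" where
  "pbw v a e x y d = act (gE ^ d) (act (gY ^ y) (act (gX ^ x) (act (gKi ^ e) (act (gK ^ a) v))))"

lemma comm_action_sc: "comm_action V sc"
  by unfold_locales (auto simp: V_zero V_add act_closed act_add_right sc_simps)

text \<open>A generator acting on an ordered word moves to its place at the cost of a power of
  \<open>q\<close>. Only \<open>Y\<close> passing the powers of \<open>E\<close> creates a second
  term, which is again an ordered word with one more \<open>X\<close>.\<close>

lemma pbw_span:
  assumes v: "v \<in> V"
  shows "act f v \<in> rspan sc {pbw v a e x y d |a e x y d. True}" (is "_ \<in> rspan sc ?S")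
proof -
  interpret sc: comm_action V sc by (rule comm_action_sc)
  have pV: "pbw v a e x y d \<in> V" for a e x y d unfolding pbw_def by (intro act_closed v)
  have SV: "?S \<subseteq> V" using pV by auto
  let ?H = "rspan sc ?S"
  have HV: "?H \<subseteq> V" by (rule sc.rspan_closed[OF SV])
  have base: "pbw v a e x y d \<in> ?H" for a e x y d by (rule sc.rspan_base[OF SV]) blast
  have scH: "sc c u \<in> ?H" if "u \<in> ?H" for c u by (rule sc.rspan_act[OF SV that])
  note W = v act_closed[OF v] act_closed[OF act_closed[OF v]] act_closed[OF act_closed[OF act_closed[OF v]]]
    act_closed[OF act_closed[OF act_closed[OF act_closed[OF v]]]]
    act_closed[OF act_closed[OF act_closed[OF act_closed[OF act_closed[OF v]]]]]
  note P = qcommD[OF qcomm_power_left]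
  have E: "act gE (pbw v a e x y d) = pbw v a e x y (Suc d)" for a e x y d
    unfolding pbw_def by (rule act_power_Suc(2)[symmetric, OF W(5)])
  have Xp: "act gX (pbw v a e x y d) \<in> ?H" for a e x y d
  proof -
    have "act gX (pbw v a e x y d) = sc (q ^ d) (sc ((q powi (-1)) ^ y) (pbw v a e (Suc x) y d))"
      by (simp only: pbw_def P[OF qcomm_generators(4)] P[OF qcomm_generators(14)] act_sc_pow
          act_power_Suc(2) act_closed v)
    then show ?thesis using scH base by simp
  qed
  have Xq: "act gX (act (gY ^ y) (act (gX ^ x) (act (gKi ^ e) (act (gK ^ a) v)))) =
      sc ((q powi (-1)) ^ y) (act (gY ^ y) (act (gX ^ Suc x) (act (gKi ^ e) (act (gK ^ a) v))))" for a e x y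
    by (simp only: P[OF qcomm_generators(14)] act_power_Suc(2) act_closed v)
  have Y: "act gY (pbw v a e x y d) \<in> ?H" for a e x y d
  proof -
    have "act gY (pbw v a e x y d) = sc (q powi (- int d)) (pbw v a e x (Suc y) d) +
      sc ((q powi int d - q powi (- int d)) / (q - q powi (-1))) (sc ((q powi (-1)) ^ y) (pbw v a e (Suc x) y (d - 1)))"
      unfolding pbw_def E_power_Y[OF W(5)] Xq by (simp only: act_sc_pow act_power_Suc(2) act_closed v)
    then show ?thesis using scH base sc.rspan_add by simp
  qed
  have K0: "act gK (act (gKi ^ e) (act (gK ^ a) v)) = act (gKi ^ e) (act (gK ^ Suc a) v)" for e a
    unfolding P[OF qcomm_generators(15) W(2)] act_power_Suc(2)[OF W(1)] by (simp add: sc_simps(3) W)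
  have K: "act gK (pbw v a e x y d) \<in> ?H" for a e x y d
  proof -
    have "act gK (pbw v a e x y d) = sc ((q powi (-2)) ^ d) (sc (q ^ y) (sc ((q powi (-1)) ^ x) (pbw v (Suc a) e x y d)))"
      by (simp only: pbw_def P[OF qcomm_generators(1)] P[OF qcomm_generators(3)] P[OF qcomm_generators(2)]
          act_sc_pow act_closed v K0)
    then show ?thesis using scH base by simp
  qed
  have Ki: "act gKi (pbw v a e x y d) \<in> ?H" for a e x y d
  proof -
    have "act gKi (pbw v a e x y d) = sc ((q powi 2) ^ d) (sc ((q powi (-1)) ^ y) (sc (q ^ x) (pbw v a (Suc e) x y d)))"
      by (simp only: pbw_def P[OF qcomm_generators(7)] P[OF qcomm_generators(9)] P[OF qcomm_generators(8)]
          act_sc_pow act_closed v act_power_Suc(2))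
    then show ?thesis using scH base by simp
  qed
  show ?thesis
  proof (rule act_closed_generators[OF HV rspan_zero])
    show "u + w \<in> ?H" if "u \<in> ?H" "w \<in> ?H" for u w by (rule sc.rspan_add[OF that])
    show "sc c u \<in> ?H" if "u \<in> ?H" for c u by (rule scH[OF that])
    have "pbw v 0 0 0 0 0 = v" by (simp add: pbw_def act_one v)
    then show "v \<in> ?H" using base[of 0 0 0 0 0] by simp
    fix g u assume "u \<in> ?H"
    then show "act (fgen g) u \<in> ?H"
    proof (induction rule: rspan.induct)
      case rspan_zero
      then show ?case by (simp add: act_zero_right rspan.rspan_zero)
    next
      case (rspan_step s u c)
      have sV: "s \<in> V" "u \<in> V" using rspan_step SV HV by blast+
      have "act (fgen g) s \<in> ?H" using rspan_step(1) E Xp Y K Ki base by (cases g) auto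
      then have "sc c (act (fgen g) s) + act (fgen g) u \<in> ?H" using scH sc.rspan_add rspan_step(3) by blast
      then show ?case by (simp only: act_add_right[OF act_closed[OF sV(1)] sV(2)] act_sc[OF sV(1)])
    qed
  qed
qed

end

section \<open>Schur's lemma and eigenvectors\<close>

context ageing_root
begin

definition central :: "'k ageing_free \<Rightarrow> bool" where
  "central z \<longleftrightarrow> (\<forall>g. qcomm z (fgen g) 1)"

lemma central_act:
  assumes z: "central z" and v: "v \<in> V"
  shows "act z (act f v) = act f (act z v)"
proof (rule ageing_hom_generators[OF ageing_rep_axioms ageing_rep_axioms, of "act z"])
  show "act z (act (fgen g) v) = act (fgen g) (act z v)" if "v \<in> V" for g v
    using qcommD[of z "fgen g" 1 v] z that by (simp add: central_def sc_simps(3) act_closed)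
  show "act z (act (fconst c) v) = act (fconst c) (act z v)" if "v \<in> V" for c v
    by (rule act_sc[OF that])
qed (simp_all add: act_closed act_add_right v)

lemma central_pow_act:
  assumes z: "central z" and v: "v \<in> V"
  shows "(act z ^^ k) (act f v) = act f ((act z ^^ k) v)" "(act z ^^ k) v \<in> V"
proof -
  show *: "(act z ^^ k) v \<in> V" for k by (induction k) (simp_all add: v act_closed)
  show "(act z ^^ k) (act f v) = act f ((act z ^^ k) v)"
    by (induction k) (simp_all add: central_act[OF z *])
qed

lemma centralI:
  assumes "qcomm z gE 1" "qcomm z gK 1" "qcomm z gKi 1" "qcomm z gX 1" "qcomm z gY 1"
  shows "central z"
  unfolding central_def
proof
  fix g show "qcomm z (fgen g) 1" using assms by (cases g) simp_all
qed

lemma q_powi_power_l: "(q powi j) ^ l = 1" "q ^ l = 1"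
proof -
  show "q ^ l = 1" using q_powi_eq_1_iff[of L] by (simp add: power_int_def)
  have "(q powi j) ^ l = q powi (j * L)" by (simp only: power_int_mult power_int_of_nat)
  then show "(q powi j) ^ l = 1" by (simp only: q_powi_eq_1_iff) simp
qed

lemma qcomm_power_l:
  assumes "qcomm a b c" "c = q powi j"
  shows "qcomm (a ^ l) b 1"
  using qcomm_power_left[OF assms(1), of l] assms(2) q_powi_power_l by simp

lemma central_powers:
  "central (gK ^ l)" "central (gKi ^ l)" "central (gX ^ l)" "central (gE ^ l)" "central (gY ^ l)"
proof -
  have q1: "q = q powi 1" "1 = q powi 0" by simp_all
  note C = qcomm_power_l[OF _ refl] qcomm_power_l[OF _ q1(1)] qcomm_power_l[OF _ q1(2)]
  have l1: "q powi (- int l) = 1" "q powi int l = 1" "q powi (- 2 * int l) = 1"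
    by (simp_all only: q_powi_eq_1_iff) simp_all
  have EY: "qcomm (gE ^ l) gY 1"
    unfolding qcomm_def using E_power_Y[of _ l] by (simp add: l1 sc_simps act_closed del: power_int_of_nat)
  have "act (gY ^ l) (act gE v) = act gE (act (gY ^ l) v)" if "v \<in> V" for v
    unfolding E_Y_power[OF that, of l] l1 using that by (simp add: sc_simps(3,4) act_closed)
  then have YE: "qcomm (gY ^ l) gE 1" by (simp add: qcomm_def sc_simps(3) act_closed)
  show "central (gK ^ l)" by (intro centralI C(3)[OF qcomm_1(3)] C(1)[OF qcomm_generators(10)] C(3)[OF qcomm_generators(6)]
      C(2)[OF qcomm_generators(11)] C(1)[OF qcomm_generators(12)])
  show "central (gKi ^ l)" by (intro centralI C(3)[OF qcomm_1(3)] C(1)[OF qcomm_generators(16)] C(3)[OF qcomm_generators(15)]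
      C(1)[OF qcomm_generators(17)] C(2)[OF qcomm_generators(18)])
  show "central (gX ^ l)" by (intro centralI C(3)[OF qcomm_1(3)] C(1)[OF qcomm_generators(13)] C(1)[OF qcomm_generators(2)]
      C(2)[OF qcomm_generators(8)] C(2)[OF qcomm_generators(5)])
  show "central (gE ^ l)" by (intro centralI C(3)[OF qcomm_1(3)] C(1)[OF qcomm_generators(1)] C(1)[OF qcomm_generators(7)]
      C(2)[OF qcomm_generators(4)] EY)
  show "central (gY ^ l)" by (intro centralI C(3)[OF qcomm_1(3)] YE C(2)[OF qcomm_generators(3)] C(1)[OF qcomm_generators(9)]
      C(1)[OF qcomm_generators(14)])
qed

lemma act_pow: "v \<in> V \<Longrightarrow> act (a ^ n) v = (act a ^^ n) v"
  by (induction n) (simp_all add: act_one act_power_Suc(2) del: power_Suc)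

lemma act_power_add: "v \<in> V \<Longrightarrow> act (a ^ (i + j)) v = act (a ^ j) (act (a ^ i) v)"
  by (simp add: power_add act_mult)

lemma power_reduce:
  assumes "central (g ^ l)" "u \<in> V"
  shows "act (g ^ n) u = (act (g ^ l) ^^ (n div l)) (act (g ^ (n mod l)) u)"
proof -
  have "n = n mod l + l * (n div l)" by simp
  then have "act (g ^ n) u = act (g ^ (l * (n div l))) (act (g ^ (n mod l)) u)"
    using act_power_add[OF assms(2), of g "n mod l" "l * (n div l)"] by simp
  also have "\<dots> = (act (g ^ l) ^^ (n div l)) (act (g ^ (n mod l)) u)"
    unfolding power_mult by (rule act_pow[OF act_closed[OF assms(2)]])
  finally show ?thesis .
qed

text \<open>Linear factors of \<open>p\<close> are applied one after the other; the last vector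
  before zero is an eigenvector. An invariant \<open>U\<close> is allowed so that eigenvectors can
  be sought inside the eigenspace of another operator.\<close>

lemma eigenvector_poly:
  fixes U
  assumes U: "U \<subseteq> V" "0 \<in> U" "\<And>v w. v \<in> U \<Longrightarrow> w \<in> U \<Longrightarrow> v + w \<in> U" "\<And>c v. v \<in> U \<Longrightarrow> sc c v \<in> U"
    "\<And>v. v \<in> U \<Longrightarrow> act f v \<in> U"
    and alg: "\<And>p :: 'k poly. degree p > 0 \<Longrightarrow> \<exists>x. poly p x = 0"
  shows "p \<noteq> 0 \<Longrightarrow> u \<in> U \<Longrightarrow> u \<noteq> 0 \<Longrightarrow> poly_act sc (act f) p u = 0 \<Longrightarrow>
    \<exists>x. \<exists>v\<in>U. v \<noteq> 0 \<and> act f v = sc x v"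
proof -
  have UV: "v \<in> V" if "v \<in> U" for v using U(1) that by blast
  interpret comm_action_endo U sc "act f"
    by unfold_locales (use U in \<open>auto simp: UV sc_simps(1-3) act_add_right intro: act_sc UV\<close>)
  show "p \<noteq> 0 \<Longrightarrow> u \<in> U \<Longrightarrow> u \<noteq> 0 \<Longrightarrow> poly_act sc (act f) p u = 0 \<Longrightarrow>
    \<exists>x. \<exists>v\<in>U. v \<noteq> 0 \<and> act f v = sc x v"
  proof (induction "degree p" arbitrary: p u rule: less_induct)
    case less
    show ?case
    proof (cases "degree p = 0")
      case True
      then obtain a where a: "p = [:a:]" by (metis degree_eq_zeroE)
      then show ?thesis using less.prems sc_eq_0[OF UV[OF less.prems(2)], of a] by (simp add: poly_act_const)
    next
      case False
      then obtain x where "poly p x = 0" using alg by blast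
      then obtain p' where p': "p = p' * [:- x, 1:]" by (metis dvdE mult.commute poly_eq_0_iff_dvd)
      define u' where "u' = poly_act sc (act f) [:- x, 1:] u"
      have u': "u' = act f u - sc x u"
        using UV[OF less.prems(2)] less.prems(2) UV[OF U(5)[OF less.prems(2)]] z_closed[OF less.prems(2)]
        by (simp add: u'_def poly_act_pCons poly_act_const sc_simps(3,5))
      have "poly_act sc (act f) p' u' = 0"
        using less.prems(2,4) unfolding p' u'_def by (simp only: poly_act_mult)
      moreover have "u' \<in> U" unfolding u'_def by (rule poly_act_closed[OF less.prems(2)])
      moreover have "p' \<noteq> 0" using less.prems(1) p' by auto
      moreover have "degree p' < degree p" unfolding p' using \<open>p' \<noteq> 0\<close> by (subst degree_mult_eq) auto
      \<comment> \<open>If \<open>u'\<close> is zero, then \<open>u\<close> itself is an eigenvector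
        for \<open>x\<close>; otherwise \<open>u'\<close> is killed by the shorter product
        \<open>p'\<close>.\<close>
      ultimately show ?thesis
        using less.hyps[of p' u'] less.prems(2,3) u' by (cases "u' = 0") auto
    qed
  qed
qed

lemma eigenvector:
  fixes U
  assumes U: "U \<subseteq> V" "0 \<in> U" "\<And>v w. v \<in> U \<Longrightarrow> w \<in> U \<Longrightarrow> v + w \<in> U" "\<And>c v. v \<in> U \<Longrightarrow> sc c v \<in> U"
    "\<And>v. v \<in> U \<Longrightarrow> act f v \<in> U"
    and alg: "\<And>p :: 'k poly. degree p > 0 \<Longrightarrow> \<exists>x. poly p x = 0"
    and n: "n > 0" "\<And>v. v \<in> U \<Longrightarrow> act (f ^ n) v = sc c v" and u: "u \<in> U" "u \<noteq> 0"
  shows "\<exists>x. \<exists>v\<in>U. v \<noteq> 0 \<and> act f v = sc x v"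
proof (rule eigenvector_poly[OF U alg _ u])
  have UV: "v \<in> V" if "v \<in> U" for v using U(1) that by blast
  interpret comm_action_endo U sc "act f"
    by unfold_locales (use U in \<open>auto simp: UV sc_simps(1-3) act_add_right intro: act_sc UV\<close>)
  \<comment> \<open>The annihilating polynomial is \<open>t^n - c\<close>.\<close>
  have "coeff (monom 1 n + [:- c:]) n = 1" using n(1) by (simp add: coeff_eq_0 coeff_pCons split: nat.split)
  then show "monom 1 n + [:- c:] \<noteq> 0" by (metis coeff_0 zero_neq_one)
  have "poly_act sc (act f) (monom 1 n) u = (\<Sum>i\<le>n. sc (coeff (monom 1 n) i) ((act f ^^ i) u))"
    by (rule poly_act_bound) (simp_all add: degree_monom_le u)
  also have "\<dots> = (\<Sum>i\<le>n. if i = n then (act f ^^ n) u else 0)"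
    by (intro sum.cong) (auto simp: sc_simps UV z_pow_closed u)
  also have "\<dots> = sc c u" using act_pow[OF UV[OF u(1)], of f n] n(2)[OF u(1)] by simp
  finally show "poly_act sc (act f) (monom 1 n + [:- c:]) u = 0"
    using u UV by (simp add: poly_act_add_left poly_act_const sc_simps)
qed

end

lemma root_exists:
  fixes c :: "'k::alg_closed_field"
  assumes "n > 0"
  shows "\<exists>x. x ^ n = c"
proof -
  have "degree (monom 1 n + [:- c:]) = n"
    using assms by (subst degree_add_eq_left) (auto simp: degree_monom_eq)
  then obtain x where "poly (monom 1 n + [:- c:]) x = 0"
    using assms alg_closed_imp_poly_has_root[of "monom 1 n + [:- c:]"] by auto
  then show ?thesis by (auto simp: poly_monom)
qed

locale ageing_simple_root = ageing_root q V act l + ageing_simple q V act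
  for q :: "'k::alg_closed_field" and V :: "'b::ab_group_add set" and act :: "'k ageing_free \<Rightarrow> 'b \<Rightarrow> 'b" and l
begin

lemma simple_range: "simple_operators V (range act)"
proof
  fix H assume "H \<subseteq> V" "0 \<in> H" "\<And>v w. v \<in> H \<Longrightarrow> w \<in> H \<Longrightarrow> v + w \<in> H"
    "\<And>A v. A \<in> range act \<Longrightarrow> v \<in> H \<Longrightarrow> A v \<in> H"
  then show "H = {0} \<or> H = V" by (intro simple) auto
qed (auto simp: V_zero V_add act_closed act_add_right nontrivial)

text \<open>A nonzero vector generates \<open>V\<close>, so ordered words applied to it span. Modulo
  the central \<open>l\<close>-th powers of the five generators only the finitely many words with
  all exponents below \<open>l\<close> are left, which is the finite generation that Zariski's lemma
  needs.\<close>

lemma schur: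
  assumes z: "central z"
  shows "\<exists>c. \<forall>v\<in>V. act z v = sc c v"
proof -
  interpret S: simple_operators V "range act" by (rule simple_range)
  interpret sc: comm_action V sc by (rule comm_action_sc)
  obtain v0 where v0: "v0 \<in> V" "v0 \<noteq> 0" using nontrivial V_zero by blast
  have endo: "S.endo (act z)" if "central z" for z
    using central_act[OF that] by (auto simp: S.endo_def act_closed act_add_right)
  have endo_sc: "S.endo (sc c)" for c
    by (auto simp: S.endo_def act_closed act_add_right act_sc)
  have pV: "pbw v0 a e x y d \<in> V" for a e x y d unfolding pbw_def by (intro act_closed v0)
  define S where "S A = (\<lambda>(a, e, x, y, d). pbw v0 a e x y d) ` A" for A
  have SV: "S A \<subseteq> V" for A using pV by (auto simp: S_def)
  let ?n = "UNIV :: nat set" and ?l = "{..<l}"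
  have memS: "pbw v0 a e x y d \<in> S A" if "(a, e, x, y, d) \<in> A" for a e x y d A
    using that unfolding S_def by (intro image_eqI[of _ _ "(a, e, x, y, d)"]) simp_all
  have lp: "l > 0" using L_pos by simp
  note cp = central_powers
  have red: "\<exists>s'\<in>S B. s = (act (g ^ l) ^^ k) s'" if "s' \<in> S B" "s = (act (g ^ l) ^^ k) s'" for s s' B g k
    using that by blast
  \<comment> \<open>One exponent at a time is reduced modulo \<open>l\<close>; the central power can
    be pulled out of the word to the front.\<close>
  have c1: "\<exists>k. \<exists>s'\<in>S (?l \<times> ?n \<times> ?n \<times> ?n \<times> ?n). s = (act (gK ^ l) ^^ k) s'" if sS: "s \<in> S UNIV" for s
  proof -
    obtain a e x y d where s: "s = pbw v0 a e x y d" using sS unfolding S_def by auto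
    have "s = (act (gK ^ l) ^^ (a div l)) (pbw v0 (a mod l) e x y d)"
      unfolding s pbw_def power_reduce[OF cp(1) v0(1), of a]
      by (simp only: central_pow_act[OF cp(1)] act_closed v0)
    then show ?thesis using memS[of "a mod l"] lp by (intro exI bexI) auto
  qed
  have c2: "\<exists>k. \<exists>s'\<in>S (?l \<times> ?l \<times> ?n \<times> ?n \<times> ?n). s = (act (gKi ^ l) ^^ k) s'" if sS: "s \<in> S (?l \<times> ?n \<times> ?n \<times> ?n \<times> ?n)" for s
  proof -
    obtain a e x y d where s: "s = pbw v0 a e x y d" "a < l"
      using sS unfolding S_def by auto
    have "s = (act (gKi ^ l) ^^ (e div l)) (pbw v0 a (e mod l) x y d)"
      unfolding s pbw_def power_reduce[OF cp(2) act_closed[OF v0(1)], of e]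
      by (simp only: central_pow_act[OF cp(2)] act_closed v0)
    then show ?thesis using memS[of a "e mod l"] lp s(2) by (intro exI bexI) auto
  qed
  have c3: "\<exists>k. \<exists>s'\<in>S (?l \<times> ?l \<times> ?l \<times> ?n \<times> ?n). s = (act (gX ^ l) ^^ k) s'" if sS: "s \<in> S (?l \<times> ?l \<times> ?n \<times> ?n \<times> ?n)" for s
  proof -
    obtain a e x y d where s: "s = pbw v0 a e x y d" "a < l" "e < l"
      using sS unfolding S_def by auto
    have "s = (act (gX ^ l) ^^ (x div l)) (pbw v0 a e (x mod l) y d)"
      unfolding s pbw_def power_reduce[OF cp(3) act_closed[OF act_closed[OF v0(1)]], of x]
      by (simp only: central_pow_act[OF cp(3)] act_closed v0)
    then show ?thesis using memS[of a e "x mod l"] lp s(2,3) by (intro exI bexI) auto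
  qed
  have c4: "\<exists>k. \<exists>s'\<in>S (?l \<times> ?l \<times> ?l \<times> ?l \<times> ?n). s = (act (gY ^ l) ^^ k) s'" if sS: "s \<in> S (?l \<times> ?l \<times> ?l \<times> ?n \<times> ?n)" for s
  proof -
    obtain a e x y d where s: "s = pbw v0 a e x y d" "a < l" "e < l" "x < l"
      using sS unfolding S_def by auto
    have "s = (act (gY ^ l) ^^ (y div l)) (pbw v0 a e x (y mod l) d)"
      unfolding s pbw_def power_reduce[OF cp(5) act_closed[OF act_closed[OF act_closed[OF v0(1)]]], of y]
      by (simp only: central_pow_act[OF cp(5)] act_closed v0)
    then show ?thesis using memS[of a e x "y mod l"] lp s(2-) by (intro exI bexI) auto
  qed
  have c5: "\<exists>k. \<exists>s'\<in>S (?l \<times> ?l \<times> ?l \<times> ?l \<times> ?l). s = (act (gE ^ l) ^^ k) s'" if sS: "s \<in> S (?l \<times> ?l \<times> ?l \<times> ?l \<times> ?n)" for s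
  proof -
    obtain a e x y d where s: "s = pbw v0 a e x y d" "a < l" "e < l" "x < l" "y < l"
      using sS unfolding S_def by auto
    have "s = (act (gE ^ l) ^^ (d div l)) (pbw v0 a e x y (d mod l))"
      unfolding s pbw_def power_reduce[OF cp(4) act_closed[OF act_closed[OF act_closed[OF act_closed[OF v0(1)]]]], of d] ..
    then show ?thesis using memS[of a e x y "d mod l"] lp s(2-) by (intro exI bexI) auto
  qed
  have fin: "finite (S (?l \<times> ?l \<times> ?l \<times> ?l \<times> ?l))" by (simp add: S_def)
  have span: "V \<subseteq> rspan sc (S UNIV)"
  proof -
    define H where "H = range (\<lambda>f. act f v0)"
    have "H = {0} \<or> H = V"
    proof (rule simple)
      show "H \<subseteq> V" using act_closed[OF v0(1)] by (auto simp: H_def)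
      show "0 \<in> H" unfolding H_def by (rule range_eqI[of _ _ 0]) (simp add: act_zero_left v0)
      fix v w assume "v \<in> H" "w \<in> H"
      then obtain f g where "v = act f v0" "w = act g v0" by (auto simp: H_def)
      then show "v + w \<in> H" unfolding H_def by (intro range_eqI[of _ _ "f + g"]) (simp add: act_add_left v0)
    next
      fix g v assume "v \<in> H"
      then obtain f where "v = act f v0" by (auto simp: H_def)
      then show "act g v \<in> H" unfolding H_def by (intro range_eqI[of _ _ "f * g"]) (simp add: act_mult v0)
    qed
    moreover have "v0 \<in> H" using act_one[OF v0(1)] by (metis H_def rangeI)
    ultimately have "V = H" using v0(2) by blast
    moreover have "{pbw v0 a e x y d |a e x y d. True} = S UNIV" unfolding S_def by (auto simp: image_def)
    ultimately show ?thesis using pbw_span[OF v0(1)] by (auto simp: H_def)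
  qed
  have central: "act z1 (U v) = U (act z1 v)" if "S.endo U" "v \<in> V" for U v z1
    using S.endoD(3)[OF that(1) _ that(2), of "act z1"] by simp
  have ea: "S.endo_action sc" using comm_action_sc endo_sc by (simp add: S.endo_action_def)
  show ?thesis
    by (rule S.schur_fg[OF ea _ endo[OF z] endo[OF cp(1)] endo[OF cp(2)] endo[OF cp(3)] endo[OF cp(5)] endo[OF cp(4)]
          _ SV SV SV SV SV SV span c1 c2 c3 c4 c5 fin]) (auto simp: central)
qed

end

section \<open>Classification of the simple modules on which \<open>X\<close> is injective\<close>

context ageing_root
begin

lemma qcomm_pow:
  assumes "qcomm a b (q powi j)"
  shows "qcomm (a ^ n) b (q powi (j * int n))"
  using qcomm_power_left[OF assms, of n] by (simp only: power_int_mult power_int_of_nat)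

lemma qcomm_gen_powi:
  "qcomm gK gKi (q powi 0)" "qcomm gKi gK (q powi 0)" "qcomm gX gKi (q powi 1)" "qcomm gX gY (q powi 1)"
  "qcomm gE gX (q powi 1)" "qcomm gY gK (q powi 1)" "qcomm gK gX (q powi 1)" "qcomm gKi gY (q powi 1)"
  "qcomm a a (q powi 0)"
  using qcomm_generators qcomm_1 by simp_all

definition ns :: nat where "ns = nat s"

lemma int_ns: "int ns = s"
  by (simp add: ns_def s_def)

lemma q_powi_1_facts:
  "q powi (- m) = q powi m" "q powi (m + - s) = 1" "q powi (2 * m) = 1" "q powi (- 2 * m) = 1" "q powi (- 2 * s) = 1"
  "q powi (s - m) = 1" "q powi (- m - s) = 1" "q powi (2 * s) = 1"
proof -
  have Lm: "L dvd 2 * m" "L dvd 2 * s" by (rule L_dvd_mult_2s)+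
  show "q powi (- m) = q powi m" by (rule q_powi_cong) (use Lm in \<open>simp add: dvd_diff_commute\<close>)
  have ms: "L dvd m - s" by (rule L_eq)
  show "q powi (m + - s) = 1" "q powi (2 * m) = 1" "q powi (- 2 * m) = 1" "q powi (- 2 * s) = 1" "q powi (2 * s) = 1"
    "q powi (s - m) = 1"
    using Lm ms dvd_diff_commute[of L s m] by (simp_all add: q_powi_eq_1_iff)
  have "- m - s = - L" by (simp add: L_eq(1))
  then show "q powi (- m - s) = 1" by (simp only: q_powi_eq_1_iff) simp
qed

text \<open>The quantum integer \<open>[m]\<close> vanishes because
  \<open>q powi (- m) = q powi m\<close>.\<close>

lemma qcomm_E_power_m: "qcomm (gE ^ ord_sq l) gY (q powi (- m))"
proof -
  have "act gY (act (gE ^ ord_sq l) v) = sc (q powi (- m)) (act (gE ^ ord_sq l) (act gY v))" if "v \<in> V" for v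
    unfolding E_power_Y[OF that] q_powi_1_facts(1) using that by (simp add: sc_simps(4) act_closed)
  then show ?thesis by (simp add: qcomm_def)
qed

lemma qcomm_Y_power_m: "qcomm (gY ^ ord_sq l) gE (q powi m)"
  unfolding qcomm_def
proof
  fix v assume v: "v \<in> V"
  have "act (gY ^ ord_sq l) (act gE v) = sc (q powi (- m)) (act gE (act (gY ^ ord_sq l) v))"
    unfolding E_Y_power[OF v] q_powi_1_facts(4) using v by (simp add: sc_simps(4) act_closed)
  then have "sc (q powi m) (act (gY ^ ord_sq l) (act gE v)) = sc (q powi m * q powi (- m)) (act gE (act (gY ^ ord_sq l) v))"
    by (simp only: sc_sc act_closed v)
  also have "q powi m * q powi (- m) = 1" using q_pow_m(4) q_powi_1_facts(1) by simp
  finally show "act gE (act (gY ^ ord_sq l) v) = sc (q powi m) (act (gY ^ ord_sq l) (act gE v))"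
    by (simp add: sc_simps(3) v act_closed)
qed

text \<open>\<open>E^m\<close> already commutes with \<open>K\<close>, but with \<open>X\<close> and
  \<open>Y\<close> only up to \<open>q powi m\<close>, which is \<open>-1\<close> for even
  \<open>l\<close>. The factor \<open>K^(-s)\<close> repairs exactly these two relations.\<close>

lemma central_E: "central (gE ^ ord_sq l * gKi ^ ns)"
proof -
  note g = qcomm_generators qcomm_gen_powi
  have c: "qcomm (gE ^ ord_sq l * gKi ^ ns) b 1"
    if "qcomm (gE ^ ord_sq l) b (q powi i)" "qcomm gKi b (q powi j)" "q powi (i + j * s) = 1" for b i j
    using qcomm_mult_left[OF that(1) qcomm_pow[OF that(2), of ns]] that(3) by (simp only: int_ns powi_simps(1)[symmetric])
  show ?thesis
  proof (rule centralI)
    show "qcomm (gE ^ ord_sq l * gKi ^ ns) gE 1"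
      by (rule c[OF qcomm_pow[OF g(27)] g(16)]) (use q_powi_1_facts in simp)
    show "qcomm (gE ^ ord_sq l * gKi ^ ns) gK 1"
      by (rule c[OF qcomm_pow[OF g(1)] g(20)]) (use q_powi_1_facts in simp)
    show "qcomm (gE ^ ord_sq l * gKi ^ ns) gKi 1"
      by (rule c[OF qcomm_pow[OF g(7)] g(27)]) (use q_powi_1_facts in simp)
    show "qcomm (gE ^ ord_sq l * gKi ^ ns) gX 1"
      by (rule c[OF qcomm_pow[OF g(23)] g(17)]) (use q_powi_1_facts in simp)
    show "qcomm (gE ^ ord_sq l * gKi ^ ns) gY 1"
      by (rule c[OF qcomm_E_power_m g(26)]) (use q_powi_1_facts in simp)
  qed
qed

text \<open>\<open>Y^m\<close> commutes with \<open>K\<close>, \<open>X\<close> and \<open>E\<close>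
  only up to \<open>q powi m\<close> or its equal inverse. \<open>K^(-s)\<close> repairs
  \<open>X\<close>, and \<open>X^s\<close> repairs \<open>K\<close> and \<open>E\<close>; against
  \<open>Y\<close> the two corrections cancel because \<open>l\<close> divides
  \<open>2 * s\<close>.\<close>

lemma central_Y: "central (gY ^ ord_sq l * gKi ^ ns * gX ^ ns)"
proof -
  note g = qcomm_generators qcomm_gen_powi
  have c: "qcomm (gY ^ ord_sq l * gKi ^ ns * gX ^ ns) b 1"
    if "qcomm (gY ^ ord_sq l) b (q powi i)" "qcomm gKi b (q powi j)" "qcomm gX b (q powi k)" "q powi (i + j * s + k * s) = 1" for b i j k
    using qcomm_mult_left[OF qcomm_mult_left[OF that(1) qcomm_pow[OF that(2), of ns]] qcomm_pow[OF that(3), of ns]] that(4)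
    by (simp only: int_ns powi_simps(1)[symmetric])
  have e: "s + s = 2 * s" by simp
  have "m + (-2) * s + (-1) * s = (m - s) - 2 * s" by simp
  then have e3: "q powi (m + (-2) * s + (-1) * s) = 1"
    using dvd_diff[OF L_eq(2) L_dvd_mult_2s(1)] by (simp only: q_powi_eq_1_iff)
  show ?thesis
  proof (rule centralI)
    show "qcomm (gY ^ ord_sq l * gKi ^ ns * gX ^ ns) gE 1"
      by (rule c[OF qcomm_Y_power_m g(16) g(13) e3])
    show "qcomm (gY ^ ord_sq l * gKi ^ ns * gX ^ ns) gK 1"
      by (rule c[OF qcomm_pow[OF g(24)] g(20) g(2)]) (use q_powi_1_facts in simp)
    show "qcomm (gY ^ ord_sq l * gKi ^ ns * gX ^ ns) gKi 1"
      by (rule c[OF qcomm_pow[OF g(9)] g(27) g(21)]) (use q_powi_1_facts in simp)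
    show "qcomm (gY ^ ord_sq l * gKi ^ ns * gX ^ ns) gX 1"
      by (rule c[OF qcomm_pow[OF g(14)] g(17) g(27)]) (use q_powi_1_facts in simp)
    show "qcomm (gY ^ ord_sq l * gKi ^ ns * gX ^ ns) gY 1"
      by (rule c[OF qcomm_pow[OF g(27)] g(26) g(22)]) (use q_powi_1_facts e in \<open>simp del: mult_2\<close>)
  qed
qed

section \<open>The normal element \<open>\<phi>\<close>\<close>

lemma act_phi: "v \<in> V \<Longrightarrow> act (phi_word q) v = act gY (act gE v) - sc q (act gE (act gY v))"
  by (simp add: act_diff_left act_mult act_closed act_sc_gen)

lemma qcomm_phi:
  assumes "qcomm (gE * gY) b c" "qcomm (gY * gE) b c"
  shows "qcomm (phi_word q) b c"
  unfolding qcomm_def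
proof
  fix v assume v: "v \<in> V"
  have p: "act (phi_word q) u = act (gE * gY) u - sc q (act (gY * gE) u)" if "u \<in> V" for u
    by (simp only: act_phi[OF that] act_mult[OF that])
  have "act b (act (phi_word q) v) = sc c (act (gE * gY) (act b v)) - sc q (sc c (act (gY * gE) (act b v)))"
    unfolding p[OF v] act_diff_right[OF act_closed[OF v] act_closed[OF act_closed[OF v]]] act_sc[OF act_closed[OF v]]
      qcommD[OF assms(1) v] qcommD[OF assms(2) v] ..
  also have "\<dots> = sc c (act (phi_word q) (act b v))"
    unfolding p[OF act_closed[OF v]] act_diff_right[OF act_closed[OF act_closed[OF v]] act_closed[OF act_closed[OF act_closed[OF v]]]]
    by (simp only: sc_sc act_closed v mult.commute)
  finally show "act b (act (phi_word q) v) = sc c (act (phi_word q) (act b v))" .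
qed

text \<open>The relation for \<open>E Y\<close> eliminates one of the two products from
  \<open>\<phi>\<close>. Playing the two forms against each other shows that \<open>\<phi>\<close>
  commutes with \<open>Y\<close> up to a scalar; the second form also recovers \<open>E Y\<close>
  from the eigenvalues of \<open>X\<close> and \<open>\<phi>\<close>.\<close>

lemma phi_forms:
  assumes v: "v \<in> V"
  shows "act (phi_word q) v = act gX v + sc (q powi (-1) - q) (act gE (act gY v))"
    "act (phi_word q) v = sc (q\<^sup>2) (act gX v) + sc (1 - q\<^sup>2) (act gY (act gE v))"
proof -
  note V = act_closed[OF v] act_closed[OF act_closed[OF v]]
  show 1: "act (phi_word q) v = act gX v + sc (q powi (-1) - q) (act gE (act gY v))"
    unfolding act_phi[OF v] EY_rel[OF v] sc_simps(6)[OF V(2)] by simp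
  have "sc q (act gY (act gE v)) = sc q (act gX v) + act gE (act gY v)"
    unfolding EY_rel[OF v] act_add_right[OF V(1) act_closed[OF V(2)]] sc_sc[OF V(2)]
    using q_nonzero by (simp add: powi_simps(10) sc_simps(3) V)
  then have EY: "act gE (act gY v) = sc q (act gY (act gE v)) - sc q (act gX v)" by simp
  have sq: "sc q (sc q u) = sc (q\<^sup>2) u" if "u \<in> V" for u by (simp only: sc_sc[OF that] power2_eq_square)
  show "act (phi_word q) v = sc (q\<^sup>2) (act gX v) + sc (1 - q\<^sup>2) (act gY (act gE v))"
    unfolding act_phi[OF v] EY act_diff_right[OF act_closed[OF V(2)] act_closed[OF V(1)]] sq[OF V(1)] sq[OF V(2)]
      sc_simps(6)[OF V(2)] sc_simps(3)[OF V(2)] by simp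
qed

lemma qcomm_E_phi: "qcomm gE (phi_word q) (q powi (-1))"
  unfolding qcomm_def
proof
  fix v assume v: "v \<in> V"
  note V = v act_closed[OF v] act_closed[OF act_closed[OF v]] act_closed[OF act_closed[OF act_closed[OF v]]]
  let ?a = "act gE (act gX v)" and ?b = "act gE (act gE (act gY v))"
  have "act (phi_word q) (act gE v) = sc q ?a + sc (q powi (-1) - q) (?a + sc (q powi (-1)) ?b)"
    unfolding phi_forms(1)[OF V(2)] EY_rel[OF v] act_relations(6)[OF v]
      act_add_right[OF V(2) act_closed[OF V(3)]] act_sc_gen[OF V(3)] ..
  also have "\<dots> = sc (q powi (-1)) (?a + sc (q powi (-1) - q) ?b)"
    unfolding act_add_right[OF V(3) act_closed[OF V(4)]] sc_sc[OF V(4)] sc_simps(6)[OF V(3)]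
    by (simp add: mult.commute)
  also have "\<dots> = sc (q powi (-1)) (act gE (act (phi_word q) v))"
    unfolding phi_forms(1)[OF v] act_add_right[OF V(2) act_closed[OF V(3)]] act_sc_gen[OF V(3)] ..
  finally show "act (phi_word q) (act gE v) = sc (q powi (-1)) (act gE (act (phi_word q) v))" .
qed

lemma qcomm_Y_phi: "qcomm gY (phi_word q) q"
  unfolding qcomm_def
proof
  fix v assume v: "v \<in> V"
  note V = v act_closed[OF v] act_closed[OF act_closed[OF v]] act_closed[OF act_closed[OF act_closed[OF v]]]
  let ?a = "act gY (act gX v)" and ?b = "act gY (act gE (act gY v))"
  have XY: "act gX (act gY v) = sc (q powi (-1)) ?a" using qcommD[OF qcomm_generators(14) v] .
  have c: "q\<^sup>2 * q powi (-1) = q" "q * (q powi (-1) - q) = 1 - q\<^sup>2"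
    using q_nonzero by (simp_all add: powi_simps(10) power2_eq_square field_simps)
  have "act (phi_word q) (act gY v) = sc q ?a + sc (1 - q\<^sup>2) ?b"
    unfolding phi_forms(2)[OF V(2)] XY sc_sc[OF V(3)] c ..
  also have "\<dots> = sc q (act gY (act gX v + sc (q powi (-1) - q) (act gE (act gY v))))"
    unfolding act_add_right[OF V(2) act_closed[OF V(3)]] act_sc_gen[OF V(3)]
      act_add_right[OF V(3) act_closed[OF V(4)]] sc_sc[OF V(4)] c ..
  also have "\<dots> = sc q (act gY (act (phi_word q) v))" unfolding phi_forms(1)[OF v] ..
  finally show "act (phi_word q) (act gY v) = sc q (act gY (act (phi_word q) v))" .
qed

lemma qcomm_phi_gens:
  "qcomm (phi_word q) gX 1" "qcomm (phi_word q) gK (q powi (-1))" "qcomm (phi_word q) gKi (q powi 1)"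
  "qcomm (phi_word q) gE (q powi 1)" "qcomm (phi_word q) gY (q powi (-1))"
  "qcomm gK (phi_word q) (q powi 1)" "qcomm gX (phi_word q) 1"
proof -
  note g = qcomm_generators
  have c: "q * q powi (-1) = 1" "q powi (-1) * q = 1" "q powi (-2) * q = q powi (-1)" "q * q powi (-2) = q powi (-1)"
    "q powi 2 * q powi (-1) = q powi 1" "q powi (-1) * q powi 2 = q powi 1"
    using q_nonzero by (simp_all add: powi_simps power2_eq_square)
  show X: "qcomm (phi_word q) gX 1"
    using qcomm_phi[OF qcomm_mult_left[OF g(4) g(14)] ] qcomm_mult_left[OF g(14) g(4)] by (simp only: c)
  show K: "qcomm (phi_word q) gK (q powi (-1))"
    using qcomm_phi[OF qcomm_mult_left[OF g(1) g(3)]] qcomm_mult_left[OF g(3) g(1)] by (simp only: c)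
  show "qcomm (phi_word q) gKi (q powi 1)"
    using qcomm_phi[OF qcomm_mult_left[OF g(7) g(9)]] qcomm_mult_left[OF g(9) g(7)] by (simp only: c)
  have i: "inverse (q powi (-1)) = q powi 1" "inverse q = q powi (-1)" "inverse (1 :: 'k) = 1"
    by (simp_all only: powi_simps inverse_inverse_eq inverse_1)
  have nz: "q powi (-1) \<noteq> 0" "(1 :: 'k) \<noteq> 0" using q_nonzero by simp_all
  show "qcomm (phi_word q) gE (q powi 1)" "qcomm (phi_word q) gY (q powi (-1))"
    "qcomm gK (phi_word q) (q powi 1)" "qcomm gX (phi_word q) 1"
    using qcomm_sym[OF qcomm_E_phi nz(1)] qcomm_sym[OF qcomm_Y_phi q_nonzero] qcomm_sym[OF K nz(1)] qcomm_sym[OF X nz(2)]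
    by (simp_all only: i)
qed

lemma central_phi: "central (phi_word q ^ l)"
proof -
  have 1: "qcomm (phi_word q) gX (q powi 0)" using qcomm_phi_gens(1) by simp
  note C = qcomm_power_l[OF _ refl]
  show ?thesis
    by (intro centralI C[OF qcomm_phi_gens(2)] C[OF qcomm_phi_gens(3)] C[OF qcomm_phi_gens(4)] C[OF qcomm_phi_gens(5)] C[OF 1])
qed

section \<open>Integer powers of \<open>K\<close> and bases built from eigenvectors\<close>

definition Kw :: "int \<Rightarrow> 'k ageing_free" where
  "Kw b = (if b \<ge> 0 then gK ^ nat b else gKi ^ nat (- b))"

lemma K_Kw:
  assumes v: "v \<in> V"
  shows "act gK (act (Kw b) v) = act (Kw (b + 1)) v" "act gKi (act (Kw b) v) = act (Kw (b - 1)) v"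
proof -
  note V = v act_closed[OF v]
  show "act gK (act (Kw b) v) = act (Kw (b + 1)) v"
  proof (cases "b \<ge> 0")
    case True
    then have "nat (b + 1) = Suc (nat b)" by simp
    moreover have "b + 1 \<ge> 0" using True by simp
    ultimately show ?thesis using True by (simp only: Kw_def act_power_Suc(2)[OF v] if_True)
  next
    case False
    then obtain n where n: "b = - int (Suc n)" by (metis int_cases not_le of_nat_0_le_iff)
    have "act gK (act (gKi ^ Suc n) v) = act (gKi ^ n) v"
      by (simp only: act_power_Suc(2)[OF v] K_cancel(2)[OF V(2)])
    then show ?thesis unfolding n Kw_def by (cases "n = 0") (auto simp: act_one v nat_add_distrib)
  qed
  show "act gKi (act (Kw b) v) = act (Kw (b - 1)) v"
  proof (cases "b > 0")
    case True
    then obtain n where n: "b = int (Suc n)" by (metis gr0_conv_Suc zero_less_imp_eq_int)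
    have "act gKi (act (gK ^ Suc n) v) = act (gK ^ n) v"
      by (simp only: act_power_Suc(2)[OF v] K_cancel(1)[OF V(2)])
    moreover have "b \<ge> 0" "b - 1 \<ge> 0" "nat b = Suc n" "nat (b - 1) = n" by (simp_all add: n)
    ultimately show ?thesis by (simp only: Kw_def if_True)
  next
    case False
    then have "nat (- (b - 1)) = Suc (nat (- b))" by simp
    moreover have "act (Kw b) v = act (gKi ^ nat (- b)) v" using False by (auto simp: Kw_def)
    moreover have "\<not> b - 1 \<ge> 0" using False by simp
    ultimately show ?thesis by (simp only: Kw_def[of "b - 1"] if_False act_power_Suc(2)[OF v])
  qed
qed

lemma Kw_add: "v \<in> V \<Longrightarrow> act (Kw b) (act (Kw c) v) = act (Kw (b + c)) v"
proof (induction b rule: int_induct[where k = 0])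
  case base
  then show ?case by (simp add: Kw_def act_one act_closed)
next
  case (step1 i)
  have "act (Kw (i + 1)) (act (Kw c) v) = act gK (act (Kw i) (act (Kw c) v))"
    by (simp only: K_Kw(1) act_closed step1.prems)
  also have "\<dots> = act (Kw (i + c + 1)) v" by (simp only: step1 K_Kw(1))
  finally show ?case by (simp add: algebra_simps)
next
  case (step2 i)
  have "act (Kw (i - 1)) (act (Kw c) v) = act gKi (act (Kw i) (act (Kw c) v))"
    by (simp only: K_Kw(2) act_closed step2.prems)
  also have "\<dots> = act (Kw (i + c - 1)) v" by (simp only: step2 K_Kw(2))
  finally show ?case by (simp add: algebra_simps)
qed

lemma qcomm_Kw:
  assumes "qcomm gK a (q powi j)"
  shows "qcomm (Kw b) a (q powi (j * b))"
proof (cases "b \<ge> 0")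
  case True
  then show ?thesis using qcomm_pow[OF assms, of "nat b"] by (simp add: Kw_def)
next
  case False
  have "qcomm a gKi (q powi j)"
    using qcomm_K_inverse[OF qcomm_sym[OF assms]] q_nonzero by simp
  then have "qcomm gKi a (q powi (- j))"
    using qcomm_sym[of a gKi "q powi j"] q_nonzero by (simp add: power_int_minus)
  then show ?thesis using False qcomm_pow[of gKi a "- j" "nat (- b)"] by (simp add: Kw_def)
qed

context
  fixes \<kappa> \<mu> :: 'k
  assumes \<mu>: "\<mu> \<noteq> 0" "\<mu> ^ l = \<kappa>" and \<kappa>: "\<forall>v\<in>V. act (gK ^ l) v = sc \<kappa> v"
begin

text \<open>Dividing \<open>K^b\<close> by \<open>\<mu>^b\<close> makes it periodic in
  \<open>b\<close> with period \<open>l\<close>, since \<open>\<mu>^l\<close> is the scalar of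
  \<open>K^l\<close>.\<close>

definition Kn :: "int \<Rightarrow> 'b \<Rightarrow> 'b" where
  "Kn b v = sc (\<mu> powi (- b)) (act (Kw b) v)"

lemma Kn_simps:
  assumes v: "v \<in> V"
  shows "Kn b v \<in> V" "Kn 0 v = v" "act gK (Kn b v) = sc \<mu> (Kn (b + 1) v)"
    "act gKi (Kn b v) = sc (inverse \<mu>) (Kn (b - 1) v)" "Kn b (Kn c v) = Kn (b + c) v"
    "Kn b (sc k v) = sc k (Kn b v)" "Kn (b + L) v = Kn b v"
proof -
  note V = act_closed[OF v] act_closed[OF act_closed[OF v]]
  show "Kn b v \<in> V" by (simp add: Kn_def V)
  show "Kn 0 v = v" by (simp add: Kn_def Kw_def act_one sc_simps v)
  have p: "\<mu> powi (- b) = \<mu> * \<mu> powi (- (b + 1))" "\<mu> powi (- b) = inverse \<mu> * \<mu> powi (- (b - 1))"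
    using \<mu>(1) by (simp_all add: power_int_minus power_int_add power_int_diff field_simps)
  show "act gK (Kn b v) = sc \<mu> (Kn (b + 1) v)"
    unfolding Kn_def act_sc_gen[OF V(1)] K_Kw[OF v] sc_sc[OF V(1)] p(1) ..
  show "act gKi (Kn b v) = sc (inverse \<mu>) (Kn (b - 1) v)"
    unfolding Kn_def act_sc_gen[OF V(1)] K_Kw[OF v] sc_sc[OF V(1)] p(2) ..
  have sK: "act (Kw b) (sc k u) = sc k (act (Kw b) u)" if "u \<in> V" for k b u by (rule act_sc[OF that])
  have pm: "\<mu> powi (- c) * \<mu> powi (- b) = \<mu> powi (- (b + c))" for b c
    using power_int_add[of \<mu> "- c" "- b"] \<mu>(1) by (simp add: algebra_simps)
  show KK: "Kn b (Kn c v) = Kn (b + c) v" for b c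
    unfolding Kn_def sK[OF V(1)] Kw_add[OF v] sc_sc[OF V(1)] by (simp only: pm add.commute)
  show "Kn b (sc k v) = sc k (Kn b v)"
    unfolding Kn_def sK[OF v] sc_sc[OF V(1)] by (simp only: mult.commute)
  have "Kn L v = v"
  proof -
    have "Kw L = gK ^ l" by (simp add: Kw_def)
    then have "Kn L v = sc (\<mu> powi (- L)) (sc \<kappa> v)" unfolding Kn_def using bspec[OF \<kappa> v] by simp
    also have "\<dots> = sc (\<mu> powi (- L) * \<kappa>) v" by (rule sc_sc[OF v])
    also have "\<mu> powi (- L) * \<kappa> = 1" using \<mu>(1) by (simp add: power_int_minus \<mu>(2)[symmetric])
    finally show ?thesis by (simp add: sc_simps v)
  qed
  then show "Kn (b + L) v = Kn b v" using KK[of b L] by simp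
qed

lemma Kw_eq_Kn:
  assumes v: "v \<in> V"
  shows "act (Kw b) v = sc (\<mu> powi b) (Kn b v)"
proof -
  have "\<mu> powi b * \<mu> powi (- b) = 1" using \<mu>(1) by (simp add: power_int_minus)
  then show ?thesis unfolding Kn_def sc_sc[OF act_closed[OF v]] by (simp add: sc_simps(3) act_closed v)
qed

lemma Kn_periodic:
  assumes v: "v \<in> V"
  shows "Kn (b mod L) v = Kn b v"
proof -
  have k: "Kn (c + L * int n) v = Kn c v" for c n
  proof (induction n)
    case (Suc n)
    have "c + L * int (Suc n) = (c + L * int n) + L" by (simp add: algebra_simps)
    then show ?case using Suc Kn_simps(7)[OF v] by metis
  qed simp
  show ?thesis
  proof (cases "b div L \<ge> 0")
    case True
    have "b = b mod L + L * int (nat (b div L))" using True by simp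
    then show ?thesis using k by metis
  next
    case False
    have "b mod L = b + L * int (nat (- (b div L)))"
      using False by (simp add: minus_div_mult_eq_mod[symmetric] mult.commute)
    then show ?thesis using k by metis
  qed
qed

lemma act_Kn: "qcomm gK a (q powi j) \<Longrightarrow> v \<in> V \<Longrightarrow> act a (Kn b v) = sc (q powi (j * b)) (Kn b (act a v))"
proof -
  assume a: "qcomm gK a (q powi j)" and v: "v \<in> V"
  have "act a (Kn b v) = sc (\<mu> powi (- b)) (act a (act (Kw b) v))"
    unfolding Kn_def by (rule act_sc[OF act_closed[OF v]])
  also have "\<dots> = sc (q powi (j * b)) (Kn b (act a v))"
    unfolding qcommD[OF qcomm_Kw[OF a] v] Kn_def by (simp only: sc_sc act_closed v mult.commute)
  finally show ?thesis .
qed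

text \<open>The basis consists of the vectors \<open>v E^a K^b\<close>, divided by powers of
  \<open>\<mu>3\<close> and \<open>\<mu>\<close>. The condition on \<open>E^m\<close> is the
  wraparound of the first index with its shift by \<open>s\<close>. The values of \<open>X\<close>
  and \<open>\<phi>\<close> follow by commutation, and \<open>Y\<close> is forced by them.\<close>

lemma M1_family:
  assumes v: "v \<in> V" and X: "act gX v = sc \<mu>1 v" and phi: "act (phi_word q) v = sc \<mu>2 v"
    and \<mu>3: "\<mu>3 \<noteq> 0" and E: "act (gE ^ ord_sq l) v = sc (\<mu>3 ^ ord_sq l) (Kn s v)"
  obtains w where "monomial UNIV w (M1_coef q \<mu>1 \<mu>2 \<mu>3 \<mu>) M1_ind" "w (0, 0) = v" "\<And>i. w i = w (M1_norm i)"
proof -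
  define e where "e A = sc (inverse \<mu>3 ^ A) (act (gE ^ A) v)" for A
  have eV: "e A \<in> V" for A by (simp add: e_def act_closed v)
  have e0: "e 0 = v" by (simp add: e_def act_one sc_simps v)
  have eE: "act gE (e A) = sc \<mu>3 (e (Suc A))" for A
    unfolding e_def act_sc_gen[OF act_closed[OF v]] act_power_Suc(2)[OF v] sc_sc[OF act_closed[OF act_closed[OF v]]]
    using \<mu>3 by (simp add: mult.assoc[symmetric])
  have em: "e (ord_sq l) = Kn s v"
    unfolding e_def E sc_sc[OF Kn_simps(1)[OF v]] using \<mu>3 by (simp add: sc_simps(3) Kn_simps(1) v flip: power_mult_distrib)
  have comm_e: "act a (e A) = sc (c ^ A * k) (e A)" if "qcomm gE a c" "act a v = sc k v" for a c k A
  proof -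
    have "act a (e A) = sc (inverse \<mu>3 ^ A) (act a (act (gE ^ A) v))"
      unfolding e_def by (rule act_sc[OF act_closed[OF v]])
    also have "act a (act (gE ^ A) v) = sc (c ^ A) (act (gE ^ A) (sc k v))"
      unfolding qcommD[OF qcomm_power_left[OF that(1)] v] that(2) ..
    also have "\<dots> = sc (c ^ A * k) (act (gE ^ A) v)"
      unfolding act_sc_pow[OF v] by (rule sc_sc[OF act_closed[OF v]])
    finally show ?thesis unfolding e_def by (simp only: sc_sc act_closed v mult.commute)
  qed
  \<comment> \<open>The shift by \<open>s\<close> for every round is dictated by
    \<open>em\<close>.\<close>
  define w where "w = (\<lambda>(a, b). Kn (b + s * (a div m)) (e (nat (a mod m))))"
  have wV: "w i \<in> V" for i by (cases i) (simp add: w_def Kn_simps(1) eV)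
  have ad: "a = m * (a div m) + int (nat (a mod m))" for a using m_pos by simp
  have Lk: "L dvd s * k - m * k" for k using L_eq(2) by (metis dvd_diff_commute dvd_mult2 left_diff_distrib)
  have Lk': "L dvd s * k + m * k" for k using L_eq(1) by (metis distrib_right dvd_triv_left add.commute)
  have X_w: "act gX (w (a, b)) = sc (\<mu>1 * q powi (a + b)) (w (a, b))" for a b
  proof -
    let ?A = "nat (a mod m)" and ?t = "b + s * (a div m)"
    have "act gX (w (a, b)) = sc (q powi (1 * ?t)) (Kn ?t (sc (q ^ ?A * \<mu>1) (e ?A)))"
      unfolding w_def prod.case act_Kn[OF qcomm_gen_powi(7) eV] comm_e[OF qcomm_generators(4) X] ..
    also have "\<dots> = sc (q powi (1 * ?t) * (q ^ ?A * \<mu>1)) (w (a, b))"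
      unfolding Kn_simps(6)[OF eV] sc_sc[OF Kn_simps(1)[OF eV]] w_def prod.case ..
    also have "q powi (1 * ?t) * (q ^ ?A * \<mu>1) = \<mu>1 * q powi (?t + int ?A)"
      by (simp only: powi_simps(1) power_int_of_nat mult_1 mult_ac)
    also have "q powi (?t + int ?A) = q powi (a + b)"
    proof (rule q_powi_cong)
      have "?t + int ?A - (a + b) = s * (a div m) - m * (a div m)" using ad[of a] by linarith
      then show "L dvd ?t + int ?A - (a + b)" using Lk by simp
    qed
    finally show ?thesis .
  qed
  have phi_w: "act (phi_word q) (w (a, b)) = sc (\<mu>2 * q powi (b - a)) (w (a, b))" for a b
  proof -
    let ?A = "nat (a mod m)" and ?t = "b + s * (a div m)"
    have "act (phi_word q) (w (a, b)) = sc (q powi (1 * ?t)) (Kn ?t (sc ((q powi (-1)) ^ ?A * \<mu>2) (e ?A)))"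
      unfolding w_def prod.case act_Kn[OF qcomm_phi_gens(6) eV] comm_e[OF qcomm_E_phi phi] ..
    also have "\<dots> = sc (q powi (1 * ?t) * ((q powi (-1)) ^ ?A * \<mu>2)) (w (a, b))"
      unfolding Kn_simps(6)[OF eV] sc_sc[OF Kn_simps(1)[OF eV]] w_def prod.case ..
    also have "(q powi (-1)) ^ ?A = q powi (- int ?A)"
      using power_int_mult[of q "-1" "int ?A"] by (simp only: power_int_of_nat mult_minus1)
    also have "q powi (1 * ?t) * (q powi (- int ?A) * \<mu>2) = \<mu>2 * q powi (?t - int ?A)"
      by (simp add: powi_simps field_simps)
    also have "q powi (?t - int ?A) = q powi (b - a)"
    proof (rule q_powi_cong)
      have "?t - int ?A - (b - a) = s * (a div m) + m * (a div m)" using ad[of a] by linarith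
      then show "L dvd ?t - int ?A - (b - a)" using Lk' by simp
    qed
    finally show ?thesis .
  qed
  have E_w: "act gE (w (a, b)) = sc (\<mu>3 * q powi (2 * b)) (w (a + 1, b))" for a b
  proof -
    let ?A = "nat (a mod m)" and ?t = "b + s * (a div m)"
    have "act gE (w (a, b)) = sc (q powi (2 * ?t)) (Kn ?t (sc \<mu>3 (e (Suc ?A))))"
      unfolding w_def prod.case act_Kn[OF qcomm_generators(10) eV] eE ..
    also have "\<dots> = sc (q powi (2 * ?t) * \<mu>3) (Kn ?t (e (Suc ?A)))"
      unfolding Kn_simps(6)[OF eV] by (rule sc_sc[OF Kn_simps(1)[OF eV]])
    also have "q powi (2 * ?t) = q powi (2 * b)"
    proof (rule q_powi_cong)
      have "2 * ?t - 2 * b = (2 * s) * (a div m)" by (simp add: algebra_simps)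
      then show "L dvd 2 * ?t - 2 * b" using L_dvd_mult_2s by (simp only: dvd_mult2)
    qed
    also have "Kn ?t (e (Suc ?A)) = w (a + 1, b)"
    proof (cases "a mod m = m - 1")
      case True
      then have d: "(a + 1) mod m = 0" "(a + 1) div m = a div m + 1" using div_mod_shift(1)[of a] by auto
      have "Suc ?A = ord_sq l" using True m_pos by simp
      then have "Kn ?t (e (Suc ?A)) = Kn (?t + s) v" by (simp only: em Kn_simps(5)[OF v])
      also have "\<dots> = w (a + 1, b)" unfolding w_def prod.case d by (simp add: e0 algebra_simps)
      finally show ?thesis .
    next
      case False
      then have d: "(a + 1) mod m = a mod m + 1" "(a + 1) div m = a div m" using div_mod_shift(2)[of a] by auto
      have "nat (a mod m + 1) = Suc ?A" using m_pos by (simp add: nat_add_distrib)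
      then show ?thesis unfolding w_def prod.case d by simp
    qed
    finally show ?thesis by (simp only: mult.commute)
  qed
  \<comment> \<open>Since \<open>\<mu>3\<close> is nonzero, \<open>w (a, b)\<close> is a multiple of
    the image of \<open>w (a - 1, b)\<close> under \<open>E\<close>, and the second form of
    \<open>\<phi>\<close> evaluates \<open>E Y\<close> on that vector. This is the origin of the
    fraction in the table of \<open>M_1\<close>.\<close>
  have Y_w: "act gY (w (a, b)) = sc (M1_coef q \<mu>1 \<mu>2 \<mu>3 \<mu> GY (a, b)) (w (a - 1, b))" for a b
  proof -
    let ?u = "w (a - 1, b)"
    have nz: "\<mu>3 * q powi (2 * b) \<noteq> 0" using \<mu>3 q_powi_nonzero by simp
    have wE: "w (a, b) = sc (inverse (\<mu>3 * q powi (2 * b))) (act gE ?u)"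
      using E_w[of "a - 1" b] sc_simps(7)[OF wV nz] by simp
    have "sc (1 - q\<^sup>2) (act gY (act gE ?u)) = sc (\<mu>2 * q powi (b - (a - 1))) ?u - sc (q\<^sup>2) (sc (\<mu>1 * q powi (a - 1 + b)) ?u)"
      using phi_forms(2)[OF wV, of "(a - 1, b)"] phi_w[of "a - 1" b] X_w[of "a - 1" b] by (simp add: algebra_simps)
    also have "\<dots> = sc (\<mu>2 * q powi (b - (a - 1)) - q\<^sup>2 * (\<mu>1 * q powi (a - 1 + b))) ?u"
      unfolding sc_sc[OF wV] by (rule sc_simps(6)[OF wV, symmetric])
    finally have "sc (inverse (1 - q\<^sup>2)) (sc (1 - q\<^sup>2) (act gY (act gE ?u))) =
        sc (inverse (1 - q\<^sup>2)) (sc (\<mu>2 * q powi (b - (a - 1)) - q\<^sup>2 * (\<mu>1 * q powi (a - 1 + b))) ?u)" by simp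
    then have EYu: "act gY (act gE ?u) = sc (inverse (1 - q\<^sup>2) * (\<mu>2 * q powi (b - (a - 1)) - q\<^sup>2 * (\<mu>1 * q powi (a - 1 + b)))) ?u"
      unfolding sc_simps(7)[OF act_closed[OF act_closed[OF wV]] q_sq_neq_1(4)] sc_sc[OF wV] .
    have "act gY (w (a, b)) = sc (inverse (\<mu>3 * q powi (2 * b))) (act gY (act gE ?u))"
      by (subst wE) (rule act_sc_gen[OF act_closed[OF wV]])
    also have "\<dots> = sc (inverse (\<mu>3 * q powi (2 * b)) * (inverse (1 - q\<^sup>2) * (\<mu>2 * q powi (b - (a - 1)) - q\<^sup>2 * (\<mu>1 * q powi (a - 1 + b))))) ?u"
      unfolding EYu by (rule sc_sc[OF wV])
    also have "inverse (\<mu>3 * q powi (2 * b)) * (inverse (1 - q\<^sup>2) * (\<mu>2 * q powi (b - (a - 1)) - q\<^sup>2 * (\<mu>1 * q powi (a - 1 + b)))) =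
        M1_coef q \<mu>1 \<mu>2 \<mu>3 \<mu> GY (a, b)"
      using \<mu>3 q_powi_nonzero[of a] q_powi_nonzero[of b] q_nonzero q_sq_neq_1(4)
      by (simp add: powi_simps divide_simps power2_eq_square) (simp add: algebra_simps)?
    finally show ?thesis .
  qed
  have K_w: "act gK (w (a, b)) = sc \<mu> (w (a, b + 1))" "act gKi (w (a, b)) = sc (inverse \<mu>) (w (a, b - 1))" for a b
    unfolding w_def prod.case Kn_simps(3,4)[OF eV] by (simp_all add: algebra_simps)
  show ?thesis
  proof (rule that[of w])
    have "act (fgen g) (w (a, b)) = sc (M1_coef q \<mu>1 \<mu>2 \<mu>3 \<mu> g (a, b)) (w (M1_ind g (a, b)))" for g a b
      using X_w E_w Y_w K_w by (cases g) (simp_all only: M1_coef.simps M1_ind.simps)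
    then show "monomial UNIV w (M1_coef q \<mu>1 \<mu>2 \<mu>3 \<mu>) M1_ind"
      unfolding monomial_def using wV by auto
    show "w (0, 0) = v" by (simp add: w_def e0 Kn_simps v)
    show "w i = w (M1_norm i)" for i
    proof (cases i)
      case (Pair a b)
      have "(a mod m) div m = 0" "a mod m mod m = a mod m" using m_pos by (simp_all add: div_pos_pos_trivial)
      then show ?thesis unfolding Pair w_def M1_norm_def prod.case by (simp add: Kn_periodic eV)
    qed
  qed
qed

text \<open>The roles of \<open>E\<close> and \<open>Y\<close> are exchanged: the basis consists of
  normalised \<open>v Y^a K^b\<close>, and \<open>E v = 0\<close> fixes the action of
  \<open>E\<close>. The factor \<open>\<theta>\<close> records whether \<open>Y^m\<close> kills
  \<open>v\<close>.\<close>

lemma nil_family: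
  assumes v: "v \<in> V" and X: "act gX v = sc \<mu>1 v" and E: "act gE v = 0"
    and \<mu>2: "\<mu>2 \<noteq> 0" and Y: "act (gY ^ ord_sq l) v = sc (\<theta> * \<mu>2 ^ ord_sq l) (Kn s v)"
  obtains w where "monomial ({0..<m} \<times> UNIV) w (nil_coef q m \<theta> \<mu>1 \<mu>2 \<mu>) (nil_ind m s)" "w (0, 0) = v"
    "\<And>i. w i = w (nil_norm i)"
proof -
  define e where "e A = sc (inverse \<mu>2 ^ A) (act (gY ^ A) v)" for A
  have eV: "e A \<in> V" for A by (simp add: e_def act_closed v)
  have e0: "e 0 = v" by (simp add: e_def act_one sc_simps v)
  have eY: "act gY (e A) = sc \<mu>2 (e (Suc A))" for A
    unfolding e_def act_sc_gen[OF act_closed[OF v]] act_power_Suc(2)[OF v] sc_sc[OF act_closed[OF act_closed[OF v]]]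
    using \<mu>2 by (simp add: mult.assoc[symmetric])
  have em: "e (ord_sq l) = sc \<theta> (Kn s v)"
    unfolding e_def Y sc_sc[OF Kn_simps(1)[OF v]] using \<mu>2 by (simp add: power_inverse field_simps)
  have eX: "act gX (e A) = sc ((q powi (-1)) ^ A * \<mu>1) (e A)" for A
  proof -
    have "act gX (act (gY ^ A) v) = sc ((q powi (-1)) ^ A * \<mu>1) (act (gY ^ A) v)"
      unfolding qcommD[OF qcomm_power_left[OF qcomm_generators(14)] v] X act_sc_pow[OF v] by (rule sc_sc[OF act_closed[OF v]])
    then show ?thesis unfolding e_def act_sc_gen[OF act_closed[OF v]] by (simp only: sc_sc act_closed v mult.commute)
  qed
  have pq: "(q powi (-1)) ^ A = q powi (- int A)" for A
    using power_int_mult[of q "-1" "int A"] by (simp only: power_int_of_nat mult_minus1)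
  \<comment> \<open>The rule for \<open>E Y^A\<close> is applied to \<open>v\<close>, where its left
    side vanishes. At \<open>A = 0\<close> the index \<open>A - 1\<close> is harmless because the
    coefficient is zero.\<close>
  have eE: "act gE (e A) = sc (- inverse \<mu>2 * \<mu>1 * q powi int A * ((q powi (- 2 * int A) - 1) / (q powi (- 2) - 1))) (e (A - 1))" for A
  proof -
    let ?d = "(q powi (- 2 * int A) - 1) / (q powi (- 2) - 1)"
    have "0 = sc (q powi (- int A)) (act gE (act (gY ^ A) v)) + sc ?d (act (gY ^ (A - 1)) (sc \<mu>1 v))"
      using E_Y_power[OF v, of A] unfolding E X by (simp only: act_zero_right)
    then have "sc (q powi (- int A)) (act gE (act (gY ^ A) v)) = - sc (?d * \<mu>1) (act (gY ^ (A - 1)) v)"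
      unfolding act_sc_pow[OF v] sc_sc[OF act_closed[OF v]] by (simp add: eq_neg_iff_add_eq_0)
    then have "sc (q powi int A) (sc (q powi (- int A)) (act gE (act (gY ^ A) v))) = sc (q powi int A) (sc (- (?d * \<mu>1)) (act (gY ^ (A - 1)) v))"
      by (simp only: sc_simps(5)[OF act_closed[OF v]])
    moreover have "q powi int A * q powi (- int A) = 1"
      unfolding power_int_minus by (rule right_inverse[OF q_powi_nonzero])
    ultimately have 1: "act gE (act (gY ^ A) v) = sc (q powi int A * - (?d * \<mu>1)) (act (gY ^ (A - 1)) v)"
      by (simp only: sc_sc act_closed v sc_simps(3))
    show ?thesis
    proof (cases A)
      case 0
      then show ?thesis by (simp add: e0 E sc_simps(4) v)
    next
      case (Suc k)
      have "inverse \<mu>2 ^ A * (q powi int A * - (?d * \<mu>1)) = - inverse \<mu>2 * \<mu>1 * q powi int A * ?d * inverse \<mu>2 ^ (A - 1)"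
        by (simp add: Suc)
      then show ?thesis unfolding e_def act_sc_gen[OF act_closed[OF v]] 1 by (simp only: sc_sc act_closed v)
    qed
  qed
  define w where "w = (\<lambda>(a, b). Kn b (e (nat a)))"
  have wV: "w i \<in> V" for i by (cases i) (simp add: w_def Kn_simps(1) eV)
  have K_w: "act gK (w (a, b)) = sc \<mu> (w (a, b + 1))" "act gKi (w (a, b)) = sc (inverse \<mu>) (w (a, b - 1))" for a b
    unfolding w_def prod.case Kn_simps(3,4)[OF eV] by simp_all
  have c: "sc x (Kn b (sc y (e A))) = sc (x * y) (Kn b (e A))" for x y b A
    unfolding Kn_simps(6)[OF eV] by (rule sc_sc[OF Kn_simps(1)[OF eV]])
  have main: "act (fgen g) (w (a, b)) = sc (nil_coef q m \<theta> \<mu>1 \<mu>2 \<mu> g (a, b)) (w (nil_ind m s g (a, b)))"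
    if a: "0 \<le> a" "a < m" for g a b
  proof (cases g)
    case GX
    have "act gX (w (a, b)) = sc (q powi (1 * b) * (q powi (- int (nat a)) * \<mu>1)) (w (a, b))"
      unfolding w_def prod.case act_Kn[OF qcomm_gen_powi(7) eV] eX pq c ..
    also have "q powi (1 * b) * (q powi (- int (nat a)) * \<mu>1) = \<mu>1 * q powi (b - a)"
      using a by (simp add: powi_simps field_simps)
    finally show ?thesis using GX by simp
  next
    case GE
    have "act gE (w (a, b)) = sc (q powi (2 * b) * (- inverse \<mu>2 * \<mu>1 * q powi int (nat a) * ((q powi (- 2 * int (nat a)) - 1) / (q powi (- 2) - 1))))
        (Kn b (e (nat a - 1)))"
      unfolding w_def prod.case act_Kn[OF qcomm_generators(10) eV] eE c ..
    also have "q powi (2 * b) * (- inverse \<mu>2 * \<mu>1 * q powi int (nat a) * ((q powi (- 2 * int (nat a)) - 1) / (q powi (- 2) - 1))) =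
        nil_coef q m \<theta> \<mu>1 \<mu>2 \<mu> GE (a, b)"
      using a by (simp add: powi_simps(1) mult_ac)
    also have "Kn b (e (nat a - 1)) = w (nil_ind m s GE (a, b))"
      using a by (simp add: w_def nat_diff_distrib)
    finally show ?thesis using GE by simp
  next
    case GY
    have 1: "act gY (w (a, b)) = sc (q powi (- b) * \<mu>2) (Kn b (e (Suc (nat a))))"
      unfolding w_def prod.case act_Kn[OF qcomm_generators(12) eV] eY c by (simp only: mult_minus1)
    show ?thesis
    proof (cases "a = m - 1")
      case True
      then have "Suc (nat a) = ord_sq l" using m_pos by simp
      then have "Kn b (e (Suc (nat a))) = sc \<theta> (w (0, s + b))"
        by (simp only: em Kn_simps(6)[OF Kn_simps(1)[OF v]] Kn_simps(5)[OF v] w_def prod.case) (simp add: e0 add.commute)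
      then have "act gY (w (a, b)) = sc (q powi (- b) * \<mu>2 * \<theta>) (w (0, s + b))"
        using 1 by (simp only: sc_sc[OF wV])
      then show ?thesis using GY True by (simp add: mult_ac)
    next
      case False
      moreover have "Suc (nat a) = nat (a + 1)" using a by simp
      ultimately show ?thesis using GY 1 by (simp add: w_def mult.commute)
    qed
  next
    case GK
    then show ?thesis using K_w by simp
  next
    case GKinv
    then show ?thesis using K_w by simp
  qed
  show ?thesis
  proof (rule that[of w])
    have "nil_ind m s g i \<in> {0..<m} \<times> UNIV" if "i \<in> {0..<m} \<times> UNIV" for g i
      using that m_ge_2 by (cases g; cases i) auto
    then show "monomial ({0..<m} \<times> UNIV) w (nil_coef q m \<theta> \<mu>1 \<mu>2 \<mu>) (nil_ind m s)"
      unfolding monomial_def using wV main by auto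
    show "w (0, 0) = v" by (simp add: w_def e0 Kn_simps v)
    show "w i = w (nil_norm i)" for i
      by (cases i) (simp add: w_def nil_norm_def Kn_periodic eV)
  qed
qed

end

end

section \<open>From multiplication tables to homomorphisms\<close>

lemma rep_hom_onto:
  assumes V: "ageing_simple q V act" and W: "ageing_rep q W act'"
    and h: "\<And>v. v \<in> W \<Longrightarrow> h v \<in> V" "\<And>v w. v \<in> W \<Longrightarrow> w \<in> W \<Longrightarrow> h (v + w) = h v + h w"
      "\<And>f v. v \<in> W \<Longrightarrow> h (act' f v) = act f (h v)"
    and w0: "w0 \<in> W" "h w0 \<noteq> 0"
  shows "h ` W = V"
proof -
  interpret V: ageing_simple q V act by (rule V)
  interpret W: ageing_rep q W act' by (rule W)
  have "h 0 = 0" using h(2)[OF W.V_zero W.V_zero] by simp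
  then have z: "0 \<in> h ` W" using W.V_zero by (metis image_eqI)
  have "h ` W = {0} \<or> h ` W = V"
  proof (rule V.simple[OF _ z])
    show "v + w \<in> h ` W" if "v \<in> h ` W" "w \<in> h ` W" for v w
    proof -
      obtain a where a: "v = h a" "a \<in> W" using \<open>v \<in> h ` W\<close> by blast
      obtain b where b: "w = h b" "b \<in> W" using \<open>w \<in> h ` W\<close> by blast
      show ?thesis unfolding a b h(2)[OF a(2) b(2), symmetric] by (intro imageI W.V_add a b)
    qed
    show "act f v \<in> h ` W" if "v \<in> h ` W" for f v
    proof -
      obtain a where a: "v = h a" "a \<in> W" using \<open>v \<in> h ` W\<close> by blast
      then show ?thesis using h(3) W.act_closed by (metis image_eqI)
    qed
  qed (use h(1) in blast)
  then show ?thesis using w0 by blast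
qed

lemma rep_hom_inj:
  assumes V: "ageing_rep q V act" and W: "ageing_simple q W act'"
    and h: "\<And>v. v \<in> W \<Longrightarrow> h v \<in> V" "\<And>v w. v \<in> W \<Longrightarrow> w \<in> W \<Longrightarrow> h (v + w) = h v + h w"
      "\<And>f v. v \<in> W \<Longrightarrow> h (act' f v) = act f (h v)"
    and w0: "w0 \<in> W" "h w0 \<noteq> 0"
  shows "inj_on h W"
proof -
  interpret V: ageing_rep q V act by (rule V)
  interpret W: ageing_simple q W act' by (rule W)
  let ?H = "{v \<in> W. h v = 0}"
  have z: "h 0 = 0" using h(2)[OF W.V_zero W.V_zero] by simp
  have "?H = {0} \<or> ?H = W"
    by (rule W.simple) (auto simp: z W.V_zero W.V_add W.act_closed h(2,3) V.act_zero_right)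
  then have H: "v = 0" if "v \<in> W" "h v = 0" for v using w0 that by blast
  show ?thesis
  proof (rule inj_onI)
    fix v w assume vw: "v \<in> W" "w \<in> W" "h v = h w"
    have mw: "- w = act' (fconst (- 1)) w" using W.sc_simps(3,5)[OF vw(2)] by simp
    then have mW: "- w \<in> W" using W.act_closed vw(2) by metis
    have "h w + h (- w) = 0" using h(2)[OF vw(2) mW] z by simp
    then have "h (v + - w) = 0" using h(2)[OF vw(1) mW] vw(3) by simp
    then show "v = w" using H[of "v + - w"] W.V_add[OF vw(1) mW] by simp
  qed
qed

context root_setting
begin

lemma M1_norm_props:
  "M1_norm i \<in> index_box l" "M1_basis i = basis_vec l (fst (M1_norm i)) (snd (M1_norm i))"
  "(a, b) \<in> index_box l \<Longrightarrow> M1_norm (a, b) = (a, b)"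
  using index_box_mod[OF l_ge_3]
  by (cases i; auto simp: M1_norm_def M1_basis_def basis_vec_def index_box_iff div_pos_pos_trivial)+

lemma nil_norm_props:
  "i \<in> {0..<m} \<times> UNIV \<Longrightarrow> nil_norm i \<in> index_box l" "nil_basis i = basis_vec l (fst (nil_norm i)) (snd (nil_norm i))"
  "(a, b) \<in> index_box l \<Longrightarrow> nil_norm (a, b) = (a, b)"
  "index_box l \<subseteq> {0..<m} \<times> UNIV"
  using L_pos by (cases i; auto simp: nil_norm_def nil_basis_def basis_vec_def index_box_iff)+

end

context ageing_root
begin

lemma power_eigen: "v \<in> V \<Longrightarrow> act f v = sc x v \<Longrightarrow> act (f ^ n) v = sc (x ^ n) v"
proof (induction n)
  case (Suc n)
  note v = Suc.prems(1)
  show ?case unfolding act_power_Suc(1)[OF v] Suc.prems(2) act_sc[OF v, of "f ^ n"] Suc.IH[OF Suc.prems] sc_sc[OF v] by simp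
qed (simp add: act_one sc_simps)

end

context ageing_simple_root
begin

text \<open>The kernel of an element that commutes with every generator up to a nonzero scalar is a
  submodule.\<close>

lemma qcomm_kernel:
  assumes z: "\<And>g. \<exists>c. c \<noteq> 0 \<and> qcomm z (fgen g) c"
  shows "(\<forall>v\<in>V. act z v = 0) \<or> (\<forall>v\<in>V. act z v = 0 \<longrightarrow> v = 0)"
proof -
  let ?H = "{v \<in> V. act z v = 0}"
  have gen: "act z (act (fgen g) v) = 0" if "v \<in> V" "act z v = 0" for g v
  proof -
    obtain c where c: "c \<noteq> 0" "qcomm z (fgen g) c" using z by blast
    have "sc c (act z (act (fgen g) v)) = 0" using qcommD[OF c(2) that(1)] that(2) act_zero_right by simp
    then show ?thesis using sc_eq_0[OF act_closed[OF act_closed[OF that(1)]]] c(1) by blast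
  qed
  have g: "act f v \<in> ?H" if "v \<in> ?H" for f v
    by (rule act_closed_generators[OF _ _ _ _ _ that])
      (auto simp: V_zero V_add act_closed act_zero_right act_add_right act_sc[of _ z] gen)
  have "?H = {0} \<or> ?H = V"
    by (rule simple) (use g in \<open>auto simp: V_zero V_add act_zero_right act_add_right\<close>)
  then show ?thesis by blast
qed

lemma gX_cases: "(\<forall>v\<in>V. act gX v = 0) \<or> (\<forall>v\<in>V. act gX v = 0 \<longrightarrow> v = 0)"
proof (rule qcomm_kernel)
  fix g show "\<exists>c. c \<noteq> 0 \<and> qcomm gX (fgen g) c"
    using qcomm_generators(2,8,5,13) qcomm_1(3) qcomm_gen_powi(4) q_nonzero q_powi_nonzero by (cases g) (metis one_neq_zero)+
qed

lemma poly_root: "degree p > 0 \<Longrightarrow> \<exists>x. poly p x = 0" for p :: "'k poly"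
  using alg_closed_imp_poly_has_root by auto

lemma scalar_eigen:
  assumes "central (f ^ l)"
    and U: "U \<subseteq> V" "0 \<in> U" "\<And>v w. v \<in> U \<Longrightarrow> w \<in> U \<Longrightarrow> v + w \<in> U" "\<And>c v. v \<in> U \<Longrightarrow> sc c v \<in> U"
    "\<And>v. v \<in> U \<Longrightarrow> act f v \<in> U" and u: "u \<in> U" "u \<noteq> 0"
  shows "\<exists>x. \<exists>v\<in>U. v \<noteq> 0 \<and> act f v = sc x v"
proof -
  obtain c where c: "\<forall>v\<in>V. act (f ^ l) v = sc c v" using schur[OF assms(1)] by blast
  show ?thesis
    by (rule eigenvector[OF U poly_root _ _ u, where n = l and c = c]) (use c U(1) L_pos in auto)
qed

lemma scalar_eigen_V:
  assumes "central (f ^ l)"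
  shows "\<exists>x. \<exists>v\<in>V. v \<noteq> 0 \<and> act f v = sc x v"
proof -
  obtain u where "u \<in> V" "u \<noteq> 0" using nontrivial V_zero by blast
  then show ?thesis by (intro scalar_eigen[OF assms, of V]) (auto simp: V_zero V_add act_closed)
qed

text \<open>The eigenspace of \<open>f\<close> is invariant under \<open>g\<close>, so an
  eigenvector of \<open>g\<close> can be found inside it.\<close>

lemma scalar_eigen_joint:
  assumes "central (f ^ l)" "central (g ^ l)" "qcomm f g 1"
  shows "\<exists>x y. \<exists>v\<in>V. v \<noteq> 0 \<and> act f v = sc x v \<and> act g v = sc y v"
proof -
  obtain x u where u: "u \<in> V" "u \<noteq> 0" "act f u = sc x u" using scalar_eigen_V[OF assms(1)] by blast
  have fg: "act f (act g v) = act g (act f v)" if "v \<in> V" for v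
    using qcommD[OF assms(3) that] by (simp add: sc_simps(3) act_closed that)
  have "\<exists>y. \<exists>v\<in>{v \<in> V. act f v = sc x v}. v \<noteq> 0 \<and> act g v = sc y v"
  proof (rule scalar_eigen[OF assms(2)])
    show "sc c v \<in> {v \<in> V. act f v = sc x v}" if "v \<in> {v \<in> V. act f v = sc x v}" for c v
      using that by (simp add: act_closed act_sc[of v f] sc_sc mult.commute)
    show "act g v \<in> {v \<in> V. act f v = sc x v}" if "v \<in> {v \<in> V. act f v = sc x v}" for v
      using that by (simp add: act_closed fg act_sc[of v g])
  qed (use u in \<open>auto simp: V_zero V_add act_zero_right act_add_right\<close>)
  then show ?thesis by blast
qed

lemma K_data:
  obtains \<kappa> \<mu> where "\<mu> \<noteq> 0" "\<mu> ^ l = \<kappa>" "\<forall>v\<in>V. act (gK ^ l) v = sc \<kappa> v"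
proof -
  obtain \<kappa> where \<kappa>: "\<forall>v\<in>V. act (gK ^ l) v = sc \<kappa> v" using schur[OF central_powers(1)] by blast
  obtain \<mu> where \<mu>: "\<mu> ^ l = \<kappa>" using root_exists[of l \<kappa>] L_pos by auto
  obtain u where u: "u \<in> V" "u \<noteq> 0" using nontrivial V_zero by blast
  have "Kw L = gK ^ l" by (simp add: Kw_def)
  then have "u = act (Kw (- L)) (act (gK ^ l) u)" using Kw_add[OF u(1), of "- L" L] by (simp add: Kw_def act_one u)
  \<comment> \<open>\<open>K^l\<close> is invertible, so its scalar is nonzero.\<close>
  then have "\<kappa> \<noteq> 0" using \<kappa> u by (metis act_zero_right sc_simps(4))
  then have "\<mu> \<noteq> 0" using \<mu> L_pos by auto
  then show ?thesis using that \<mu> \<kappa> by blast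
qed

lemma Kw_s: "act (gKi ^ ns) v = act (Kw (- s)) v"
proof -
  have s: "s \<ge> 0" by (simp add: int_ns[symmetric])
  then show ?thesis by (cases "s = 0") (auto simp: Kw_def ns_def)
qed

lemma Kw_inverse:
  assumes "u \<in> V" "act (gKi ^ ns) u = sc c v" "v \<in> V"
  shows "u = sc c (act (Kw s) v)"
proof -
  have "act (Kw s) (act (Kw (- s)) u) = u" using Kw_add[OF assms(1), of s "- s"] by (simp add: Kw_def act_one assms(1))
  then show ?thesis using assms Kw_s[of u] act_sc[OF assms(3)] by metis
qed

text \<open>The scalar of the central element \<open>E^m K^(-s)\<close> decides: if it is nonzero,
  the table of \<open>M_1\<close> arises, otherwise \<open>E\<close> is nilpotent. In the first
  alternative \<open>\<mu>2\<close> may vanish; the equation for \<open>\<phi>\<close> is kept so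
  that torsion-freeness can exclude this.\<close>

lemma classification:
  assumes X: "\<forall>v\<in>V. act gX v = 0 \<longrightarrow> v = 0"
  shows "(\<exists>\<mu>1 \<mu>2 \<mu>3 \<mu>4 w. \<mu>1 \<noteq> 0 \<and> \<mu>3 \<noteq> 0 \<and> \<mu>4 \<noteq> 0 \<and> monomial UNIV w (M1_coef q \<mu>1 \<mu>2 \<mu>3 \<mu>4) M1_ind \<and>
      w (0, 0) \<noteq> 0 \<and> (\<forall>i. w i = w (M1_norm i)) \<and> act (phi_word q) (w (0, 0)) = sc \<mu>2 (w (0, 0))) \<or>
    (\<exists>\<theta> \<mu>1 \<mu>2 \<mu>3 w. (\<theta> = 1 \<or> \<theta> = 0 \<and> \<mu>2 = 1) \<and> \<mu>1 \<noteq> 0 \<and> \<mu>2 \<noteq> 0 \<and> \<mu>3 \<noteq> 0 \<and>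
      monomial ({0..<m} \<times> UNIV) w (nil_coef q m \<theta> \<mu>1 \<mu>2 \<mu>3) (nil_ind m s) \<and> w (0, 0) \<noteq> 0 \<and> (\<forall>i. w i = w (nil_norm i)))"
    (is "?A \<or> ?B")
proof -
  obtain \<kappa> \<mu> where K: "\<mu> \<noteq> 0" "\<mu> ^ l = \<kappa>" "\<forall>v\<in>V. act (gK ^ l) v = sc \<kappa> v" by (rule K_data) blast
  note KwKn = Kw_eq_Kn[OF K]
  note KnV = Kn_simps(1)[OF K]
  have nz: "\<mu>1 \<noteq> 0" if "v \<in> V" "v \<noteq> 0" "act gX v = sc \<mu>1 v" for v \<mu>1
    using that X sc_simps(4) by metis
  obtain \<gamma> where \<gamma>: "\<forall>v\<in>V. act (gE ^ ord_sq l * gKi ^ ns) v = sc \<gamma> v" using schur[OF central_E] by blast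
  have Em: "act (gE ^ ord_sq l) v = sc \<gamma> (act (Kw s) v)" if v: "v \<in> V" for v
    using \<gamma> v by (intro Kw_inverse act_closed) (auto simp: act_mult)
  show ?thesis
  proof (cases "\<gamma> = 0")
    case False
    obtain \<mu>1 \<mu>2 v where v: "v \<in> V" "v \<noteq> 0" "act gX v = sc \<mu>1 v" "act (phi_word q) v = sc \<mu>2 v"
      using scalar_eigen_joint[OF central_powers(3) central_phi qcomm_phi_gens(7)] by blast
    \<comment> \<open>\<open>E^m v\<close> is \<open>\<gamma>\<close> times \<open>v K^s\<close>,
      and normalising \<open>K^s\<close> contributes the factor \<open>\<mu> powi s\<close>.\<close>
    obtain \<mu>3 where \<mu>3: "\<mu>3 ^ ord_sq l = \<gamma> * \<mu> powi s" using root_exists[of "ord_sq l"] m_pos by auto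
    then have \<mu>3nz: "\<mu>3 \<noteq> 0" using False K(1) m_pos by (auto simp: power_0_left)
    have "act (gE ^ ord_sq l) v = sc (\<mu>3 ^ ord_sq l) (Kn \<mu> s v)"
      unfolding Em[OF v(1)] KwKn[OF v(1)] sc_sc[OF KnV[OF v(1)]] \<mu>3 ..
    then obtain w where w: "monomial UNIV w (M1_coef q \<mu>1 \<mu>2 \<mu>3 \<mu>) M1_ind" "w (0, 0) = v" "\<And>i. w i = w (M1_norm i)"
      using M1_family[OF K v(1,3,4) \<mu>3nz] by blast
    have "?A" using nz[OF v(1-3)] \<mu>3nz K(1) w v by (intro exI[of _ \<mu>1] exI[of _ \<mu>2] exI[of _ \<mu>3] exI[of _ \<mu>] exI[of _ w]) simp
    then show ?thesis ..
  next
    case True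
    obtain x u where u: "u \<in> V" "u \<noteq> 0" "act gX u = sc x u" using scalar_eigen_V[OF central_powers(3)] by blast
    \<comment> \<open>The last nonzero vector among the images of \<open>u\<close> under powers of
      \<open>E\<close> is killed by \<open>E\<close> and remains an eigenvector of
      \<open>X\<close>.\<close>
    define n where "n = (LEAST n. act (gE ^ n) u = 0)"
    have ex: "act (gE ^ ord_sq l) u = 0" unfolding Em[OF u(1)] True by (rule sc_simps(4)[OF act_closed[OF u(1)]])
    then have n0: "act (gE ^ n) u = 0" unfolding n_def by (rule LeastI)
    then obtain k where k: "n = Suc k" using u act_one by (cases n) auto
    define v where "v = act (gE ^ k) u"
    have "v \<noteq> 0" using not_less_Least[of k "\<lambda>n. act (gE ^ n) u = 0"] k unfolding n_def v_def by auto
    have v: "v \<in> V" by (simp add: v_def act_closed u)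
    have E: "act gE v = 0" using n0 unfolding k v_def act_power_Suc(2)[OF u(1)] .
    define \<mu>1 where "\<mu>1 = q ^ k * x"
    have Xv: "act gX v = sc \<mu>1 v"
      unfolding v_def \<mu>1_def qcommD[OF qcomm_power_left[OF qcomm_generators(4)] u(1)] u(3) act_sc[OF u(1)] by (rule sc_sc[OF act_closed[OF u(1)]])
    have \<mu>1: "\<mu>1 \<noteq> 0" by (rule nz[OF v \<open>v \<noteq> 0\<close> Xv])
    obtain \<gamma>' where \<gamma>': "\<forall>v\<in>V. act (gY ^ ord_sq l * gKi ^ ns * gX ^ ns) v = sc \<gamma>' v" using schur[OF central_Y] by blast
    \<comment> \<open>The factor \<open>X^s\<close> of the central element is stripped off:
      \<open>z\<close> is an eigenvector of \<open>X\<close> with nonzero eigenvalue, so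
      \<open>z X^s\<close> is a nonzero multiple of \<open>z\<close>, and \<open>z\<close> becomes a
      multiple of \<open>v\<close>.\<close>
    define z where "z = act (gY ^ ord_sq l * gKi ^ ns) v"
    obtain c where c: "c \<noteq> 0" "qcomm (gY ^ ord_sq l * gKi ^ ns) gX c"
      using qcomm_mult_left[OF qcomm_power_left[OF qcomm_generators(14)] qcomm_power_left[OF qcomm_generators(17)]] q_powi_nonzero
      by (metis mult_eq_0_iff power_eq_0_iff)
    have zV: "z \<in> V" by (simp add: z_def act_closed v)
    have Xz: "act gX z = sc (c * \<mu>1) z" unfolding z_def qcommD[OF c(2) v] Xv act_sc[OF v] by (rule sc_sc[OF act_closed[OF v]])
    have "act (gX ^ ns) z = sc \<gamma>' v"
      using bspec[OF \<gamma>' v] unfolding z_def act_mult[OF v, of "gY ^ ord_sq l * gKi ^ ns" "gX ^ ns"] .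
    then have "sc ((c * \<mu>1) ^ ns) z = sc \<gamma>' v" unfolding power_eigen[OF zV Xz] .
    then have "z = sc (inverse ((c * \<mu>1) ^ ns)) (sc \<gamma>' v)"
      using sc_simps(7)[OF zV, of "(c * \<mu>1) ^ ns"] c \<mu>1 by simp
    then have "act (gKi ^ ns) (act (gY ^ ord_sq l) v) = sc (inverse ((c * \<mu>1) ^ ns) * \<gamma>') v"
      unfolding z_def act_mult[OF v] sc_sc[OF v] .
    then have "act (gY ^ ord_sq l) v = sc (inverse ((c * \<mu>1) ^ ns) * \<gamma>') (act (Kw s) v)"
      by (intro Kw_inverse act_closed v)
    then obtain \<eta> where \<eta>: "act (gY ^ ord_sq l) v = sc \<eta> (Kn \<mu> s v)"
      unfolding KwKn[OF v] sc_sc[OF KnV[OF v]] by blast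
    \<comment> \<open>If \<open>Y^m\<close> kills \<open>v\<close>, no root is available to fix a
      scale, and \<open>\<mu>2 = 1\<close> selects \<open>M_3\<close>; otherwise an
      \<open>m\<close>-th root of \<open>\<eta>\<close> gives \<open>M_2\<close>.\<close>
    obtain \<theta> \<mu>2 where \<theta>: "\<theta> = 1 \<or> \<theta> = 0 \<and> \<mu>2 = 1" "\<mu>2 \<noteq> 0" "\<eta> = \<theta> * \<mu>2 ^ ord_sq l"
    proof (cases "\<eta> = 0")
      case True
      then show ?thesis by (intro that[of 0 1]) auto
    next
      case False
      obtain r where "r ^ ord_sq l = \<eta>" using root_exists[of "ord_sq l"] m_pos by auto
      then show ?thesis using False m_pos by (intro that[of 1 r]) auto
    qed
    obtain w where "monomial ({0..<m} \<times> UNIV) w (nil_coef q m \<theta> \<mu>1 \<mu>2 \<mu>) (nil_ind m s)" "w (0, 0) = v" "\<And>i. w i = w (nil_norm i)"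
      using nil_family[OF K v Xv E \<theta>(2) \<eta>[unfolded \<theta>(3)]] by blast
    then have "?B" using \<theta>(1,2) \<mu>1 K(1) \<open>v \<noteq> 0\<close>
      by (intro exI[of _ \<theta>] exI[of _ \<mu>1] exI[of _ \<mu>2] exI[of _ \<mu>] exI[of _ w]) simp
    then show ?thesis ..
  qed
qed

end

lemma rspan_sum: "finite A \<Longrightarrow> A \<subseteq> B \<Longrightarrow> (\<Sum>p\<in>A. \<rho> (c p) (w p)) \<in> rspan \<rho> (w ` B)"
  by (induction A rule: finite_induct) (auto intro: rspan.intros)

definition (in root_setting) model_operators :: "(ageing_gen \<Rightarrow> int \<Rightarrow> int \<Rightarrow> 'k coords) set" where
  "model_operators =
    {M1_op q l \<mu>1 \<mu>2 \<mu>3 \<mu>4 |\<mu>1 \<mu>2 \<mu>3 \<mu>4. \<mu>1 \<noteq> 0 \<and> \<mu>2 \<noteq> 0 \<and> \<mu>3 \<noteq> 0 \<and> \<mu>4 \<noteq> 0} \<union>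
    {M2_op q l \<mu>1 \<mu>2 \<mu>3 |\<mu>1 \<mu>2 \<mu>3. \<mu>1 \<noteq> 0 \<and> \<mu>2 \<noteq> 0 \<and> \<mu>3 \<noteq> 0} \<union>
    {M3_op q l \<mu>1 \<mu>2 |\<mu>1 \<mu>2. \<mu>1 \<noteq> 0 \<and> \<mu>2 \<noteq> 0}"

lemma (in root_setting) model_simple:
  "T \<in> model_operators \<Longrightarrow> ageing_simple q (coord_space l) (free_action l T)"
  unfolding model_operators_def by (elim UnE CollectE exE conjE) (simp_all only: M1_simple M2_simple M3_simple simp_thms)

context ageing_simple_root
begin

lemma coord_hom_onto:
  assumes M: "ageing_rep q (coord_space l) (free_action l T)"
    and u: "free_rep.monomial (coord_space l) (free_action l T) J u c \<sigma>"
    and w: "monomial J w c \<sigma>"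
    and nrm: "\<forall>i\<in>J. nrm i \<in> index_box l \<and> u i = basis_vec l (fst (nrm i)) (snd (nrm i)) \<and> w i = w (nrm i)"
    and box: "index_box l \<subseteq> J" "\<forall>p\<in>index_box l. nrm p = p"
    and i: "i \<in> J" "w i \<noteq> 0"
  shows "\<exists>h. h ` coord_space l = V \<and>
      (ageing_simple q (coord_space l) (free_action l T) \<longrightarrow> bij_betw h (coord_space l) V) \<and>
      (\<forall>v\<in>coord_space l. \<forall>v'\<in>coord_space l. h (v + v') = h v + h v') \<and>
      (\<forall>f. \<forall>v\<in>coord_space l. h (free_action l T f v) = act f (h v))"
    and "w ` index_box l \<subseteq> V \<and> V \<subseteq> rspan sc (w ` index_box l)"
proof -
  obtain h where h: "\<forall>v\<in>coord_space l. h v \<in> V"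
    "\<forall>v\<in>coord_space l. \<forall>v'\<in>coord_space l. h (v + v') = h v + h v'"
    "\<forall>f. \<forall>v\<in>coord_space l. h (free_action l T f v) = act f (h v)"
    "\<forall>i\<in>J. h (u i) = w i"
    "\<forall>v. h v = (\<Sum>p\<in>index_box l. sc (v p) (w p))"
  proof (rule coord_hom[OF l_ge_3 M ageing_rep_axioms u w, of nrm])
    show "nrm i \<in> index_box l \<and> u i = basis_vec l (fst (nrm i)) (snd (nrm i)) \<and> w i = w (nrm i)" if "i \<in> J" for i
      using nrm that by blast
  qed (use box in auto)
  have uV: "u i \<in> coord_space l" using nrm i(1) basis_vec_in_coord_space[OF l_ge_3] by simp
  have nz: "h (u i) \<noteq> 0" using h(4) i by simp
  have onto: "h ` coord_space l = V"
    by (rule rep_hom_onto[where h = h, OF ageing_simple_axioms M _ _ _ uV nz]) (use h(1-3) in blast)+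
  have "bij_betw h (coord_space l) V" if "ageing_simple q (coord_space l) (free_action l T)"
    unfolding bij_betw_def
    by (intro conjI onto rep_hom_inj[where h = h, OF ageing_rep_axioms that _ _ _ uV nz]) (use h(1-3) in blast)+
  then show "\<exists>h. h ` coord_space l = V \<and>
      (ageing_simple q (coord_space l) (free_action l T) \<longrightarrow> bij_betw h (coord_space l) V) \<and>
      (\<forall>v\<in>coord_space l. \<forall>v'\<in>coord_space l. h (v + v') = h v + h v') \<and>
      (\<forall>f. \<forall>v\<in>coord_space l. h (free_action l T f v) = act f (h v))"
    using onto h(2,3) by blast
  have "h v \<in> rspan sc (w ` index_box l)" for v
    unfolding h(5)[rule_format] by (rule rspan_sum[OF finite_index_box order_refl])
  then have "V \<subseteq> rspan sc (w ` index_box l)" unfolding onto[symmetric] by blast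
  moreover have "w ` index_box l \<subseteq> V" using monomialD(1)[OF w] box(1) by blast
  ultimately show "w ` index_box l \<subseteq> V \<and> V \<subseteq> rspan sc (w ` index_box l)" by blast
qed

text \<open>With \<open>X = 0\<close> the element \<open>E K^(-1)\<close> commutes with
  \<open>Y\<close>, and its \<open>l\<close>-th power is central. A common eigenvector
  \<open>v\<close> of the two then has an invariant span of the \<open>l\<close> vectors
  \<open>v K^b\<close>.\<close>

lemma span_bound_X_zero:
  assumes X: "\<forall>v\<in>V. act gX v = 0"
  shows "\<exists>S. S \<subseteq> V \<and> finite S \<and> card S \<le> l \<and> V \<subseteq> rspan sc S"
proof -
  obtain \<kappa> \<mu> where K: "\<mu> \<noteq> 0" "\<mu> ^ l = \<kappa>" "\<forall>v\<in>V. act (gK ^ l) v = sc \<kappa> v" by (rule K_data) blast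
  note g = qcomm_generators and KnV = Kn_simps(1)[OF K]
  have EY: "qcomm gE gY (q powi (-1))"
    unfolding qcomm_def using EY_rel X by (simp add: act_closed)
  have "qcomm (gE * gKi) gY (q powi (-1) * q)" by (rule qcomm_mult_left[OF EY g(18)])
  then have ZY: "qcomm (gE * gKi) gY 1" using q_nonzero by (simp add: powi_simps)
  have c0: "1 = q powi 0" by simp
  note C = qcomm_power_l[of "gE * gKi", OF qcomm_mult_left]
  have Z: "central ((gE * gKi) ^ l)"
  proof (rule centralI)
    show "qcomm ((gE * gKi) ^ l) gE 1"
      by (rule C[OF qcomm_1(3) g(16), of "- 2"]) simp
    show "qcomm ((gE * gKi) ^ l) gK 1"
      by (rule C[OF g(1) g(15), of "- 2"]) simp
    show "qcomm ((gE * gKi) ^ l) gKi 1"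
      by (rule C[OF g(7) qcomm_1(3), of 2]) simp
    show "qcomm ((gE * gKi) ^ l) gX 1"
      by (rule C[OF g(4) g(17), of 0]) (use q_nonzero in \<open>simp add: powi_simps\<close>)
    show "qcomm ((gE * gKi) ^ l) gY 1" by (rule qcomm_power_l[OF ZY c0])
  qed
  obtain \<epsilon> y v where v: "v \<in> V" "v \<noteq> 0" "act (gE * gKi) v = sc \<epsilon> v" "act gY v = sc y v"
    using scalar_eigen_joint[OF Z central_powers(5) ZY] by blast
  have K1: "act gK v = sc \<mu> (Kn \<mu> 1 v)" using Kn_simps(3)[OF K v(1), of 0] Kn_simps(2)[OF K v(1)] by simp
  \<comment> \<open>Undoing the factor \<open>K^(-1)\<close> turns the eigenvalue equation into a
    formula for \<open>E\<close> on \<open>v\<close>.\<close>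
  have "act gE v = act gK (act gKi (act gE v))" using K_cancel(2)[OF act_closed[OF v(1)]] by simp
  also have "act gKi (act gE v) = sc \<epsilon> v" using v(3) act_mult[OF v(1)] by simp
  finally have E: "act gE v = sc (\<epsilon> * \<mu>) (Kn \<mu> 1 v)"
    unfolding act_sc_gen[OF v(1)] K1 sc_sc[OF KnV[OF v(1)]] .
  define S where "S = (\<lambda>b. Kn \<mu> b v) ` {0..<L}"
  have SV: "S \<subseteq> V" using KnV v(1) by (auto simp: S_def)
  interpret sc: comm_action V sc by (rule comm_action_sc)
  have KnS: "Kn \<mu> b v \<in> S" for b
    unfolding S_def using Kn_periodic[OF K v(1), of b] L_pos by (intro image_eqI[of _ _ "b mod L"]) simp_all
  have mem: "sc c (Kn \<mu> b v) \<in> rspan sc S" for c b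
    by (rule sc.rspan_act[OF SV sc.rspan_base[OF SV KnS]])
  have gS: "act (fgen g) (Kn \<mu> b v) \<in> rspan sc S" for g b
  proof (cases g)
    case GE
    have "act gE (Kn \<mu> b v) = sc (q powi (2 * b) * (\<epsilon> * \<mu>)) (Kn \<mu> (b + 1) v)"
      unfolding act_Kn[OF K g(10) v(1)] E Kn_simps(6)[OF K KnV[OF v(1)]] Kn_simps(5)[OF K v(1)] sc_sc[OF KnV[OF v(1)]] ..
    then show ?thesis using GE mem by simp
  next
    case GY
    have "act gY (Kn \<mu> b v) = sc (q powi (-1 * b) * y) (Kn \<mu> b v)"
      unfolding act_Kn[OF K g(12) v(1)] v(4) Kn_simps(6)[OF K v(1)] sc_sc[OF KnV[OF v(1)]] ..
    then show ?thesis using GY mem by simp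
  qed (use X KnV[OF v(1)] rspan.rspan_zero Kn_simps(3,4)[OF K v(1)] mem in simp_all)
  have gH: "act (fgen g) u \<in> rspan sc S" if "u \<in> rspan sc S" for g u
    using that
  proof (induction rule: rspan.induct)
    case rspan_zero
    show ?case unfolding act_zero_right by (rule rspan.rspan_zero)
  next
    case (rspan_step x u r)
    have "x \<in> V" "u \<in> V" using rspan_step(1,2) SV sc.rspan_closed[OF SV] by auto
    then have "act (fgen g) (sc r x + u) = sc r (act (fgen g) x) + act (fgen g) u"
      by (simp only: act_add_right act_closed act_sc_gen)
    moreover obtain b where "x = Kn \<mu> b v" using rspan_step(1) unfolding S_def by blast
    ultimately show ?case using sc.rspan_add[OF sc.rspan_act[OF SV gS] rspan_step(3)] by simp
  qed
  note H = sc.rspan_closed[OF SV] rspan.rspan_zero[of sc S] sc.rspan_add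
  have "rspan sc S = {0} \<or> rspan sc S = V"
  proof (rule simple[OF H(1,2)])
    show "u + u' \<in> rspan sc S" if "u \<in> rspan sc S" "u' \<in> rspan sc S" for u u' using that by (rule H(3))
    show "act f u \<in> rspan sc S" if "u \<in> rspan sc S" for f u
    proof (rule act_closed_generators[OF H(1,2) _ _ _ that])
      show "u + u' \<in> rspan sc S" if "u \<in> rspan sc S" "u' \<in> rspan sc S" for u u' using that by (rule H(3))
      show "sc c u \<in> rspan sc S" if "u \<in> rspan sc S" for c u by (rule sc.rspan_act[OF SV that])
    qed (rule gH)
  qed
  moreover have "v \<in> rspan sc S" using mem[of 1 0] Kn_simps(2)[OF K v(1)] by (simp add: sc_simps(3) v)
  ultimately have "V \<subseteq> rspan sc S" using v(2) by blast
  moreover have "card S \<le> l" unfolding S_def using card_image_le[of "{0..<L}" "\<lambda>b. Kn \<mu> b v"] by simp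
  moreover have "finite S" by (simp add: S_def)
  ultimately show ?thesis using SV by blast
qed

lemma M1_hom_onto:
  assumes \<mu>: "\<mu>3 \<noteq> 0" "\<mu>4 \<noteq> 0" and w: "monomial UNIV w (M1_coef q \<mu>1 \<mu>2 \<mu>3 \<mu>4) M1_ind" "w (0, 0) \<noteq> 0"
    "\<forall>i. w i = w (M1_norm i)"
  shows "\<exists>h. h ` coord_space l = V \<and>
      (ageing_simple q (coord_space l) (free_action l (M1_op q l \<mu>1 \<mu>2 \<mu>3 \<mu>4)) \<longrightarrow> bij_betw h (coord_space l) V) \<and>
      (\<forall>v\<in>coord_space l. \<forall>v'\<in>coord_space l. h (v + v') = h v + h v') \<and>
      (\<forall>f. \<forall>v\<in>coord_space l. h (free_action l (M1_op q l \<mu>1 \<mu>2 \<mu>3 \<mu>4) f v) = act f (h v))"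
    and "w ` index_box l \<subseteq> V \<and> V \<subseteq> rspan sc (w ` index_box l)"
proof -
  have n: "\<forall>i\<in>UNIV. M1_norm i \<in> index_box l \<and> M1_basis i = basis_vec l (fst (M1_norm i)) (snd (M1_norm i)) \<and> w i = w (M1_norm i)"
    using M1_norm_props(1,2) w(3) by blast
  have b: "index_box l \<subseteq> UNIV" "\<forall>p\<in>index_box l. M1_norm p = p" using M1_norm_props(3) by auto
  note r = coord_hom_onto[OF M1_rep[OF \<mu>] M1_monomial w(1) n b UNIV_I w(2)]
  show "\<exists>h. h ` coord_space l = V \<and>
      (ageing_simple q (coord_space l) (free_action l (M1_op q l \<mu>1 \<mu>2 \<mu>3 \<mu>4)) \<longrightarrow> bij_betw h (coord_space l) V) \<and>
      (\<forall>v\<in>coord_space l. \<forall>v'\<in>coord_space l. h (v + v') = h v + h v') \<and>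
      (\<forall>f. \<forall>v\<in>coord_space l. h (free_action l (M1_op q l \<mu>1 \<mu>2 \<mu>3 \<mu>4) f v) = act f (h v))"
    "w ` index_box l \<subseteq> V \<and> V \<subseteq> rspan sc (w ` index_box l)" by (rule r)+
qed

lemma nil_hom_onto:
  assumes \<mu>: "\<mu>1 \<noteq> 0" "\<mu>2 \<noteq> 0" "\<mu>3 \<noteq> 0" and \<theta>: "\<theta> = 1 \<or> \<theta> = 0 \<and> \<mu>2 = 1"
    and w: "monomial ({0..<m} \<times> UNIV) w (nil_coef q m \<theta> \<mu>1 \<mu>2 \<mu>3) (nil_ind m s)" "w (0, 0) \<noteq> 0" "\<forall>i. w i = w (nil_norm i)"
  shows "\<exists>T\<in>model_operators. \<exists>h. bij_betw h (coord_space l) V \<and>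
      (\<forall>v\<in>coord_space l. \<forall>v'\<in>coord_space l. h (v + v') = h v + h v') \<and>
      (\<forall>f. \<forall>v\<in>coord_space l. h (free_action l T f v) = act f (h v))"
    and "w ` index_box l \<subseteq> V \<and> V \<subseteq> rspan sc (w ` index_box l)"
proof -
  have n: "\<forall>i\<in>{0..<m} \<times> UNIV. nil_norm i \<in> index_box l \<and> nil_basis i = basis_vec l (fst (nil_norm i)) (snd (nil_norm i)) \<and> w i = w (nil_norm i)"
    using nil_norm_props(1,2) w(3) by blast
  have b: "index_box l \<subseteq> {0..<m} \<times> UNIV" "\<forall>p\<in>index_box l. nil_norm p = p" using nil_norm_props(3,4) by auto
  have J: "(0, 0) \<in> {0..<m} \<times> (UNIV :: int set)" using m_pos by simp
  obtain T where T: "T \<in> model_operators"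
    and mono: "free_rep.monomial (coord_space l) (free_action l T) ({0..<m} \<times> UNIV) nil_basis (nil_coef q m \<theta> \<mu>1 \<mu>2 \<mu>3) (nil_ind m s)"
    using \<theta>
  proof
    assume "\<theta> = 1"
    then show ?thesis using \<mu> M2_monomial that[of "M2_op q l \<mu>1 \<mu>2 \<mu>3"] unfolding model_operators_def by blast
  next
    assume "\<theta> = 0 \<and> \<mu>2 = 1"
    then show ?thesis using \<mu> M3_monomial that[of "M3_op q l \<mu>1 \<mu>3"] unfolding model_operators_def by blast
  qed
  note sim = model_simple[OF T]
  note r = coord_hom_onto[OF ageing_simple.axioms(1)[OF sim] mono w(1) n b J w(2)]
  show "\<exists>T\<in>model_operators. \<exists>h. bij_betw h (coord_space l) V \<and>
      (\<forall>v\<in>coord_space l. \<forall>v'\<in>coord_space l. h (v + v') = h v + h v') \<and>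
      (\<forall>f. \<forall>v\<in>coord_space l. h (free_action l T f v) = act f (h v))" using r(1) T sim by blast
  show "w ` index_box l \<subseteq> V \<and> V \<subseteq> rspan sc (w ` index_box l)" by (rule r(2))
qed

text \<open>The table of \<open>M_1\<close> may occur with \<open>\<mu>2 = 0\<close>, where
  simplicity of the coordinate module is not established; the spanning set coming from a surjection
  is enough for an upper bound.\<close>

lemma span_bound: "\<exists>S. S \<subseteq> V \<and> finite S \<and> card S \<le> ord_sq l * l \<and> V \<subseteq> rspan sc S"
proof (cases "\<forall>v\<in>V. act gX v = 0")
  case True
  have "l \<le> ord_sq l * l" using m_pos by simp
  then show ?thesis using span_bound_X_zero[OF True] by (meson le_trans)
next
  case False
  then have X: "\<forall>v\<in>V. act gX v = 0 \<longrightarrow> v = 0" using gX_cases by blast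
  obtain w :: "int \<times> int \<Rightarrow> 'b" where w: "w ` index_box l \<subseteq> V \<and> V \<subseteq> rspan sc (w ` index_box l)"
    using classification[OF X]
  proof (rule disjE)
    assume "\<exists>\<mu>1 \<mu>2 \<mu>3 \<mu>4 w. \<mu>1 \<noteq> 0 \<and> \<mu>3 \<noteq> 0 \<and> \<mu>4 \<noteq> 0 \<and> monomial UNIV w (M1_coef q \<mu>1 \<mu>2 \<mu>3 \<mu>4) M1_ind \<and>
        w (0, 0) \<noteq> 0 \<and> (\<forall>i. w i = w (M1_norm i)) \<and> act (phi_word q) (w (0, 0)) = sc \<mu>2 (w (0, 0))"
    then obtain \<mu>1 \<mu>2 \<mu>3 \<mu>4 w where \<mu>: "\<mu>3 \<noteq> 0" "\<mu>4 \<noteq> 0"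
      and w: "monomial UNIV w (M1_coef q \<mu>1 \<mu>2 \<mu>3 \<mu>4) M1_ind" "w (0, 0) \<noteq> 0" "\<forall>i. w i = w (M1_norm i)" by (elim exE conjE)
    show ?thesis by (rule that[OF M1_hom_onto(2)[OF \<mu> w]])
  next
    assume "\<exists>\<theta> \<mu>1 \<mu>2 \<mu>3 w. (\<theta> = 1 \<or> \<theta> = 0 \<and> \<mu>2 = 1) \<and> \<mu>1 \<noteq> 0 \<and> \<mu>2 \<noteq> 0 \<and> \<mu>3 \<noteq> 0 \<and>
        monomial ({0..<m} \<times> UNIV) w (nil_coef q m \<theta> \<mu>1 \<mu>2 \<mu>3) (nil_ind m s) \<and> w (0, 0) \<noteq> 0 \<and> (\<forall>i. w i = w (nil_norm i))"
    then obtain \<theta> \<mu>1 \<mu>2 \<mu>3 w where \<mu>: "\<mu>1 \<noteq> 0" "\<mu>2 \<noteq> 0" "\<mu>3 \<noteq> 0" "\<theta> = 1 \<or> \<theta> = 0 \<and> \<mu>2 = 1"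
      and w: "monomial ({0..<m} \<times> UNIV) w (nil_coef q m \<theta> \<mu>1 \<mu>2 \<mu>3) (nil_ind m s)" "w (0, 0) \<noteq> 0" "\<forall>i. w i = w (nil_norm i)"
      by (elim exE conjE)
    show ?thesis by (rule that[OF nil_hom_onto(2)[OF \<mu> w]])
  qed
  have "card (w ` index_box l) \<le> ord_sq l * l"
    using card_image_le[OF finite_index_box, of w l] by (simp only: card_index_box)
  then show ?thesis using w finite_index_box[of l] by (intro exI[of _ "w ` index_box l"]) simp
qed

lemma torsion_free_model:
  assumes X: "\<forall>v\<in>V. act gX v = 0 \<longrightarrow> v = 0" and phi: "\<forall>v\<in>V. act (phi_word q) v = 0 \<longrightarrow> v = 0"
  shows "\<exists>T\<in>model_operators. \<exists>h. bij_betw h (coord_space l) V \<and>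
    (\<forall>v\<in>coord_space l. \<forall>v'\<in>coord_space l. h (v + v') = h v + h v') \<and>
    (\<forall>f. \<forall>v\<in>coord_space l. h (free_action l T f v) = act f (h v))"
  using classification[OF X]
proof
  assume "\<exists>\<mu>1 \<mu>2 \<mu>3 \<mu>4 w. \<mu>1 \<noteq> 0 \<and> \<mu>3 \<noteq> 0 \<and> \<mu>4 \<noteq> 0 \<and> monomial UNIV w (M1_coef q \<mu>1 \<mu>2 \<mu>3 \<mu>4) M1_ind \<and>
      w (0, 0) \<noteq> 0 \<and> (\<forall>i. w i = w (M1_norm i)) \<and> act (phi_word q) (w (0, 0)) = sc \<mu>2 (w (0, 0))"
  then obtain \<mu>1 \<mu>2 \<mu>3 \<mu>4 w where \<mu>: "\<mu>1 \<noteq> 0" "\<mu>3 \<noteq> 0" "\<mu>4 \<noteq> 0"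
    and w: "monomial UNIV w (M1_coef q \<mu>1 \<mu>2 \<mu>3 \<mu>4) M1_ind" "w (0, 0) \<noteq> 0" "\<forall>i. w i = w (M1_norm i)"
    and p: "act (phi_word q) (w (0, 0)) = sc \<mu>2 (w (0, 0))" by blast
  have wV: "w (0, 0) \<in> V" by (rule monomialD(1)[OF w(1)]) simp
  \<comment> \<open>\<open>\<phi>\<close> multiplies the nonzero vector \<open>w (0, 0)\<close> by
    \<open>\<mu>2\<close>, so injectivity of \<open>\<phi>\<close> excludes zero.\<close>
  have \<mu>2: "\<mu>2 \<noteq> 0" using bspec[OF phi wV] p w(2) sc_simps(4)[OF wV] by auto
  have "M1_op q l \<mu>1 \<mu>2 \<mu>3 \<mu>4 \<in> model_operators" using \<mu> \<mu>2 unfolding model_operators_def by blast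
  then show ?thesis using M1_hom_onto(1)[OF \<mu>(2,3) w] model_simple by blast
next
  assume "\<exists>\<theta> \<mu>1 \<mu>2 \<mu>3 w. (\<theta> = 1 \<or> \<theta> = 0 \<and> \<mu>2 = 1) \<and> \<mu>1 \<noteq> 0 \<and> \<mu>2 \<noteq> 0 \<and> \<mu>3 \<noteq> 0 \<and>
      monomial ({0..<m} \<times> UNIV) w (nil_coef q m \<theta> \<mu>1 \<mu>2 \<mu>3) (nil_ind m s) \<and> w (0, 0) \<noteq> 0 \<and> (\<forall>i. w i = w (nil_norm i))"
  then show ?thesis using nil_hom_onto(1) by blast
qed

end

section \<open>Transfer to the given module and its dimension\<close>

locale realization = ageing_simple_root q V act l
  for q :: "'k::alg_closed_field" and V :: "'k ageing_free set" and act and l +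
  fixes N :: "('k ageing_free set, 'v) module" and h
  assumes N_module: "right_module (ageing_algebra q) N"
    and h_bij: "bij_betw h V (carrier N)"
    and h_add: "u \<in> V \<Longrightarrow> w \<in> V \<Longrightarrow> h (u + w) = h u \<oplus>\<^bsub>N\<^esub> h w"
    and h_act: "u \<in> V \<Longrightarrow> h (act f u) = ageing_class q f \<odot>\<^bsub>N\<^esub> h u"
    and act_const: "v \<in> V \<Longrightarrow> act (fconst c) v = fconst c * v"
begin

sublocale N: abelian_group N by (rule right_module_group[OF N_module])

lemma h_closed: "v \<in> V \<Longrightarrow> h v \<in> carrier N"
  using h_bij by (auto simp: bij_betw_def)

lemma h_zero: "h 0 = \<zero>\<^bsub>N\<^esub>"
proof -
  have "h 0 \<oplus>\<^bsub>N\<^esub> h 0 = h 0 \<oplus>\<^bsub>N\<^esub> \<zero>\<^bsub>N\<^esub>"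
    using h_add[OF V_zero V_zero] h_closed[OF V_zero] by simp
  then show ?thesis using h_closed[OF V_zero] by (simp only: N.add.l_cancel N.zero_closed)
qed

lemma h_eq_zero: "v \<in> V \<Longrightarrow> h v = \<zero>\<^bsub>N\<^esub> \<Longrightarrow> v = 0"
  using h_zero V_zero bij_betw_imp_inj_on[OF h_bij] by (metis inj_onD)

lemma h_sum: "finite I \<Longrightarrow> (\<And>i. i \<in> I \<Longrightarrow> u i \<in> V) \<Longrightarrow> h (sum u I) = (\<Oplus>\<^bsub>N\<^esub>i\<in>I. h (u i))"
proof (induction I rule: finite_induct)
  case (insert x I)
  have "(\<lambda>i. h (u i)) \<in> I \<rightarrow> carrier N" "h (u x) \<in> carrier N" using insert.prems h_closed by auto
  then show ?case using insert by (simp add: h_add V_sum N.finsum_insert)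
qed (simp add: h_zero)

lemma has_dimI:
  assumes b: "b \<in> {..<n} \<rightarrow> V"
    and u: "\<And>v. v \<in> V \<Longrightarrow> \<exists>!c. c \<in> {..<n} \<rightarrow>\<^sub>E (UNIV :: 'k set) \<and> v = (\<Sum>i<n. sc (c i) (b i))"
  shows "ageing_module_has_dim q N n"
  unfolding ageing_module_has_dim_def
proof (intro exI[of _ "\<lambda>i. h (b i)"] conjI ballI)
  show "(\<lambda>i. h (b i)) \<in> {..<n} \<rightarrow> carrier N" using b h_closed by auto
  fix x assume "x \<in> carrier N"
  then obtain v where v: "v \<in> V" "x = h v" using h_bij by (auto simp: bij_betw_def)
  have "(\<Oplus>\<^bsub>N\<^esub>i\<in>{..<n}. ageing_class q (fconst (c i)) \<odot>\<^bsub>N\<^esub> h (b i)) = h (\<Sum>i<n. sc (c i) (b i))" for c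
  proof -
    have "h (\<Sum>i<n. sc (c i) (b i)) = (\<Oplus>\<^bsub>N\<^esub>i\<in>{..<n}. h (sc (c i) (b i)))"
      by (rule h_sum) (use b act_closed in auto)
    also have "\<dots> = (\<Oplus>\<^bsub>N\<^esub>i\<in>{..<n}. ageing_class q (fconst (c i)) \<odot>\<^bsub>N\<^esub> h (b i))"
    proof (rule N.finsum_cong'[OF refl])
      have bV: "b i \<in> V" if "i \<in> {..<n}" for i using b that by auto
      show "h (sc (c i) (b i)) = ageing_class q (fconst (c i)) \<odot>\<^bsub>N\<^esub> h (b i)" if "i \<in> {..<n}" for i
        by (rule h_act[OF bV[OF that]])
      show "(\<lambda>i. ageing_class q (fconst (c i)) \<odot>\<^bsub>N\<^esub> h (b i)) \<in> {..<n} \<rightarrow> carrier N"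
        using right_module_act(1)[OF N_module h_closed[OF bV]] by blast
    qed
    finally show ?thesis ..
  qed
  moreover have "h v = h w \<longleftrightarrow> v = w" if "w \<in> V" for w
    using that v(1) bij_betw_imp_inj_on[OF h_bij] by (auto dest: inj_onD)
  moreover have "(\<Sum>i<n. sc (c i) (b i)) \<in> V" for c by (rule V_sum) (use b act_closed in auto)
  ultimately show "\<exists>!c. c \<in> {..<n} \<rightarrow>\<^sub>E (UNIV :: 'k set) \<and>
      x = (\<Oplus>\<^bsub>N\<^esub>i\<in>{..<n}. ageing_class q (fconst (c i)) \<odot>\<^bsub>N\<^esub> h (b i))"
    using u[OF v(1)] by (simp only: v(2))
qed

text \<open>\<open>V\<close> lies in the vector space of the free algebra with the same scalars, so
  a maximal independent subset of the spanning set is a basis of \<open>V\<close>.\<close>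

lemma dim_bound: "\<exists>k \<le> ord_sq l * l. ageing_module_has_dim q N k"
proof -
  interpret F: vector_space "\<lambda>c f. fconst c * (f :: 'k ageing_free)" by (rule vector_space_free)
  obtain S where S: "S \<subseteq> V" "finite S" "card S \<le> ord_sq l * l" "V \<subseteq> rspan sc S" using span_bound by blast
  have "u \<in> F.span S" if "u \<in> rspan sc S" for u
    using that
  proof (induction rule: rspan.induct)
    case (rspan_step x u r)
    then have "sc r x = fconst r * x" using S(1) by (auto simp: act_const)
    then show ?case using rspan_step by (simp add: F.span_add F.span_scale F.span_base)
  qed (rule F.span_zero)
  then have VS: "V \<subseteq> F.span S" using S(4) by blast
  obtain B where B: "B \<subseteq> S" "F.independent B" "S \<subseteq> F.span B" by (rule F.maximal_independent_subset)
  have fB: "finite B" and BV: "B \<subseteq> V" using B(1) S(1,2) finite_subset by auto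
  have VB: "V \<subseteq> F.span B" using VS F.span_mono[OF B(3)] by (simp add: F.span_span subset_iff)
  obtain e where e: "bij_betw e {..<card B} B"
    using ex_bij_betw_nat_finite[OF fB] by (auto simp: atLeast0LessThan)
  have eB: "e i \<in> B" if "i < card B" for i using e that by (auto simp: bij_betw_def)
  have s: "(\<Sum>i<card B. sc (c i) (e i)) = (\<Sum>i<card B. fconst (c i) * e i)" for c
  proof (intro sum.cong refl)
    fix i assume "i \<in> {..<card B}"
    then have "e i \<in> V" using eB BV by blast
    then show "sc (c i) (e i) = fconst (c i) * e i" by (rule act_const)
  qed
  have r: "(\<Sum>b\<in>B. fconst (c b) * b) = (\<Sum>i<card B. fconst (c (e i)) * e i)" for c
    by (rule sum.reindex_bij_betw[OF e, symmetric])
  have "ageing_module_has_dim q N (card B)"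
  proof (rule has_dimI[of e])
    show "e \<in> {..<card B} \<rightarrow> V" using eB BV by auto
    fix v assume "v \<in> V"
    then have "v \<in> F.span B" using VB by blast
    then obtain c where c: "v = (\<Sum>b\<in>B. fconst (c b) * b)" by (auto simp: F.span_finite[OF fB])
    show "\<exists>!c. c \<in> {..<card B} \<rightarrow>\<^sub>E (UNIV :: 'k set) \<and> v = (\<Sum>i<card B. sc (c i) (e i))"
      unfolding s
    proof (rule ex1I[of _ "restrict (\<lambda>i. c (e i)) {..<card B}"])
      show "restrict (\<lambda>i. c (e i)) {..<card B} \<in> {..<card B} \<rightarrow>\<^sub>E UNIV \<and>
          v = (\<Sum>i<card B. fconst (restrict (\<lambda>i. c (e i)) {..<card B} i) * e i)"
        by (simp add: c r)
      fix d assume d: "d \<in> {..<card B} \<rightarrow>\<^sub>E UNIV \<and> v = (\<Sum>i<card B. fconst (d i) * e i)"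
      \<comment> \<open>The difference of two coefficient families, moved from positions to basis
        vectors, is a linear relation on \<open>B\<close> and hence zero.\<close>
      define d' where "d' b = d (the_inv_into {..<card B} e b) - c b" for b
      have d'e: "d' (e i) = d i - c (e i)" if "i < card B" for i
        unfolding d'_def using the_inv_into_f_f[OF bij_betw_imp_inj_on[OF e], of i] that by simp
      have "(\<Sum>b\<in>B. fconst (d' b) * b) = (\<Sum>i<card B. fconst (d i) * e i - fconst (c (e i)) * e i)"
        unfolding r by (intro sum.cong refl) (simp add: d'e F.scale_left_diff_distrib)
      also have "\<dots> = v - v" unfolding sum_subtractf using d c r by metis
      finally have "(\<Sum>b\<in>B. fconst (d' b) * b) = 0" by simp
      then have "d' b = 0" if "b \<in> B" for b
        using F.independentD[OF B(2) fB order_refl _ that] by blast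
      then have "d i = c (e i)" if "i < card B" for i using d'e[OF that] eB[OF that] by simp
      then show "d = restrict (\<lambda>i. c (e i)) {..<card B}"
        by (auto simp: fun_eq_iff PiE_arb[OF conjunct1[OF d]])
    qed
  qed
  moreover have "card B \<le> ord_sq l * l" using card_mono[OF S(2) B(1)] S(3) by simp
  ultimately show ?thesis by blast
qed

lemma torsion_free_result:
  assumes "X_phi_torsion_free q N"
  shows "\<exists>T\<in>model_operators. right_module_isomorphic (ageing_algebra q) N (module_of_operators l T)"
    and "ageing_module_has_dim q N (ord_sq l * l)"
proof -
  have X: "\<forall>v\<in>V. act gX v = 0 \<longrightarrow> v = 0" and phi: "\<forall>v\<in>V. act (phi_word q) v = 0 \<longrightarrow> v = 0"
    using assms h_closed h_eq_zero h_act h_zero unfolding X_phi_torsion_free_def ageing_X_def ageing_phi_def by metis+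
  obtain T g where T: "T \<in> model_operators" and g: "bij_betw g (coord_space l) V"
    "\<forall>v\<in>coord_space l. \<forall>v'\<in>coord_space l. g (v + v') = g v + g v'"
    "\<forall>f. \<forall>v\<in>coord_space l. g (free_action l T f v) = act f (g v)"
    using torsion_free_model[OF X phi] by blast
  interpret M: ageing_simple q "coord_space l" "free_action l T" by (rule model_simple[OF T])
  note rep = ageing_simple.axioms(1)[OF model_simple[OF T]]
  have gV: "g v \<in> V" if "v \<in> coord_space l" for v using g(1) that by (auto simp: bij_betw_def)
  \<comment> \<open>The constructed map leads from the coordinate module to \<open>N\<close>,
    whereas isomorphism is stated from \<open>N\<close>; therefore its inverse is used.\<close>
  let ?H = "\<lambda>v. h (g v)" and ?R = "inv_into (coord_space l) (\<lambda>v. h (g v))"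
  have bij: "bij_betw ?H (coord_space l) (carrier N)"
    using bij_betw_trans[OF g(1) h_bij] by (simp add: o_def)
  have "right_module_isomorphic (ageing_algebra q) N (module_of_operators l T)"
    unfolding right_module_isomorphic_def module_of_operators_simps
  proof (intro exI[of _ ?R] conjI ballI)
    show b: "bij_betw ?R (carrier N) (coord_space l)" by (rule bij_betw_inv_into[OF bij])
    have R: "?R x \<in> coord_space l" "?H (?R x) = x" if "x \<in> carrier N" for x
      using b bij_betw_inv_into_right[OF bij that] that by (auto simp: bij_betw_def)
    have RH: "?R (?H v) = v" if "v \<in> coord_space l" for v
      using bij_betw_inv_into_left[OF bij that] .
    show "?R (x \<oplus>\<^bsub>N\<^esub> y) = ?R x + ?R y" if "x \<in> carrier N" "y \<in> carrier N" for x y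
    proof -
      have "?H (?R x + ?R y) = x \<oplus>\<^bsub>N\<^esub> y"
        using R[OF that(1)] R[OF that(2)] g(2) by (simp add: h_add gV)
      then show ?thesis using RH[OF M.V_add[OF R(1)[OF that(1)] R(1)[OF that(2)]]] by simp
    qed
    show "?R (a \<odot>\<^bsub>N\<^esub> x) = a \<odot>\<^bsub>module_of_operators l T\<^esub> ?R x" if "a \<in> carrier (ageing_algebra q)" "x \<in> carrier N" for a x
    proof -
      obtain f where f: "a = ageing_class q f" using \<open>a \<in> carrier (ageing_algebra q)\<close> by (auto simp: ageing_algebra_simps)
      have "?H (free_action l T f (?R x)) = a \<odot>\<^bsub>N\<^esub> x"
        using R[OF that(2)] g(3) by (simp add: h_act gV f)
      then show ?thesis
        using RH[OF M.act_closed[OF R(1)[OF that(2)], of f]] module_of_operators_smult[OF rep R(1)[OF that(2)], of f] f by simp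
    qed
  qed
  then show "\<exists>T\<in>model_operators. right_module_isomorphic (ageing_algebra q) N (module_of_operators l T)" using T by blast
  obtain e where e: "bij_betw e {..<ord_sq l * l} (index_box l)"
    using ex_bij_betw_nat_finite[OF finite_index_box[of l]] unfolding card_index_box by (auto simp: atLeast0LessThan)
  let ?n = "ord_sq l * l"
  define b :: "nat \<Rightarrow> 'k coords" where "b i = basis_vec l (fst (e i)) (snd (e i))" for i
  have bV: "b i \<in> coord_space l" for i unfolding b_def by (rule basis_vec_in_coord_space[OF l_ge_3])
  have eb: "b i = (\<lambda>p. if p = e i then 1 else 0)" if "i < ?n" for i
    unfolding b_def using e that basis_vec_box[of "fst (e i)" "snd (e i)" l] by (auto simp: bij_betw_def)
  have g0: "g 0 = 0" using g(2) M.V_zero by (metis add_cancel_right_left)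
  have gsum: "g (sum u I) = (\<Sum>i\<in>I. g (u i))" if u: "\<And>i. u i \<in> coord_space l" for u and I :: "nat set"
  proof (induction I rule: infinite_finite_induct)
    case (insert x I)
    have "sum u I \<in> coord_space l" by (rule coord_space_sum) (rule u)
    then have "g (u x + sum u I) = g (u x) + g (sum u I)" using g(2) u by blast
    then show ?case by (simp only: sum.insert[OF insert.hyps] insert.IH)
  qed (simp_all only: sum.infinite sum.empty not_False_eq_True simp_thms g0)
  have gs: "(\<Sum>i<?n. sc (c i) (g (b i))) = g (\<Sum>i<?n. scale_vec (c i) (b i))" for c
  proof -
    have "sc (c i) (g (b i)) = g (scale_vec (c i) (b i))" for i
      using g(3)[rule_format, OF bV, of "fconst (c i)"] unfolding free_action_const by (rule sym)
    then show ?thesis unfolding gsum[of "\<lambda>i. scale_vec (c i) (b i)", OF scale_vec_coord_space[OF bV]] by (simp only:)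
  qed
  have coord: "(\<Sum>i<?n. scale_vec (c i) (b i)) (e j) = c j" if "j < ?n" for c j
  proof -
    have "(\<Sum>i<?n. scale_vec (c i) (b i)) (e j) = (\<Sum>i<?n. if i = j then c j else 0)"
      unfolding sum_fun_apply
    proof (intro sum.cong refl)
      fix i assume i: "i \<in> {..<?n}"
      have "e j = e i \<longleftrightarrow> i = j" using bij_betw_imp_inj_on[OF e] i that by (auto dest: inj_onD)
      then show "scale_vec (c i) (b i) (e j) = (if i = j then c j else 0)" using i by (simp add: eb scale_vec_def)
    qed
    then show ?thesis using that by simp
  qed
  show "ageing_module_has_dim q N ?n"
  proof (rule has_dimI[of "\<lambda>i. g (b i)"])
    show "(\<lambda>i. g (b i)) \<in> {..<?n} \<rightarrow> V" using gV bV by auto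
    fix v assume "v \<in> V"
    then obtain u where u: "u \<in> coord_space l" "v = g u" using g(1) by (auto simp: bij_betw_def)
    have sV: "(\<Sum>i<?n. scale_vec (c i) (b i)) \<in> coord_space l" for c
      by (intro coord_space_sum scale_vec_coord_space bV)
    have ginj: "g u = g u' \<longleftrightarrow> u = u'" if "u' \<in> coord_space l" for u'
      using bij_betw_imp_inj_on[OF g(1)] u(1) that by (auto dest: inj_onD)
    have ext: "x = y" if "x \<in> coord_space l" "y \<in> coord_space l" "\<And>j. j < ?n \<Longrightarrow> x (e j) = y (e j)" for x y
    proof
      fix p show "x p = y p"
      proof (cases "p \<in> index_box l")
        case True
        then obtain j where "j < ?n" "p = e j" using e by (auto simp: bij_betw_def)
        then show ?thesis using that(3) by simp
      qed (use that in \<open>cases p; simp add: coord_space_def\<close>)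
    qed
    show "\<exists>!c. c \<in> {..<?n} \<rightarrow>\<^sub>E (UNIV :: 'k set) \<and> v = (\<Sum>i<?n. sc (c i) (g (b i)))"
      unfolding gs u(2) ginj[OF sV]
    proof (rule ex1I[of _ "restrict (\<lambda>i. u (e i)) {..<?n}"])
      show "restrict (\<lambda>i. u (e i)) {..<?n} \<in> {..<?n} \<rightarrow>\<^sub>E UNIV \<and>
          u = (\<Sum>i<?n. scale_vec (restrict (\<lambda>i. u (e i)) {..<?n} i) (b i))"
        using ext[OF u(1) sV] coord by simp
      fix d assume d: "d \<in> {..<?n} \<rightarrow>\<^sub>E UNIV \<and> u = (\<Sum>i<?n. scale_vec (d i) (b i))"
      have "u (e j) = d j" if "j < ?n" for j using coord[OF that, of d] conjunct2[OF d] by (simp only:)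
      then show "d = restrict (\<lambda>i. u (e i)) {..<?n}" by (auto simp: fun_eq_iff PiE_arb[OF conjunct1[OF d]])
    qed
  qed
qed

end

section \<open>The modules \<open>M\<^sub>1\<close> are jointly faithful\<close>

lemma poly_eq_0_if_vanishing:
  fixes P :: "'k::field poly"
  assumes inf: "infinite (UNIV :: 'k set)" and z: "\<And>t. t \<noteq> 0 \<Longrightarrow> poly P t = 0"
  shows "P = 0"
proof (rule ccontr)
  assume "P \<noteq> 0"
  then have "finite {t. poly P t = 0}" by (rule poly_roots_finite)
  moreover have "UNIV - {0} \<subseteq> {t. poly P t = 0}" using z by auto
  ultimately have "finite (UNIV - {0 :: 'k})" using finite_subset by blast
  then show False using inf by simp
qed

text \<open>Multiplying by a large power of \<open>t\<close> turns the sum into a polynomial with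
  infinitely many roots. Exponents may coincide, so only the sums over the fibres of
  \<open>e\<close> vanish.\<close>

lemma laurent_coefficients:
  fixes c :: "'i \<Rightarrow> 'k::field" and e :: "'i \<Rightarrow> int"
  assumes inf: "infinite (UNIV :: 'k set)" and A: "finite A"
    and z: "\<And>t. t \<noteq> 0 \<Longrightarrow> (\<Sum>a\<in>A. c a * t powi e a) = 0"
  shows "(\<Sum>a | a \<in> A \<and> e a = k. c a) = 0"
proof -
  define M where "M = (\<Sum>a\<in>A. \<bar>e a\<bar>) + \<bar>k\<bar>"
  have M: "e a + M \<ge> 0" if "a \<in> A" for a
  proof -
    have "\<bar>e a\<bar> \<le> (\<Sum>a\<in>A. \<bar>e a\<bar>)" by (rule member_le_sum[OF that _ A]) simp
    then show ?thesis by (simp add: M_def)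
  qed
  have k: "k + M \<ge> 0" 
  proof -
    have "0 \<le> (\<Sum>a\<in>A. \<bar>e a\<bar>)" by (rule sum_nonneg) simp
    then show ?thesis unfolding M_def by linarith
  qed
  define P where "P = (\<Sum>a\<in>A. monom (c a) (nat (e a + M)))"
  have "poly P t = 0" if t: "t \<noteq> 0" for t
  proof -
    have "poly P t = (\<Sum>a\<in>A. c a * t powi e a * t powi M)"
      unfolding P_def poly_sum poly_monom
    proof (intro sum.cong refl)
      fix a assume "a \<in> A"
      then have "t ^ nat (e a + M) = t powi (e a + M)" using M by (simp add: power_int_def)
      then show "c a * t ^ nat (e a + M) = c a * t powi e a * t powi M" using t by (simp add: power_int_add)
    qed
    also have "\<dots> = (\<Sum>a\<in>A. c a * t powi e a) * t powi M" by (simp add: sum_distrib_right)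
    finally show ?thesis using z[OF t] by simp
  qed
  then have "P = 0" by (rule poly_eq_0_if_vanishing[OF inf])
  then have "0 = coeff P (nat (k + M))" by simp
  also have "\<dots> = (\<Sum>a\<in>A. coeff (monom (c a) (nat (e a + M))) (nat (k + M)))" unfolding P_def coeff_sum ..
  also have "\<dots> = (\<Sum>a\<in>A. if e a = k then c a else 0)"
    by (intro sum.cong refl) (use M k in \<open>auto simp: eq_nat_nat_iff\<close>)
  also have "\<dots> = (\<Sum>a | a \<in> A \<and> e a = k. c a)" by (rule sum.inter_filter[OF A, symmetric])
  finally show ?thesis by simp
qed

lemma prod_linear_factors:
  fixes \<alpha> :: "nat \<Rightarrow> 'k::field"
  shows "degree (\<Prod>k<n. [:- \<alpha> k, 1:]) = n \<and> coeff (\<Prod>k<n. [:- \<alpha> k, 1:]) n = 1"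
proof -
  have m: "lead_coeff (\<Prod>k<n. [:- \<alpha> k, 1:]) = 1 \<and> degree (\<Prod>k<n. [:- \<alpha> k, 1:]) = n" for n
  proof (induction n)
    case (Suc n)
    let ?A = "\<Prod>k<n. [:- \<alpha> k, 1:]"
    have A: "?A \<noteq> 0" "[:- \<alpha> n, 1:] \<noteq> 0" using Suc by auto
    have d: "degree (?A * [:- \<alpha> n, 1:]) = n + 1" using degree_mult_eq[OF A] Suc by simp
    have l: "lead_coeff (?A * [:- \<alpha> n, 1:]) = 1" 
    proof -
      have "lead_coeff ?A = 1" using Suc by blast
      moreover have "lead_coeff [:- \<alpha> n, 1:] = 1" by simp
      ultimately show ?thesis by (simp only: lead_coeff_mult mult_1_left)
    qed
    show ?case unfolding prod.lessThan_Suc by (intro conjI l) (simp only: d Suc_eq_plus1)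
  qed simp
  then show ?thesis by metis
qed

text \<open>The products are monic of pairwise distinct degrees \<open>y a\<close>. In the largest
  degree that occurs with a nonzero coefficient, a single term would survive.\<close>

lemma staircase_independent:
  fixes c :: "'i \<Rightarrow> 'k::field" and \<alpha> :: "nat \<Rightarrow> 'k" and y :: "'i \<Rightarrow> nat"
  assumes inf: "infinite (UNIV :: 'k set)" and A: "finite A" "inj_on y A"
    and z: "\<And>t. t \<noteq> 0 \<Longrightarrow> (\<Sum>a\<in>A. c a * (\<Prod>k<y a. t - \<alpha> k)) = 0" and a: "a \<in> A"
  shows "c a = 0"
proof (rule ccontr)
  assume "c a \<noteq> 0"
  define P where "P = (\<Sum>a\<in>A. smult (c a) (\<Prod>k<y a. [:- \<alpha> k, 1:]))"
  have "P = 0" by (rule poly_eq_0_if_vanishing[OF inf]) (use z in \<open>simp add: P_def poly_sum poly_prod\<close>)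
  let ?B = "{a \<in> A. c a \<noteq> 0}"
  have fB: "finite (y ` ?B)" "y ` ?B \<noteq> {}" using A(1) a \<open>c a \<noteq> 0\<close> by auto
  then have "Max (y ` ?B) \<in> y ` ?B" by (rule Max_in)
  then obtain b where b: "b \<in> A" "c b \<noteq> 0" "y b = Max (y ` ?B)" by auto
  have "0 = (\<Sum>a\<in>A. c a * coeff (\<Prod>k<y a. [:- \<alpha> k, 1:]) (y b))"
    using \<open>P = 0\<close> by (simp add: P_def flip: coeff_sum coeff_smult)
  also have "\<dots> = (\<Sum>a\<in>A. if a = b then c b else 0)"
  proof (intro sum.cong refl)
    fix a' assume a': "a' \<in> A"
    show "c a' * coeff (\<Prod>k<y a'. [:- \<alpha> k, 1:]) (y b) = (if a' = b then c b else 0)"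
    proof (cases "a' = b \<or> c a' = 0")
      case True
      then show ?thesis using prod_linear_factors[of \<alpha> "y b"] by auto
    next
      case False
      then have "y a' \<le> y b" using a' fB(1) unfolding b(3) by (intro Max_ge) auto
      moreover have "y a' \<noteq> y b" using A(2) a' b(1) False by (auto dest: inj_onD)
      ultimately show ?thesis using prod_linear_factors[of \<alpha> "y a'"] False by (simp add: coeff_eq_0)
    qed
  qed
  also have "\<dots> = c b" using A(1) b(1) by simp
  finally show False using b(2) by simp
qed

text \<open>In contrast to \<open>pbw\<close>, the powers of \<open>K\<close> and of its inverse are
  merged into one integer exponent, which makes the words independent.\<close>

definition pbw_word :: "int \<times> nat \<times> nat \<times> nat \<Rightarrow> 'k::field ageing_free" where
  "pbw_word = (\<lambda>(b, x, y, d). ageing_root.Kw b * fgen GX ^ x * fgen GY ^ y * fgen GE ^ d)"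

context ageing_root
begin

lemma M1_powers:
  assumes w: "monomial UNIV w (M1_coef q \<mu>1 \<mu>2 \<mu>3 \<mu>4) M1_ind" and \<mu>: "\<mu>4 \<noteq> 0"
  shows "act (Kw b) (w (i, j)) = sc (\<mu>4 powi b) (w (i, j + b))"
    "act (gX ^ n) (w (i, j)) = sc ((\<mu>1 * q powi (i + j)) ^ n) (w (i, j))"
    "act (gY ^ n) (w (i, j)) = sc (\<Prod>k<n. M1_coef q \<mu>1 \<mu>2 \<mu>3 \<mu>4 GY (i - int k, j)) (w (i - int n, j))"
    "act (gE ^ n) (w (i, j)) = sc ((\<mu>3 * q powi (2 * j)) ^ n) (w (i + int n, j))"
proof -
  have V: "w p \<in> V" for p by (rule monomialD(1)[OF w]) simp
  have g: "act (fgen g) (w p) = sc (M1_coef q \<mu>1 \<mu>2 \<mu>3 \<mu>4 g p) (w (M1_ind g p))" for g p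
    by (rule monomialD(3)[OF w]) simp
  show "act (Kw b) (w (i, j)) = sc (\<mu>4 powi b) (w (i, j + b))"
  proof (induction b rule: int_induct[where k = 0])
    case base
    then show ?case by (simp add: Kw_def act_one sc_simps V)
  next
    case (step1 b)
    have p: "\<mu>4 powi (b + 1) = \<mu>4 powi b * \<mu>4" using \<mu> by (simp add: power_int_add)
    show ?case
      unfolding K_Kw(1)[OF V, symmetric] step1 act_sc_gen[OF V] g M1_coef.simps M1_ind.simps sc_sc[OF V] p by (simp add: add.assoc)
  next
    case (step2 b)
    have p: "\<mu>4 powi (b - 1) = \<mu>4 powi b * inverse \<mu>4" using \<mu> by (simp add: power_int_diff divide_inverse)
    show ?case
      unfolding K_Kw(2)[OF V, symmetric] step2 act_sc_gen[OF V] g M1_coef.simps M1_ind.simps sc_sc[OF V] p by (simp add: algebra_simps)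
  qed
  show "act (gX ^ n) (w (i, j)) = sc ((\<mu>1 * q powi (i + j)) ^ n) (w (i, j))"
    by (rule power_eigen[OF V]) (simp only: g M1_coef.simps M1_ind.simps)
  show "act (gY ^ n) (w (i, j)) = sc (\<Prod>k<n. M1_coef q \<mu>1 \<mu>2 \<mu>3 \<mu>4 GY (i - int k, j)) (w (i - int n, j))"
  proof (induction n)
    case (Suc n)
    have "i - int n - 1 = i - int (Suc n)" by simp
    then show ?case
      unfolding act_power_Suc(2)[OF V] Suc act_sc_gen[OF V] g M1_ind.simps sc_sc[OF V] prod.lessThan_Suc by (simp only:)
  qed (simp add: act_one sc_simps V)
  show "act (gE ^ n) (w (i, j)) = sc ((\<mu>3 * q powi (2 * j)) ^ n) (w (i + int n, j))"
  proof (induction n)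
    case (Suc n)
    have "i + int n + 1 = i + int (Suc n)" by simp
    then show ?case
      unfolding act_power_Suc(2)[OF V] Suc act_sc_gen[OF V] g M1_coef.simps M1_ind.simps sc_sc[OF V]
      unfolding power_Suc2 by (simp only:)
  qed (simp add: act_one sc_simps V)
qed

text \<open>The part of the coefficient of an ordered word on \<open>w (0, 0)\<close> that depends
  on \<open>q\<close> alone; it is never zero.\<close>

definition pbw_unit :: "int \<times> nat \<times> nat \<times> nat \<Rightarrow> 'k" where
  "pbw_unit = (\<lambda>(b, x, y, d). (q powi b) ^ x * (\<Prod>k<y. q powi (int k - b) * q / (1 - q\<^sup>2)) * (q powi (2 * b)) ^ d)"

lemma pbw_unit_nonzero: "pbw_unit a \<noteq> 0"
  using q_nonzero q_sq_neq_1 by (auto simp: pbw_unit_def split: prod.splits)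

text \<open>The coefficient is a power of \<open>\<mu>4\<close> times a power of
  \<open>\<mu>3\<close> times a homogeneous polynomial of degree \<open>x + y\<close> in
  \<open>\<mu>1\<close> and \<open>\<mu>2\<close>, so varying the parameters separates the
  exponents.\<close>

lemma M1_pbw_word:
  assumes w: "monomial UNIV w (M1_coef q \<mu>1 \<mu>2 \<mu>3 \<mu>4) M1_ind" and \<mu>: "\<mu>3 \<noteq> 0" "\<mu>4 \<noteq> 0"
  shows "act (pbw_word (b, x, y, d)) (w (0, 0)) =
    sc (pbw_unit (b, x, y, d) * (\<Prod>k<y. \<mu>2 - q powi (- 2 * int k) * \<mu>1) * \<mu>1 ^ x * \<mu>3 powi (int d - int y) * \<mu>4 powi b)
      (w (int d - int y, b))"
proof -
  have V: "w p \<in> V" for p by (rule monomialD(1)[OF w]) simp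
  note P = M1_powers[OF w \<mu>(2)]
  have c: "M1_coef q \<mu>1 \<mu>2 \<mu>3 \<mu>4 GY (0 - int k, b) = inverse \<mu>3 * ((q powi (int k - b) * q / (1 - q\<^sup>2)) * (\<mu>2 - q powi (- 2 * int k) * \<mu>1))" for k
  proof -
    have e: "2 * (0 - int k) + 1 = 1 + (- 2 * int k)" "- (0 - int k + b) = int k - b" by simp_all
    have E: "(q * \<mu>2 - q * q powi (- 2 * int k) * \<mu>1) / (1 - q\<^sup>2) = q / (1 - q\<^sup>2) * (\<mu>2 - q powi (- 2 * int k) * \<mu>1)"
      by (simp add: right_diff_distrib diff_divide_distrib mult.assoc)
    show ?thesis unfolding M1_coef.simps e powi_simps(1)[of 1] powi_simps(9) E by (simp add: mult.assoc)
  qed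
  have Yp: "(\<Prod>k<y. M1_coef q \<mu>1 \<mu>2 \<mu>3 \<mu>4 GY (0 - int k, b)) =
      inverse \<mu>3 ^ y * ((\<Prod>k<y. q powi (int k - b) * q / (1 - q\<^sup>2)) * (\<Prod>k<y. \<mu>2 - q powi (- 2 * int k) * \<mu>1))"
    unfolding c prod.distrib by simp
  have "\<mu>3 powi (int d - int y) = \<mu>3 ^ d * inverse \<mu>3 ^ y"
    using \<mu>(1) by (simp add: power_int_diff divide_inverse power_inverse)
  moreover have "0 - int y + int d = int d - int y" by simp
  ultimately show ?thesis
    unfolding pbw_word_def prod.case act_mult[OF V] P(1) act_sc_pow[OF V] sc_sc[OF V] add_0 P(2-4) Yp pbw_unit_def
    by (simp add: power_mult_distrib mult_ac)
qed

lemma Kw_of_nat: "Kw (int a) = gK ^ a" "Kw (- int e) = gKi ^ e"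
  by (simp_all add: Kw_def)

lemma pbw_eq_word:
  assumes v: "v \<in> V"
  shows "pbw v a e x y d = act (pbw_word (int a - int e, x, y, d)) v"
proof -
  have "act (gKi ^ e) (act (gK ^ a) v) = act (Kw (- int e)) (act (Kw (int a)) v)" by (simp only: Kw_of_nat)
  also have "\<dots> = act (Kw (int a - int e)) v" unfolding Kw_add[OF v] by simp
  finally show ?thesis unfolding pbw_def pbw_word_def prod.case by (simp only: act_mult[OF v])
qed

end

definition pbw_span_set :: "'k::field ageing_free set" where
  "pbw_span_set = {g. \<exists>A c. finite A \<and> g = (\<Sum>a\<in>A. fconst (c a) * pbw_word a)}"

lemma pbw_span_set_add:
  assumes "g \<in> pbw_span_set"
  shows "fconst r * pbw_word a + g \<in> pbw_span_set"
proof -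
  obtain A c where A: "finite A" "g = (\<Sum>a\<in>A. fconst (c a) * pbw_word a)" using assms unfolding pbw_span_set_def by blast
  let ?A = "insert a A" and ?c = "\<lambda>b. (if b = a then r else 0) + (if b \<in> A then c b else 0)"
  have "(\<Sum>b\<in>?A. fconst (?c b) * pbw_word b) =
      (\<Sum>b\<in>?A. if b = a then fconst r * pbw_word a else 0) + (\<Sum>b\<in>?A. if b \<in> A then fconst (c b) * pbw_word b else 0)"
    unfolding sum.distrib[symmetric] by (intro sum.cong refl) (simp add: fconst_simps distrib_right)
  also have "(\<Sum>b\<in>?A. if b = a then fconst r * pbw_word a else 0) = fconst r * pbw_word a" using A(1) by simp
  also have "(\<Sum>b\<in>?A. if b \<in> A then fconst (c b) * pbw_word b else 0) = g"
    unfolding A(2) using A(1) by (intro sum.mono_neutral_cong_right) auto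
  finally have eq: "fconst r * pbw_word a + g = (\<Sum>b\<in>?A. fconst (?c b) * pbw_word b)" by (rule sym)
  have "finite ?A" using A(1) by simp
  then show ?thesis unfolding pbw_span_set_def mem_Collect_eq using eq by (intro exI[of _ ?A] exI[of _ ?c]) (rule conjI)
qed

context root_setting
begin

text \<open>The spanning result is applied to the algebra acting on itself, with the class of 1 as
  the vector.\<close>

lemma pbw_mod_ideal: "\<exists>g\<in>pbw_span_set. f - g \<in> ageing_ideal q"
proof -
  obtain \<pi> where \<pi>: "\<And>x y. \<pi> x = \<pi> y \<longleftrightarrow> x - y \<in> ageing_ideal q" "\<And>x. \<pi> (\<pi> x) = \<pi> x"
    and "\<And>x y. \<pi> (x + y) = \<pi> x + \<pi> y" and "\<And>c x. \<pi> (fconst c * x) = fconst c * \<pi> x"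
    and rep: "ageing_rep q (range \<pi>) (\<lambda>f u. \<pi> (u * f))"
    by (rule quotient_realization[of "ageing_ideal q" q]) (use ageing_ideal_closed in auto)
  interpret R: ageing_root q "range \<pi>" "\<lambda>f u. \<pi> (u * f)" l
    by (intro ageing_root.intro rep root_setting_axioms)
  have v: "\<pi> 1 \<in> range \<pi>" by simp
  have one: "\<pi> (\<pi> 1 * g) = \<pi> g" for g
  proof -
    have "\<pi> 1 - 1 \<in> ageing_ideal q" using \<pi>(1)[of "\<pi> 1" 1] \<pi>(2) by simp
    then have "(\<pi> 1 - 1) * g \<in> ageing_ideal q" by (rule ageing_ideal_closed(5))
    then show ?thesis unfolding \<pi>(1) by (simp add: left_diff_distrib)
  qed
  have "\<exists>g\<in>pbw_span_set. u = \<pi> (\<pi> 1 * g)"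
    if "u \<in> rspan (\<lambda>c u. \<pi> (u * fconst c)) {R.pbw (\<pi> 1) a e x y d |a e x y d. True}" for u
    using that
  proof (induction rule: rspan.induct)
    case rspan_zero
    have "(0 :: 'k ageing_free) \<in> pbw_span_set" unfolding pbw_span_set_def by (auto intro!: exI[of _ "{}"])
    moreover have "0 = \<pi> (\<pi> 1 * 0)" using R.act_zero_left[OF v] by simp
    ultimately show ?case by blast
  next
    case (rspan_step p u r)
    obtain a e x y d where p: "p = R.pbw (\<pi> 1) a e x y d" using rspan_step(1) by blast
    obtain g where g: "g \<in> pbw_span_set" "u = \<pi> (\<pi> 1 * g)" using rspan_step(3) by blast
    let ?w = "pbw_word (int a - int e, x, y, d)"
    have "\<pi> (p * fconst r) = \<pi> (\<pi> 1 * (fconst r * ?w))"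
      unfolding p R.pbw_eq_word[OF v] R.act_mult[OF v] by (rule R.act_sc[OF v, symmetric])
    then have "\<pi> (p * fconst r) + u = \<pi> (\<pi> 1 * (fconst r * ?w + g))" unfolding g(2) R.act_add_left[OF v] by (simp only:)
    then show ?case using pbw_span_set_add[OF g(1)] by blast
  qed
  from this[OF R.pbw_span[OF v, of f]] obtain g where "g \<in> pbw_span_set" "\<pi> (\<pi> 1 * f) = \<pi> (\<pi> 1 * g)" by blast
  then show ?thesis unfolding one \<pi>(1) by blast
qed

text \<open>The exponents are recovered one by one: varying \<open>\<mu>4\<close> isolates
  \<open>b\<close>, varying \<open>\<mu>3\<close> isolates \<open>d - y\<close>, scaling
  \<open>\<mu>1\<close> and \<open>\<mu>2\<close> together isolates \<open>x + y\<close>, and the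
  remaining ratio isolates \<open>y\<close> because the products have distinct degrees.\<close>

lemma pbw_independent:
  assumes inf: "infinite (UNIV :: 'k set)" and A: "finite A"
    and z: "\<And>\<mu>1 \<mu>2 \<mu>3 \<mu>4. \<mu>1 \<noteq> 0 \<Longrightarrow> \<mu>2 \<noteq> 0 \<Longrightarrow> \<mu>3 \<noteq> 0 \<Longrightarrow> \<mu>4 \<noteq> 0 \<Longrightarrow>
      free_action l (M1_op q l \<mu>1 \<mu>2 \<mu>3 \<mu>4) (\<Sum>a\<in>A. fconst (c a) * pbw_word a) (M1_basis (0, 0)) = 0"
    and a0: "a0 \<in> A"
  shows "c a0 = 0"
proof -
  let ?B = "fst :: int \<times> nat \<times> nat \<times> nat \<Rightarrow> int" and ?x = "\<lambda>a :: int \<times> nat \<times> nat \<times> nat. fst (snd a)"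
    and ?y = "\<lambda>a :: int \<times> nat \<times> nat \<times> nat. fst (snd (snd a))" and ?d = "\<lambda>a :: int \<times> nat \<times> nat \<times> nat. snd (snd (snd a))"
  let ?u = "ageing_root.pbw_unit q :: int \<times> nat \<times> nat \<times> nat \<Rightarrow> 'k"
  define ind where "ind a = (int (?d a) - int (?y a), ?B a)" for a
  \<comment> \<open>Only one coordinate is observed, that of the basis vector hit by
    \<open>a0\<close>; \<open>\<delta>\<close> tells which other words contribute there.\<close>
  define p0 where "p0 = M1_norm (ind a0)"
  define \<delta> where "\<delta> a = (M1_basis (ind a) :: 'k coords) p0" for a
  define F where "F \<mu>1 \<mu>2 n = (\<Prod>k<n. \<mu>2 - q powi (- 2 * int k) * \<mu>1)" for \<mu>1 \<mu>2 :: 'k and n :: nat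
  have act: "(\<Sum>a\<in>A. c a * (?u a * F \<mu>1 \<mu>2 (?y a) * \<mu>1 ^ ?x a * \<mu>3 powi (int (?d a) - int (?y a)) * \<mu>4 powi ?B a) * \<delta> a) = 0"
    and nz: "?u a \<noteq> 0"
    if \<mu>: "\<mu>1 \<noteq> 0" "\<mu>2 \<noteq> 0" "\<mu>3 \<noteq> 0" "\<mu>4 \<noteq> 0" for \<mu>1 \<mu>2 \<mu>3 \<mu>4 a
  proof -
    interpret R: ageing_root q "coord_space l" "free_action l (M1_op q l \<mu>1 \<mu>2 \<mu>3 \<mu>4)" l
      by (intro ageing_root.intro M1_rep \<mu> root_setting_axioms)
    note mono = M1_monomial[of \<mu>1 \<mu>2 \<mu>3 \<mu>4]
    have V: "M1_basis i \<in> coord_space l" for i by (rule R.monomialD(1)[OF mono]) simp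
    show "?u a \<noteq> 0" by (rule R.pbw_unit_nonzero)
    let ?s = "\<lambda>a. ?u a * F \<mu>1 \<mu>2 (?y a) * \<mu>1 ^ ?x a * \<mu>3 powi (int (?d a) - int (?y a)) * \<mu>4 powi ?B a"
    have w: "free_action l (M1_op q l \<mu>1 \<mu>2 \<mu>3 \<mu>4) (pbw_word a) (M1_basis (0, 0)) = scale_vec (?s a) (M1_basis (ind a))" for a
      using R.M1_pbw_word[OF mono \<mu>(3,4), of "?B a" "?x a" "?y a" "?d a"]
      by (simp only: prod.collapse free_action_const F_def ind_def)
    have "0 = (\<Sum>a\<in>A. scale_vec (c a) (scale_vec (?s a) (M1_basis (ind a))))"
      using z[OF \<mu>] unfolding free_action_sum free_action_mult free_action_const free_action_scale w by (rule sym)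
    then have "0 = (\<Sum>a\<in>A. scale_vec (c a) (scale_vec (?s a) (M1_basis (ind a)))) p0" by (metis zero_fun_apply)
    then show "(\<Sum>a\<in>A. c a * ?s a * \<delta> a) = 0" by (simp add: sum_fun_apply scale_vec_def \<delta>_def mult.assoc)
  qed
  let ?A1 = "{a \<in> A. ?B a = ?B a0}"
  let ?A2 = "{a \<in> ?A1. int (?d a) - int (?y a) = int (?d a0) - int (?y a0)}"
  let ?A3 = "{a \<in> ?A2. int (?x a + ?y a) = int (?x a0 + ?y a0)}"
  have s1: "(\<Sum>a\<in>?A1. c a * ?u a * \<delta> a * F \<mu>1 \<mu>2 (?y a) * \<mu>1 ^ ?x a * \<mu>3 powi (int (?d a) - int (?y a))) = 0"
    if \<mu>: "\<mu>1 \<noteq> 0" "\<mu>2 \<noteq> 0" "\<mu>3 \<noteq> 0" for \<mu>1 \<mu>2 \<mu>3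
    by (rule laurent_coefficients[OF inf A, of _ ?B "?B a0"]) (use act[OF \<mu>] in \<open>simp add: mult_ac\<close>)
  have s2: "(\<Sum>a\<in>?A2. c a * ?u a * \<delta> a * F \<mu>1 \<mu>2 (?y a) * \<mu>1 ^ ?x a) = 0"
    if \<mu>: "\<mu>1 \<noteq> 0" "\<mu>2 \<noteq> 0" for \<mu>1 \<mu>2
    by (rule laurent_coefficients[OF inf, of ?A1 _ "\<lambda>a. int (?d a) - int (?y a)"]) (use A s1[OF \<mu>] in simp_all)
  \<comment> \<open>The substitution of \<open>t\<close> for \<open>\<mu>1\<close> and
    \<open>t * r\<close> for \<open>\<mu>2\<close> uses homogeneity: the power of \<open>t\<close>
    is \<open>x + y\<close>.\<close>
  have s3: "(\<Sum>a\<in>?A3. c a * ?u a * \<delta> a * F 1 r (?y a)) = 0" if r: "r \<noteq> 0" for r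
  proof (rule laurent_coefficients[OF inf, of ?A2 _ "\<lambda>a. int (?x a + ?y a)"])
    fix t :: 'k assume t: "t \<noteq> 0"
    have "F t (t * r) n = t ^ n * F 1 r n" for n
    proof -
      have "F t (t * r) n = (\<Prod>k<n. t * (r - q powi (- 2 * int k) * 1))"
        unfolding F_def by (intro prod.cong refl) (simp add: right_diff_distrib mult.commute)
      then show ?thesis unfolding prod.distrib F_def by simp
    qed
    then have e: "c a * ?u a * \<delta> a * F t (t * r) (?y a) * t ^ ?x a = c a * ?u a * \<delta> a * F 1 r (?y a) * t powi int (?x a + ?y a)" for a
      by (simp only: power_int_of_nat power_add mult_ac)
    show "(\<Sum>a\<in>?A2. c a * ?u a * \<delta> a * F 1 r (?y a) * t powi int (?x a + ?y a)) = 0"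
      unfolding e[symmetric] by (rule s2) (use t r in auto)
  qed (use A in simp)
  \<comment> \<open>On \<open>?A3\<close> the values of \<open>b\<close>, \<open>d - y\<close> and
    \<open>x + y\<close> are fixed, so \<open>y\<close> determines the word.\<close>
  have inj: "inj_on ?y ?A3"
  proof (rule inj_onI)
    fix a a' assume "a \<in> ?A3" "a' \<in> ?A3" "?y a = ?y a'"
    then show "a = a'" by (auto simp: prod_eq_iff)
  qed
  have "c a0 * ?u a0 * \<delta> a0 = 0"
  proof (rule staircase_independent[OF inf _ inj, of _ "\<lambda>k. q powi (- 2 * int k)"])
    show "(\<Sum>a\<in>?A3. c a * ?u a * \<delta> a * (\<Prod>k<?y a. r - q powi (- 2 * int k))) = 0" if "r \<noteq> 0" for r
      using s3[OF that] by (simp only: F_def mult_1_right)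
  qed (use A a0 in auto)
  moreover have "\<delta> a0 = 1"
    unfolding \<delta>_def p0_def M1_norm_props(2)[of "ind a0"]
    by (simp add: basis_vec_box M1_norm_props(1))
  ultimately show ?thesis using nz[OF one_neq_zero one_neq_zero one_neq_zero one_neq_zero, of a0] by simp
qed

text \<open>Modulo the ideal \<open>f\<close> is a combination of ordered words, and their
  independence is already visible on the single vector \<open>M1_basis (0, 0)\<close> as the
  parameters vary.\<close>

theorem M1_jointly_faithful:
  assumes inf: "infinite (UNIV :: 'k set)"
    and z: "\<And>\<mu>1 \<mu>2 \<mu>3 \<mu>4. \<mu>1 \<noteq> 0 \<Longrightarrow> \<mu>2 \<noteq> 0 \<Longrightarrow> \<mu>3 \<noteq> 0 \<Longrightarrow> \<mu>4 \<noteq> 0 \<Longrightarrow>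
      free_action l (M1_op q l \<mu>1 \<mu>2 \<mu>3 \<mu>4) f (M1_basis (0, 0)) = 0"
  shows "f \<in> ageing_ideal q"
proof -
  obtain g where g: "g \<in> pbw_span_set" "f - g \<in> ageing_ideal q" using pbw_mod_ideal by blast
  obtain A c where A: "finite A" "g = (\<Sum>a\<in>A. fconst (c a) * pbw_word a)" using g(1) unfolding pbw_span_set_def by blast
  have zg: "free_action l (M1_op q l \<mu>1 \<mu>2 \<mu>3 \<mu>4) g (M1_basis (0, 0)) = 0"
    if \<mu>: "\<mu>1 \<noteq> 0" "\<mu>2 \<noteq> 0" "\<mu>3 \<noteq> 0" "\<mu>4 \<noteq> 0" for \<mu>1 \<mu>2 \<mu>3 \<mu>4
  proof -
    interpret R: ageing_root q "coord_space l" "free_action l (M1_op q l \<mu>1 \<mu>2 \<mu>3 \<mu>4)" l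
      by (intro ageing_root.intro M1_rep \<mu> root_setting_axioms)
    have V: "M1_basis i \<in> coord_space l" for i by (rule R.monomialD(1)[OF M1_monomial]) simp
    have "free_action l (M1_op q l \<mu>1 \<mu>2 \<mu>3 \<mu>4) (f - g) (M1_basis (0, 0)) = 0" by (rule R.act_ideal[OF g(2) V])
    then show ?thesis using z[OF \<mu>] unfolding R.act_diff_left[OF V] by simp
  qed
  have "c a = 0" if "a \<in> A" for a
    by (rule pbw_independent[OF inf A(1) zg[unfolded A(2)] that])
  then have "g = 0" unfolding A(2) by (intro sum.neutral) (simp add: fconst_simps)
  then show ?thesis using g(2) by simp
qed

end

section \<open>Monic identities have degree at least \<open>2n\<close>\<close>

definition free_eval :: "(nat \<Rightarrow> 'k::field ageing_free) \<Rightarrow> nc_poly \<Rightarrow> 'k ageing_free" where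
  "free_eval g f = (\<Sum>w\<in>Poly_Mapping.keys f. of_int (Poly_Mapping.lookup f w) * prod_list (map g w))"

text \<open>Inclusion-exclusion, obtained by expanding the product over \<open>D\<close> of factors
  that are \<open>-1\<close> on \<open>T\<close> and \<open>0\<close> off \<open>T\<close>.\<close>

lemma sum_alternating_supersets:
  assumes D: "finite D" and T: "T \<subseteq> D"
  shows "(\<Sum>S\<in>Pow D. (- 1) ^ card S * (if T \<subseteq> S then 1 else 0)) = (if T = D then (- 1) ^ card D else (0 :: 'a::comm_ring_1))"
proof -
  have "(\<Sum>S\<in>Pow D. (- 1) ^ card S * (if T \<subseteq> S then 1 else 0)) =
      (\<Sum>S\<in>Pow D. (\<Prod>p\<in>S. - 1) * (\<Prod>p\<in>D - S. if p \<in> T then 0 else (1 :: 'a)))"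
  proof (intro sum.cong refl)
    fix S assume S: "S \<in> Pow D"
    have "(\<Prod>p\<in>D - S. if p \<in> T then 0 else (1 :: 'a)) = (if T \<subseteq> S then 1 else 0)"
    proof (cases "T \<subseteq> S")
      case True
      then show ?thesis by (auto intro!: prod.neutral)
    next
      case False
      then show ?thesis using D T by (auto intro!: prod_zero)
    qed
    then show "(- 1) ^ card S * (if T \<subseteq> S then 1 else 0) = (\<Prod>p\<in>S. - 1) * (\<Prod>p\<in>D - S. if p \<in> T then 0 else (1 :: 'a))"
      by simp
  qed
  also have "\<dots> = (\<Prod>p\<in>D. - 1 + (if p \<in> T then 0 else 1))" by (rule prod_add[OF D, symmetric])
  also have "\<dots> = (if T = D then (- 1) ^ card D else 0)"
  proof (cases "T = D")
    case False
    then obtain p where "p \<in> D" "p \<notin> T" using T by blast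
    then show ?thesis using D False by (auto intro!: prod_zero)
  qed simp
  finally show ?thesis .
qed

lemma prod_list_sum_choices:
  fixes U :: "nat \<Rightarrow> 'r::ring_1"
  assumes S: "finite S"
  shows "prod_list (map (\<lambda>i. \<Sum>p | p \<in> S \<and> c p = i. U p) w) = (\<Sum>ps | set ps \<subseteq> S \<and> map c ps = w. prod_list (map U ps))"
proof (induction w)
  case Nil
  have "{ps. set ps \<subseteq> S \<and> map c ps = []} = {[]}" by auto
  then show ?case by simp
next
  case (Cons i w)
  let ?P = "{p. p \<in> S \<and> c p = i}" and ?Q = "{ps. set ps \<subseteq> S \<and> map c ps = w}"
  have Q: "{ps. set ps \<subseteq> S \<and> map c ps = i # w} = (\<lambda>(p, ps). p # ps) ` (?P \<times> ?Q)"
  proof -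
    have "ps \<in> (\<lambda>(p, ps). p # ps) ` (?P \<times> ?Q)" if "set ps \<subseteq> S" "map c ps = i # w" for ps
      using that by (cases ps) auto
    then show ?thesis by auto
  qed
  have "prod_list (map (\<lambda>i. \<Sum>p | p \<in> S \<and> c p = i. U p) (i # w)) = (\<Sum>p\<in>?P. U p) * (\<Sum>ps\<in>?Q. prod_list (map U ps))"
    using Cons by simp
  also have "\<dots> = (\<Sum>(p, ps)\<in>?P \<times> ?Q. prod_list (map U (p # ps)))"
    by (simp add: sum_product sum.cartesian_product)
  also have "\<dots> = (\<Sum>ps | set ps \<subseteq> S \<and> map c ps = i # w. prod_list (map U ps))"
    unfolding Q by (subst sum.reindex) (auto simp: inj_on_def case_prod_beta')
  finally show ?case .
qed

section \<open>Staircase walks\<close>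

context free_rep
begin

lemma act_of_int_mult: "v \<in> V \<Longrightarrow> act (of_int k * f) v = act (of_int k) (act f v)"
  by (simp only: mult_of_int_commute act_mult)

context
  fixes U :: "nat \<Rightarrow> 'k ageing_free" and b :: "nat \<Rightarrow> 'b" and d :: nat
  assumes b: "\<And>i. b i \<in> V"
    and U: "\<And>p v. p < d \<Longrightarrow> v \<le> d div 2 \<Longrightarrow> act (U p) (b v) = (if v = p div 2 then b (Suc p div 2) else 0)"
begin

text \<open>The steps \<open>U 0, U 1, U 2, U 3\<close> are the matrix units
  \<open>e_00, e_01, e_11, e_12\<close>, and so on: the classical staircase, on which
  \<open>d\<close> steps visit the vectors up to \<open>d div 2\<close>.\<close>

lemma walk_Cons:
  assumes "p < d" "v \<le> d div 2" "act (prod_list (map U (p # ps))) (b v) \<noteq> 0"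
  shows "v = p div 2" "act (prod_list (map U ps)) (b (Suc p div 2)) \<noteq> 0"
  using assms U[OF assms(1,2)] by (auto simp: act_mult b act_zero_right split: if_splits)

lemma walk_ge:
  "set ps \<subseteq> {..<d} \<Longrightarrow> v \<le> d div 2 \<Longrightarrow> act (prod_list (map U ps)) (b v) \<noteq> 0 \<Longrightarrow> p \<in> set ps \<Longrightarrow> v \<le> p div 2"
proof (induction ps arbitrary: v)
  case (Cons p' ps)
  have p': "p' < d" using Cons.prems(1) by simp
  note W = walk_Cons[OF p' Cons.prems(2,3)]
  have "Suc p' div 2 \<le> d div 2" using p' by (intro div_le_mono) simp
  then have "p \<in> set ps \<Longrightarrow> Suc p' div 2 \<le> p div 2" using Cons.IH[of "Suc p' div 2"] Cons.prems(1) W(2) by simp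
  moreover have "p' div 2 \<le> Suc p' div 2" by (intro div_le_mono) simp
  ultimately show ?case using Cons.prems(4) W(1) by auto
qed simp

lemma walk_unique:
  "distinct ps \<Longrightarrow> set ps = {j..<d} \<Longrightarrow> j \<le> d \<Longrightarrow> act (prod_list (map U ps)) (b (j div 2)) \<noteq> 0 \<Longrightarrow> ps = [j..<d]"
proof (induction ps arbitrary: j)
  case (Cons p ps)
  have p: "j \<le> p" "p < d" using Cons.prems(2) by auto
  have jd: "j div 2 \<le> d div 2" using Cons.prems(3) by (rule div_le_mono)
  note W = walk_Cons[OF p(2) jd Cons.prems(4)]
  have "p = j"
  \<comment> \<open>The walk could only skip a stationary step: \<open>p = Suc j\<close> with
    \<open>j\<close> even. After \<open>p\<close> it stands at \<open>j div 2 + 1\<close> and cannot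
    return for the step \<open>j\<close>, which still has to be used.\<close>
  proof (rule ccontr)
    assume "p \<noteq> j"
    then have "p = Suc j" "even j" using W(1) p(1) by presburger+
    have "j \<in> set (p # ps)" unfolding Cons.prems(2) using p by simp
    then have j: "j \<in> set ps" using \<open>p = Suc j\<close> by simp
    have "Suc p div 2 \<le> d div 2" using p(2) by (intro div_le_mono) simp
    then have "Suc p div 2 \<le> j div 2" 
    proof -
      have "set ps \<subseteq> set (p # ps)" by auto
      also have "\<dots> \<subseteq> {..<d}" unfolding Cons.prems(2) by auto
      finally show ?thesis using walk_ge[OF _ _ W(2) j] \<open>Suc p div 2 \<le> d div 2\<close> by blast
    qed
    then show False using \<open>p = Suc j\<close> by presburger
  qed
  moreover have "set ps = {Suc j..<d}"
  proof -
    have "set ps = set (p # ps) - {p}" using Cons.prems(1) by auto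
    also have "\<dots> = {j..<d} - {p}" by (simp only: Cons.prems(2))
    also have "\<dots> = {Suc j..<d}" using \<open>p = j\<close> by auto
    finally show ?thesis .
  qed
  ultimately have "ps = [Suc j..<d]" using Cons.IH[of "Suc j"] Cons.prems(1) W(2) p by simp
  then show ?case using \<open>p = j\<close> p by (simp add: upt_conv_Cons)
qed simp

lemma walk_upt: "j \<le> d \<Longrightarrow> act (prod_list (map U [j..<d])) (b (j div 2)) = b (d div 2)"
proof (induction j rule: inc_induct)
  case (step j)
  have "j div 2 \<le> d div 2" using step.hyps by (intro div_le_mono) simp
  then show ?case using step U[of j "j div 2"] by (simp add: upt_conv_Cons act_mult b)
qed (simp add: act_one b)

text \<open>
  Each variable is replaced by the sum of those steps \<open>U p\<close>, \<open>p \<in> S\<close>, of a staircase walk that the word \<open>w0\<close> assigns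
  to it. The alternating sum over \<open>S\<close> keeps only the walks using every step, and a word of length at most
  \<open>d\<close> admits such a walk only if it is \<open>w0\<close>.
\<close>

lemma no_identity_of_degree:
  assumes keys: "\<forall>w\<in>Poly_Mapping.keys f. length w \<le> d" and w0: "length w0 = d" "Poly_Mapping.lookup f w0 = 1"
    and ident: "\<And>g. act (free_eval g f) (b 0) = 0"
  shows "b (d div 2) = 0"
proof -
  let ?K = "Poly_Mapping.keys f" and ?D = "{..<d}"
  define P where "P w = {ps. set ps \<subseteq> ?D \<and> map ((!) w0) ps = w}" for w
  have finP: "finite (P w)" for w
    by (rule finite_subset[of _ "{ps. set ps \<subseteq> ?D \<and> length ps = length w}"]) (auto simp: P_def finite_lists_length_eq)
  \<comment> \<open>A variable may occur several times in \<open>w0\<close>, so it receives the sum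
    of all steps at its positions, restricted to \<open>S\<close>.\<close>
  define \<rho> where "\<rho> S i = (\<Sum>p | p \<in> S \<and> w0 ! p = i. U p)" for S i
  have \<rho>: "prod_list (map (\<rho> S) w) = (\<Sum>ps\<in>P w. (if set ps \<subseteq> S then 1 else 0) * prod_list (map U ps))" if S: "S \<in> Pow ?D" for S w
  proof -
    have "finite S" using S finite_subset[of S ?D] by simp
    then have "prod_list (map (\<rho> S) w) = (\<Sum>ps | set ps \<subseteq> S \<and> map ((!) w0) ps = w. prod_list (map U ps))"
      unfolding \<rho>_def[abs_def] by (rule prod_list_sum_choices)
    also have "{ps. set ps \<subseteq> S \<and> map ((!) w0) ps = w} = {ps \<in> P w. set ps \<subseteq> S}" using S by (auto simp: P_def)
    also have "(\<Sum>ps\<in>{ps \<in> P w. set ps \<subseteq> S}. prod_list (map U ps)) = (\<Sum>ps\<in>P w. if set ps \<subseteq> S then prod_list (map U ps) else 0)"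
      by (rule sum.inter_filter[OF finP])
    also have "\<dots> = (\<Sum>ps\<in>P w. (if set ps \<subseteq> S then 1 else 0) * prod_list (map U ps))" by (intro sum.cong) auto
    finally show ?thesis .
  qed
  define T where "T w = (\<Sum>ps\<in>P w. (if set ps = ?D then 1 else 0) * prod_list (map U ps))" for w
  \<comment> \<open>Summing over \<open>S\<close> with alternating signs cancels every sequence of
    steps that misses a member of \<open>?D\<close>.\<close>
  have alt: "(\<Sum>S\<in>Pow ?D. of_int ((- 1) ^ card S) * prod_list (map (\<rho> S) w)) = of_int ((- 1) ^ d) * T w" for w
  proof -
    have "(\<Sum>S\<in>Pow ?D. of_int ((- 1) ^ card S) * prod_list (map (\<rho> S) w)) =
        (\<Sum>S\<in>Pow ?D. \<Sum>ps\<in>P w. of_int ((- 1) ^ card S * (if set ps \<subseteq> S then 1 else 0)) * prod_list (map U ps))"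
    proof (intro sum.cong refl)
      fix S assume "S \<in> Pow ?D"
      then show "of_int ((- 1) ^ card S) * prod_list (map (\<rho> S) w) =
          (\<Sum>ps\<in>P w. of_int ((- 1) ^ card S * (if set ps \<subseteq> S then 1 else 0)) * prod_list (map U ps))"
        unfolding \<rho>[OF \<open>S \<in> Pow ?D\<close>] sum_distrib_left by (intro sum.cong refl) auto
    qed
    also have "\<dots> = (\<Sum>ps\<in>P w. of_int (\<Sum>S\<in>Pow ?D. (- 1) ^ card S * (if set ps \<subseteq> S then 1 else 0)) * prod_list (map U ps))"
      by (subst sum.swap) (simp only: of_int_sum sum_distrib_right)
    also have "\<dots> = of_int ((- 1) ^ d) * T w"
      unfolding T_def sum_distrib_left
    proof (intro sum.cong refl)
      fix ps assume "ps \<in> P w"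
      then have "set ps \<subseteq> ?D" by (simp add: P_def)
      show "of_int (\<Sum>S\<in>Pow ?D. (- 1) ^ card S * (if set ps \<subseteq> S then 1 else 0)) * prod_list (map U ps) =
          of_int ((- 1) ^ d) * ((if set ps = ?D then 1 else 0) * prod_list (map U ps))"
        unfolding sum_alternating_supersets[OF finite_lessThan \<open>set ps \<subseteq> ?D\<close>] by (cases "set ps = ?D") simp_all
    qed
    finally show ?thesis .
  qed
  \<comment> \<open>A word of length at most \<open>d\<close> that uses all \<open>d\<close> steps
    uses each of them once, and the only such walk takes them in order and spells
    \<open>w0\<close>.\<close>
  have Tw: "act (T w) (b 0) = (if w = w0 then b (d div 2) else 0)" if w: "w \<in> ?K" for w
  proof -
    have t: "act ((if set ps = ?D then 1 else 0) * prod_list (map U ps)) (b 0) = (if ps = [0..<d] then b (d div 2) else 0)"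
      if ps: "ps \<in> P w" for ps
    proof (cases "set ps = ?D \<and> act (prod_list (map U ps)) (b 0) \<noteq> 0")
      case True
      have "map ((!) w0) ps = w" using ps by (simp add: P_def)
      then have "length ps = length w" by (metis length_map)
      then have "length ps \<le> d" using keys w by simp
      moreover have "card (set ps) = d" using conjunct1[OF True] by simp
      ultimately have "card (set ps) = length ps" using card_length[of ps] by linarith
      then have dist: "distinct ps" by (rule card_distinct)
      have s: "set ps = {0..<d}" using conjunct1[OF True] by (simp only: atLeast0LessThan)
      have "act (prod_list (map U ps)) (b (0 div 2)) \<noteq> 0" using conjunct2[OF True] unfolding div_0 .
      then have "ps = [0..<d]" by (rule walk_unique[OF dist s le0])
      then have "act (prod_list (map U ps)) (b 0) = b (d div 2)" using walk_upt[OF le0] by (simp only: div_0)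
      moreover have "(if set ps = ?D then 1 else 0) * prod_list (map U ps) = prod_list (map U ps)"
        using conjunct1[OF True] by (simp only: if_True simp_thms mult_1_left)
      ultimately show ?thesis using \<open>ps = [0..<d]\<close> by (simp only: if_True simp_thms)
    next
      case False
      then have F: "set ps = ?D \<longrightarrow> act (prod_list (map U ps)) (b 0) = 0" by (simp only: de_Morgan_conj not_not imp_conv_disj)
      have r: "b (d div 2) = 0" if "ps = [0..<d]"
      proof -
        have a: "act (prod_list (map U ps)) (b 0) = b (d div 2)" using walk_upt[OF le0] by (simp only: div_0 that)
        have "set ps = ?D" unfolding that by auto
        then show ?thesis by (rule trans[OF a[symmetric] mp[OF F]])
      qed
      have "act ((if set ps = ?D then 1 else 0) * prod_list (map U ps)) (b 0) = 0"
      proof (cases "set ps = ?D")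
        case True
        then have "act (prod_list (map U ps)) (b 0) = 0" by (rule mp[OF F])
        then show ?thesis by (simp only: True if_True simp_thms mult_1_left)
      qed (simp add: act_zero_left b)
      then show ?thesis by (cases "ps = [0..<d]") (simp_all only: r if_True if_False simp_thms)
    qed
    have "act (T w) (b 0) = (\<Sum>ps\<in>P w. if ps = [0..<d] then b (d div 2) else 0)"
      unfolding T_def act_sum_left[OF b] by (intro sum.cong refl t)
    also have "\<dots> = (if [0..<d] \<in> P w then b (d div 2) else 0)" by (rule sum.delta[OF finP])
    also have "[0..<d] \<in> P w \<longleftrightarrow> w = w0" 
    proof -
      have "map ((!) w0) [0..<d] = w0" using map_nth[of w0] unfolding w0(1) .
      moreover have "set [0..<d] \<subseteq> ?D" by auto
      ultimately have "[0..<d] \<in> P w \<longleftrightarrow> w0 = w" unfolding P_def mem_Collect_eq by (simp only: simp_thms)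
      then show ?thesis by (simp only: eq_commute)
    qed
    finally show ?thesis .
  qed
  have ic: "of_int i * (of_int k * x) = of_int k * (of_int i * x)" for i k and x :: "'k ageing_free"
  proof -
    have "of_int i * of_int k = (of_int k * of_int i :: 'k ageing_free)" by (rule mult_of_int_commute)
    then show ?thesis by (simp only: mult.assoc[symmetric])
  qed
  have "(\<Sum>S\<in>Pow ?D. of_int ((- 1) ^ card S) * free_eval (\<rho> S) f) =
      (\<Sum>S\<in>Pow ?D. \<Sum>w\<in>?K. of_int (Poly_Mapping.lookup f w) * (of_int ((- 1) ^ card S) * prod_list (map (\<rho> S) w)))"
    unfolding free_eval_def sum_distrib_left by (intro sum.cong refl ic)
  also have "\<dots> = (\<Sum>w\<in>?K. \<Sum>S\<in>Pow ?D. of_int (Poly_Mapping.lookup f w) * (of_int ((- 1) ^ card S) * prod_list (map (\<rho> S) w)))"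
    by (rule sum.swap)
  also have "\<dots> = (\<Sum>w\<in>?K. of_int (Poly_Mapping.lookup f w) * (of_int ((- 1) ^ d) * T w))"
    unfolding sum_distrib_left[symmetric] alt ..
  also have "\<dots> = of_int ((- 1) ^ d) * (\<Sum>w\<in>?K. of_int (Poly_Mapping.lookup f w) * T w)"
    unfolding sum_distrib_left by (intro sum.cong refl ic)
  finally have eq: "of_int ((- 1) ^ d) * (\<Sum>w\<in>?K. of_int (Poly_Mapping.lookup f w) * T w) =
      (\<Sum>S\<in>Pow ?D. of_int ((- 1) ^ card S) * free_eval (\<rho> S) f)" ..
  have "act (\<Sum>S\<in>Pow ?D. of_int ((- 1) ^ card S) * free_eval (\<rho> S) f) (b 0) = 0"
    unfolding act_sum_left[OF b] by (intro sum.neutral ballI) (simp only: act_of_int_mult[OF b] ident act_zero_right)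
  then have z: "act (of_int ((- 1) ^ d)) (act (\<Sum>w\<in>?K. of_int (Poly_Mapping.lookup f w) * T w) (b 0)) = 0"
    unfolding eq[symmetric] act_of_int_mult[OF b] .
  have s: "act (\<Sum>w\<in>?K. of_int (Poly_Mapping.lookup f w) * T w) (b 0) = b (d div 2)"
  proof -
    have "act (\<Sum>w\<in>?K. of_int (Poly_Mapping.lookup f w) * T w) (b 0) = (\<Sum>w\<in>?K. if w = w0 then b (d div 2) else 0)"
      unfolding act_sum_left[OF b]
    proof (intro sum.cong refl)
      fix w assume w: "w \<in> ?K"
      show "act (of_int (Poly_Mapping.lookup f w) * T w) (b 0) = (if w = w0 then b (d div 2) else 0)"
        unfolding act_of_int_mult[OF b] Tw[OF w] 
          by (cases "w = w0") (simp_all only: w0(2) if_True if_False simp_thms of_int_1 act_one[OF b] act_zero_right)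
    qed
    also have "\<dots> = (if w0 \<in> ?K then b (d div 2) else 0)" by (rule sum.delta) simp
    also have "\<dots> = b (d div 2)" using w0(2) by (simp add: in_keys_iff)
    finally show ?thesis .
  qed
  \<comment> \<open>The sign \<open>(-1)^d\<close> is removed by applying it a second time.\<close>
  have "act (of_int ((- 1) ^ d) * of_int ((- 1) ^ d)) (b (d div 2)) = 0"
    unfolding act_of_int_mult[OF b] z[unfolded s] by (rule act_zero_right)
  moreover have "of_int ((- 1) ^ d) * of_int ((- 1) ^ d) = (1 :: 'k ageing_free)"
    by (simp only: of_int_mult[symmetric] power_mult_distrib[symmetric]) simp
  ultimately show ?thesis by (simp add: act_one b)
qed

end

end

section \<open>The PI degree\<close>

lemma nc_eval_class: "nc_eval (ageing_algebra q) (\<lambda>i. ageing_class q (g i)) f = ageing_class q (free_eval g f)"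
proof -
  interpret R: ring "ageing_algebra q" by (rule ageing_algebra_ring)
  have cl: "ageing_class q x \<in> carrier (ageing_algebra q)" for x by (simp add: ageing_algebra_simps)
  have prod: "foldr (\<lambda>i r. ageing_class q (g i) \<otimes>\<^bsub>ageing_algebra q\<^esub> r) w \<one>\<^bsub>ageing_algebra q\<^esub> = ageing_class q (prod_list (map g w))" for w
    by (induction w) (simp_all add: ageing_algebra_simps)
  have nat: "[n] \<cdot>\<^bsub>ageing_algebra q\<^esub> ageing_class q x = ageing_class q (of_nat n * x)" for n :: nat and x
  proof (induction n)
    case 0
    then show ?case by (simp add: ageing_algebra_simps)
  next
    case (Suc n)
    have "[Suc n] \<cdot>\<^bsub>ageing_algebra q\<^esub> ageing_class q x = [n] \<cdot>\<^bsub>ageing_algebra q\<^esub> ageing_class q x \<oplus>\<^bsub>ageing_algebra q\<^esub> ageing_class q x"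
      by (rule R.add.nat_pow_Suc)
    then show ?case unfolding Suc by (simp add: ageing_algebra_simps algebra_simps)
  qed
  have neg: "\<ominus>\<^bsub>ageing_algebra q\<^esub> ageing_class q x = ageing_class q (- x)" for x
    by (rule R.minus_equality) (simp_all add: ageing_algebra_simps)
  have int: "[k] \<cdot>\<^bsub>ageing_algebra q\<^esub> ageing_class q x = ageing_class q (of_int k * x)" for k :: int and x
  proof (cases "k \<ge> 0")
    case True
    then obtain n where k: "k = int n" by (metis nonneg_int_cases)
    show ?thesis using nat[of n x] unfolding k by (simp add: add_pow_def int_pow_int)
  next
    case False
    then obtain n where k: "k = - int n" by (metis int_cases4 of_nat_0_le_iff)
    have "[k] \<cdot>\<^bsub>ageing_algebra q\<^esub> ageing_class q x = \<ominus>\<^bsub>ageing_algebra q\<^esub> ([n] \<cdot>\<^bsub>ageing_algebra q\<^esub> ageing_class q x)"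
      using R.add.int_pow_neg[OF cl[of x], of "int n"] unfolding k by (simp add: add_pow_def int_pow_int)
    then show ?thesis unfolding nat neg k by simp
  qed
  have "(\<Oplus>\<^bsub>ageing_algebra q\<^esub>w\<in>K. ageing_class q (h w)) = ageing_class q (\<Sum>w\<in>K. h w)" if "finite K" for K :: "nat list set" and h
    using that
  proof (induction K rule: finite_induct)
    case empty
    then show ?case by (simp add: ageing_algebra_simps)
  next
    case (insert w K)
    then show ?case using cl by (simp add: R.finsum_insert Pi_def ageing_algebra_simps)
  qed
  then show ?thesis unfolding nc_eval_def free_eval_def prod int by simp
qed

lemma polynomial_identity_iff:
  "polynomial_identity (ageing_algebra q) f \<longleftrightarrow> (\<forall>g. free_eval g f \<in> ageing_ideal q)"
proof
  assume id: "polynomial_identity (ageing_algebra q) f"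
  show "\<forall>g. free_eval g f \<in> ageing_ideal q"
  proof
    fix g
    have "nc_eval (ageing_algebra q) (\<lambda>i. ageing_class q (g i)) f = \<zero>\<^bsub>ageing_algebra q\<^esub>"
      using id unfolding polynomial_identity_def by (simp add: ageing_algebra_simps)
    then show "free_eval g f \<in> ageing_ideal q"
      unfolding nc_eval_class ageing_algebra_simps ageing_class_eq_iff by simp
  qed
next
  assume id: "\<forall>g. free_eval g f \<in> ageing_ideal q"
  show "polynomial_identity (ageing_algebra q) f"
    unfolding polynomial_identity_def
  proof (intro allI impI)
    fix \<rho> :: "nat \<Rightarrow> 'a ageing_free set" assume "\<forall>i. \<rho> i \<in> carrier (ageing_algebra q)"
    then have "\<exists>g. \<forall>i. \<rho> i = ageing_class q (g i)" by (intro choice) (auto simp: ageing_algebra_simps)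
    then obtain g where "\<rho> = (\<lambda>i. ageing_class q (g i))" by blast
    then show "nc_eval (ageing_algebra q) \<rho> f = \<zero>\<^bsub>ageing_algebra q\<^esub>"
      using id by (simp only: nc_eval_class ageing_algebra_simps ageing_class_eq_iff) simp
  qed
qed

definition standard_poly :: "nat \<Rightarrow> nc_poly" where
  "standard_poly N = (\<Sum>w | set w \<subseteq> {..<N} \<and> length w = N. Poly_Mapping.single w (std_coeff N w))"

lemma lookup_standard_poly:
  "Poly_Mapping.lookup (standard_poly N) w = (if set w \<subseteq> {..<N} \<and> length w = N then std_coeff N w else 0)"
proof -
  have "Poly_Mapping.lookup (standard_poly N) w = (\<Sum>w' | set w' \<subseteq> {..<N} \<and> length w' = N. if w' = w then std_coeff N w else 0)"
    unfolding standard_poly_def lookup_sum by (intro sum.cong refl) (simp add: lookup_single when_def)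
  then show ?thesis using finite_words[of N N] by simp
qed

lemma standard_poly_monic: "nc_monic N (standard_poly N)"
proof -
  have "length w \<le> N" if "w \<in> Poly_Mapping.keys (standard_poly N)" for w
    using that by (auto simp: in_keys_iff lookup_standard_poly split: if_splits)
  moreover have "Poly_Mapping.lookup (standard_poly N) [0..<N] = 1"
    unfolding lookup_standard_poly by (auto simp: std_coeff_upt)
  moreover have "length [0..<N] = N" by simp
  ultimately show ?thesis unfolding nc_monic_def by blast
qed

lemma free_eval_standard_poly:
  "free_eval g (standard_poly N) = (\<Sum>w | set w \<subseteq> {..<N} \<and> length w = N. of_int (std_coeff N w) * prod_list (map g w))"
  unfolding free_eval_def
  by (rule sum.mono_neutral_cong_left[OF finite_words])
    (auto simp: in_keys_iff lookup_standard_poly split: if_splits)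

context root_setting
begin

lemma box_enumeration:
  obtains e where "bij_betw e {..<ord_sq l * l} (index_box l)"
  using ex_bij_betw_nat_finite[OF finite_index_box[of l]] unfolding card_index_box by (auto simp: atLeast0LessThan)

lemma standard_poly_identity:
  assumes inf: "infinite (UNIV :: 'k set)"
  shows "polynomial_identity (ageing_algebra q) (standard_poly (2 * (ord_sq l * l)))"
  unfolding polynomial_identity_iff
proof
  fix g
  let ?n = "ord_sq l * l"
  obtain e where e: "bij_betw e {..<?n} (index_box l)" by (rule box_enumeration)
  define b where "b i = (basis_vec l (fst (e i)) (snd (e i)) :: 'k coords)" for i
  have bV: "b i \<in> coord_space l" for i unfolding b_def by (rule basis_vec_in_coord_space[OF l_ge_3])
  have expand: "v = (\<Sum>r<?n. scale_vec (v (e r)) (b r))" if "v \<in> coord_space l" for v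
  proof -
    have "v = (\<Sum>p\<in>index_box l. scale_vec (v p) (basis_vec l (fst p) (snd p)))"
      using coord_expand[OF that] by (simp add: case_prod_beta')
    also have "\<dots> = (\<Sum>r<?n. scale_vec (v (e r)) (b r))"
      unfolding b_def by (rule sum.reindex_bij_betw[OF e, symmetric])
    finally show ?thesis .
  qed
  show "free_eval g (standard_poly (2 * ?n)) \<in> ageing_ideal q"
  proof (rule M1_jointly_faithful[OF inf])
    fix \<mu>1 \<mu>2 \<mu>3 \<mu>4 :: 'k assume \<mu>: "\<mu>1 \<noteq> 0" "\<mu>2 \<noteq> 0" "\<mu>3 \<noteq> 0" "\<mu>4 \<noteq> 0"
    let ?T = "M1_op q l \<mu>1 \<mu>2 \<mu>3 \<mu>4"
    interpret R: ageing_rep q "coord_space l" "free_action l ?T" by (rule M1_rep[OF \<mu>(3,4)])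
    \<comment> \<open>\<open>x i\<close> is the matrix of \<open>g i\<close> in the enumerated
      basis, with images as rows; in this convention the right action turns words into products in
      the same order.\<close>
    define x where "x i p r = free_action l ?T (g i) (b p) (e r)" for i p r
    have gb: "free_action l ?T (g i) (b p) = (\<Sum>r<?n. scale_vec (x i p r) (b r))" for i p
      unfolding x_def by (rule expand[OF R.act_closed[OF bV]])
    have word: "free_action l ?T (prod_list (map g w)) (b p) = (\<Sum>r<?n. scale_vec (wprod ?n x w p r) (b r))" if "p < ?n" for w p
      using that
    proof (induction w arbitrary: p)
      case Nil
      have "(\<Sum>r<?n. scale_vec (wprod ?n x [] p r) (b r)) = (\<Sum>r<?n. if r = p then b p else 0)"
        by (intro sum.cong refl) (simp add: scale_vec_simps)
      then show ?case using Nil by (simp add: R.act_one[OF bV])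
    next
      case (Cons i w)
      have "free_action l ?T (prod_list (map g (i # w))) (b p) = (\<Sum>r<?n. scale_vec (x i p r) (free_action l ?T (prod_list (map g w)) (b r)))"
        by (simp add: free_action_mult gb free_action_sum_right free_action_scale)
      also have "\<dots> = (\<Sum>r<?n. scale_vec (x i p r) (\<Sum>t<?n. scale_vec (wprod ?n x w r t) (b t)))"
        using Cons.IH by (intro sum.cong refl) simp
      also have "\<dots> = (\<Sum>t<?n. \<Sum>r<?n. scale_vec (x i p r * wprod ?n x w r t) (b t))"
        unfolding scale_vec_sum scale_vec_simps(3) by (rule sum.swap)
      also have "\<dots> = (\<Sum>t<?n. scale_vec (wprod ?n x (i # w) p t) (b t))"
        by (intro sum.cong refl) (simp add: fun_eq_iff sum_fun_apply scale_vec_def sum_distrib_right)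
      finally show ?case .
    qed
    have scale_int: "free_action l ?T (of_int k * f) v = scale_vec (of_int k) (free_action l ?T f v)" for k f v
    proof -
      have "of_int k = (fconst (of_int k) :: 'k ageing_free)"
      proof (induction k rule: int_induct[where k = 0])
        case (step2 i)
        then show ?case by (simp add: fconst_def single_diff) (metis fconst_def single_one zero_list_def)
      next
        case (step1 i)
        then show ?case by (simp add: fconst_def single_add) (metis fconst_def single_one zero_list_def)
      qed (simp add: fconst_def)
      then show ?thesis by (simp only: free_action_mult free_action_const free_action_scale)
    qed
    have bp: "free_action l ?T (free_eval g (standard_poly (2 * ?n))) (b p) = 0" if p: "p < ?n" for p
    proof -
      let ?W = "{w. set w \<subseteq> {..<2 * ?n} \<and> length w = 2 * ?n}"
      have "free_action l ?T (free_eval g (standard_poly (2 * ?n))) (b p) =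
          (\<Sum>w\<in>?W. scale_vec (of_int (std_coeff (2 * ?n) w)) (\<Sum>r<?n. scale_vec (wprod ?n x w p r) (b r)))"
        unfolding free_eval_standard_poly free_action_sum scale_int word[OF p] ..
      also have "\<dots> = (\<Sum>r<?n. \<Sum>w\<in>?W. scale_vec (of_int (std_coeff (2 * ?n) w) * wprod ?n x w p r) (b r))"
        unfolding scale_vec_sum scale_vec_simps(3) by (rule sum.swap)
      also have "\<dots> = (\<Sum>r<?n. scale_vec (\<Sum>w\<in>?W. of_int (std_coeff (2 * ?n) w) * wprod ?n x w p r) (b r))"
        by (intro sum.cong refl) (simp add: fun_eq_iff sum_fun_apply scale_vec_def sum_distrib_right)
      also have "\<dots> = 0"
        by (intro sum.neutral ballI) (simp add: amitsur_levitzki[OF p] scale_vec_simps)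
      finally show ?thesis .
    qed
    have V0: "M1_basis (0, 0) \<in> coord_space l" unfolding M1_basis_def prod.case by (rule basis_vec_in_coord_space[OF l_ge_3])
    show "free_action l ?T (free_eval g (standard_poly (2 * ?n))) (M1_basis (0, 0)) = 0"
      by (subst expand[OF V0], subst free_action_sum_right) (simp add: free_action_scale bp scale_vec_simps)
  qed
qed

text \<open>Below degree \<open>2 * n\<close> a staircase of \<open>d\<close> steps fits on
  \<open>n\<close> basis vectors, since \<open>d div 2 < n\<close>. Its matrix units come from
  elements of the algebra, so the identity would kill a basis vector.\<close>

lemma identity_degree_bound:
  assumes f: "nc_monic d f" "polynomial_identity (ageing_algebra q) f"
  shows "2 * (ord_sq l * l) \<le> d"
proof (rule ccontr)
  let ?n = "ord_sq l * l"
  assume "\<not> 2 * ?n \<le> d"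
  then have d: "d div 2 < ?n" by linarith
  obtain w0 where w0: "length w0 = d" "Poly_Mapping.lookup f w0 = 1" and keys: "\<forall>w\<in>Poly_Mapping.keys f. length w \<le> d"
    using f(1) unfolding nc_monic_def by blast
  obtain e where e: "bij_betw e {..<?n} (index_box l)" by (rule box_enumeration)
  have eb: "e i \<in> index_box l" if "i < ?n" for i using e that by (auto simp: bij_betw_def)
  \<comment> \<open>Any module \<open>M_1\<close> with nonzero parameters has all matrix units; ones
    are the simplest choice.\<close>
  let ?T = "M1_op q l 1 1 1 1"
  interpret R: ageing_rep q "coord_space l" "free_action l ?T" by (rule M1_rep) simp_all
  define b where "b i = (basis_vec l (fst (e i)) (snd (e i)) :: 'k coords)" for i
  have bV: "b i \<in> coord_space l" for i unfolding b_def by (rule basis_vec_in_coord_space[OF l_ge_3])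
  have "\<forall>p. \<exists>u. p < d \<longrightarrow> (\<forall>r\<in>index_box l. free_action l ?T u (basis_vec l (fst r) (snd r)) = (if r = e (p div 2) then b (Suc p div 2) else 0))"
  proof
    fix p
    show "\<exists>u. p < d \<longrightarrow> (\<forall>r\<in>index_box l. free_action l ?T u (basis_vec l (fst r) (snd r)) = (if r = e (p div 2) then b (Suc p div 2) else 0))"
    proof (cases "p < d")
      case True
      then have "Suc p div 2 \<le> d div 2" by (intro div_le_mono) simp
      moreover have "p div 2 \<le> Suc p div 2" by (intro div_le_mono) simp
      ultimately have p: "p div 2 < ?n" "Suc p div 2 < ?n" using d by linarith+
      show ?thesis unfolding b_def
        using M1_units[OF one_neq_zero one_neq_zero one_neq_zero one_neq_zero eb[OF p(1)] eb[OF p(2)]] by blast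
    qed simp
  qed
  then obtain U where U: "\<forall>p. p < d \<longrightarrow> (\<forall>r\<in>index_box l. free_action l ?T (U p) (basis_vec l (fst r) (snd r)) = (if r = e (p div 2) then b (Suc p div 2) else 0))"
    by (rule choice[THEN exE])
  have "b (d div 2) = 0"
  proof (rule R.no_identity_of_degree[where U = U, OF bV _ keys w0])
    show "free_action l ?T (U p) (b v) = (if v = p div 2 then b (Suc p div 2) else 0)" if p: "p < d" and v: "v \<le> d div 2" for p v
    proof -
      have pn: "p div 2 < ?n" "v < ?n" using d v div_le_mono[of p d 2] p by linarith+
      have "e v = e (p div 2) \<longleftrightarrow> v = p div 2" using bij_betw_imp_inj_on[OF e] pn by (auto dest: inj_onD)
      then show ?thesis using U p eb[OF pn(2)] unfolding b_def[of v] by simp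
    qed
    show "free_action l ?T (free_eval g f) (b 0) = 0" for g
      using f(2) R.act_ideal[OF _ bV] unfolding polynomial_identity_iff by blast
  qed
  moreover have "b (d div 2) (e (d div 2)) = 1"
    unfolding b_def using eb[OF d] by (simp add: basis_vec_box)
  ultimately show False by simp
qed

lemma PI_degree_ageing_algebra:
  assumes inf: "infinite (UNIV :: 'k set)"
  shows "PI_degree (ageing_algebra q) = ord_sq l * l"
proof -
  have "PI_min_degree (ageing_algebra q) = 2 * (ord_sq l * l)"
    unfolding PI_min_degree_def
  proof (rule Least_equality)
    show "\<exists>f. nc_monic (2 * (ord_sq l * l)) f \<and> polynomial_identity (ageing_algebra q) f"
      using standard_poly_monic standard_poly_identity[OF inf] by blast
  qed (use identity_degree_bound in blast)
  then show ?thesis unfolding PI_degree_def by simp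
qed

end

theorem theorem5p1:
  fixes q :: "'k::alg_closed_field" and l :: nat
  assumes "l \<ge> 3" and "primitive_root_of_unity l q"
  shows
    "(\<forall>\<mu>1 \<mu>2 \<mu>3 \<mu>4. \<mu>1 \<noteq> 0 \<and> \<mu>2 \<noteq> 0 \<and> \<mu>3 \<noteq> 0 \<and> \<mu>4 \<noteq> 0 \<longrightarrow>
        simple_right_module (ageing_algebra q) (M1 q l \<mu>1 \<mu>2 \<mu>3 \<mu>4)) \<and>
     (\<forall>\<mu>1 \<mu>2 \<mu>3. \<mu>1 \<noteq> 0 \<and> \<mu>2 \<noteq> 0 \<and> \<mu>3 \<noteq> 0 \<longrightarrow>
        simple_right_module (ageing_algebra q) (M2 q l \<mu>1 \<mu>2 \<mu>3)) \<and>
     (\<forall>\<mu>1 \<mu>2. \<mu>1 \<noteq> 0 \<and> \<mu>2 \<noteq> 0 \<longrightarrow>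
        simple_right_module (ageing_algebra q) (M3 q l \<mu>1 \<mu>2)) \<and>
     (\<forall>N :: ('k ageing_free set, 'v) module.
        simple_right_module (ageing_algebra q) N \<and> X_phi_torsion_free q N \<longrightarrow>
          ((\<exists>\<mu>1 \<mu>2 \<mu>3 \<mu>4. \<mu>1 \<noteq> 0 \<and> \<mu>2 \<noteq> 0 \<and> \<mu>3 \<noteq> 0 \<and> \<mu>4 \<noteq> 0 \<and>
              right_module_isomorphic (ageing_algebra q) N (M1 q l \<mu>1 \<mu>2 \<mu>3 \<mu>4)) \<or>
           (\<exists>\<mu>1 \<mu>2 \<mu>3. \<mu>1 \<noteq> 0 \<and> \<mu>2 \<noteq> 0 \<and> \<mu>3 \<noteq> 0 \<and>
              right_module_isomorphic (ageing_algebra q) N (M2 q l \<mu>1 \<mu>2 \<mu>3)) \<or>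
           (\<exists>\<mu>1 \<mu>2. \<mu>1 \<noteq> 0 \<and> \<mu>2 \<noteq> 0 \<and>
              right_module_isomorphic (ageing_algebra q) N (M3 q l \<mu>1 \<mu>2))) \<and>
          ageing_module_has_dim q N (PI_degree (ageing_algebra q))) \<and>
     (\<forall>S :: ('k ageing_free set, 'w) module.
        simple_right_module (ageing_algebra q) S \<longrightarrow>
          (\<exists>m \<le> PI_degree (ageing_algebra q). ageing_module_has_dim q S m))"
proof -
  interpret root_setting q l by unfold_locales (rule assms)+
  have PI: "PI_degree (ageing_algebra q) = ord_sq l * l" by (rule PI_degree_ageing_algebra[OF infinite_alg_closed])
  \<comment> \<open>The carrier type is left general, as this is used for \<open>'v\<close> and for
    \<open>'w\<close>.\<close>
  have realize: "\<exists>V act h. realization q V act l N h"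
    if N: "simple_right_module (ageing_algebra q) N" for N :: "('k ageing_free set, 'x) module"
  proof -
    obtain V :: "'k ageing_free set" and act h where V: "ageing_simple q V act" and h: "bij_betw h V (carrier N)"
      "\<And>u w. u \<in> V \<Longrightarrow> w \<in> V \<Longrightarrow> h (u + w) = h u \<oplus>\<^bsub>N\<^esub> h w"
      "\<And>f u. u \<in> V \<Longrightarrow> h (act f u) = ageing_class q f \<odot>\<^bsub>N\<^esub> h u"
      "\<And>c v. v \<in> V \<Longrightarrow> act (fconst c) v = fconst c * v"
      by (rule simple_module_realization[OF N]) blast
    have N': "right_module (ageing_algebra q) N" using N by (simp add: simple_right_module_def)
    have "ageing_simple_root q V act l"
      by (intro ageing_simple_root.intro ageing_root.intro V ageing_simple.axioms(1)[OF V] root_setting_axioms)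
    then have "realization q V act l N h"
      by (intro realization.intro realization_axioms.intro N' h)
    then show ?thesis by blast
  qed
  have sim: "simple_right_module (ageing_algebra q) (module_of_operators l T)" if "T \<in> model_operators" for T
    by (rule simple_operators_module[OF model_simple[OF that]])
  show ?thesis
  proof (intro conjI allI impI)
    show "simple_right_module (ageing_algebra q) (M1 q l \<mu>1 \<mu>2 \<mu>3 \<mu>4)"
      if "\<mu>1 \<noteq> 0 \<and> \<mu>2 \<noteq> 0 \<and> \<mu>3 \<noteq> 0 \<and> \<mu>4 \<noteq> 0" for \<mu>1 \<mu>2 \<mu>3 \<mu>4
      unfolding M1_def by (rule sim) (use that in \<open>unfold model_operators_def, blast\<close>)
    show "simple_right_module (ageing_algebra q) (M2 q l \<mu>1 \<mu>2 \<mu>3)"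
      if "\<mu>1 \<noteq> 0 \<and> \<mu>2 \<noteq> 0 \<and> \<mu>3 \<noteq> 0" for \<mu>1 \<mu>2 \<mu>3
      unfolding M2_def by (rule sim) (use that in \<open>unfold model_operators_def, blast\<close>)
    show "simple_right_module (ageing_algebra q) (M3 q l \<mu>1 \<mu>2)"
      if "\<mu>1 \<noteq> 0 \<and> \<mu>2 \<noteq> 0" for \<mu>1 \<mu>2
      unfolding M3_def by (rule sim) (use that in \<open>unfold model_operators_def, blast\<close>)
  next
    fix N :: "('k ageing_free set, 'v) module"
    assume N: "simple_right_module (ageing_algebra q) N \<and> X_phi_torsion_free q N"
    obtain V act h where "realization q V act l N h" using realize N by blast
    note R = realization.torsion_free_result[OF this conjunct2[OF N]]
    show "ageing_module_has_dim q N (PI_degree (ageing_algebra q))" unfolding PI by (rule R(2))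
    show "(\<exists>\<mu>1 \<mu>2 \<mu>3 \<mu>4. \<mu>1 \<noteq> 0 \<and> \<mu>2 \<noteq> 0 \<and> \<mu>3 \<noteq> 0 \<and> \<mu>4 \<noteq> 0 \<and>
              right_module_isomorphic (ageing_algebra q) N (M1 q l \<mu>1 \<mu>2 \<mu>3 \<mu>4)) \<or>
           (\<exists>\<mu>1 \<mu>2 \<mu>3. \<mu>1 \<noteq> 0 \<and> \<mu>2 \<noteq> 0 \<and> \<mu>3 \<noteq> 0 \<and>
              right_module_isomorphic (ageing_algebra q) N (M2 q l \<mu>1 \<mu>2 \<mu>3)) \<or>
           (\<exists>\<mu>1 \<mu>2. \<mu>1 \<noteq> 0 \<and> \<mu>2 \<noteq> 0 \<and>
              right_module_isomorphic (ageing_algebra q) N (M3 q l \<mu>1 \<mu>2))"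
      using R(1) unfolding model_operators_def M1_def M2_def M3_def by blast
  next
    fix S :: "('k ageing_free set, 'w) module"
    assume "simple_right_module (ageing_algebra q) S"
    then obtain V act h where "realization q V act l S h" using realize by blast
    then show "\<exists>m \<le> PI_degree (ageing_algebra q). ageing_module_has_dim q S m"
      unfolding PI by (rule realization.dim_bound)
  qed
qed

end
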